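(* Let $u$ be the exact solution of the hyperbolic problem and let $u_h^n$ be the solution of the scheme RKSV$(s,k)$ (LSV or RRSV), as in the context. Let $\zeta$ be the termination index, $\rho$ the contribution index and $c^{(\zeta)}_{\zeta\zeta}$ the diagonal entry obtained by the matrix transferring process for $\mathrm{RHS}(\xi_u^n)$ described in the context. Suppose one of the following holds: (1) $c^{(\zeta)}_{\zeta\zeta}<0$, $\rho=\zeta$, and the CFL condition $\tau=\mathcal O(h)$ is satisfied; (2) $c^{(\zeta)}_{\zeta\zeta}<0$, $\rho<\zeta$, and the CFL condition $\lambda^{2\rho+1}=\mathcal O(\tau)$ is satisfied; (3) $c^{(\zeta)}_{\zeta\zeta}>0$, and the CFL condition $\lambda^{\gamma}=\mathcal O(\tau)$ with $\gamma=\min(2\zeta,2\rho+1)$ is satisfied. Then the error estimate of RKSV$(s,k)$ is $$\|u^n-u_h^n\|\lesssim (h^{k+1}+\tau^s)\,\|u\|_{k+2,\infty}.$$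
   Context: **Problem.** $\partial_t u+\partial_x u=0$ on $[a,b]\times(0,T]$, $u(x,0)=u_0(x)$, with either $u(a,t)=0$ or the periodic condition $u(a,t)=u(b,t)$. $\|\cdot\|$ is the $L_2(a,b)$ norm, $\|u\|_{m,\infty}$ is the $W^{m,\infty}$ norm of $u$, and $\lesssim$ means $\le C\,\cdot$ with a constant $C>0$ independent of $\tau$, $h$ and $n$. The integers $s\ge1$ and $k\ge1$ are arbitrary. $\tau=T/M$, $t_n=n\tau$ ($0\le n\le M$), $u^n=u(\cdot,t_n)$, and $\lambda=\tau/h$ is the CFL number. **Mesh.** $a=x_{1/2}<x_{3/2}<\dots<x_{N+1/2}=b$, $I_i=[x_{i-1/2},x_{i+1/2}]$, $h_i=x_{i+1/2}-x_{i-1/2}$, $x_i=\frac12(x_{i-1/2}+x_{i+1/2})$, $h=\max_i h_i$. The mesh is regular: for some fixed $\alpha>0$, $\alpha\max_i h_i\le\min_i h_i$. Given $-1=y_0<y_1<\dots<y_k<y_{k+1}=1$, put $x_{i,j}=\frac12h_iy_j+x_i$ and $C_{i,j}=[x_{i,j},x_{i,j+1}]$, $0\le j\le k$. - LSV: $y_1,\dots,y_k$ are the $k$ Gauss-Legendre points. - RRSV: $y_1,\dots,y_k,y_{k+1}=1$ are the $k+1$ right Radau points (zeros of $P_{k+1}-P_k$, $P_m$ the Legendre polynomial of degree $m$). $A_0,\dots,A_{k+1}$ are the weights of the associated quadrature $\sum_{j=0}^{k+1}A_jf(y_j)$ for $\int_{-1}^1f\,dy$ (Gauss with $A_0=A_{k+1}=0$,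 respectively right Radau with $A_0=0$), and $A_{i,j}=\frac{h_i}{2}A_j$. **Spaces, map, forms.** $\mathcal U_h=\{w\in L_2(a,b):w|_{I_i}\in\mathbf P^k(I_i),\ 1\le i\le N\}$, where $\mathbf P^k$ is the space of polynomials of degree at most $k$. For $w\in\mathcal U_h$, $w^*$ is the function equal to the constant $w^*_{i,j}$ on $C_{i,j}$, where $w^*_{i,0}=w^+_{i-1/2}+A_{i,0}w_x(x_{i,0})$ and $w^*_{i,j}-w^*_{i,j-1}=A_{i,j}w_x(x_{i,j})$, $1\le j\le k$. Superscripts $\pm$ denote right/left limits, $(\cdot,\cdot)$ is the $L_2(a,b)$ inner product, and $$a_h(v,w^* )=-\sum_{i=1}^N\sum_{j=0}^kw^*_{i,j}(v^-_{i,j+1}-v^-_{i,j}),\qquad v^-_{i,j}=v^-(x_{i,j}),$$ with $v^-_{1,0}$ given by the boundary condition ($0$, or $v^-(b)$ in the periodic case). **Scheme RKSV$(s,k)$.** Let $g_{00}=1$ and, for $s\ge2$, $g_{s-1,\ell}=\frac1\ell g_{s-2,\ell-1}$ ($1\le\ell\le s-2$), $g_{s-1,s-1}=\frac1{s!}$, $g_{s-1,0}=1-\sum_{\ell=1}^{s-1}g_{s-1,\ell}$. With $u_h^{n,0}=u_h^n\in\mathcal U_h$, the stages $u_h^{n,\ell}\in\mathcal U_h$ satisfy for all $w\in\mathcal U_h$ $$(u_h^{n,\ell+1},w^* )=(u_h^{n,\ell},w^* )+\tau a_h(u_h^{n,\ell},w^* ),\quad 0\le\ell\le s-2,$$ $$(u_h^{n,s},w^*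 )=\sum_{\kappa=0}^{s-1}g_{s-1,\kappa}(u_h^{n,\kappa},w^* )+\tau g_{s-1,s-1}a_h(u_h^{n,s-1},w^* ),$$ and $u_h^{n+1}=u_h^{n,s}$. **Errors.** The exact stage functions $u^{n,\ell}$, with $u^{n,0}=u^n$ and $u^{n,s}=u^{n+1}$, satisfy the same relations as $u_h^{n,\ell}$, except that $(G^{n,s},w^* )$ is added to the right side of the last one, $G^{n,s}$ being the temporal truncation error. $\mathcal P_hv\in\mathcal U_h$ is the Lagrange projection: $\mathcal P_hv(x_{i,j})=v(x_{i,j})$ for $1\le i\le N$, $1\le j\le k+1$. Put $e_u^{n,\ell}=u^{n,\ell}-u_h^{n,\ell}=\xi_u^{n,\ell}-\eta_u^{n,\ell}$, $\xi_u^{n,\ell}=\mathcal P_hu^{n,\ell}-u_h^{n,\ell}$, $\eta_u^{n,\ell}=\mathcal P_hu^{n,\ell}-u^{n,\ell}$; a superscript $n$ alone means $\ell=0$. **Temporal differences of the error.** $\mathbb E_0e_u^n=e_u^n$ and, for $1\le\kappa\le s$, $\mathbb E_\kappa e_u^n=\sum_{0\le\ell\le\kappa}\beta_{\kappa\ell}e_u^{n,\ell}$ with $\sum_{\ell}\beta_{\kappa\ell}=0$ (same combinations for $\xi_u$, $\eta_u$), the constants being determined recursively by $$(\mathbb E_\kappa\xi_u^n,w^* )=\tau a_h(\mathbb E_{\kappa-1}\xi_u^n,w^* )+(\mathbb E_\kappa\eta_u^n,w^* )+(\tilde G^{n,\kappa},w^* )\quad\forall w\in\mathcal U_h,$$ where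 $\tilde G^{n,\kappa}=0$ for $\kappa<s$ and $\tilde G^{n,s}=G^{n,s}/g_{s-1,s-1}$. The coefficients $\beta_0,\dots,\beta_s$ ($\beta_0>0$, used only for scaling) are those of the identity $\beta_0e_u^{n+1}=\sum_{\kappa=0}^s\beta_\kappa\mathbb E_\kappa e_u^n$. With $|||w|||^2=(w,w^* )$, one has $$\beta_0^2(|||\xi_u^{n+1}|||^2-|||\xi_u^n|||^2)=\mathrm{RHS}(\xi_u^n)=\sum_{0\le p,q\le s}c_{pq}(\mathbb E_p\xi_u^n,(\mathbb E_q\xi_u^n)^* )+\sum_{0\le p,q\le s}d_{pq}(\mathbb E_p\eta_u^n,(\mathbb E_q\xi_u^n)^* ),$$ with $c_{00}=0$, $c_{pq}=\beta_p\beta_q$ for $p+q>0$, $d_{ss}=0$, and $d_{pq}=-c_{pq}$ for $0\le p+q<2s$. **Matrix transferring process for $\mathrm{RHS}(\xi_u^n)$.** All matrices are symmetric with indices $0,\dots,s$; entries with an index exceeding $s$ are read as $0$. (The process also updates matrices for the $\eta_u$ and $\tilde G$ terms; these do not enter $\zeta$, $\rho$ or $c^{(\zeta)}_{\zeta\zeta}$.) Start with $\mathbb C^{(0)}=\{c_{pq}\}$, $\mathbb H^{(0)}=0$. For $l\ge1$ and $q\le p$, $$c^{(l)}_{pq}=c^{(l)}_{qp}=\begin{cases}0,&q=l-1,\\ c^{(l-1)}_{pq}-2c^{(l-1)}_{p+1,q-1},&p=l,\ q=l,\\ c^{(l-1)}_{pq}-c^{(l-1)}_{p+1,q-1},&l+1\le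 p\le s-1,\ q=l,\\ c^{(l-1)}_{pq},&\text{otherwise},\end{cases}$$ $$h^{(l)}_{pq}=h^{(l)}_{qp}=\begin{cases}2c^{(l-1)}_{p,q},&l\le p\le s,\ q=l-1,\\ h^{(l-1)}_{pq},&\text{otherwise}.\end{cases}$$ If $c^{(l)}_{ll}=0$, continue with the next $l$; otherwise stop and set the termination index $\zeta=l$. For $0\le\kappa\le\zeta-1$ let $\mathbb H^\zeta_\kappa$ be the leading principal submatrix of $\mathbb H^{(\zeta)}=\{h^{(\zeta)}_{pq}\}$ of order $\kappa+1$. The contribution index is $\rho=\min\{\kappa:0\le\kappa\le\zeta-1,\ \det\mathbb H^\zeta_\kappa\le0\}$ if this set is nonempty, and $\rho=\zeta$ otherwise.
   Formalization: The scheme is started from u_h^0 = P_h u_0 (no start is specified); in case (1), τ = O(h) means τ ≤ c h for some sufficiently small c > 0; the H update is covered both as printed (which forces ρ = 0) and with the entry 2c_{p,q} placed at (p-1,q). *)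

theory Defs
  imports "HOL-Analysis.Analysis" "Jordan_Normal_Form.Determinant"
begin

section \<open>Norms and the exact solution\<close>

definition l2_inner :: "real \<Rightarrow> real \<Rightarrow> (real \<Rightarrow> real) \<Rightarrow> (real \<Rightarrow> real) \<Rightarrow> real" where
  "l2_inner a b f g = (LINT x:{a..b}|lborel. f x * g x)"

definition l2_norm :: "real \<Rightarrow> real \<Rightarrow> (real \<Rightarrow> real) \<Rightarrow> real" where
  "l2_norm a b f = sqrt (l2_inner a b f f)"

text \<open>\<open>\<phi>\<close> is a test function of class \<open>C\<^sup>1\<close> with compact support in the open interval, and \<open>\<phi>'\<close>
  is its derivative.\<close>

definition test_function :: "real \<Rightarrow> real \<Rightarrow> (real \<Rightarrow> real) \<Rightarrow> (real \<Rightarrow> real) \<Rightarrow> bool" where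
  "test_function a b \<phi> \<phi>' \<longleftrightarrow>
     (\<forall>x. (\<phi> has_real_derivative \<phi>' x) (at x)) \<and> continuous_on UNIV \<phi>' \<and>
     (\<exists>c d. a < c \<and> d < b \<and> (\<forall>x. x \<notin> {c..d} \<longrightarrow> \<phi> x = 0))"

definition weak_derivative :: "real \<Rightarrow> real \<Rightarrow> (real \<Rightarrow> real) \<Rightarrow> (real \<Rightarrow> real) \<Rightarrow> bool" where
  "weak_derivative a b f g \<longleftrightarrow>
     (\<forall>\<phi> \<phi>'. test_function a b \<phi> \<phi>' \<longrightarrow>
        (LINT x:{a<..<b}|lborel. f x * \<phi>' x) = - (LINT x:{a<..<b}|lborel. g x * \<phi> x))"

text \<open>The norm of \<open>W\<^sup>m\<^sup>,\<^sup>\<infinity>(a,b)\<close>, i.e. the maximum over \<open>j \<le> m\<close> of the essential suprema of the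
  weak derivatives of order \<open>j\<close>. The infimum of the empty set makes it infinite for functions that
  are not in this space.\<close>

definition sobolev_inf_norm :: "nat \<Rightarrow> real \<Rightarrow> real \<Rightarrow> (real \<Rightarrow> real) \<Rightarrow> ennreal" where
  "sobolev_inf_norm m a b f = Inf {ennreal K | K. 0 \<le> K \<and>
     (\<exists>g :: nat \<Rightarrow> real \<Rightarrow> real. g 0 = f \<and>
        (\<forall>j\<le>m. set_borel_measurable lborel {a<..<b} (g j) \<and>
               (AE x in lborel. x \<in> {a<..<b} \<longrightarrow> \<bar>g j x\<bar> \<le> K)) \<and>
        (\<forall>j<m. weak_derivative a b (g j) (g (Suc j))))}"

text \<open>The norm \<open>\<parallel>u\<parallel>\<^sub>m\<^sub>,\<^sub>\<infinity>\<close> of a function \<open>u x t\<close> of space and time. For a solution of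
  \<open>u\<^sub>t + u\<^sub>x = 0\<close> every mixed derivative is, up to sign, a pure derivative in \<open>x\<close>, so that this
  is also the space-time norm.\<close>

definition solution_norm ::
    "nat \<Rightarrow> real \<Rightarrow> real \<Rightarrow> real \<Rightarrow> (real \<Rightarrow> real \<Rightarrow> real) \<Rightarrow> ennreal" where
  "solution_norm m a b T u = (SUP t\<in>{0..T}. sobolev_inf_norm m a b (\<lambda>x. u x t))"

datatype boundary = Zero_Inflow | Periodic

definition exact_solution ::
    "boundary \<Rightarrow> real \<Rightarrow> real \<Rightarrow> real \<Rightarrow> (real \<Rightarrow> real) \<Rightarrow> (real \<Rightarrow> real \<Rightarrow> real) \<Rightarrow> bool" where
  "exact_solution bc a b T u0 u \<longleftrightarrow>
     continuous_on ({a..b} \<times> {0..T}) (\<lambda>(x, t). u x t) \<and>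
     (\<forall>x\<in>{a..b}. \<forall>t\<in>{0<..T}. \<exists>ux ut.
        ((\<lambda>(x, t). u x t) has_derivative (\<lambda>(dx, dt). ux * dx + ut * dt))
           (at (x, t) within {a..b} \<times> {0..T}) \<and>
        ut + ux = 0) \<and>
     (\<forall>x\<in>{a..b}. u x 0 = u0 x) \<and>
     (\<forall>t\<in>{0<..T}. case bc of Zero_Inflow \<Rightarrow> u a t = 0 | Periodic \<Rightarrow> u a t = u b t)"


section \<open>Meshes and control volumes\<close>

text \<open>A mesh is given by \<open>X i = x\<^bsub>i+1/2\<^esub>\<close> for \<open>0 \<le> i \<le> N\<close>; its cells are
  \<open>I\<^sub>i = [X (i - 1), X i]\<close> for \<open>1 \<le> i \<le> N\<close>.\<close>

definition cell_len :: "(nat \<Rightarrow> real) \<Rightarrow> nat \<Rightarrow> real" where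
  "cell_len X i = X i - X (i - 1)"

definition mesh_size :: "nat \<Rightarrow> (nat \<Rightarrow> real) \<Rightarrow> real" where
  "mesh_size N X = Max (cell_len X ` {1..N})"

definition regular_mesh :: "real \<Rightarrow> real \<Rightarrow> real \<Rightarrow> nat \<Rightarrow> (nat \<Rightarrow> real) \<Rightarrow> bool" where
  "regular_mesh \<alpha> a b N X \<longleftrightarrow>
     1 \<le> N \<and> X 0 = a \<and> X N = b \<and> strict_mono_on {0..N} X \<and>
     \<alpha> * Max (cell_len X ` {1..N}) \<le> Min (cell_len X ` {1..N})"

fun legendre :: "nat \<Rightarrow> real poly" where
  "legendre 0 = 1"
| "legendre (Suc 0) = [:0, 1:]"
| "legendre (Suc (Suc n)) =
     Polynomial.smult (1 / real (n + 2))
       (Polynomial.smult (real (2 * n + 3)) ([:0, 1:] * legendre (Suc n)) -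
        Polynomial.smult (real (n + 1)) (legendre n))"

datatype sv_method = LSV | RRSV

definition reference_points :: "sv_method \<Rightarrow> nat \<Rightarrow> (nat \<Rightarrow> real) \<Rightarrow> bool" where
  "reference_points meth k y \<longleftrightarrow>
     y 0 = -1 \<and> y (k + 1) = 1 \<and> strict_mono_on {0..k + 1} y \<and>
     (case meth of
        LSV \<Rightarrow> \<forall>j\<in>{1..k}. poly (legendre k) (y j) = 0
      | RRSV \<Rightarrow> \<forall>j\<in>{1..k + 1}. poly (legendre (k + 1) - legendre k) (y j) = 0)"

definition quadrature_indices :: "sv_method \<Rightarrow> nat \<Rightarrow> nat set" where
  "quadrature_indices meth k = (case meth of LSV \<Rightarrow> {1..k} | RRSV \<Rightarrow> {1..k + 1})"

text \<open>Gauss and right Radau weights as integrals of the Lagrange basis polynomials.\<close>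

definition weight :: "sv_method \<Rightarrow> nat \<Rightarrow> (nat \<Rightarrow> real) \<Rightarrow> nat \<Rightarrow> real" where
  "weight meth k y j =
     (if j \<in> quadrature_indices meth k
      then integral {-1..1} (\<lambda>x. \<Prod>m\<in>quadrature_indices meth k - {j}. (x - y m) / (y j - y m))
      else 0)"

definition ctrl_point :: "(nat \<Rightarrow> real) \<Rightarrow> (nat \<Rightarrow> real) \<Rightarrow> nat \<Rightarrow> nat \<Rightarrow> real" where
  "ctrl_point y X i j = cell_len X i / 2 * y j + (X (i - 1) + X i) / 2"

definition cell_weight ::
    "sv_method \<Rightarrow> nat \<Rightarrow> (nat \<Rightarrow> real) \<Rightarrow> (nat \<Rightarrow> real) \<Rightarrow> nat \<Rightarrow> nat \<Rightarrow> real" where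
  "cell_weight meth k y X i j = cell_len X i / 2 * weight meth k y j"


section \<open>The spectral volume spaces and forms\<close>

text \<open>Elements of \<open>\<U>\<^sub>h\<close> are represented by functions whose values at the mesh points
  \<open>X i\<close> are irrelevant; only one-sided limits are used there.\<close>

definition left_lim :: "(real \<Rightarrow> real) \<Rightarrow> real \<Rightarrow> real" where
  "left_lim f x = Lim (at_left x) f"

definition right_lim :: "(real \<Rightarrow> real) \<Rightarrow> real \<Rightarrow> real" where
  "right_lim f x = Lim (at_right x) f"

definition trial_space :: "nat \<Rightarrow> nat \<Rightarrow> (nat \<Rightarrow> real) \<Rightarrow> (real \<Rightarrow> real) set" where
  "trial_space k N X =
     {w. \<forall>i\<in>{1..N}. \<exists>p. degree p \<le> k \<and> (\<forall>x\<in>{X (i - 1)<..<X i}. w x = poly p x)}"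

primrec star_val ::
    "sv_method \<Rightarrow> nat \<Rightarrow> (nat \<Rightarrow> real) \<Rightarrow> (nat \<Rightarrow> real) \<Rightarrow> (real \<Rightarrow> real) \<Rightarrow> nat \<Rightarrow> nat \<Rightarrow> real" where
  "star_val meth k y X w i 0 =
     right_lim w (X (i - 1)) +
     cell_weight meth k y X i 0 * right_lim (deriv w) (ctrl_point y X i 0)"
| "star_val meth k y X w i (Suc j) =
     star_val meth k y X w i j +
     cell_weight meth k y X i (Suc j) * deriv w (ctrl_point y X i (Suc j))"

definition star ::
    "sv_method \<Rightarrow> nat \<Rightarrow> (nat \<Rightarrow> real) \<Rightarrow> nat \<Rightarrow> (nat \<Rightarrow> real) \<Rightarrow> (real \<Rightarrow> real) \<Rightarrow> real \<Rightarrow> real" where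
  "star meth k y N X w x =
     (\<Sum>i=1..N. \<Sum>j=0..k. star_val meth k y X w i j *
        indicator {ctrl_point y X i j<..<ctrl_point y X i (j + 1)} x)"

definition upwind_val ::
    "boundary \<Rightarrow> (nat \<Rightarrow> real) \<Rightarrow> nat \<Rightarrow> (nat \<Rightarrow> real) \<Rightarrow> (real \<Rightarrow> real) \<Rightarrow> nat \<Rightarrow> nat \<Rightarrow> real" where
  "upwind_val bc y N X v i j =
     (if i = 1 \<and> j = 0
      then (case bc of Zero_Inflow \<Rightarrow> 0 | Periodic \<Rightarrow> left_lim v (X N))
      else left_lim v (ctrl_point y X i j))"

text \<open>\<open>sv_form \<dots> v w\<close> is \<open>a\<^sub>h(v, w\<^sup>*)\<close>.\<close>

definition sv_form ::
    "boundary \<Rightarrow> sv_method \<Rightarrow> nat \<Rightarrow> (nat \<Rightarrow> real) \<Rightarrow> nat \<Rightarrow> (nat \<Rightarrow> real) \<Rightarrow>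
     (real \<Rightarrow> real) \<Rightarrow> (real \<Rightarrow> real) \<Rightarrow> real" where
  "sv_form bc meth k y N X v w =
     - (\<Sum>i=1..N. \<Sum>j=0..k. star_val meth k y X w i j *
          (upwind_val bc y N X v i (j + 1) - upwind_val bc y N X v i j))"

text \<open>At the right end point of a cell the interpolation condition concerns the trace from
  inside that cell.\<close>

definition lagrange_projection ::
    "nat \<Rightarrow> (nat \<Rightarrow> real) \<Rightarrow> nat \<Rightarrow> (nat \<Rightarrow> real) \<Rightarrow> (real \<Rightarrow> real) \<Rightarrow> (real \<Rightarrow> real) \<Rightarrow> bool" where
  "lagrange_projection k y N X v pv \<longleftrightarrow>
     pv \<in> trial_space k N X \<and>
     (\<forall>i\<in>{1..N}. \<forall>j\<in>{1..k + 1}.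
        left_lim pv (ctrl_point y X i j) = v (ctrl_point y X i j))"


section \<open>The scheme\<close>

text \<open>\<open>rk_coeff (s - 1) l\<close> is \<open>g\<^bsub>s-1,l\<^esub>\<close>.\<close>

primrec rk_coeff :: "nat \<Rightarrow> nat \<Rightarrow> real" where
  "rk_coeff 0 = (\<lambda>l. if l = 0 then 1 else 0)"
| "rk_coeff (Suc m) =
     (let r = (\<lambda>l. if l = Suc m then 1 / fact (m + 2)
                   else if 1 \<le> l \<and> l \<le> m then 1 / real l * rk_coeff m (l - 1)
                   else 0)
      in (\<lambda>l. if l = 0 then 1 - (\<Sum>i=1..Suc m. r i) else r l))"

text \<open>\<open>U n l\<close> is the stage \<open>u\<^sub>h\<^sup>n\<^sup>,\<^sup>l\<close>, so that \<open>u\<^sub>h\<^sup>n = U n 0\<close>.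
  The scheme is started from the Lagrange projection of the initial value.\<close>

definition rksv_solution ::
    "boundary \<Rightarrow> sv_method \<Rightarrow> nat \<Rightarrow> nat \<Rightarrow> (nat \<Rightarrow> real) \<Rightarrow> nat \<Rightarrow> (nat \<Rightarrow> real) \<Rightarrow>
     nat \<Rightarrow> real \<Rightarrow> (real \<Rightarrow> real) \<Rightarrow> (nat \<Rightarrow> nat \<Rightarrow> real \<Rightarrow> real) \<Rightarrow> bool" where
  "rksv_solution bc meth s k y N X M \<tau> u0 U \<longleftrightarrow>
     (let ip = (\<lambda>v w. l2_inner (X 0) (X N) v (star meth k y N X w));
          ah = sv_form bc meth k y N X;
          g = rk_coeff (s - 1)
      in lagrange_projection k y N X u0 (U 0 0) \<and>
         (\<forall>n<M. (\<forall>l\<le>s. U n l \<in> trial_space k N X) \<and>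
            (\<forall>w\<in>trial_space k N X.
               (\<forall>l. l + 2 \<le> s \<longrightarrow> ip (U n (l + 1)) w = ip (U n l) w + \<tau> * ah (U n l) w) \<and>
               ip (U n s) w =
                 (\<Sum>\<kappa><s. g \<kappa> * ip (U n \<kappa>) w) + \<tau> * g (s - 1) * ah (U n (s - 1)) w) \<and>
            U (n + 1) 0 = U n s))"


section \<open>Temporal differences\<close>

text \<open>Writing \<open>L\<close> for the operator given by \<open>(L v, w\<^sup>*) = a\<^sub>h(v, w\<^sup>*)\<close>, the stage relations
  express \<open>\<tau> L v\<^bsub>m\<^esub>\<close>, for \<open>0 \<le> m < s\<close>, as a linear combination of the stages
  \<open>v\<^bsub>0\<^esub>, \<dots>, v\<^bsub>s\<^esub>\<close>, and \<open>stage_diff s m l\<close> is the coefficient of \<open>v\<^bsub>l\<^esub>\<close> in it. The recursion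
  \<open>\<bbbE>\<^bsub>\<kappa>\<^esub> = \<tau> L \<bbbE>\<^bsub>\<kappa>-1\<^esub>\<close> then determines the coefficients \<open>\<beta>\<^bsub>\<kappa>l\<^esub> = temporal_diff s \<kappa> l\<close>.
  The truncation error enters only the relation for \<open>m = s - 1\<close>, which is divided by
  \<open>g\<^bsub>s-1,s-1\<^esub>\<close> and used only for \<open>\<kappa> = s\<close>; this is the term \<open>G / g\<^bsub>s-1,s-1\<^esub>\<close>
  in the defining relations of the temporal differences.\<close>

definition stage_diff :: "nat \<Rightarrow> nat \<Rightarrow> nat \<Rightarrow> real" where
  "stage_diff s m l =
     (if m + 2 \<le> s then (if l = m + 1 then 1 else if l = m then -1 else 0)
      else (if l = s then 1 else if l < s then - rk_coeff (s - 1) l else 0)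
             / rk_coeff (s - 1) (s - 1))"

primrec temporal_diff :: "nat \<Rightarrow> nat \<Rightarrow> nat \<Rightarrow> real" where
  "temporal_diff s 0 = (\<lambda>l. if l = 0 then 1 else 0)"
| "temporal_diff s (Suc \<kappa>) = (\<lambda>l. \<Sum>m\<le>\<kappa>. temporal_diff s \<kappa> m * stage_diff s m l)"

text \<open>The identity \<open>\<beta>\<^sub>0 e\<^sup>n\<^sup>,\<^sup>s = \<Sum>\<^bsub>\<kappa>\<^esub> \<beta>\<^bsub>\<kappa>\<^esub> \<bbbE>\<^bsub>\<kappa>\<^esub> e\<^sup>n\<close> between formal linear combinations of the
  stages, i.e. the coefficients of each \<open>e\<^sup>n\<^sup>,\<^sup>l\<close> agree.\<close>

definition evolution_coeffs :: "nat \<Rightarrow> (nat \<Rightarrow> real) \<Rightarrow> bool" where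
  "evolution_coeffs s \<beta> \<longleftrightarrow>
     0 < \<beta> 0 \<and>
     (\<forall>l\<le>s. (\<Sum>\<kappa>\<le>s. \<beta> \<kappa> * temporal_diff s \<kappa> l) = (if l = s then \<beta> 0 else 0))"


section \<open>The matrix transferring process\<close>

primrec c_matrix :: "nat \<Rightarrow> (nat \<Rightarrow> real) \<Rightarrow> nat \<Rightarrow> nat \<Rightarrow> nat \<Rightarrow> real" where
  "c_matrix s \<beta> 0 = (\<lambda>p q. if p \<le> s \<and> q \<le> s \<and> 0 < p + q then \<beta> p * \<beta> q else 0)"
| "c_matrix s \<beta> (Suc m) = (\<lambda>p' q'.
     let l = Suc m; p = max p' q'; q = min p' q'; c = c_matrix s \<beta> m
     in if s < p then 0
        else if q = l - 1 then 0
        else if p = l \<and> q = l then c p q - 2 * c (p + 1) (q - 1)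
        else if l + 1 \<le> p \<and> p \<le> s - 1 \<and> q = l then c p q - c (p + 1) (q - 1)
        else c p q)"

text \<open>The matrix \<open>\<bbbH>\<close> collects the terms \<open>\<tau> a\<^sub>h(\<bbbE>\<^bsub>p\<^esub>\<xi>, (\<bbbE>\<^bsub>q\<^esub>\<xi>)\<^sup>*)\<close>. The parameter \<open>r\<close> distinguishes two
  index conventions for its update
  \<^item> \<open>r = 0\<close>: \<open>h\<^bsub>p,q\<^esub> = 2 c\<^bsub>p,q\<^esub>\<close> for \<open>l \<le> p \<le> s\<close>, \<open>q = l - 1\<close>;
  \<^item> \<open>r = 1\<close>: \<open>h\<^bsub>p-1,q\<^esub> = 2 c\<^bsub>p,q\<^esub>\<close> for \<open>l \<le> p \<le> s\<close>, \<open>q = l - 1\<close>.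

  The first one, taken literally, leaves the diagonal of \<open>\<bbbH>\<close> equal to zero and hence always gives
  contribution index \<open>0\<close>. The second one is what the relation
  \<open>(\<bbbE>\<^bsub>p\<^esub>\<xi>, (\<bbbE>\<^bsub>q\<^esub>\<xi>)\<^sup>*) = \<tau> a\<^sub>h(\<bbbE>\<^bsub>p-1\<^esub>\<xi>, (\<bbbE>\<^bsub>q\<^esub>\<xi>)\<^sup>*) + \<dots>\<close> produces.\<close>

primrec h_matrix :: "nat \<Rightarrow> nat \<Rightarrow> (nat \<Rightarrow> real) \<Rightarrow> nat \<Rightarrow> nat \<Rightarrow> nat \<Rightarrow> real" where
  "h_matrix r s \<beta> 0 = (\<lambda>p q. 0)"
| "h_matrix r s \<beta> (Suc m) = (\<lambda>p' q'.
     let l = Suc m; p = max p' q'; q = min p' q'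
     in if l \<le> p + r \<and> p + r \<le> s \<and> q = l - 1 then 2 * c_matrix s \<beta> m (p + r) q
        else h_matrix r s \<beta> m p q)"

definition termination_index :: "nat \<Rightarrow> (nat \<Rightarrow> real) \<Rightarrow> nat" where
  "termination_index s \<beta> = (LEAST l. 1 \<le> l \<and> c_matrix s \<beta> l l l \<noteq> 0)"

definition leading_minor :: "nat \<Rightarrow> nat \<Rightarrow> (nat \<Rightarrow> real) \<Rightarrow> nat \<Rightarrow> real" where
  "leading_minor r s \<beta> \<kappa> =
     Determinant.det (Matrix.mat (\<kappa> + 1) (\<kappa> + 1)
       (\<lambda>(p, q). h_matrix r s \<beta> (termination_index s \<beta>) p q))"

definition contribution_index :: "nat \<Rightarrow> nat \<Rightarrow> (nat \<Rightarrow> real) \<Rightarrow> nat" where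
  "contribution_index r s \<beta> =
     (let K = {\<kappa>. \<kappa> \<le> termination_index s \<beta> - 1 \<and> leading_minor r s \<beta> \<kappa> \<le> 0}
      in if K \<noteq> {} then Min K else termination_index s \<beta>)"


section \<open>The error estimate\<close>

text \<open>The estimate with the constant \<open>C\<close>, for all exact solutions, all regular meshes and all
  step numbers \<open>M\<close> for which \<open>\<tau> = T / M\<close> and \<open>h\<close> satisfy the condition \<open>cfl \<tau> h\<close>.\<close>

definition error_estimate ::
    "boundary \<Rightarrow> sv_method \<Rightarrow> nat \<Rightarrow> nat \<Rightarrow> (nat \<Rightarrow> real) \<Rightarrow> real \<Rightarrow> real \<Rightarrow> real \<Rightarrow> real \<Rightarrow>
     (real \<Rightarrow> real \<Rightarrow> bool) \<Rightarrow> real \<Rightarrow> bool" where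
  "error_estimate bc meth s k y a b T \<alpha> cfl C \<longleftrightarrow>
     (\<forall>u0 u N X M U.
        exact_solution bc a b T u0 u \<and> regular_mesh \<alpha> a b N X \<and> 1 \<le> M \<and>
        rksv_solution bc meth s k y N X M (T / real M) u0 U \<and>
        cfl (T / real M) (mesh_size N X) \<longrightarrow>
        (\<forall>n\<le>M. ennreal (l2_norm a b (\<lambda>x. u x (real n * (T / real M)) - U n 0 x))
           \<le> ennreal (C * (mesh_size N X ^ (k + 1) + (T / real M) ^ s)) *
              solution_norm (k + 2) a b T u))"


section \<open>Consistency of the definitions of the coefficients\<close>

lemma rk_coeff_last: "rk_coeff m m = 1 / fact (Suc m)"
  by (cases m) (simp_all add: Let_def)

lemma temporal_diff_zero: "\<kappa> \<le> s \<Longrightarrow> \<kappa> < l \<Longrightarrow> temporal_diff s \<kappa> l = 0"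
proof (induction \<kappa> arbitrary: l)
  case (Suc \<kappa>)
  have "stage_diff s m l = 0" if "m \<le> \<kappa>" for m
    using that Suc.prems by (auto simp: stage_diff_def)
  then show ?case by simp
qed simp

lemma stage_diff_step:
  fixes v :: "nat \<Rightarrow> 'a::real_vector"
  assumes "1 \<le> s"
    and stage: "\<And>l. l + 2 \<le> s \<Longrightarrow> v (l + 1) = v l + D (v l)"
    and last: "v s = (\<Sum>\<kappa><s. rk_coeff (s - 1) \<kappa> *\<^sub>R v \<kappa>)
                      + rk_coeff (s - 1) (s - 1) *\<^sub>R D (v (s - 1))"
    and "m < s"
  shows "(\<Sum>l\<le>s. stage_diff s m l *\<^sub>R v l) = D (v m)"
proof (cases "m + 2 \<le> s")
  case True
  have "(\<Sum>l\<le>s. stage_diff s m l *\<^sub>R v l) = (\<Sum>l\<in>{m, m + 1}. stage_diff s m l *\<^sub>R v l)"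
    using True by (intro sum.mono_neutral_right) (auto simp: stage_diff_def)
  also have "\<dots> = v (m + 1) - v m"
    using True by (simp add: stage_diff_def)
  finally show ?thesis using stage[OF True] by simp
next
  case False
  then have m: "m = s - 1" using assms by simp
  let ?g = "rk_coeff (s - 1)"
  have g: "?g (s - 1) \<noteq> 0" by (simp add: rk_coeff_last)
  have "{..s} = insert s {..<s}" by auto
  then have "(\<Sum>l\<le>s. stage_diff s m l *\<^sub>R v l)
      = stage_diff s m s *\<^sub>R v s + (\<Sum>l<s. stage_diff s m l *\<^sub>R v l)" by simp
  also have "\<dots> = (1 / ?g (s - 1)) *\<^sub>R (v s - (\<Sum>\<kappa><s. ?g \<kappa> *\<^sub>R v \<kappa>))"
    using False
    by (simp add: stage_diff_def scaleR_right_diff_distrib scaleR_sum_right sum_negf divide_inverse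
        mult.commute)
  also have "\<dots> = D (v m)" using g last m by simp
  finally show ?thesis .
qed

lemma temporal_diff_step:
  fixes v :: "nat \<Rightarrow> 'a::real_vector"
  assumes D: "linear D" and s: "1 \<le> s"
    and stage: "\<And>l. l + 2 \<le> s \<Longrightarrow> v (l + 1) = v l + D (v l)"
    and last: "v s = (\<Sum>\<kappa><s. rk_coeff (s - 1) \<kappa> *\<^sub>R v \<kappa>)
                      + rk_coeff (s - 1) (s - 1) *\<^sub>R D (v (s - 1))"
    and \<kappa>: "\<kappa> < s"
  shows "(\<Sum>l\<le>\<kappa> + 1. temporal_diff s (\<kappa> + 1) l *\<^sub>R v l) = D (\<Sum>l\<le>\<kappa>. temporal_diff s \<kappa> l *\<^sub>R v l)"
proof -
  have "(\<Sum>l\<le>\<kappa> + 1. temporal_diff s (\<kappa> + 1) l *\<^sub>R v l) = (\<Sum>l\<le>s. temporal_diff s (\<kappa> + 1) l *\<^sub>R v l)"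
    using \<kappa> by (intro sum.mono_neutral_left) (auto simp del: temporal_diff.simps
        intro!: temporal_diff_zero)
  also have "\<dots> = (\<Sum>l\<le>s. \<Sum>m\<le>\<kappa>. temporal_diff s \<kappa> m *\<^sub>R stage_diff s m l *\<^sub>R v l)"
    by (simp add: scaleR_sum_left)
  also have "\<dots> = (\<Sum>m\<le>\<kappa>. temporal_diff s \<kappa> m *\<^sub>R (\<Sum>l\<le>s. stage_diff s m l *\<^sub>R v l))"
    by (subst sum.swap) (simp add: scaleR_sum_right)
  also have "\<dots> = (\<Sum>m\<le>\<kappa>. temporal_diff s \<kappa> m *\<^sub>R D (v m))"
    using \<kappa> stage_diff_step[OF s stage last] by (intro sum.cong) auto
  also have "\<dots> = D (\<Sum>l\<le>\<kappa>. temporal_diff s \<kappa> l *\<^sub>R v l)"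
    using D by (simp add: linear_sum linear_scale)
  finally show ?thesis .
qed

end

theory Submission imports Defs begin

text \<open>The error estimate is an instance of ``stability and consistency imply convergence'',
  applied to a one-step recursion in a finite-dimensional space of piecewise polynomials.

  \<^bold>\<open>The scheme as an operator power series.\<close> On each cell everything is pulled back to \<open>[-1, 1]\<close>.
  The increments of \<open>w\<^sup>*\<close> over a cell are quadrature terms, so summation by parts turns \<open>(v, w\<^sup>*)\<close>
  into an inner product \<open>mass\<close> on \<open>\<P>\<^sup>k\<close>, namely the \<open>L\<^sub>2\<close> product plus (for LSV) a positive
  multiple of the product of the leading coefficients; this is \<open>mass_eq_star\<close> and \<open>l2_inner_eq\<close>.
  The same identity shows that \<open>a\<^sub>h(v, w\<^sup>*)\<close> is represented in this inner product by an explicit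
  operator \<open>L\<close>: minus the derivative of the polynomial of degree \<open>k + 1\<close> that interpolates the
  upwind values of \<open>v\<close> at all \<open>k + 2\<close> points of the cell. Since \<open>w\<close> is arbitrary, the stages are
  polynomials in \<open>\<tau>L\<close> applied to \<open>u\<^sub>h\<^sup>n\<close>, and one step is \<open>R(\<tau>L) = \<Sum>\<^bsub>\<kappa>\<le>s\<^esub> (\<tau>L)\<^sup>\<kappa>/\<kappa>!\<close>
  (\<open>scheme_step\<close>). Likewise \<open>\<beta>\<^sub>\<kappa> = \<beta>\<^sub>0/\<kappa>!\<close>, whence \<open>\<beta>\<^sub>0\<^sup>2 (|||R(\<tau>L)v|||\<^sup>2 - |||v|||\<^sup>2)\<close> is the
  quadratic form of the matrix \<open>\<bbbC>\<^bsup>(0)\<^esup>\<close> in the numbers \<open>((\<tau>L)\<^sup>p v, ((\<tau>L)\<^sup>q v)\<^sup>*)\<close>.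

  \<^bold>\<open>Stability.\<close> Upwinding makes \<open>L\<close> skew-symmetric up to jumps: \<open>(Lv, w\<^sup>*) + (v, (Lw)\<^sup>*)\<close> is minus
  the sum of the products of the jumps of \<open>v\<close> and \<open>w\<close> (\<open>energy_skew\<close>). The transferring process is
  nothing but repeated use of this relation (\<open>transfer_process\<close>): it rewrites the form of \<open>\<bbbC>\<^bsup>(0)\<^esup>\<close>
  as the form of \<open>\<bbbC>\<^bsup>(\<zeta>)\<^esup>\<close>, whose entries of index below \<open>\<zeta>\<close> vanish, minus half the form of
  \<open>\<bbbH>\<^bsup>(\<zeta>)\<^esup>\<close> in the jumps. By Sylvester's criterion the leading block of \<open>\<bbbH>\<^bsup>(\<zeta>)\<^esup>\<close> of order \<open>\<rho>\<close> is
  positive definite, so only jumps of \<open>(\<tau>L)\<^sup>p v\<close> with \<open>p \<ge> \<rho>\<close> can contribute with the wrong sign.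
  As each application of \<open>\<tau>L\<close> costs a factor of the order of the CFL number \<open>\<lambda>\<close>, the growth is at
  most of order \<open>\<lambda>\<^bsup>2\<zeta>\<^esup> + \<lambda>\<^bsup>2\<rho>+1\<^esup>\<close>. A negative entry at \<open>(\<zeta>, \<zeta>)\<close> removes the first term for small
  \<open>\<lambda>\<close>, and it absorbs the second one as well if \<open>\<rho> = \<zeta>\<close> (\<open>energy_growth_bound\<close>). The CFL condition
  converts these bounds into \<open>|||R(\<tau>L)v|||\<^sup>2 \<le> (1 + C\<tau>) |||v|||\<^sup>2\<close>; if it limits a power of \<open>\<lambda>\<close> by
  \<open>\<tau>\<close>, CFL numbers that are not small are harmless, because \<open>\<tau>\<close> is then bounded from below.

  \<^bold>\<open>Consistency.\<close> A finite norm \<open>\<parallel>u\<parallel>\<^bsub>k+2,\<infinity>\<^esub>\<close> means \<open>u(x, t) = w(x - t)\<close> with a profile \<open>w\<close> that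
  has \<open>k + 1\<close> classical derivatives, all of them Lipschitz and compatible with the boundary
  condition (\<open>smooth_profile_exists\<close>). Let \<open>V\<^sub>j\<close> be the Lagrange projection of \<open>\<partial>\<^sub>t\<^sup>j u\<close>. The flux
  polynomial of \<open>V\<^sub>j\<close> interpolates \<open>\<partial>\<^sub>t\<^sup>j u\<close> at \<open>k + 2\<close> points, so \<open>LV\<^sub>j - V\<^bsub>j+1\<^esub>\<close> is of order
  \<open>h\<^bsup>k+1-j\<^esup>\<close> (\<open>consistency_cell\<close>); iterating and comparing with Taylor's formula in time gives a
  local error of order \<open>\<tau> (h\<^bsup>k+1\<^esup> + \<tau>\<^sup>s)\<close> (\<open>local_error\<close>). Summing the local errors with the
  stability bound, and adding the projection error, proves the estimate
  (\<open>error_estimate_if_stable\<close>).\<close>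

section \<open>Positive definiteness and leading principal minors\<close>

definition leading_pos :: "nat \<Rightarrow> (nat \<Rightarrow> nat \<Rightarrow> real) \<Rightarrow> bool" where
  "leading_pos n h \<longleftrightarrow>
     (\<forall>\<kappa><n. 0 < Determinant.det (Matrix.mat (\<kappa> + 1) (\<kappa> + 1) (\<lambda>(p, q). h p q)))"

text \<open>The Schur complement of the corner entry, re-indexed to start at \<open>0\<close>.\<close>

definition schur :: "(nat \<Rightarrow> nat \<Rightarrow> real) \<Rightarrow> nat \<Rightarrow> nat \<Rightarrow> real" where
  "schur h p q = h (Suc p) (Suc q) - h (Suc p) 0 * h 0 (Suc q) / h 0 0"

text \<open>Eliminating the first column is left multiplication by a unit lower triangular block matrix,
  which does not change the determinant.\<close>

lemma det_schur:
  fixes h :: "nat \<Rightarrow> nat \<Rightarrow> real"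
  assumes "h 0 0 \<noteq> 0"
  shows "Determinant.det (Matrix.mat (Suc n) (Suc n) (\<lambda>(p, q). h p q)) =
         h 0 0 * Determinant.det (Matrix.mat n n (\<lambda>(p, q). schur h p q))"
proof -
  define L1 L2 L3 L4 where "L1 = Matrix.mat 1 1 (\<lambda>(p, q). 1::real)" and "L2 = (0\<^sub>m 1 n :: real Matrix.mat)"
    and "L3 = Matrix.mat n 1 (\<lambda>(p, q). h (Suc p) 0 / h 0 0)" and "L4 = (1\<^sub>m n :: real Matrix.mat)"
  define R1 R2 R3 R4 where "R1 = Matrix.mat 1 1 (\<lambda>(p, q). h 0 0)"
    and "R2 = Matrix.mat 1 n (\<lambda>(p, q). h 0 (Suc q))"
    and "R3 = (0\<^sub>m n 1 :: real Matrix.mat)" and "R4 = Matrix.mat n n (\<lambda>(p, q). schur h p q)"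
  note defs = L1_def L2_def L3_def L4_def R1_def R2_def R3_def R4_def
  have c: "L1 \<in> carrier_mat 1 1" "L2 \<in> carrier_mat 1 n" "L3 \<in> carrier_mat n 1" "L4 \<in> carrier_mat n n"
    "R1 \<in> carrier_mat 1 1" "R2 \<in> carrier_mat 1 n" "R3 \<in> carrier_mat n 1" "R4 \<in> carrier_mat n n"
    by (auto simp: defs)
  have p1: "L1 * R1 + L2 * R3 = R1"
    by (rule eq_matI) (auto simp: defs scalar_prod_def)
  have p2: "L1 * R2 + L2 * R4 = R2"
    by (rule eq_matI) (auto simp: defs scalar_prod_def)
  have p3: "L3 * R1 + L4 * R3 = Matrix.mat n 1 (\<lambda>(p, q). h (Suc p) 0)"
    using assms by (intro eq_matI) (auto simp: defs scalar_prod_def)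
  have p4: "L3 * R2 + L4 * R4 = Matrix.mat n n (\<lambda>(p, q). h (Suc p) (Suc q))"
  proof -
    have "L4 * R4 = R4" unfolding L4_def using c by simp
    then show ?thesis
      by (intro eq_matI) (auto simp: L3_def R2_def R4_def scalar_prod_def schur_def)
  qed
  have m: "Matrix.mat (Suc n) (Suc n) (\<lambda>(p, q). h p q) =
      four_block_mat L1 L2 L3 L4 * four_block_mat R1 R2 R3 R4"
    unfolding mult_four_block_mat[OF c] p1 p2 p3 p4
    by (rule eq_matI) (auto simp: R1_def R2_def)
  have "Determinant.det (four_block_mat L1 L2 L3 L4) = Determinant.det L1 * Determinant.det L4"
    by (rule det_four_block_mat_upper_right_zero) (use c L2_def in auto)
  moreover have "Determinant.det (four_block_mat R1 R2 R3 R4) = Determinant.det R1 * Determinant.det R4"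
    by (rule det_four_block_mat_lower_left_zero) (use c R3_def in auto)
  moreover have "Determinant.det L1 = 1" "Determinant.det R1 = h 0 0"
    using det_single[OF c(1)] det_single[OF c(5)] by (auto simp: L1_def R1_def)
  moreover have "Determinant.det L4 = 1" by (simp add: L4_def)
  moreover have "Determinant.det (four_block_mat L1 L2 L3 L4 * four_block_mat R1 R2 R3 R4) =
     Determinant.det (four_block_mat L1 L2 L3 L4) * Determinant.det (four_block_mat R1 R2 R3 R4)"
    by (rule Determinant.det_mult[of _ "1 + n"]) (use c in auto)
  ultimately show ?thesis unfolding m by (simp add: R4_def)
qed

text \<open>Sylvester's criterion. Completing the square in the first variable leaves the form of the
  Schur complement, whose leading minors are quotients of those of \<open>h\<close> by \<open>det_schur\<close>, so that
  induction on the order applies. The margin \<open>\<epsilon>\<close> will pay for the cross terms with variables outside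
  of the positive block.\<close>

lemma sylvester:
  fixes h :: "nat \<Rightarrow> nat \<Rightarrow> real"
  assumes "\<And>p q. h p q = h q p" and "leading_pos n h"
  shows "\<exists>\<epsilon>>0. \<forall>x :: nat \<Rightarrow> real.
           \<epsilon> * (\<Sum>p<n. (x p)\<^sup>2) \<le> (\<Sum>p<n. \<Sum>q<n. h p q * (x p * x q))"
  using assms
proof (induction n arbitrary: h)
  case 0
  then show ?case by (auto intro: exI[of _ 1])
next
  case (Suc n)
  have sym: "\<And>p q. h p q = h q p" by fact
  have h0: "0 < h 0 0"
  proof -
    have "0 < Determinant.det (Matrix.mat 1 1 (\<lambda>(p, q). h p q))"
      using Suc.prems(2) unfolding leading_pos_def by (metis add_0 zero_less_Suc)
    also have "Determinant.det (Matrix.mat 1 1 (\<lambda>(p, q). h p q)) = h 0 0"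
      by (subst det_single) auto
    finally show ?thesis .
  qed
  have "leading_pos n (schur h)"
    unfolding leading_pos_def
  proof (intro allI impI)
    fix \<kappa> assume "\<kappa> < n"
    then have "0 < Determinant.det (Matrix.mat (Suc (\<kappa> + 1)) (Suc (\<kappa> + 1)) (\<lambda>(p, q). h p q))"
      using Suc.prems(2) unfolding leading_pos_def by (metis Suc_eq_plus1 Suc_mono)
    then show "0 < Determinant.det (Matrix.mat (\<kappa> + 1) (\<kappa> + 1) (\<lambda>(p, q). schur h p q))"
      using h0 by (subst (asm) det_schur) (auto simp: zero_less_mult_iff)
  qed
  moreover have "schur h p q = schur h q p" for p q
    using sym by (simp add: schur_def mult.commute)
  ultimately obtain \<epsilon> where e: "0 < \<epsilon>"
    and pd: "\<And>x :: nat \<Rightarrow> real. \<epsilon> * (\<Sum>p<n. (x p)\<^sup>2) \<le> (\<Sum>p<n. \<Sum>q<n. schur h p q * (x p * x q))"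
    using Suc.IH[of "schur h"] by blast
  define K where "K = (\<Sum>q<n. (h 0 (Suc q) / h 0 0)\<^sup>2)"
  have K: "0 \<le> K" unfolding K_def by (intro sum_nonneg) auto
  \<comment> \<open>completing the square in the first variable\<close>
  have square: "(\<Sum>p<Suc n. \<Sum>q<Suc n. h p q * (x p * x q)) =
      h 0 0 * (x 0 + (\<Sum>q<n. h 0 (Suc q) / h 0 0 * x (Suc q)))\<^sup>2 +
      (\<Sum>p<n. \<Sum>q<n. schur h p q * (x (Suc p) * x (Suc q)))" for x :: "nat \<Rightarrow> real"
  proof -
    define b where "b = (\<Sum>q<n. h 0 (Suc q) * x (Suc q))"
    have b0: "(\<Sum>q<n. h 0 (Suc q) / h 0 0 * x (Suc q)) = b / h 0 0"
      by (simp add: b_def sum_divide_distrib)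
    have bb: "(\<Sum>p<n. \<Sum>q<n. h (Suc p) 0 * h 0 (Suc q) / h 0 0 * (x (Suc p) * x (Suc q))) = b\<^sup>2 / h 0 0"
    proof -
      have "b\<^sup>2 / h 0 0 = (\<Sum>p<n. \<Sum>q<n. (h 0 (Suc p) * x (Suc p)) * (h 0 (Suc q) * x (Suc q)) / h 0 0)"
        unfolding b_def power2_eq_square sum_product by (simp only: sum_divide_distrib)
      also have "\<dots> = (\<Sum>p<n. \<Sum>q<n. h (Suc p) 0 * h 0 (Suc q) / h 0 0 * (x (Suc p) * x (Suc q)))"
        by (intro sum.cong refl) (simp add: sym[of "Suc _" 0])
      finally show ?thesis by simp
    qed
    have "(\<Sum>p<Suc n. \<Sum>q<Suc n. h p q * (x p * x q)) =
       h 0 0 * (x 0)\<^sup>2 + 2 * x 0 * b + (\<Sum>p<n. \<Sum>q<n. h (Suc p) (Suc q) * (x (Suc p) * x (Suc q)))"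
    proof -
      have "(\<Sum>p<n. h (Suc p) 0 * (x (Suc p) * x 0)) = x 0 * b"
        unfolding b_def sum_distrib_left by (intro sum.cong refl) (simp add: sym[of "Suc _" 0])
      moreover have "(\<Sum>q<n. h 0 (Suc q) * (x 0 * x (Suc q))) = x 0 * b"
        unfolding b_def sum_distrib_left by (intro sum.cong refl) simp
      ultimately show ?thesis
        unfolding sum.lessThan_Suc_shift sum.distrib by (simp add: power2_eq_square)
    qed
    moreover have "(\<Sum>p<n. \<Sum>q<n. schur h p q * (x (Suc p) * x (Suc q))) =
       (\<Sum>p<n. \<Sum>q<n. h (Suc p) (Suc q) * (x (Suc p) * x (Suc q))) - b\<^sup>2 / h 0 0"
      unfolding bb[symmetric] schur_def by (simp add: sum_subtractf algebra_simps)
    moreover have "h 0 0 * (x 0 + b / h 0 0)\<^sup>2 = h 0 0 * (x 0)\<^sup>2 + 2 * x 0 * b + b\<^sup>2 / h 0 0"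
      using h0 by (simp add: field_simps power2_eq_square)
    ultimately show ?thesis unfolding b0 by simp
  qed
  \<comment> \<open>The first variable is \<open>x 0 + l\<close> minus \<open>l\<close>, and \<open>l\<close> is controlled by the other variables: half
    of \<open>h 0 0\<close> pays for the former, a part of \<open>\<epsilon>\<close> for the latter.\<close>
  define \<delta> where "\<delta> = min (h 0 0 / 2) (\<epsilon> / (2 * K + 1))"
  have "0 < \<delta>" using h0 e K by (simp add: \<delta>_def)
  moreover have "\<delta> * (\<Sum>p<Suc n. (x p)\<^sup>2) \<le> (\<Sum>p<Suc n. \<Sum>q<Suc n. h p q * (x p * x q))"
    for x :: "nat \<Rightarrow> real"
  proof -
    define Y where "Y = (\<Sum>p<n. (x (Suc p))\<^sup>2)"
    define l where "l = (\<Sum>q<n. h 0 (Suc q) / h 0 0 * x (Suc q))"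
    have "l\<^sup>2 \<le> K * Y"
      unfolding l_def K_def Y_def by (rule Cauchy_Schwarz_ineq_sum)
    moreover have "(x 0)\<^sup>2 \<le> 2 * (x 0 + l)\<^sup>2 + 2 * l\<^sup>2"
      using zero_le_power2[of "x 0 + 2 * l"] by (simp add: power2_eq_square algebra_simps)
    ultimately have x0: "(x 0)\<^sup>2 \<le> 2 * (x 0 + l)\<^sup>2 + 2 * K * Y" by linarith
    have Y: "0 \<le> Y" unfolding Y_def by (intro sum_nonneg) auto
    have "\<delta> * (\<Sum>p<Suc n. (x p)\<^sup>2) = \<delta> * ((x 0)\<^sup>2 + Y)"
      unfolding sum.lessThan_Suc_shift Y_def by simp
    also have "\<dots> \<le> \<delta> * (2 * (x 0 + l)\<^sup>2 + (2 * K + 1) * Y)"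
      using x0 \<open>0 < \<delta>\<close> by (intro mult_left_mono) (auto simp: algebra_simps)
    also have "\<dots> = (\<delta> * 2) * (x 0 + l)\<^sup>2 + (\<delta> * (2 * K + 1)) * Y" by (simp add: algebra_simps)
    also have "\<dots> \<le> h 0 0 * (x 0 + l)\<^sup>2 + \<epsilon> * Y"
    proof (intro add_mono mult_right_mono)
      show "\<delta> * 2 \<le> h 0 0" by (simp add: \<delta>_def min_def)
      have "\<delta> \<le> \<epsilon> / (2 * K + 1)" by (simp add: \<delta>_def)
      then show "\<delta> * (2 * K + 1) \<le> \<epsilon>" using K by (simp add: pos_le_divide_eq)
    qed (use Y in auto)
    also have "\<dots> \<le> (\<Sum>p<Suc n. \<Sum>q<Suc n. h p q * (x p * x q))"
      unfolding square l_def using pd[of "\<lambda>p. x (Suc p)"] by (simp add: Y_def)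
    finally show ?thesis .
  qed
  ultimately show ?case by blast
qed

section \<open>The matrix transferring process and quadratic forms\<close>

definition quad_form :: "nat \<Rightarrow> (nat \<Rightarrow> nat \<Rightarrow> real) \<Rightarrow> (nat \<Rightarrow> nat \<Rightarrow> real) \<Rightarrow> real" where
  "quad_form s M f = (\<Sum>p\<le>s. \<Sum>q\<le>s. M p q * f p q)"

lemma quad_form_column:
  assumes "j \<le> s"
  shows "quad_form s (\<lambda>p q. if q = j then r p else 0) f = (\<Sum>p\<le>s. r p * f p j)"
proof -
  have "(\<Sum>q\<le>s. (if q = j then r p else 0) * f p q) = r p * f p j" for p
  proof -
    have "(\<Sum>q\<le>s. (if q = j then r p else 0) * f p q) = (\<Sum>q\<le>s. if q = j then r p * f p q else 0)"
      by (intro sum.cong) auto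
    then show ?thesis using assms by simp
  qed
  then show ?thesis by (simp add: quad_form_def)
qed

lemma quad_form_add: "quad_form s (\<lambda>p q. M p q + M' p q) f = quad_form s M f + quad_form s M' f"
  by (simp add: quad_form_def sum.distrib distrib_right)

lemma quad_form_diff: "quad_form s (\<lambda>p q. M p q - M' p q) f = quad_form s M f - quad_form s M' f"
  by (simp add: quad_form_def sum_subtractf left_diff_distrib)

lemma quad_form_transpose:
  assumes "\<And>p q. f p q = f q p"
  shows "quad_form s (\<lambda>p q. M q p) f = quad_form s M f"
  unfolding quad_form_def by (subst sum.swap) (use assms in auto)

lemma quad_form_cong:
  assumes "\<And>p q. p \<le> s \<Longrightarrow> q \<le> s \<Longrightarrow> M p q = M' p q"
  shows "quad_form s M f = quad_form s M' f"
  using assms by (simp add: quad_form_def)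

lemma c_matrix_sym: "c_matrix s \<beta> l p q = c_matrix s \<beta> l q p"
  by (cases l) (auto simp: Let_def max.commute min.commute mult.commute)

lemma c_matrix_beyond: "s < p \<Longrightarrow> c_matrix s \<beta> l p q = 0"
  by (cases l) (auto simp: Let_def)

text \<open>Step \<open>m\<close> clears the row and the column of index \<open>m - 1\<close>, and later steps do not touch them
  again.\<close>

lemma c_matrix_eliminated: "min p q < l \<Longrightarrow> c_matrix s \<beta> l p q = 0"
proof (induction l arbitrary: p q)
  case (Suc l)
  show ?case
  proof (cases "min p q = l")
    case False
    then have "min p q < l" using Suc.prems by simp
    moreover from this have "c_matrix s \<beta> l (max p q) (min p q) = 0"
      by (intro Suc.IH) auto
    ultimately show ?thesis by (auto simp: Let_def simp del: min_less_iff_conj)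
  qed (simp add: Let_def)
qed simp

lemma h_matrix_sym: "h_matrix r s \<beta> l p q = h_matrix r s \<beta> l q p"
  by (cases l) (auto simp: Let_def max.commute min.commute)

text \<open>Step \<open>m\<close> writes only to the row and the column of index \<open>m - 1\<close>.\<close>

lemma h_matrix_pending: "l \<le> min p q \<Longrightarrow> h_matrix r s \<beta> l p q = 0"
proof (induction l arbitrary: p q)
  case (Suc l)
  have "h_matrix r s \<beta> l (max p q) (min p q) = 0"
    using Suc.prems by (intro Suc.IH) auto
  then show ?case using Suc.prems by (auto simp: Let_def simp del: min_less_iff_conj)
qed simp

text \<open>Without the index shift only entries with \<open>p > q\<close> and their mirror images are ever written.\<close>

lemma h_matrix_unshifted_diag: "h_matrix 0 s \<beta> l p p = 0"
  by (induction l arbitrary: p) (auto simp: Let_def)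

text \<open>By \<open>rel\<close> the entry \<open>a (p + 1) m\<close> equals \<open>- S p m - a p (m + 1)\<close>, so that the row and column
  \<open>m\<close> of the matrix can be moved one step towards the diagonal, at the price of an entry at \<open>(p, m)\<close>
  in the form of \<open>S\<close>. This is why the index shift \<open>r = 1\<close> is the one that gives an identity. The
  entry \<open>a m m\<close> itself cannot be moved, so its coefficient has to vanish.\<close>

lemma transfer_step:
  fixes a S :: "nat \<Rightarrow> nat \<Rightarrow> real"
  assumes a: "\<And>p q. a p q = a q p" and S: "\<And>p q. S p q = S q p"
    and rel: "\<And>p q. a (Suc p) q + a p (Suc q) = - S p q"
    and m: "m < s" and diag: "c_matrix s \<beta> m m m = 0"
  shows "quad_form s (c_matrix s \<beta> m) a = quad_form s (c_matrix s \<beta> (Suc m)) a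
     - quad_form s (\<lambda>p q. h_matrix 1 s \<beta> (Suc m) p q - h_matrix 1 s \<beta> m p q) S / 2"
proof -
  define c where "c = c_matrix s \<beta> m"
  define C where "C p = c (Suc p) m" for p
  have csym: "c p q = c q p" for p q unfolding c_def by (rule c_matrix_sym)
  have cs: "c p q = 0" if "s < p" for p q unfolding c_def using that by (rule c_matrix_beyond)
  have c0: "c m m = 0" using diag by (simp add: c_def)
  \<comment> \<open>The changes of the two matrices, split into columns and their transposes; \<open>G\<close> halves the
    diagonal entry, which belongs to both.\<close>
  define E where "E p q = (if q = m then (if m < p then c p m else 0) else 0) +
     (if q = Suc m then (if m < p \<and> p < s then C p else 0) else 0)" for p q
  define G where "G p q = (if q = m then (if p < s then (if m < p then 2 * C p else if p = m then C m else 0) else 0) else 0)"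
    for p q
  have d: "c p q - c_matrix s \<beta> (Suc m) p q = E p q + E q p" if "p \<le> s" "q \<le> s" for p q
  proof -
    have "c p q - c_matrix s \<beta> (Suc m) p q = E p q + E q p" if pq: "q \<le> p" "p \<le> s" for p q
    proof -
      have s: "c (Suc s) m = 0" by (rule cs) simp
      have low: "c p q = 0" if "q < m" unfolding c_def by (rule c_matrix_eliminated) (use that pq in auto)
      consider "q < m" | "q = m" | "q = Suc m" "p = Suc m" | "q = Suc m" "Suc m < p" | "Suc m < q"
        using pq by linarith
      then show ?thesis
      proof cases
        case 3
        then show ?thesis using pq s unfolding E_def C_def c_def by (cases "p < s") (auto simp: Let_def)
      next
        case 4
        then show ?thesis using pq s unfolding E_def C_def c_def by (cases "p < s") (auto simp: Let_def)
      qed (use pq low c0 in \<open>auto simp: Let_def E_def C_def c_def[symmetric]\<close>)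
    qed
    from this[of q p] this[of p q] that show ?thesis
      using csym c_matrix_sym[of s \<beta> "Suc m"] by (cases "q \<le> p") (auto simp: add.commute)
  qed
  have dh: "h_matrix 1 s \<beta> (Suc m) p q - h_matrix 1 s \<beta> m p q = G p q + G q p" for p q
  proof -
    have "h_matrix 1 s \<beta> (Suc m) p q - h_matrix 1 s \<beta> m p q = G p q + G q p" if pq: "q \<le> p" for p q
    proof (cases "q = m")
      case True
      then have "h_matrix 1 s \<beta> m p q = 0" using pq by (intro h_matrix_pending) simp
      then show ?thesis using pq True
        by (auto simp: Let_def G_def C_def c_def max_def min_def)
    qed (use pq in \<open>auto simp: Let_def G_def max_def min_def\<close>)
    from this[of q p] this[of p q] show ?thesis
      using h_matrix_sym[of 1 s \<beta> "Suc m"] h_matrix_sym[of 1 s \<beta> m]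
      by (cases "q \<le> p") (auto simp: add.commute)
  qed
  have "quad_form s c a - quad_form s (c_matrix s \<beta> (Suc m)) a = quad_form s (\<lambda>p q. E p q + E q p) a"
    unfolding quad_form_diff[symmetric] by (intro quad_form_cong d)
  also have "\<dots> = 2 * quad_form s E a"
    unfolding quad_form_add using quad_form_transpose[of a s E] a by simp
  also have "quad_form s E a = (\<Sum>p\<le>s. (if m < p then c p m else 0) * a p m)
      + (\<Sum>p\<le>s. (if m < p \<and> p < s then C p else 0) * a p (Suc m))"
    unfolding E_def quad_form_add using m by (simp add: quad_form_column)
  also have "(\<Sum>p\<le>s. (if m < p then c p m else 0) * a p m) =
      (\<Sum>p<s. (if m \<le> p then C p else 0) * a (Suc p) m)"
    unfolding sum.atMost_shift C_def by (simp add: less_Suc_eq_le)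
  also have "(\<Sum>p\<le>s. (if m < p \<and> p < s then C p else 0) * a p (Suc m)) =
      (\<Sum>p<s. (if m < p then C p else 0) * a p (Suc m))"
    unfolding lessThan_Suc_atMost[symmetric] by simp
  also have "(\<Sum>p<s. (if m \<le> p then C p else 0) * a (Suc p) m) +
      (\<Sum>p<s. (if m < p then C p else 0) * a p (Suc m)) =
      (\<Sum>p<s. - (if p < s then (if m < p then 2 * C p else if p = m then C m else 0) else 0) * S p m / 2)"
    unfolding sum.distrib[symmetric]
  proof (intro sum.cong refl)
    fix p assume "p \<in> {..<s}"
    have 1: "a (Suc m) m = - S m m / 2" using rel[of m m] a[of "Suc m" m] by simp
    have "C p * (a (Suc p) m + a p (Suc m)) = C p * (- S p m)" unfolding rel ..
    then have 2: "C p * a (Suc p) m + C p * a p (Suc m) = - C p * S p m" by (simp add: distrib_left)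
    show "(if m \<le> p then C p else 0) * a (Suc p) m + (if m < p then C p else 0) * a p (Suc m) =
       - (if p < s then (if m < p then 2 * C p else if p = m then C m else 0) else 0) * S p m / 2"
      using \<open>p \<in> {..<s}\<close> 1 2 by (cases p m rule: linorder_cases) auto
  qed
  also have "\<dots> = - (\<Sum>p\<le>s. (if p < s then (if m < p then 2 * C p else if p = m then C m else 0) else 0) * S p m) / 2"
    unfolding lessThan_Suc_atMost[symmetric] by (simp add: sum_divide_distrib sum_negf)
  also have "(\<Sum>p\<le>s. (if p < s then (if m < p then 2 * C p else if p = m then C m else 0) else 0) * S p m)
      = quad_form s G S"
    unfolding G_def using m by (simp add: quad_form_column)
  finally have "quad_form s c a - quad_form s (c_matrix s \<beta> (Suc m)) a = - quad_form s G S"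
    by simp
  moreover have "quad_form s (\<lambda>p q. h_matrix 1 s \<beta> (Suc m) p q - h_matrix 1 s \<beta> m p q) S = 2 * quad_form s G S"
    unfolding dh quad_form_add using quad_form_transpose[of S s G] S by simp
  ultimately show ?thesis by (simp add: c_def)
qed

lemma transfer_process:
  fixes a S :: "nat \<Rightarrow> nat \<Rightarrow> real"
  assumes a: "\<And>p q. a p q = a q p" and S: "\<And>p q. S p q = S q p"
    and rel: "\<And>p q. a (Suc p) q + a p (Suc q) = - S p q"
    and "l \<le> s" and "\<And>m. m < l \<Longrightarrow> c_matrix s \<beta> m m m = 0"
  shows "quad_form s (c_matrix s \<beta> 0) a =
     quad_form s (c_matrix s \<beta> l) a - quad_form s (h_matrix 1 s \<beta> l) S / 2"
  using assms(4,5)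
proof (induction l)
  case 0
  show ?case by (simp add: quad_form_def)
next
  case (Suc l)
  have "quad_form s (c_matrix s \<beta> l) a = quad_form s (c_matrix s \<beta> (Suc l)) a
     - quad_form s (\<lambda>p q. h_matrix 1 s \<beta> (Suc l) p q - h_matrix 1 s \<beta> l p q) S / 2"
    by (rule transfer_step) (use a S rel Suc.prems in auto)
  then show ?case using Suc.IH Suc.prems unfolding quad_form_diff
    by (simp del: h_matrix.simps c_matrix.simps add: field_simps)
qed

text \<open>The leading block is positive definite with a margin. By Young's inequality, the cross terms
  with the remaining variables use up no more than this margin and a multiple of the remaining
  squares.\<close>

lemma quad_lower_bound:
  fixes h :: "nat \<Rightarrow> nat \<Rightarrow> real"
  assumes sym: "\<And>p q. h p q = h q p" and pos: "leading_pos \<rho> h" and \<rho>: "\<rho> \<le> s"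
  shows "\<exists>C\<ge>0. \<forall>x :: nat \<Rightarrow> real.
           - C * (\<Sum>p=\<rho>..s. (x p)\<^sup>2) \<le> quad_form s h (\<lambda>p q. x p * x q)"
proof -
  obtain \<epsilon> where e: "0 < \<epsilon>"
    and pd: "\<And>x :: nat \<Rightarrow> real. \<epsilon> * (\<Sum>p<\<rho>. (x p)\<^sup>2) \<le> (\<Sum>p<\<rho>. \<Sum>q<\<rho>. h p q * (x p * x q))"
    using sylvester[OF sym pos] by blast
  \<comment> \<open>A variable of the block occurs in at most \<open>2 (s + 1)\<close> cross terms, each weighted by \<open>e' /
    2\<close>.\<close>
  define e' where "e' = \<epsilon> / real (s + 1)"
  have e': "0 < e'" using e by (simp add: e'_def)
  define A where "A = (\<Sum>p\<le>s. \<Sum>q\<le>s. \<bar>h p q\<bar>)"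
  have hA: "\<bar>h p q\<bar> \<le> A" if "p \<le> s" "q \<le> s" for p q
  proof -
    have "\<bar>h p q\<bar> \<le> (\<Sum>q\<le>s. \<bar>h p q\<bar>)" using that by (intro member_le_sum) auto
    also have "\<dots> \<le> A" unfolding A_def using that
      by (intro member_le_sum[of p _ "\<lambda>p. \<Sum>q\<le>s. \<bar>h p q\<bar>"]) (auto intro: sum_nonneg)
    finally show ?thesis .
  qed
  have A: "0 \<le> A" unfolding A_def by (intro sum_nonneg) auto
  define K where "K = A + A\<^sup>2 / e'"
  have K: "A \<le> K" "A\<^sup>2 / e' \<le> K" "0 \<le> K" using A e' by (auto simp: K_def)
  define C where "C = K * real (s + 1)"
  have "- C * (\<Sum>p=\<rho>..s. (x p)\<^sup>2) \<le> quad_form s h (\<lambda>p q. x p * x q)" for x :: "nat \<Rightarrow> real"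
  proof -
    define u v where "u p = (if p < \<rho> then (x p)\<^sup>2 else 0)" and "v p = (if p < \<rho> then 0 else (x p)\<^sup>2)" for p
    have young: "2 * \<bar>x p * x q\<bar> * A \<le> e' * (x p)\<^sup>2 + K * (x q)\<^sup>2" for p q
    proof -
      have "0 \<le> (e' * \<bar>x p\<bar> - A * \<bar>x q\<bar>)\<^sup>2 / e'" using e' by simp
      also have "\<dots> = e' * (x p)\<^sup>2 - 2 * A * \<bar>x p * x q\<bar> + A\<^sup>2 / e' * (x q)\<^sup>2"
        using e' by (simp add: power2_eq_square abs_mult field_simps)
      also have "A\<^sup>2 / e' * (x q)\<^sup>2 \<le> K * (x q)\<^sup>2" using K by (intro mult_right_mono) auto
      finally show ?thesis by (simp add: mult_ac)
    qed
    have am: "2 * \<bar>x p * x q\<bar> * A \<le> K * ((x p)\<^sup>2 + (x q)\<^sup>2)" for p q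
    proof -
      have "2 * \<bar>x p * x q\<bar> \<le> (x p)\<^sup>2 + (x q)\<^sup>2"
        using zero_le_power2[of "\<bar>x p\<bar> - \<bar>x q\<bar>"] by (simp add: power2_eq_square abs_mult algebra_simps)
      then have "2 * \<bar>x p * x q\<bar> * A \<le> ((x p)\<^sup>2 + (x q)\<^sup>2) * A" using A by (intro mult_right_mono)
      also have "\<dots> \<le> ((x p)\<^sup>2 + (x q)\<^sup>2) * K" using K by (intro mult_left_mono) auto
      finally show ?thesis by (simp add: mult.commute)
    qed
    have termwise: "(if p < \<rho> \<and> q < \<rho> then h p q * (x p * x q) else 0)
        - e' / 2 * (u p + u q) - K / 2 * (v p + v q) \<le> h p q * (x p * x q)" if "p \<le> s" "q \<le> s" for p q
    proof -
      have "\<bar>h p q * (x p * x q)\<bar> \<le> A * \<bar>x p * x q\<bar>"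
        unfolding abs_mult[of "h p q"] using hA[OF that] by (intro mult_right_mono) auto
      moreover have "2 * \<bar>x p * x q\<bar> * A = 2 * (A * \<bar>x p * x q\<bar>)" by (simp only: mult.assoc mult.commute[of A])
      ultimately have "- (2 * \<bar>x p * x q\<bar> * A) \<le> 2 * (h p q * (x p * x q))" by linarith
      moreover have "2 * \<bar>x q * x p\<bar> * A = 2 * \<bar>x p * x q\<bar> * A" by (simp add: mult.commute)
      moreover have "0 \<le> e' * (x p)\<^sup>2" "0 \<le> e' * (x q)\<^sup>2" "0 \<le> K * (x p)\<^sup>2" "0 \<le> K * (x q)\<^sup>2"
        using e' K by auto
      ultimately show ?thesis using young[of p q] young[of q p] am[of p q]
        unfolding u_def v_def
        by (cases "p < \<rho>"; cases "q < \<rho>"; simp only: if_True if_False simp_thms distrib_left mult_zero_right; linarith)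
    qed
    have "(\<Sum>p\<le>s. \<Sum>q\<le>s. (if p < \<rho> \<and> q < \<rho> then h p q * (x p * x q) else 0)
        - e' / 2 * (u p + u q) - K / 2 * (v p + v q)) \<le> quad_form s h (\<lambda>p q. x p * x q)"
      unfolding quad_form_def by (intro sum_mono termwise) auto
    moreover have "(\<Sum>p\<le>s. \<Sum>q\<le>s. (if p < \<rho> \<and> q < \<rho> then h p q * (x p * x q) else 0)
        - e' / 2 * (u p + u q) - K / 2 * (v p + v q)) =
        (\<Sum>p<\<rho>. \<Sum>q<\<rho>. h p q * (x p * x q)) - e' * real (s + 1) * (\<Sum>p\<le>s. u p)
          - K * real (s + 1) * (\<Sum>p\<le>s. v p)"
    proof -
      have 1: "(\<Sum>p\<le>s. \<Sum>q\<le>s. (if p < \<rho> \<and> q < \<rho> then h p q * (x p * x q) else 0)) =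
          (\<Sum>p<\<rho>. \<Sum>q<\<rho>. h p q * (x p * x q))"
      proof -
        have R: "{..s} \<inter> {p. p < \<rho>} = {..<\<rho>}" using \<rho> by auto
        have "(\<Sum>p\<le>s. \<Sum>q\<le>s. (if p < \<rho> \<and> q < \<rho> then h p q * (x p * x q) else 0)) =
           (\<Sum>p\<le>s. if p < \<rho> then (\<Sum>q\<le>s. if q < \<rho> then h p q * (x p * x q) else 0) else 0)"
          by (intro sum.cong) auto
        then show ?thesis by (simp add: sum.If_cases R)
      qed
      have 2: "(\<Sum>p\<le>s. \<Sum>q\<le>s. c * (w p + w q)) = 2 * c * real (s + 1) * (\<Sum>p\<le>s. w p)"
        for c and w :: "nat \<Rightarrow> real"
        by (simp add: sum.distrib sum_distrib_left[symmetric] algebra_simps)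
      show ?thesis
        unfolding sum_subtractf 1 2 by simp
    qed
    moreover have "(\<Sum>p\<le>s. u p) = (\<Sum>p<\<rho>. (x p)\<^sup>2)"
      unfolding u_def using \<rho> by (intro sum.mono_neutral_cong_right) auto
    moreover have "(\<Sum>p\<le>s. v p) = (\<Sum>p=\<rho>..s. (x p)\<^sup>2)"
      unfolding v_def by (intro sum.mono_neutral_cong_right) auto
    moreover have "e' * real (s + 1) = \<epsilon>" by (simp add: e'_def)
    ultimately show ?thesis using pd[of x] by (simp add: C_def)
  qed
  moreover have "0 \<le> C" using K by (simp add: C_def)
  ultimately show ?thesis by blast
qed

text \<open>The properties of the iterates of the discrete operator that enter the energy argument. In
  the application \<open>a p q\<close> is \<open>((\<tau>L)\<^sup>p v, ((\<tau>L)\<^sup>q v)\<^sup>*)\<close>, \<open>J p i\<close> is \<open>\<surd>\<tau>\<close> times the jump of \<open>(\<tau>L)\<^sup>p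
  v\<close> at the mesh point \<open>i\<close>, and \<open>\<mu>\<close> is a multiple of the CFL number. Besides the Cauchy-Schwarz
  inequality these are skew-symmetry up to jumps, the inverse inequality, and the trace inequality.\<close>

definition energy_tower :: "real \<Rightarrow> (nat \<Rightarrow> nat \<Rightarrow> real) \<Rightarrow> nat set \<Rightarrow> (nat \<Rightarrow> nat \<Rightarrow> real) \<Rightarrow> bool" where
  "energy_tower \<mu> a I J \<longleftrightarrow> 0 \<le> \<mu> \<and> finite I \<and> (\<forall>p q. a p q = a q p) \<and> (\<forall>p. 0 \<le> a p p) \<and>
     (\<forall>p q. (a p q)\<^sup>2 \<le> a p p * a q q) \<and>
     (\<forall>p q. a (Suc p) q + a p (Suc q) = - (\<Sum>i\<in>I. J p i * J q i)) \<and>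
     (\<forall>p. a (Suc p) (Suc p) \<le> \<mu>\<^sup>2 * a p p) \<and>
     (\<forall>p. (\<Sum>i\<in>I. (J p i)\<^sup>2) \<le> \<mu> * a p p)"

lemma energy_tower_decay:
  assumes "energy_tower \<mu> a I J"
  shows "a (j + m) (j + m) \<le> \<mu> ^ (2 * m) * a j j"
proof (induction m)
  case (Suc m)
  have "a (j + Suc m) (j + Suc m) \<le> \<mu>\<^sup>2 * a (j + m) (j + m)"
    using assms unfolding energy_tower_def by simp
  also have "\<dots> \<le> \<mu>\<^sup>2 * (\<mu> ^ (2 * m) * a j j)" using Suc.IH by (intro mult_left_mono) auto
  finally show ?case by (simp add: power2_eq_square)
qed simp

text \<open>After the transfer only indices of at least \<open>\<zeta>\<close> are left, and each entry off the corner \<open>(\<zeta>,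
  \<zeta>)\<close> contains at least one further application of the operator, hence a factor \<open>\<mu>\<close>. In the form of
  \<open>\<bbbH>\<close> only the jumps of index at least \<open>\<rho>\<close> can have the wrong sign, and the trace inequality bounds
  them by \<open>\<mu> * a \<rho> \<rho>\<close>.\<close>

lemma transferred_energy_bound:
  assumes \<zeta>: "1 \<le> \<zeta>" "\<zeta> \<le> s" and zero: "\<And>m. m < \<zeta> \<Longrightarrow> c_matrix s \<beta> m m m = 0"
    and \<rho>: "\<rho> \<le> \<zeta>" and pos: "leading_pos \<rho> (h_matrix 1 s \<beta> \<zeta>)"
  shows "\<exists>C\<ge>0. \<forall>\<mu> a I J. energy_tower \<mu> a I J \<and> \<mu> \<le> 1 \<longrightarrow>
      quad_form s (c_matrix s \<beta> 0) a \<le>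
        (c_matrix s \<beta> \<zeta> \<zeta> \<zeta> + C * \<mu>) * a \<zeta> \<zeta> + C * \<mu> * a \<rho> \<rho>"
proof -
  obtain B where B: "0 \<le> B" and low: "\<And>x :: nat \<Rightarrow> real.
       - B * (\<Sum>p=\<rho>..s. (x p)\<^sup>2) \<le> quad_form s (h_matrix 1 s \<beta> \<zeta>) (\<lambda>p q. x p * x q)"
    using quad_lower_bound[OF h_matrix_sym pos, of s] \<rho> \<zeta> by fastforce
  define c where "c = c_matrix s \<beta> \<zeta>"
  define A where "A = (\<Sum>p\<le>s. \<Sum>q\<le>s. \<bar>c p q\<bar>)"
  have A: "0 \<le> A" unfolding A_def by (intro sum_nonneg) auto
  define C where "C = A + B * real (s + 1)"
  have C: "0 \<le> C" "A \<le> C" "B * real (s + 1) \<le> C" using A B by (auto simp: C_def)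
  have "quad_form s (c_matrix s \<beta> 0) a \<le> (c \<zeta> \<zeta> + C * \<mu>) * a \<zeta> \<zeta> + C * \<mu> * a \<rho> \<rho>"
    if tower: "energy_tower \<mu> a I J" and \<mu>1: "\<mu> \<le> 1" for \<mu> a I J
  proof -
    have \<mu>: "0 \<le> \<mu>" and fin: "finite I" and sym: "\<And>p q. a p q = a q p" and nn: "\<And>p. 0 \<le> a p p"
      and cs: "\<And>p q. (a p q)\<^sup>2 \<le> a p p * a q q"
      and rel: "\<And>p q. a (Suc p) q + a p (Suc q) = - (\<Sum>i\<in>I. J p i * J q i)"
      and tr: "\<And>p. (\<Sum>i\<in>I. (J p i)\<^sup>2) \<le> \<mu> * a p p"
      using tower unfolding energy_tower_def by auto
    have dec: "a p p \<le> a j j" if "j \<le> p" for j p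
    proof -
      have "a p p \<le> \<mu> ^ (2 * (p - j)) * a j j"
        using energy_tower_decay[OF tower, of j "p - j"] that by simp
      also have "\<dots> \<le> 1 * a j j" using \<mu> \<mu>1 nn by (intro mult_right_mono power_le_one) auto
      finally show ?thesis by simp
    qed
    have dec1: "a p p \<le> \<mu>\<^sup>2 * a \<zeta> \<zeta>" if "\<zeta> < p" for p
    proof -
      have "a p p \<le> a (Suc \<zeta>) (Suc \<zeta>)" using that by (intro dec) auto
      also have "\<dots> \<le> \<mu>\<^sup>2 * a \<zeta> \<zeta>" using tower unfolding energy_tower_def by simp
      finally show ?thesis .
    qed
    define S where "S p q = (\<Sum>i\<in>I. J p i * J q i)" for p q
    have off: "\<bar>a p q\<bar> \<le> \<mu> * a \<zeta> \<zeta>" if "\<zeta> \<le> p" "\<zeta> \<le> q" "p \<noteq> \<zeta> \<or> q \<noteq> \<zeta>" for p q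
    proof -
      have "(a p q)\<^sup>2 \<le> a p p * a q q" by (rule cs)
      also have "\<dots> \<le> (\<mu>\<^sup>2 * a \<zeta> \<zeta>) * a \<zeta> \<zeta>"
      proof (cases "p = \<zeta>")
        case True
        then have "a q q \<le> \<mu>\<^sup>2 * a \<zeta> \<zeta>" using that dec1 by simp
        then have "a p p * a q q \<le> a \<zeta> \<zeta> * (\<mu>\<^sup>2 * a \<zeta> \<zeta>)" using True nn by (simp add: mult_left_mono)
        then show ?thesis by (simp add: mult_ac)
      next
        case False
        then show ?thesis using that dec1[of p] dec[of \<zeta> q] nn by (intro mult_mono) auto
      qed
      also have "\<dots> = (\<mu> * a \<zeta> \<zeta>)\<^sup>2" by (simp add: power2_eq_square)
      finally have "\<bar>a p q\<bar> \<le> \<bar>\<mu> * a \<zeta> \<zeta>\<bar>" unfolding abs_le_square_iff .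
      then show ?thesis using \<mu> nn by (simp add: abs_mult)
    qed
    have "quad_form s c a - c \<zeta> \<zeta> * a \<zeta> \<zeta> =
        (\<Sum>p\<le>s. \<Sum>q\<le>s. if p = \<zeta> \<and> q = \<zeta> then 0 else c p q * a p q)"
    proof -
      have "c \<zeta> \<zeta> * a \<zeta> \<zeta> = (\<Sum>p\<le>s. \<Sum>q\<le>s. if p = \<zeta> \<and> q = \<zeta> then c p q * a p q else 0)"
      proof -
        have "(\<Sum>p\<le>s. \<Sum>q\<le>s. if p = \<zeta> \<and> q = \<zeta> then c p q * a p q else 0) =
          (\<Sum>p\<le>s. if p = \<zeta> then (\<Sum>q\<le>s. if q = \<zeta> then c p q * a p q else 0) else 0)"
          by (intro sum.cong) auto
        then show ?thesis using \<zeta> by simp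
      qed
      then show ?thesis unfolding quad_form_def by (simp add: sum_subtractf[symmetric]) (intro sum.cong, auto)
    qed
    also have "\<dots> \<le> (\<Sum>p\<le>s. \<Sum>q\<le>s. \<bar>c p q\<bar> * (\<mu> * a \<zeta> \<zeta>))"
    proof (intro sum_mono)
      fix p q assume "p \<in> {..s}" "q \<in> {..s}"
      show "(if p = \<zeta> \<and> q = \<zeta> then 0 else c p q * a p q) \<le> \<bar>c p q\<bar> * (\<mu> * a \<zeta> \<zeta>)"
      proof (cases "min p q < \<zeta>")
        case True
        then have "c p q = 0" unfolding c_def by (rule c_matrix_eliminated)
        then show ?thesis by simp
      next
        case False
        then have "\<zeta> \<le> p" "\<zeta> \<le> q" by auto
        show ?thesis
        proof (cases "p = \<zeta> \<and> q = \<zeta>")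
          case False
          have "c p q * a p q \<le> \<bar>c p q\<bar> * \<bar>a p q\<bar>" by (metis abs_ge_self abs_mult)
          also have "\<dots> \<le> \<bar>c p q\<bar> * (\<mu> * a \<zeta> \<zeta>)"
            using off \<open>\<zeta> \<le> p\<close> \<open>\<zeta> \<le> q\<close> False by (intro mult_left_mono) auto
          finally show ?thesis using False by (subst if_not_P) auto
        qed (use \<mu> nn in auto)
      qed
    qed
    also have "\<dots> = A * \<mu> * a \<zeta> \<zeta>" unfolding A_def by (simp add: sum_distrib_right mult.assoc)
    also have "\<dots> \<le> C * \<mu> * a \<zeta> \<zeta>" using C \<mu> nn by (intro mult_right_mono) auto
    finally have high: "quad_form s c a \<le> (c \<zeta> \<zeta> + C * \<mu>) * a \<zeta> \<zeta>" by (simp add: algebra_simps)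
    have "quad_form s (h_matrix 1 s \<beta> \<zeta>) S =
        (\<Sum>i\<in>I. quad_form s (h_matrix 1 s \<beta> \<zeta>) (\<lambda>p q. J p i * J q i))"
    proof -
      have "(\<Sum>i\<in>I. quad_form s (h_matrix 1 s \<beta> \<zeta>) (\<lambda>p q. J p i * J q i)) =
          (\<Sum>p\<le>s. \<Sum>i\<in>I. \<Sum>q\<le>s. h_matrix 1 s \<beta> \<zeta> p q * (J p i * J q i))"
        unfolding quad_form_def by (rule sum.swap)
      also have "\<dots> = (\<Sum>p\<le>s. \<Sum>q\<le>s. \<Sum>i\<in>I. h_matrix 1 s \<beta> \<zeta> p q * (J p i * J q i))"
        by (intro sum.cong refl sum.swap)
      finally show ?thesis unfolding quad_form_def S_def sum_distrib_left by simp
    qed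
    moreover have "(\<Sum>i\<in>I. - B * (\<Sum>p=\<rho>..s. (J p i)\<^sup>2)) \<le>
        (\<Sum>i\<in>I. quad_form s (h_matrix 1 s \<beta> \<zeta>) (\<lambda>p q. J p i * J q i))"
      by (intro sum_mono low)
    moreover have "(\<Sum>i\<in>I. - B * (\<Sum>p=\<rho>..s. (J p i)\<^sup>2)) = - (B * (\<Sum>p=\<rho>..s. \<Sum>i\<in>I. (J p i)\<^sup>2))"
      by (subst sum.swap) (simp add: sum_distrib_left sum_negf)
    moreover have "B * (\<Sum>p=\<rho>..s. \<Sum>i\<in>I. (J p i)\<^sup>2) \<le> B * (real (s + 1) * (\<mu> * a \<rho> \<rho>))"
    proof (intro mult_left_mono B)
      have "(\<Sum>p=\<rho>..s. \<Sum>i\<in>I. (J p i)\<^sup>2) \<le> (\<Sum>p=\<rho>..s. \<mu> * a \<rho> \<rho>)"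
      proof (intro sum_mono)
        fix p assume "p \<in> {\<rho>..s}"
        then have "\<mu> * a p p \<le> \<mu> * a \<rho> \<rho>" using \<mu> dec by (intro mult_left_mono) auto
        then show "(\<Sum>i\<in>I. (J p i)\<^sup>2) \<le> \<mu> * a \<rho> \<rho>" using tr[of p] by simp
      qed
      also have "\<dots> = real (s + 1 - \<rho>) * (\<mu> * a \<rho> \<rho>)" by simp
      also have "\<dots> \<le> real (s + 1) * (\<mu> * a \<rho> \<rho>)" using \<mu> nn by (intro mult_right_mono) auto
      finally show "(\<Sum>p=\<rho>..s. \<Sum>i\<in>I. (J p i)\<^sup>2) \<le> real (s + 1) * (\<mu> * a \<rho> \<rho>)" .
    qed
    moreover have "B * (real (s + 1) * (\<mu> * a \<rho> \<rho>)) \<le> C * \<mu> * a \<rho> \<rho>"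
    proof -
      have "(B * real (s + 1)) * (\<mu> * a \<rho> \<rho>) \<le> C * (\<mu> * a \<rho> \<rho>)"
        using C \<mu> nn by (intro mult_right_mono) auto
      then show ?thesis by (simp add: mult_ac)
    qed
    moreover have "0 \<le> C * \<mu> * a \<rho> \<rho>" using C \<mu> nn by auto
    ultimately have "- quad_form s (h_matrix 1 s \<beta> \<zeta>) S / 2 \<le> C * \<mu> * a \<rho> \<rho>" by linarith
    moreover have "quad_form s (c_matrix s \<beta> 0) a =
        quad_form s c a - quad_form s (h_matrix 1 s \<beta> \<zeta>) S / 2"
      unfolding c_def by (rule transfer_process) (use sym rel zero \<zeta> in \<open>auto simp: S_def mult.commute\<close>)
    ultimately show ?thesis using high by linarith
  qed
  then show ?thesis using C unfolding c_def by blast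
qed

section \<open>Growth of the energy in terms of the two indices\<close>

text \<open>With the shifted convention this is the minimality of \<open>\<rho>\<close>. With the literal one the corner
  entry of \<open>\<bbbH>\<close> is zero, so \<open>\<rho> = 0\<close>, and the claim about minors is vacuous. Hence both conventions
  yield what the energy argument needs, which concerns the shifted matrix.\<close>

lemma contribution_index_spec:
  assumes \<rho>: "\<rho> = contribution_index r s \<beta>" and \<zeta>: "\<zeta> = termination_index s \<beta>"
    and r: "r \<in> {0, 1}" and "1 \<le> \<zeta>"
  shows "\<rho> \<le> \<zeta>" and "leading_pos \<rho> (h_matrix 1 s \<beta> \<zeta>)"
proof -
  define K where "K = {\<kappa>. \<kappa> \<le> \<zeta> - 1 \<and> leading_minor r s \<beta> \<kappa> \<le> 0}"
  have fin: "finite K" unfolding K_def by (rule finite_subset[of _ "{..\<zeta> - 1}"]) auto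
  have \<rho>K: "\<rho> = (if K \<noteq> {} then Min K else \<zeta>)"
    unfolding \<rho> contribution_index_def K_def \<zeta> Let_def ..
  show le: "\<rho> \<le> \<zeta>"
  proof (cases "K = {}")
    case False
    then have "Min K \<in> K" using fin by simp
    then show ?thesis using False \<rho>K by (auto simp: K_def)
  qed (use \<rho>K in simp)
  have minors: "0 < leading_minor r s \<beta> \<kappa>" if "\<kappa> < \<rho>" for \<kappa>
  proof -
    have "\<kappa> \<notin> K"
    proof
      assume "\<kappa> \<in> K"
      then have "\<rho> \<le> \<kappa>" using \<rho>K fin by auto
      then show False using that by simp
    qed
    then show ?thesis using that le by (auto simp: K_def)
  qed
  show "leading_pos \<rho> (h_matrix 1 s \<beta> \<zeta>)"
  proof (cases "r = 1")
    case True
    then show ?thesis using minors unfolding leading_pos_def leading_minor_def \<zeta> by simp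
  next
    case False
    then have r0: "r = 0" using r by simp
    have "leading_minor 0 s \<beta> 0 = 0"
      unfolding leading_minor_def by (subst det_single) (auto simp: h_matrix_unshifted_diag)
    then have "\<not> 0 < \<rho>" using minors[of 0] r0 by auto
    then show ?thesis by (simp add: leading_pos_def)
  qed
qed

text \<open>If the process never stops, \<open>\<zeta>\<close> is the least element of an empty set and as such
  unspecified; a nonzero diagonal entry is what makes it meaningful.\<close>

lemma termination_index_spec:
  assumes \<zeta>: "\<zeta> = termination_index s \<beta>" and nz: "c_matrix s \<beta> \<zeta> \<zeta> \<zeta> \<noteq> 0"
  shows "1 \<le> \<zeta>" and "\<zeta> \<le> s" and "\<And>m. m < \<zeta> \<Longrightarrow> c_matrix s \<beta> m m m = 0"
proof -
  show 1: "1 \<le> \<zeta>"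
  proof (rule ccontr)
    assume "\<not> 1 \<le> \<zeta>"
    then have "\<zeta> = 0" by simp
    then show False using nz by simp
  qed
  show "\<zeta> \<le> s" using c_matrix_beyond[of s \<zeta> \<beta> \<zeta> \<zeta>] nz by force
  show "c_matrix s \<beta> m m m = 0" if "m < \<zeta>" for m
  proof (cases "m = 0")
    case False
    then show ?thesis using that not_less_Least[of m "\<lambda>l. 1 \<le> l \<and> c_matrix s \<beta> l l l \<noteq> 0"]
      unfolding \<zeta> termination_index_def by auto
  qed simp
qed

text \<open>The three cases of the theorem at the level of quadratic forms. Since \<open>a p p \<le> \<mu>\<^bsup>2p\<^esup> a 0 0\<close>,
  the two terms of \<open>transferred_energy_bound\<close> are of order \<open>\<mu>\<^bsup>2\<zeta>\<^esup>\<close> and \<open>\<mu>\<^bsup>2\<rho>+1\<^esup>\<close>. A negative corner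
  entry makes the first one nonpositive for small \<open>\<mu>\<close>, and the sum of both if \<open>\<rho> = \<zeta>\<close>.\<close>

lemma energy_growth_bound:
  assumes \<zeta>: "1 \<le> \<zeta>" "\<zeta> \<le> s" and zero: "\<And>m. m < \<zeta> \<Longrightarrow> c_matrix s \<beta> m m m = 0"
    and \<rho>: "\<rho> \<le> \<zeta>" and pos: "leading_pos \<rho> (h_matrix 1 s \<beta> \<zeta>)"
  defines "c \<equiv> c_matrix s \<beta> \<zeta> \<zeta> \<zeta>"
  shows "\<exists>C\<ge>0. \<exists>\<mu>0. 0 < \<mu>0 \<and> \<mu>0 \<le> 1 \<and> (\<forall>\<mu> a I J. energy_tower \<mu> a I J \<and> \<mu> \<le> \<mu>0 \<longrightarrow>
      (c < 0 \<and> \<rho> = \<zeta> \<longrightarrow> quad_form s (c_matrix s \<beta> 0) a \<le> 0) \<and>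
      (c < 0 \<longrightarrow> quad_form s (c_matrix s \<beta> 0) a \<le> C * \<mu> ^ (2 * \<rho> + 1) * a 0 0) \<and>
      quad_form s (c_matrix s \<beta> 0) a \<le> C * \<mu> ^ min (2 * \<zeta>) (2 * \<rho> + 1) * a 0 0)"
proof -
  obtain B where B: "0 \<le> B" and bound: "\<And>\<mu> a I J. energy_tower \<mu> a I J \<Longrightarrow> \<mu> \<le> 1 \<Longrightarrow>
      quad_form s (c_matrix s \<beta> 0) a \<le> (c + B * \<mu>) * a \<zeta> \<zeta> + B * \<mu> * a \<rho> \<rho>"
    using transferred_energy_bound[OF \<zeta> zero \<rho> pos] unfolding c_def by blast
  \<comment> \<open>Below this threshold the negative corner entry outweighs \<open>2 * B * \<mu>\<close>.\<close>
  define \<mu>0 where "\<mu>0 = (if c < 0 then min 1 (- c / (2 * B + 1)) else 1)"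
  have \<mu>0: "0 < \<mu>0" "\<mu>0 \<le> 1" using B by (auto simp: \<mu>0_def divide_neg_pos)
  have small: "c + 2 * B * \<mu> \<le> 0" if "c < 0" "\<mu> \<le> \<mu>0" "0 \<le> \<mu>" for \<mu>
  proof -
    have "\<mu> \<le> - c / (2 * B + 1)" using that by (simp add: \<mu>0_def)
    moreover have "0 < 2 * B + 1" using B by simp
    ultimately have "\<mu> * (2 * B + 1) \<le> - c" by (simp only: pos_le_divide_eq)
    then show ?thesis using that by (simp add: algebra_simps)
  qed
  define C where "C = \<bar>c\<bar> + 2 * B"
  have C: "0 \<le> C" "B \<le> C" "\<bar>c\<bar> + B \<le> C" using B by (auto simp: C_def)
  have "(c < 0 \<and> \<rho> = \<zeta> \<longrightarrow> quad_form s (c_matrix s \<beta> 0) a \<le> 0) \<and>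
      (c < 0 \<longrightarrow> quad_form s (c_matrix s \<beta> 0) a \<le> C * \<mu> ^ (2 * \<rho> + 1) * a 0 0) \<and>
      quad_form s (c_matrix s \<beta> 0) a \<le> C * \<mu> ^ min (2 * \<zeta>) (2 * \<rho> + 1) * a 0 0"
    if tower: "energy_tower \<mu> a I J" and le: "\<mu> \<le> \<mu>0" for \<mu> a I J
  proof -
    have \<mu>: "0 \<le> \<mu>" "\<mu> \<le> 1" and nn: "\<And>p. 0 \<le> a p p"
      using tower le \<mu>0 unfolding energy_tower_def by auto
    have main: "quad_form s (c_matrix s \<beta> 0) a \<le> (c + B * \<mu>) * a \<zeta> \<zeta> + B * \<mu> * a \<rho> \<rho>"
      using bound[OF tower] \<mu> by simp
    have dec: "a p p \<le> \<mu> ^ (2 * p) * a 0 0" for p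
      using energy_tower_decay[OF tower, of 0 p] by simp
    have low: "B * \<mu> * a \<rho> \<rho> \<le> B * (\<mu> ^ (2 * \<rho> + 1) * a 0 0)"
      using mult_left_mono[OF dec[of \<rho>], of "B * \<mu>"] B \<mu> by (simp add: mult_ac)
    have 1: "quad_form s (c_matrix s \<beta> 0) a \<le> 0" if "c < 0" "\<rho> = \<zeta>"
    proof -
      have "(c + B * \<mu>) * a \<zeta> \<zeta> + B * \<mu> * a \<rho> \<rho> = (c + 2 * B * \<mu>) * a \<zeta> \<zeta>"
        using that by (simp add: algebra_simps)
      also have "\<dots> \<le> 0" using small[OF that(1) le \<mu>(1)] nn by (intro mult_nonpos_nonneg) auto
      finally show ?thesis using main by linarith
    qed
    have 2: "quad_form s (c_matrix s \<beta> 0) a \<le> C * \<mu> ^ (2 * \<rho> + 1) * a 0 0" if "c < 0"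
    proof -
      have "c + B * \<mu> \<le> 0" using small[OF that le \<mu>(1)] B \<mu> mult_nonneg_nonneg[of B \<mu>] by linarith
      then have "(c + B * \<mu>) * a \<zeta> \<zeta> \<le> 0" using nn by (intro mult_nonpos_nonneg) auto
      moreover have "B * (\<mu> ^ (2 * \<rho> + 1) * a 0 0) \<le> C * (\<mu> ^ (2 * \<rho> + 1) * a 0 0)"
        using C \<mu> nn by (intro mult_right_mono) auto
      ultimately show ?thesis using main low by (simp add: mult.assoc)
    qed
    have 3: "quad_form s (c_matrix s \<beta> 0) a \<le> C * \<mu> ^ min (2 * \<zeta>) (2 * \<rho> + 1) * a 0 0"
    proof -
      define X where "X = \<mu> ^ min (2 * \<zeta>) (2 * \<rho> + 1) * a 0 0"
      have X: "0 \<le> X" using \<mu> nn by (simp add: X_def)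
      have pw: "\<mu> ^ n * a 0 0 \<le> X" if "min (2 * \<zeta>) (2 * \<rho> + 1) \<le> n" for n
        unfolding X_def using that \<mu> nn by (intro mult_right_mono power_decreasing) auto
      have "(c + B * \<mu>) * a \<zeta> \<zeta> \<le> (\<bar>c\<bar> + B) * a \<zeta> \<zeta>"
        using B \<mu> nn by (intro mult_right_mono add_mono) (auto intro: mult_left_le)
      also have "\<dots> \<le> (\<bar>c\<bar> + B) * X"
        using dec[of \<zeta>] pw[of "2 * \<zeta>"] B by (intro mult_left_mono) auto
      finally have "(c + B * \<mu>) * a \<zeta> \<zeta> \<le> (\<bar>c\<bar> + B) * X" .
      moreover have "B * (\<mu> ^ (2 * \<rho> + 1) * a 0 0) \<le> B * X"
        by (intro mult_left_mono pw B) simp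
      moreover have "(\<bar>c\<bar> + B) * X + B * X = C * X" by (simp add: C_def algebra_simps)
      ultimately show ?thesis using main low unfolding X_def[symmetric] mult.assoc by linarith
    qed
    show ?thesis using 1 2 3 by blast
  qed
  then show ?thesis using C(1) \<mu>0 by blast
qed

section \<open>Polynomials on the reference cell\<close>

definition cell_int :: "real poly \<Rightarrow> real" where
  "cell_int p = integral {-1..1} (poly p)"

lemma poly_integrable: "poly p integrable_on {c..d}" for p :: "real poly"
  by (intro integrable_continuous_real continuous_intros)

lemma integral_pderiv:
  fixes p :: "real poly"
  assumes "c \<le> d"
  shows "integral {c..d} (poly (pderiv p)) = poly p d - poly p c"
proof -
  have "(poly (pderiv p) has_integral (poly p d - poly p c)) {c..d}"
    by (rule fundamental_theorem_of_calculus[OF assms])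
      (auto intro: has_field_derivative_at_within poly_DERIV
        simp: has_real_derivative_iff_has_vector_derivative[symmetric])
  then show ?thesis by (rule integral_unique)
qed

lemma cell_int_pderiv: "cell_int (pderiv p) = poly p 1 - poly p (-1)"
  unfolding cell_int_def by (rule integral_pderiv) simp

lemma cell_int_add: "cell_int (p + q) = cell_int p + cell_int q"
  unfolding cell_int_def poly_add by (rule integral_add) (rule poly_integrable)+

lemma cell_int_smult: "cell_int (Polynomial.smult c p) = c * cell_int p"
  unfolding cell_int_def poly_smult by simp

lemma cell_int_diff: "cell_int (p - q) = cell_int p - cell_int q"
  using cell_int_add[of p "Polynomial.smult (-1) q"] cell_int_smult[of "-1" q] by simp

lemma cell_int_0 [simp]: "cell_int 0 = 0"
  using cell_int_smult[of 0 0] by simp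

lemma cell_int_sum: "cell_int (sum f A) = (\<Sum>i\<in>A. cell_int (f i))"
  by (induction A rule: infinite_finite_induct) (auto simp: cell_int_add)

lemma cell_int_square_nonneg: "0 \<le> cell_int (p * p)"
  unfolding cell_int_def by (intro integral_nonneg poly_integrable) auto

lemma cell_int_square_eq_0_iff: "cell_int (p * p) = 0 \<longleftrightarrow> p = 0"
proof
  assume *: "cell_int (p * p) = 0"
  have "poly (p * p) x = 0" if "x \<in> {-1..1}" for x
  proof -
    have "integral {-1..1} (poly (p * p)) = 0 \<longleftrightarrow> (\<forall>x\<in>{-1..1}. poly (p * p) x = 0)"
      by (rule integral_eq_0_iff) (auto intro!: continuous_intros)
    then show ?thesis using * that by (simp add: cell_int_def)
  qed
  then have "{-1..1} \<subseteq> {x. poly p x = 0}" by auto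
  then have "infinite {x. poly p x = 0}"
    using infinite_super[of "{-1..1::real}"] infinite_Icc[of "-1::real" 1] by simp
  then show "p = 0" using poly_roots_finite[of p] by blast
qed simp

lemma antiderivative_exists:
  fixes p :: "real poly"
  shows "\<exists>P. pderiv P = p \<and> degree P \<le> Suc (degree p) \<and> poly P (-1) = 0 \<and>
    (\<forall>i. coeff P (Suc i) = coeff p i / real (Suc i))"
proof -
  define Q where "Q = (\<Sum>i\<le>degree p. monom (coeff p i / real (Suc i)) (Suc i))"
  define P where "P = Q - [:poly Q (-1):]"
  have cQ: "coeff Q (Suc i) = coeff p i / real (Suc i)" for i
  proof -
    have "coeff Q (Suc i) = (\<Sum>j\<le>degree p. if j = i then coeff p j / real (Suc j) else 0)"
      unfolding Q_def coeff_sum by (intro sum.cong) auto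
    then show ?thesis by (simp add: coeff_eq_0)
  qed
  have cP: "coeff P (Suc i) = coeff p i / real (Suc i)" for i
    using cQ by (simp add: P_def)
  have "pderiv P = p"
    by (rule poly_eqI) (simp add: coeff_pderiv cP del: of_nat_Suc)
  moreover have "degree P \<le> Suc (degree p)"
  proof (intro degree_le allI impI)
    fix i assume "Suc (degree p) < i"
    then obtain j where "i = Suc j" "degree p < j" by (metis Suc_lessE)
    then show "coeff P i = 0" by (simp add: cP coeff_eq_0)
  qed
  moreover have "poly P (-1) = 0" by (simp add: P_def)
  ultimately show ?thesis using cP by blast
qed

lemma cell_int_by_parts:
  "cell_int (pderiv p * q) = poly p 1 * poly q 1 - poly p (-1) * poly q (-1) - cell_int (p * pderiv q)"
  using cell_int_pderiv[of "p * q"] by (simp add: pderiv_mult cell_int_add algebra_simps)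

lemma coeff_mult_top:
  fixes p q :: "real poly"
  assumes "degree p \<le> m" "degree q \<le> n"
  shows "coeff (p * q) (m + n) = coeff p m * coeff q n"
proof -
  have "coeff (p * q) (m + n) = (\<Sum>i\<le>m + n. coeff p i * coeff q (m + n - i))"
    by (simp add: coeff_mult)
  also have "\<dots> = (\<Sum>i\<in>{m}. coeff p i * coeff q (m + n - i))"
  proof (intro sum.mono_neutral_right ballI)
    fix i assume i: "i \<in> {..m + n} - {m}"
    show "coeff p i * coeff q (m + n - i) = 0"
    proof (cases "i < m")
      case True
      then have "degree q < m + n - i" using assms by linarith
      then show ?thesis by (simp add: coeff_eq_0)
    next
      case False
      then have "degree p < i" using i assms by auto
      then show ?thesis by (simp add: coeff_eq_0)
    qed
  qed auto
  finally show ?thesis by simp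
qed

lemma legendre_rec:
  "Polynomial.smult (real (n + 2)) (legendre (Suc (Suc n))) =
     Polynomial.smult (real (2 * n + 3)) ([:0, 1:] * legendre (Suc n)) - Polynomial.smult (real (n + 1)) (legendre n)"
  by (simp add: smult_diff_right)

lemma smult_left_cancel:
  fixes p q :: "real poly"
  assumes "c \<noteq> 0" and "Polynomial.smult c p = Polynomial.smult c q"
  shows "p = q"
  using assms by (metis smult_smult smult_1_left left_inverse)

text \<open>The two identities are proved together because the induction step for each of them uses
  both.\<close>

lemma legendre_derivatives:
  "pderiv (legendre (Suc n)) = [:0, 1:] * pderiv (legendre n) + Polynomial.smult (real (Suc n)) (legendre n) \<and>
   [:0, 1:] * pderiv (legendre (Suc n)) - pderiv (legendre n) = Polynomial.smult (real (Suc n)) (legendre (Suc n))"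
proof (induction n)
  case 0
  show ?case by (simp add: pderiv_pCons)
next
  case (Suc n)
  let ?X = "[:0, 1:] :: real poly"
  define P Q R where "P = legendre n" and "Q = legendre (Suc n)" and "R = legendre (Suc (Suc n))"
  define r where "r = real n"
  have rn: "real (Suc n) = r + 1" "real (n + 2) = r + 2" "real (2 * n + 3) = 2 * r + 3" "real (n + 1) = r + 1"
     "real (Suc (Suc n)) = r + 2"
    by (auto simp: r_def)
  have rec: "Polynomial.smult (r + 2) R = Polynomial.smult (2 * r + 3) (?X * Q) - Polynomial.smult (r + 1) P"
    using legendre_rec[of n] unfolding P_def Q_def R_def rn .
  have A: "pderiv Q = ?X * pderiv P + Polynomial.smult (r + 1) P"
   and B: "?X * pderiv Q - pderiv P = Polynomial.smult (r + 1) Q"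
    using Suc unfolding P_def Q_def rn by auto
  have "Polynomial.smult (r + 2) (pderiv R) =
     Polynomial.smult (2 * r + 3) (?X * pderiv Q + Q) - Polynomial.smult (r + 1) (pderiv P)"
    using arg_cong[OF rec, of pderiv]
    by (simp only: pderiv_smult pderiv_diff pderiv_mult) (simp add: pderiv_pCons algebra_simps)
  also have "pderiv P = ?X * pderiv Q - Polynomial.smult (r + 1) Q" using B by (simp add: algebra_simps)
  also have "Polynomial.smult (2 * r + 3) (?X * pderiv Q + Q) - Polynomial.smult (r + 1) (?X * pderiv Q - Polynomial.smult (r + 1) Q)
     = Polynomial.smult (r + 2) (?X * pderiv Q + Polynomial.smult (r + 2) Q)"
    by (rule poly_eq_poly_eq_iff[THEN iffD1]) (simp add: fun_eq_iff algebra_simps)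
  finally have "pderiv R = ?X * pderiv Q + Polynomial.smult (r + 2) Q"
    by (rule smult_left_cancel[rotated]) (simp add: r_def)
  note A' = this
  have "Polynomial.smult (r + 2) R - Polynomial.smult (r + 2) (?X * Q) = Polynomial.smult (r + 1) (?X * Q - P)"
    unfolding rec by (rule poly_eq_poly_eq_iff[THEN iffD1]) (simp add: fun_eq_iff algebra_simps)
  moreover have "?X * ?X * pderiv Q - pderiv Q = Polynomial.smult (r + 1) (?X * Q - P)"
  proof -
    have "?X * (?X * pderiv Q - pderiv P) - (pderiv Q - ?X * pderiv P) =
       ?X * Polynomial.smult (r + 1) Q - Polynomial.smult (r + 1) P"
      by (simp only: B) (simp add: A)
    then show ?thesis by (simp add: algebra_simps smult_diff_right)
  qed
  ultimately have "?X * ?X * pderiv Q - pderiv Q = Polynomial.smult (r + 2) R - Polynomial.smult (r + 2) (?X * Q)"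
    by simp
  then have "?X * pderiv R - pderiv Q = Polynomial.smult (r + 2) R"
    unfolding A' by (simp add: algebra_simps)
  then show ?case using A' unfolding P_def[symmetric] Q_def[symmetric] R_def[symmetric] rn by blast
qed

text \<open>Legendre's differential equation in self-adjoint form.\<close>

lemma legendre_ode:
  "pderiv ([:-1, 0, 1:] * pderiv (legendre n)) = Polynomial.smult (real n * real (n + 1)) (legendre n)"
proof (cases n)
  case (Suc m)
  let ?X = "[:0, 1:] :: real poly"
  define P Q where "P = legendre m" and "Q = legendre (Suc m)"
  define r where "r = real m"
  have rn: "real (Suc m) = r + 1" by (simp add: r_def)
  have A: "pderiv Q = ?X * pderiv P + Polynomial.smult (r + 1) P"
   and B: "?X * pderiv Q - pderiv P = Polynomial.smult (r + 1) Q"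
    using legendre_derivatives[of m] unfolding P_def[symmetric] Q_def[symmetric] rn by blast+
  have X2: "[:-1, 0, 1:] = ?X * ?X - 1" by (simp add: one_pCons)
  have "?X * (?X * pderiv Q - pderiv P) - (pderiv Q - ?X * pderiv P) =
       ?X * Polynomial.smult (r + 1) Q - Polynomial.smult (r + 1) P"
    by (simp only: B) (simp add: A)
  then have "[:-1, 0, 1:] * pderiv Q = Polynomial.smult (r + 1) (?X * Q - P)"
    unfolding X2 by (simp add: algebra_simps smult_diff_right)
  then have "pderiv ([:-1, 0, 1:] * pderiv Q) = Polynomial.smult (r + 1) (?X * pderiv Q + Q - pderiv P)"
    by (simp only: pderiv_smult pderiv_diff pderiv_mult) (simp add: pderiv_pCons algebra_simps)
  also have "?X * pderiv Q + Q - pderiv P = Polynomial.smult (r + 1) Q + Q"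
    using B by (simp add: algebra_simps)
  also have "\<dots> = Polynomial.smult (r + 2) Q"
    by (rule poly_eq_poly_eq_iff[THEN iffD1]) (simp add: fun_eq_iff algebra_simps)
  finally show ?thesis using Suc by (simp add: Q_def r_def algebra_simps)
qed (simp add: pderiv_pCons)

text \<open>Legendre polynomials are eigenfunctions, for distinct eigenvalues, of the operator \<open>p \<mapsto>
  ((x\<^sup>2 - 1) p')'\<close>, which is symmetric because \<open>x\<^sup>2 - 1\<close> vanishes at both end points.\<close>

lemma legendre_orthogonal:
  assumes "m \<noteq> n"
  shows "cell_int (legendre m * legendre n) = 0"
proof -
  let ?w = "[:-1, 0, 1:] :: real poly"
  have sym: "cell_int (Polynomial.smult (real m * real (m + 1)) (legendre m) * legendre n) =
     - cell_int (?w * (pderiv (legendre m) * pderiv (legendre n)))" for m n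
    unfolding legendre_ode[symmetric] cell_int_by_parts mult.assoc by simp
  have "real m * real (m + 1) * cell_int (legendre m * legendre n) =
        real n * real (n + 1) * cell_int (legendre m * legendre n)"
    using sym[of m n] sym[of n m] by (simp add: cell_int_smult mult.commute)
  moreover have "real m * real (m + 1) \<noteq> real n * real (n + 1)"
  proof -
    have "m * (m + 1) \<noteq> n * (n + 1)"
      using assms by (metis add_less_mono1 linorder_neqE_nat mult_strict_mono' nat_less_le zero_le)
    then show ?thesis by (metis of_nat_eq_iff of_nat_mult)
  qed
  ultimately show ?thesis by (simp add: left_diff_distrib[symmetric])
qed

lemma legendre_degree: "degree (legendre n) = n \<and> lead_coeff (legendre n) > 0 \<and> legendre n \<noteq> 0"
proof (induction n rule: legendre.induct)
  case (3 n)
  have d: "degree ([:0, 1:] * legendre (Suc n)) = Suc (Suc n)"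
    using 3 by (subst degree_mult_eq) auto
  have c: "coeff (legendre (Suc (Suc n))) (Suc (Suc n)) > 0"
  proof -
    have "coeff (legendre n) (Suc (Suc n)) = 0" using 3 by (intro coeff_eq_0) auto
    moreover have "coeff (legendre (Suc n)) (Suc n) > 0" using 3(1,2) by metis
    ultimately show ?thesis by simp
  qed
  have "degree (legendre (Suc (Suc n))) \<le> Suc (Suc n)"
    using 3 d by (auto intro!: degree_diff_le simp del: mult_pCons_left)
  then have "degree (legendre (Suc (Suc n))) = Suc (Suc n)"
    using c le_degree[of "legendre (Suc (Suc n))" "Suc (Suc n)"] by (intro antisym) (metis less_irrefl)+
  then show ?case using c by auto
qed auto

lemma legendre_top_coeff: "0 < coeff (legendre n) n"
  using legendre_degree[of n] by auto

lemma legendre_split: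
  assumes "degree p \<le> n"
  obtains a r where "p = Polynomial.smult a (legendre n) + r" and "r = 0 \<or> degree r < n"
proof -
  define a where "a = coeff p n / coeff (legendre n) n"
  define r where "r = p - Polynomial.smult a (legendre n)"
  have "coeff r i = 0" if "n \<le> i" for i
  proof (cases "i = n")
    case True
    then show ?thesis using legendre_top_coeff[of n] by (simp add: r_def a_def)
  next
    case False
    then have "n < i" using that by simp
    then show ?thesis using assms legendre_degree[of n] by (simp add: r_def coeff_eq_0)
  qed
  then have "r = 0 \<or> degree r < n" by (metis leading_coeff_0_iff not_less)
  then show ?thesis using that[of a r] by (simp add: r_def)
qed

lemma legendre_orthogonal_lower:
  assumes "q = 0 \<or> degree q < n"
  shows "cell_int (legendre n * q) = 0"
  using assms
proof (induction "degree q" arbitrary: q rule: less_induct)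
  case less
  show ?case
  proof (cases "q = 0")
    case False
    obtain a r where q: "q = Polynomial.smult a (legendre (degree q)) + r" and r: "r = 0 \<or> degree r < degree q"
      using legendre_split[of q "degree q"] by blast
    have "cell_int (legendre n * r) = 0"
      using r less.prems False by (cases "r = 0") (auto intro!: less.hyps)
    moreover have "cell_int (legendre n * legendre (degree q)) = 0"
      using less.prems False by (intro legendre_orthogonal) auto
    ultimately show ?thesis
      by (subst q) (simp add: distrib_left cell_int_add cell_int_smult)
  qed simp
qed

text \<open>Linear functionals on a finite-dimensional space are bounded. Splitting off the component
  along the Legendre polynomial of top degree, which is orthogonal to the rest, reduces the degree.\<close>

lemma functional_bound:
  fixes F :: "real poly \<Rightarrow> real"
  assumes add: "\<And>p q. F (p + q) = F p + F q" and smult: "\<And>c p. F (Polynomial.smult c p) = c * F p"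
  shows "\<exists>C\<ge>0. \<forall>p. degree p \<le> n \<longrightarrow> (F p)\<^sup>2 \<le> C * cell_int (p * p)"
proof -
  have F0: "F 0 = 0" using smult[of 0 0] by simp
  have "\<exists>C\<ge>0. \<forall>p. (p = 0 \<or> degree p < n) \<longrightarrow> (F p)\<^sup>2 \<le> C * cell_int (p * p)" for n
  proof (induction n)
    case 0
    show ?case by (auto simp: F0)
  next
    case (Suc n)
    then obtain C where C: "0 \<le> C" and b: "\<And>p. p = 0 \<or> degree p < n \<Longrightarrow> (F p)\<^sup>2 \<le> C * cell_int (p * p)"
      by blast
    define g where "g = cell_int (legendre n * legendre n)"
    have g: "0 < g"
      using cell_int_square_nonneg[of "legendre n"] cell_int_square_eq_0_iff[of "legendre n"] legendre_degree[of n]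
      unfolding g_def by linarith
    define K where "K = 2 * (F (legendre n))\<^sup>2 / g + 2 * C"
    have "(F p)\<^sup>2 \<le> K * cell_int (p * p)" if p: "degree p \<le> n" for p
    proof -
      obtain a r where q: "p = Polynomial.smult a (legendre n) + r" and r: "r = 0 \<or> degree r < n"
        using legendre_split[OF p] by blast
      have "cell_int (p * p) = a\<^sup>2 * g + cell_int (r * r)"
      proof -
        have "p * p = Polynomial.smult (a\<^sup>2) (legendre n * legendre n) +
            Polynomial.smult (2 * a) (legendre n * r) + r * r"
          unfolding q by (rule poly_eq_poly_eq_iff[THEN iffD1]) (simp add: fun_eq_iff algebra_simps power2_eq_square)
        then show ?thesis using legendre_orthogonal_lower[OF r]
          by (simp add: cell_int_add cell_int_smult g_def)
      qed
      moreover have "(F p)\<^sup>2 \<le> 2 * (a * F (legendre n))\<^sup>2 + 2 * (F r)\<^sup>2"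
      proof -
        have "F p = a * F (legendre n) + F r" by (simp add: q add smult)
        then show ?thesis using zero_le_power2[of "a * F (legendre n) - F r"]
          by (simp add: power2_eq_square algebra_simps)
      qed
      moreover have "(F r)\<^sup>2 \<le> C * cell_int (r * r)" by (rule b[OF r])
      moreover have "2 * (a * F (legendre n))\<^sup>2 = 2 * (F (legendre n))\<^sup>2 / g * (a\<^sup>2 * g)"
        using g by (simp add: power_mult_distrib)
      moreover have "0 \<le> 2 * (F (legendre n))\<^sup>2 / g * cell_int (r * r)" "0 \<le> 2 * C * (a\<^sup>2 * g)"
        using g C cell_int_square_nonneg[of r] by auto
      moreover have "K * cell_int (p * p) = 2 * (F (legendre n))\<^sup>2 / g * cell_int (p * p) + 2 * C * cell_int (p * p)"
        unfolding K_def by (rule distrib_right)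
      ultimately show ?thesis by (simp only: distrib_left)
    qed
    moreover have "0 \<le> K" using C g by (simp add: K_def)
    ultimately show ?case using F0 by (intro exI[of _ K]) auto
  qed
  from this[of "Suc n"] show ?thesis by (auto simp: less_Suc_eq_le)
qed

section \<open>The spectral volume forms on the reference cell\<close>

lemma summation_by_parts:
  fixes f w :: "nat \<Rightarrow> real"
  shows "(\<Sum>j\<le>n. f j * (w (Suc j) - w j)) =
     f n * w (Suc n) - f 0 * w 0 - (\<Sum>j=1..n. (f j - f (j - 1)) * w j)"
  by (induction n) (auto simp: algebra_simps)

definition lagr :: "(nat \<Rightarrow> real) \<Rightarrow> nat set \<Rightarrow> nat \<Rightarrow> real poly" where
  "lagr y S j = (\<Prod>m\<in>S - {j}. Polynomial.smult (1 / (y j - y m)) [:- y m, 1:])"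

lemma poly_lagr: "poly (lagr y S j) x = (\<Prod>m\<in>S - {j}. (x - y m) / (y j - y m))"
  unfolding lagr_def poly_prod by (intro prod.cong) (auto simp: diff_divide_distrib)

lemma poly_lagr_node:
  assumes "finite S" "inj_on y S" "i \<in> S" "j \<in> S"
  shows "poly (lagr y S j) (y i) = (if i = j then 1 else 0)"
proof (cases "i = j")
  case True
  have "y j \<noteq> y m" if "m \<in> S - {j}" for m
    using that assms by (auto simp: inj_on_eq_iff)
  then have "(\<Prod>m\<in>S - {j}. (y j - y m) / (y j - y m)) = 1" by (intro prod.neutral) auto
  then show ?thesis using True by (simp add: poly_lagr)
next
  case False
  then have "(\<Prod>m\<in>S - {j}. (y i - y m) / (y j - y m)) = 0"
    using assms by (intro prod_zero) auto
  then show ?thesis using False by (simp add: poly_lagr)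
qed

lemma degree_lagr:
  assumes "finite S" "j \<in> S"
  shows "degree (lagr y S j) < card S"
proof -
  have "degree (lagr y S j) \<le> sum (degree \<circ> (\<lambda>m. Polynomial.smult (1 / (y j - y m)) [:- y m, 1:])) (S - {j})"
    unfolding lagr_def using assms by (intro degree_prod_sum_le) auto
  also have "\<dots> \<le> (\<Sum>m\<in>S - {j}. 1)" by (intro sum_mono) (auto intro: degree_smult_le[THEN order_trans])
  also have "\<dots> = card S - 1" using assms by simp
  finally show ?thesis using assms card_gt_0_iff[of S] by fastforce
qed

lemma poly_zero_if_roots:
  fixes p :: "real poly"
  assumes "finite S" "inj_on y S" "p = 0 \<or> degree p < card S" "\<And>j. j \<in> S \<Longrightarrow> poly p (y j) = 0"
  shows "p = 0"
proof (rule ccontr)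
  assume p: "p \<noteq> 0"
  have "card S = card (y ` S)" using assms by (simp add: card_image)
  also have "\<dots> \<le> card {x. poly p x = 0}"
    using assms p by (intro card_mono poly_roots_finite) auto
  also have "\<dots> \<le> degree p" using p by (rule card_poly_roots_bound)
  finally show False using assms p by auto
qed

lemma lagrange_interpolation:
  assumes S: "finite S" "inj_on y S" and p: "degree p < card S"
  shows "p = (\<Sum>j\<in>S. Polynomial.smult (poly p (y j)) (lagr y S j))"
proof -
  define d where "d = p - (\<Sum>j\<in>S. Polynomial.smult (poly p (y j)) (lagr y S j))"
  have "degree (\<Sum>j\<in>S. Polynomial.smult (poly p (y j)) (lagr y S j)) < card S"
    using S p degree_lagr[OF S(1)]
    by (intro degree_sum_less) (auto intro: degree_smult_le[THEN order.strict_trans1])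
  then have deg: "degree d < card S" unfolding d_def using p by (intro degree_diff_less)
  have "poly d (y i) = 0" if "i \<in> S" for i
  proof -
    have "(\<Sum>j\<in>S. poly p (y j) * poly (lagr y S j) (y i)) = (\<Sum>j\<in>S. if j = i then poly p (y j) else 0)"
      using that S by (intro sum.cong) (auto simp: poly_lagr_node)
    then show ?thesis using that S by (simp add: d_def poly_sum)
  qed
  then have "d = 0" using S deg by (intro poly_zero_if_roots[of S y]) auto
  then show ?thesis by (simp add: d_def)
qed

text \<open>Applied to traces, norms and derivatives this turns nodal error bounds into bounds for the
  whole polynomial.\<close>

lemma nodal_functional_bound:
  fixes F :: "real poly \<Rightarrow> real"
  assumes S: "finite S" "inj_on y S" and p: "degree p < card S"
    and add: "\<And>p q. F (p + q) = F p + F q" and smult: "\<And>c p. F (Polynomial.smult c p) = c * F p"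
    and \<epsilon>: "\<And>j. j \<in> S \<Longrightarrow> \<bar>poly p (y j)\<bar> \<le> \<epsilon>"
  shows "\<bar>F p\<bar> \<le> (\<Sum>j\<in>S. \<bar>F (lagr y S j)\<bar>) * \<epsilon>"
proof -
  have F0: "F 0 = 0" using smult[of 0 0] by simp
  have Fsum: "F (sum f A) = (\<Sum>j\<in>A. F (f j))" for f and A :: "nat set"
    by (induction A rule: infinite_finite_induct) (auto simp: add F0)
  have "F p = (\<Sum>j\<in>S. poly p (y j) * F (lagr y S j))"
    by (subst lagrange_interpolation[OF S p]) (simp add: Fsum smult)
  also have "\<bar>\<dots>\<bar> \<le> (\<Sum>j\<in>S. \<bar>poly p (y j) * F (lagr y S j)\<bar>)" by (rule sum_abs)
  also have "\<dots> \<le> (\<Sum>j\<in>S. \<bar>F (lagr y S j)\<bar> * \<epsilon>)"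
    by (intro sum_mono) (auto simp: abs_mult mult.commute intro!: mult_right_mono \<epsilon>)
  finally show ?thesis by (simp add: sum_distrib_right)
qed

lemma poly_as_sum:
  fixes p :: "real poly"
  assumes "degree p \<le> n"
  shows "poly p x = (\<Sum>i\<le>n. coeff p i * x ^ i)"
  unfolding poly_altdef using assms by (intro sum.mono_neutral_left) (auto intro!: coeff_eq_0)

locale reference_cell =
  fixes meth :: sv_method and k :: nat and y :: "nat \<Rightarrow> real"
  assumes points: "reference_points meth k y" and k_pos: "1 \<le> k"
begin

abbreviation idx :: "nat set" where "idx \<equiv> quadrature_indices meth k"

lemma y_first: "y 0 = -1" and y_last: "y (Suc k) = 1"
  using points by (auto simp: reference_points_def)

lemma y_strict: "i < j \<Longrightarrow> j \<le> Suc k \<Longrightarrow> y i < y j"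
  using points unfolding reference_points_def strict_mono_on_def by auto

lemma y_inj: "inj_on y {0..Suc k}"
proof (rule linorder_inj_onI)
  fix i j assume "i < j" "i \<in> {0..Suc k}" "j \<in> {0..Suc k}"
  then show "y i \<noteq> y j" using y_strict[of i j] by auto
qed auto

lemma y_mono: "i \<le> j \<Longrightarrow> j \<le> Suc k \<Longrightarrow> y i \<le> y j"
  using y_strict[of i j] by (cases "i = j") auto

lemma y_range: "i \<le> Suc k \<Longrightarrow> y i \<in> {-1..1}"
  using y_mono[of 0 i] y_mono[of i "Suc k"] y_first y_last by auto

lemma idx_subset: "idx \<subseteq> {1..Suc k}" and idx_superset: "{1..k} \<subseteq> idx" and idx_finite: "finite idx"
  and idx_last: "idx - {1..k} \<subseteq> {Suc k}"
  by (auto simp: quadrature_indices_def split: sv_method.splits)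

lemma idx_inj: "inj_on y idx"
  using y_inj idx_subset by (rule inj_on_subset[OF _ order_trans]) auto

lemma card_idx: "k \<le> card idx" "card idx \<le> Suc k"
  using card_mono[OF idx_finite idx_superset] card_mono[OF _ idx_subset] by auto

definition node_poly :: "real poly" where
  "node_poly = (\<Prod>j\<in>idx. [:- y j, 1:])"

lemma node_poly_degree: "degree node_poly = card idx" and node_poly_monic: "lead_coeff node_poly = 1"
proof -
  show "degree node_poly = card idx"
    unfolding node_poly_def by (subst degree_prod_eq_sum_degree) auto
  show "lead_coeff node_poly = 1"
    unfolding node_poly_def lead_coeff_prod by simp
qed

lemma node_poly_root: "j \<in> idx \<Longrightarrow> poly node_poly (y j) = 0"
  unfolding node_poly_def poly_prod using idx_finite by (intro prod_zero) auto

text \<open>The node polynomial is a multiple of \<open>P\<^sub>k\<close> (LSV) or of \<open>P\<^bsub>k+1\<^esub> - P\<^sub>k\<close> (RRSV).\<close>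

lemma node_poly_orthogonal:
  assumes q: "q = 0 \<or> degree q < k"
  shows "cell_int (node_poly * q) = 0"
proof -
  define D where "D = (case meth of LSV \<Rightarrow> legendre k | RRSV \<Rightarrow> legendre (k + 1) - legendre k)"
  have root: "poly D (y j) = 0" if "j \<in> idx" for j
    using that points unfolding D_def reference_points_def quadrature_indices_def
    by (auto split: sv_method.splits)
  have "cell_int (legendre (Suc k) * q) = 0" "cell_int (legendre k * q) = 0"
    using q by (auto intro!: legendre_orthogonal_lower)
  then have orth: "cell_int (D * q) = 0"
    unfolding D_def by (auto split: sv_method.splits simp: left_diff_distrib cell_int_diff)
  have top: "0 < coeff D (card idx)"
    using legendre_top_coeff[of k] legendre_top_coeff[of "Suc k"] legendre_degree[of k]
    by (auto simp: D_def quadrature_indices_def coeff_eq_0 split: sv_method.splits)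
  have deg: "degree D \<le> card idx"
    using legendre_degree[of k] legendre_degree[of "Suc k"]
    by (auto simp: D_def quadrature_indices_def split: sv_method.splits intro!: degree_diff_le)
  define c where "c = coeff D (card idx)"
  define R where "R = D - Polynomial.smult c node_poly"
  have "coeff R i = 0" if "card idx \<le> i" for i
  proof (cases "i = card idx")
    case True
    then show ?thesis using node_poly_monic node_poly_degree by (simp add: R_def c_def)
  next
    case False
    then show ?thesis using that deg node_poly_degree by (simp add: R_def coeff_eq_0)
  qed
  then have "R = 0 \<or> degree R < card idx" by (metis leading_coeff_0_iff not_less)
  moreover have "poly R (y j) = 0" if "j \<in> idx" for j
    using that by (simp add: R_def root node_poly_root)
  ultimately have "R = 0" using idx_finite idx_inj by (intro poly_zero_if_roots[of idx y]) auto
  then have "D = Polynomial.smult c node_poly" by (simp add: R_def)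
  then have "cell_int (D * q) = c * cell_int (node_poly * q)" by (simp add: cell_int_smult)
  then show ?thesis using orth top by (simp add: c_def)
qed

definition quad :: "real poly \<Rightarrow> real" where
  "quad f = (\<Sum>j\<in>idx. weight meth k y j * poly f (y j))"

lemma weight_eq: "j \<in> idx \<Longrightarrow> weight meth k y j = cell_int (lagr y idx j)"
  unfolding weight_def cell_int_def by (auto simp: poly_lagr[abs_def])

lemma quad_interpolatory:
  assumes "degree f < card idx"
  shows "quad f = cell_int f"
proof -
  have "cell_int f = (\<Sum>j\<in>idx. poly f (y j) * cell_int (lagr y idx j))"
    by (subst lagrange_interpolation[OF idx_finite idx_inj assms]) (simp add: cell_int_sum cell_int_smult)
  then show ?thesis unfolding quad_def by (simp add: weight_eq mult.commute)
qed

text \<open>Division by the node polynomial: the multiple of it is invisible to the rule because it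
  vanishes at the nodes, and to the integral by orthogonality.\<close>

lemma quad_exact:
  assumes "degree f < card idx + k"
  shows "quad f = cell_int f"
proof -
  define q r where "q = f div node_poly" and "r = f mod node_poly"
  have n0: "node_poly \<noteq> 0" using node_poly_monic by auto
  have f: "f = node_poly * q + r" by (simp add: q_def r_def)
  have r: "degree r < card idx"
    using degree_mod_less[OF n0, of f] node_poly_degree card_idx k_pos by (auto simp: r_def)
  have "q = 0 \<or> degree q < k"
  proof (rule disjCI)
    assume "\<not> degree q < k"
    show "q = 0"
    proof (rule ccontr)
      assume "q \<noteq> 0"
      then have d: "degree (node_poly * q) = card idx + degree q"
        using n0 by (simp add: degree_mult_eq node_poly_degree)
      then have "degree f = card idx + degree q"
        unfolding f using r by (subst degree_add_eq_left) auto
      then show False using assms \<open>\<not> degree q < k\<close> by simp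
    qed
  qed
  then have "cell_int f = cell_int r" by (subst f) (simp add: cell_int_add node_poly_orthogonal)
  moreover have "quad f = quad r"
    unfolding quad_def by (intro sum.cong refl, subst f) (simp add: node_poly_root)
  ultimately show ?thesis using quad_interpolatory[OF r] by simp
qed

text \<open>Up to degree \<open>2k\<close> the only defect of the rules is that the Gauss rule with \<open>k\<close> nodes misses
  the coefficient of degree \<open>2k\<close>.\<close>

definition quad_error :: real where
  "quad_error = (case meth of LSV \<Rightarrow> cell_int (node_poly * node_poly) | RRSV \<Rightarrow> 0)"

lemma quad_defect:
  assumes "degree f \<le> 2 * k"
  shows "cell_int f - quad f = coeff f (2 * k) * quad_error"
proof (cases meth)
  case RRSV
  then have "card idx = Suc k" by (simp add: quadrature_indices_def)
  then have "quad f = cell_int f" using assms by (intro quad_exact) simp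
  moreover have "quad_error = 0" using RRSV unfolding quad_error_def by simp
  ultimately show ?thesis by simp
next
  case LSV
  then have c: "card idx = k" by (simp add: quadrature_indices_def)
  define a where "a = coeff f (2 * k)"
  define g where "g = f - Polynomial.smult a (node_poly * node_poly)"
  have top: "coeff (node_poly * node_poly) (2 * k) = 1"
    using coeff_mult_top[of node_poly k node_poly k] node_poly_degree node_poly_monic c by (simp add: mult_2)
  have dd: "degree (node_poly * node_poly) \<le> 2 * k"
    using degree_mult_le[of node_poly node_poly] node_poly_degree c by simp
  have "coeff g i = 0" if "2 * k \<le> i" for i
    using that top dd assms by (cases "i = 2 * k") (auto simp: g_def a_def coeff_eq_0)
  then have "g = 0 \<or> degree g < 2 * k" by (metis leading_coeff_0_iff not_less)
  then have "quad g = cell_int g"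
    using c k_pos by (intro quad_exact) auto
  moreover have "quad f = quad g"
    unfolding quad_def by (intro sum.cong refl) (simp add: g_def node_poly_root)
  moreover have "cell_int f = cell_int g + a * cell_int (node_poly * node_poly)"
    by (simp add: g_def cell_int_diff cell_int_smult)
  moreover have "quad_error = cell_int (node_poly * node_poly)" using LSV unfolding quad_error_def by simp
  ultimately show ?thesis by (simp add: a_def)
qed

lemma quad_error_nonneg: "0 \<le> quad_error"
  unfolding quad_error_def by (auto split: sv_method.split simp: cell_int_square_nonneg)

text \<open>The bilinear form \<open>(p, q\<^sup>*)\<close> on the reference cell, see \<open>mass_eq_star\<close>. In contrast to its
  definition by means of \<open>q\<^sup>*\<close>, this expression is visibly symmetric and at least the \<open>L\<^sub>2\<close> product
  on the diagonal.\<close>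

definition mass :: "real poly \<Rightarrow> real poly \<Rightarrow> real" where
  "mass p q = cell_int (p * q) + real k / real (k + 1) * quad_error * (coeff p k * coeff q k)"

lemma mass_commute: "mass p q = mass q p"
  by (simp add: mass_def mult.commute)

lemma mass_add: "mass (p + q) r = mass p r + mass q r"
  by (simp add: mass_def cell_int_add distrib_right distrib_left)

lemma mass_smult: "mass (Polynomial.smult c p) r = c * mass p r"
  by (simp add: mass_def cell_int_smult algebra_simps)

lemma mass_ge: "cell_int (p * p) \<le> mass p p"
  unfolding mass_def using quad_error_nonneg by simp

lemma mass_nonneg: "0 \<le> mass p p"
  using mass_ge[of p] cell_int_square_nonneg[of p] by linarith

lemma mass_eq_0: "mass p p = 0 \<Longrightarrow> p = 0"
  using mass_ge[of p] cell_int_square_nonneg[of p] cell_int_square_eq_0_iff[of p] by linarith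

text \<open>The values of \<open>q\<^sup>*\<close> on the control volumes of the reference cell.\<close>

definition ref_star :: "real poly \<Rightarrow> nat \<Rightarrow> real" where
  "ref_star q j = poly q (-1) + (\<Sum>m=1..j. weight meth k y m * poly (pderiv q) (y m))"

text \<open>Integration by parts. The additional term of \<open>mass\<close> is the quadrature defect of \<open>q' (W -
  W(1))\<close>, a polynomial of degree at most \<open>2k\<close>.\<close>

lemma mass_pderiv:
  assumes W: "degree W \<le> Suc k" and q: "degree q \<le> k"
  shows "mass (pderiv W) q =
    poly q (-1) * (poly W 1 - poly W (-1)) - quad (pderiv q * (W - [:poly W 1:]))"
proof -
  define f where "f = pderiv q * (W - [:poly W 1:])"
  have dq: "degree (pderiv q) \<le> k - 1" using q by (simp add: degree_pderiv)
  have dW: "degree (W - [:poly W 1:]) \<le> Suc k" using W by (intro degree_diff_le) auto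
  have "degree f \<le> 2 * k"
    using degree_mult_le[of "pderiv q" "W - [:poly W 1:]"] dq dW k_pos by (simp add: f_def)
  then have defect: "cell_int f - quad f = coeff f (2 * k) * quad_error" by (rule quad_defect)
  have "coeff f (k - 1 + Suc k) = coeff (pderiv q) (k - 1) * coeff (W - [:poly W 1:]) (Suc k)"
    unfolding f_def by (rule coeff_mult_top[OF dq dW])
  then have top: "coeff f (2 * k) = real k / real (k + 1) * (coeff (pderiv W) k * coeff q k)"
    using k_pos by (simp add: coeff_pderiv mult_2)
  have "cell_int f = - poly q (-1) * (poly W (-1) - poly W 1) - cell_int (q * pderiv W)"
    unfolding f_def cell_int_by_parts by (simp add: pderiv_diff pderiv_pCons)
  then show ?thesis using defect unfolding top mass_def f_def[symmetric]
    by (simp add: algebra_simps)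
qed

text \<open>Summation by parts, since the increments of \<open>q\<^sup>*\<close> are the terms \<open>A\<^sub>j q'(y\<^sub>j)\<close> of the
  quadrature rule. With an antiderivative of \<open>p\<close> in the place of \<open>W\<close> the right-hand side is \<open>(p,
  q\<^sup>*)\<close>; with a polynomial interpolating the upwind values it is \<open>- a\<^sub>h(p, q\<^sup>*)\<close>.\<close>

lemma mass_eq_star:
  assumes W: "degree W \<le> Suc k" and q: "degree q \<le> k"
  shows "mass (pderiv W) q = (\<Sum>j\<le>k. ref_star q j * (poly W (y (Suc j)) - poly W (y j)))"
proof -
  have "(\<Sum>j\<le>k. ref_star q j * (poly W (y (Suc j)) - poly W (y j))) =
     ref_star q k * poly W 1 - poly q (-1) * poly W (-1) -
     (\<Sum>j=1..k. (ref_star q j - ref_star q (j - 1)) * poly W (y j))"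
    using summation_by_parts[of "ref_star q" "\<lambda>j. poly W (y j)" k]
    by (simp add: y_first y_last) (simp add: ref_star_def)
  also have "(\<Sum>j=1..k. (ref_star q j - ref_star q (j - 1)) * poly W (y j)) =
     (\<Sum>j=1..k. weight meth k y j * poly (pderiv q) (y j) * poly W (y j))"
  proof (intro sum.cong refl)
    fix j assume "j \<in> {1..k}"
    then obtain i where "j = Suc i" by (cases j) auto
    then show "(ref_star q j - ref_star q (j - 1)) * poly W (y j) = weight meth k y j * poly (pderiv q) (y j) * poly W (y j)"
      by (simp add: ref_star_def)
  qed
  also have "ref_star q k * poly W 1 - poly q (-1) * poly W (-1) -
      (\<Sum>j=1..k. weight meth k y j * poly (pderiv q) (y j) * poly W (y j)) =
      poly q (-1) * (poly W 1 - poly W (-1)) -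
      (\<Sum>j=1..k. weight meth k y j * poly (pderiv q * (W - [:poly W 1:])) (y j))"
    by (simp add: ref_star_def algebra_simps sum_subtractf sum_distrib_left)
  also have "(\<Sum>j=1..k. weight meth k y j * poly (pderiv q * (W - [:poly W 1:])) (y j)) =
      quad (pderiv q * (W - [:poly W 1:]))"
    unfolding quad_def
    using idx_superset idx_finite idx_last y_last by (intro sum.mono_neutral_left) auto
  finally show ?thesis using mass_pderiv[OF W q] by simp
qed

text \<open>The correction that changes the value at the left end point and at no other node.\<close>

definition upwind_poly :: "real poly" where
  "upwind_poly = lagr y {0..Suc k} 0"

lemma upwind_poly_first: "poly upwind_poly (-1) = 1"
  using poly_lagr_node[of "{0..Suc k}" y 0 0] y_inj y_first by (simp add: upwind_poly_def)

lemma upwind_poly_node: "j \<in> {1..Suc k} \<Longrightarrow> poly upwind_poly (y j) = 0"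
  using poly_lagr_node[of "{0..Suc k}" y j 0] y_inj by (simp add: upwind_poly_def)

lemma upwind_poly_degree: "degree upwind_poly \<le> Suc k"
  using degree_lagr[of "{0..Suc k}" 0 y] by (simp add: upwind_poly_def)

text \<open>The polynomial of degree \<open>k + 1\<close> through the upwind values: the inflow value \<open>c\<close> at the left
  end point and the values of \<open>p\<close> at the other points.\<close>

definition flux_poly :: "real poly \<Rightarrow> real \<Rightarrow> real poly" where
  "flux_poly p c = p - Polynomial.smult (poly p (-1) - c) upwind_poly"

definition ref_adv :: "real poly \<Rightarrow> real \<Rightarrow> real poly" where
  "ref_adv p c = - pderiv (flux_poly p c)"

lemma flux_poly_degree: "degree p \<le> k \<Longrightarrow> degree (flux_poly p c) \<le> Suc k"
  unfolding flux_poly_def using upwind_poly_degree by (intro degree_diff_le) (auto intro: degree_smult_le[THEN order_trans])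

lemma flux_poly_first: "poly (flux_poly p c) (-1) = c"
  by (simp add: flux_poly_def upwind_poly_first)

lemma flux_poly_node: "j \<in> {1..Suc k} \<Longrightarrow> poly (flux_poly p c) (y j) = poly p (y j)"
  by (simp add: flux_poly_def upwind_poly_node)

lemma flux_poly_last: "poly (flux_poly p c) 1 = poly p 1"
  using flux_poly_node[of "Suc k" p c] y_last by simp

lemma ref_adv_degree: "degree p \<le> k \<Longrightarrow> degree (ref_adv p c) \<le> k"
  using flux_poly_degree[of p c] by (simp add: ref_adv_def degree_pderiv)

lemma mass_uminus: "mass (- p) q = - mass p q"
  using mass_smult[of "-1" p q] by simp

text \<open>The right-hand side is the upwind discontinuous Galerkin form: at the quadrature nodes the
  flux polynomial coincides with \<open>p\<close>, and the rule is exact for \<open>q' p\<close>, of degree at most \<open>2k - 1\<close>.\<close>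

lemma mass_ref_adv:
  assumes p: "degree p \<le> k" and q: "degree q \<le> k"
  shows "mass (ref_adv p c) q = c * poly q (-1) - poly p 1 * poly q 1 + cell_int (pderiv q * p)"
proof -
  have nodes: "quad (pderiv q * (flux_poly p c - [:poly p 1:])) = quad (pderiv q * (p - [:poly p 1:]))"
    unfolding quad_def using idx_subset by (intro sum.cong refl) (auto simp: flux_poly_node)
  have "degree (pderiv q * (p - [:poly p 1:])) \<le> degree (pderiv q) + degree (p - [:poly p 1:])"
    by (rule degree_mult_le)
  also have "\<dots> \<le> (k - 1) + k"
    using p q by (intro add_mono degree_diff_le) (auto simp: degree_pderiv)
  finally have "quad (pderiv q * (p - [:poly p 1:])) = cell_int (pderiv q * (p - [:poly p 1:]))"
    using card_idx k_pos by (intro quad_exact) auto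
  also have "\<dots> = cell_int (pderiv q * p) - poly p 1 * (poly q 1 - poly q (-1))"
  proof -
    have "pderiv q * (p - [:poly p 1:]) = pderiv q * p - Polynomial.smult (poly p 1) (pderiv q)"
      by (simp add: algebra_simps)
    then show ?thesis by (simp add: cell_int_diff cell_int_smult cell_int_pderiv)
  qed
  finally show ?thesis
    unfolding ref_adv_def mass_uminus mass_pderiv[OF flux_poly_degree[OF p] q] flux_poly_first flux_poly_last nodes
    by (simp add: algebra_simps)
qed

lemma mass_coeff_bound: "\<exists>C\<ge>0. \<forall>p. degree p \<le> k \<longrightarrow> mass p p \<le> C * (\<Sum>i\<le>k. (coeff p i)\<^sup>2)"
proof -
  define K where "K = real k / real (k + 1) * quad_error"
  have K: "0 \<le> K" using quad_error_nonneg by (simp add: K_def)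
  have "mass p p \<le> (2 * real (k + 1) + K) * (\<Sum>i\<le>k. (coeff p i)\<^sup>2)" if p: "degree p \<le> k" for p
  proof -
    define A where "A = (\<Sum>i\<le>k. (coeff p i)\<^sup>2)"
    have "poly (p * p) x \<le> real (k + 1) * A" if x: "x \<in> {-1..1}" for x
    proof -
      have "poly p x = (\<Sum>i\<le>k. coeff p i * x ^ i)" by (rule poly_as_sum) (use p in auto)
      then have "(poly p x)\<^sup>2 \<le> A * (\<Sum>i\<le>k. (x ^ i)\<^sup>2)"
        unfolding A_def by (simp only: Cauchy_Schwarz_ineq_sum)
      moreover have "(\<Sum>i\<le>k. (x ^ i)\<^sup>2) \<le> (\<Sum>i\<le>k. 1)"
      proof (intro sum_mono)
        fix i
        have "\<bar>x ^ i\<bar> \<le> 1" unfolding power_abs using x by (intro power_le_one) auto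
        then show "(x ^ i)\<^sup>2 \<le> 1" by (simp add: abs_square_le_1)
      qed
      moreover have "0 \<le> A" unfolding A_def by (intro sum_nonneg) auto
      ultimately have "(poly p x)\<^sup>2 \<le> A * real (k + 1)"
        using mult_left_mono[of "\<Sum>i\<le>k. (x ^ i)\<^sup>2" "real (k + 1)" A] by simp
      then show ?thesis by (simp add: power2_eq_square mult.commute)
    qed
    note pointwise = this
    have "cell_int (p * p) \<le> integral {-1..1::real} (\<lambda>x. real (k + 1) * A)"
      unfolding cell_int_def
    proof (rule integral_le)
      show "poly (p * p) integrable_on {-1..1}" by (rule poly_integrable)
      show "(\<lambda>x. real (k + 1) * A) integrable_on {-1..1::real}" by (rule integrable_const_ivl)
      show "poly (p * p) x \<le> real (k + 1) * A" if "x \<in> {-1..1}" for x using pointwise[OF that] .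
    qed
    also have "\<dots> = 2 * real (k + 1) * A" by simp
    finally have "cell_int (p * p) \<le> 2 * real (k + 1) * A" .
    moreover have "(coeff p k)\<^sup>2 \<le> A" unfolding A_def by (rule member_le_sum) auto
    then have "K * (coeff p k * coeff p k) \<le> K * A"
      using K by (intro mult_left_mono) (auto simp: power2_eq_square)
    ultimately show ?thesis by (simp add: mass_def K_def A_def algebra_simps)
  qed
  then show ?thesis using K by (intro exI[of _ "2 * real (k + 1) + K"]) auto
qed

lemma mass_functional_bound:
  fixes F :: "real poly \<Rightarrow> real"
  assumes "\<And>p q. F (p + q) = F p + F q" and "\<And>c p. F (Polynomial.smult c p) = c * F p"
  shows "\<exists>C\<ge>0. \<forall>p. degree p \<le> k \<longrightarrow> (F p)\<^sup>2 \<le> C * mass p p"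
proof -
  obtain C where "0 \<le> C" "\<And>p. degree p \<le> k \<Longrightarrow> (F p)\<^sup>2 \<le> C * cell_int (p * p)"
    using functional_bound[of F k] assms by blast
  then show ?thesis using mass_ge mult_left_mono[OF mass_ge] by (intro exI[of _ C]) (meson order_trans)
qed

text \<open>The inverse inequality on the reference cell.\<close>

lemma ref_adv_bound:
  "\<exists>C\<ge>0. \<forall>p c. degree p \<le> k \<longrightarrow> mass (ref_adv p c) (ref_adv p c) \<le> C * (mass p p + c\<^sup>2)"
proof -
  obtain A where A: "0 \<le> A" "\<And>p. degree p \<le> k \<Longrightarrow> mass p p \<le> A * (\<Sum>i\<le>k. (coeff p i)\<^sup>2)"
    using mass_coeff_bound by blast
  define F where "F i p = coeff (ref_adv p 0) i" for i p
  define d where "d i = coeff (pderiv upwind_poly) i" for i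
  have co: "coeff (ref_adv p c) i = F i p - c * d i" for p c i
    by (simp add: F_def d_def ref_adv_def flux_poly_def pderiv_diff pderiv_smult algebra_simps)
  have "\<exists>C\<ge>0. \<forall>p. degree p \<le> k \<longrightarrow> (F i p)\<^sup>2 \<le> C * mass p p" for i
    by (rule mass_functional_bound)
      (auto simp: F_def ref_adv_def flux_poly_def pderiv_diff pderiv_smult pderiv_add algebra_simps)
  then obtain B where B: "\<And>i. 0 \<le> B i" "\<And>i p. degree p \<le> k \<Longrightarrow> (F i p)\<^sup>2 \<le> B i * mass p p"
    by metis
  define C where "C = A * (\<Sum>i\<le>k. 2 * B i + 2 * (d i)\<^sup>2)"
  have "0 \<le> C" unfolding C_def using A B by (intro mult_nonneg_nonneg sum_nonneg) auto
  moreover have "mass (ref_adv p c) (ref_adv p c) \<le> C * (mass p p + c\<^sup>2)" if p: "degree p \<le> k" for p c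
  proof -
    have "(coeff (ref_adv p c) i)\<^sup>2 \<le> (2 * B i + 2 * (d i)\<^sup>2) * (mass p p + c\<^sup>2)" for i
    proof -
      have "(F i p - c * d i)\<^sup>2 \<le> 2 * (F i p)\<^sup>2 + 2 * (c\<^sup>2 * (d i)\<^sup>2)"
        using zero_le_power2[of "F i p + c * d i"] by (simp add: power2_eq_square algebra_simps)
      also have "\<dots> \<le> 2 * (B i * mass p p) + 2 * (c\<^sup>2 * (d i)\<^sup>2)" using B(2)[OF p] by simp
      also have "\<dots> \<le> (2 * B i + 2 * (d i)\<^sup>2) * (mass p p + c\<^sup>2)"
        using B(1)[of i] mass_nonneg[of p] by (simp add: algebra_simps)
      finally show ?thesis unfolding co .
    qed
    then have "(\<Sum>i\<le>k. (coeff (ref_adv p c) i)\<^sup>2) \<le> (\<Sum>i\<le>k. (2 * B i + 2 * (d i)\<^sup>2) * (mass p p + c\<^sup>2))"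
      by (intro sum_mono)
    then have "A * (\<Sum>i\<le>k. (coeff (ref_adv p c) i)\<^sup>2) \<le> C * (mass p p + c\<^sup>2)"
      using A(1) unfolding C_def sum_distrib_right[symmetric] mult.assoc by (intro mult_left_mono)
    then show ?thesis using A(2)[OF ref_adv_degree[OF p], of c] by linarith
  qed
  ultimately show ?thesis by blast
qed

text \<open>Together with the following two lemmas this turns pointwise interpolation errors at the
  nodes into bounds in the energy, for the derivative, and in the maximum norm.\<close>

lemma mass_nodal_bound:
  "\<exists>C\<ge>0. \<forall>p \<epsilon>. degree p \<le> k \<longrightarrow> (\<forall>j\<in>{1..Suc k}. \<bar>poly p (y j)\<bar> \<le> \<epsilon>) \<longrightarrow> mass p p \<le> C * \<epsilon>\<^sup>2"
proof -
  obtain A where A: "0 \<le> A" "\<And>p. degree p \<le> k \<Longrightarrow> mass p p \<le> A * (\<Sum>i\<le>k. (coeff p i)\<^sup>2)"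
    using mass_coeff_bound by blast
  define c where "c i = (\<Sum>j\<in>{1..Suc k}. \<bar>coeff (lagr y {1..Suc k} j) i\<bar>)" for i
  have "mass p p \<le> (A * (\<Sum>i\<le>k. (c i)\<^sup>2)) * \<epsilon>\<^sup>2"
    if p: "degree p \<le> k" and \<epsilon>: "\<forall>j\<in>{1..Suc k}. \<bar>poly p (y j)\<bar> \<le> \<epsilon>" for p \<epsilon>
  proof -
    have "(coeff p i)\<^sup>2 \<le> (c i)\<^sup>2 * \<epsilon>\<^sup>2" for i
    proof -
      have "\<bar>coeff p i\<bar> \<le> c i * \<epsilon>" unfolding c_def
        using p \<epsilon> y_inj by (intro nodal_functional_bound) (auto intro: inj_on_subset)
      then have "\<bar>coeff p i\<bar>\<^sup>2 \<le> (c i * \<epsilon>)\<^sup>2" by (intro power_mono) auto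
      then show ?thesis by (simp add: power_mult_distrib)
    qed
    then have "(\<Sum>i\<le>k. (coeff p i)\<^sup>2) \<le> (\<Sum>i\<le>k. (c i)\<^sup>2 * \<epsilon>\<^sup>2)" by (intro sum_mono)
    then have "A * (\<Sum>i\<le>k. (coeff p i)\<^sup>2) \<le> (A * (\<Sum>i\<le>k. (c i)\<^sup>2)) * \<epsilon>\<^sup>2"
      using A(1) unfolding sum_distrib_right[symmetric] mult.assoc by (intro mult_left_mono)
    then show ?thesis using A(2)[OF p] by linarith
  qed
  moreover have "0 \<le> A * (\<Sum>i\<le>k. (c i)\<^sup>2)" using A(1) by (intro mult_nonneg_nonneg sum_nonneg) auto
  ultimately show ?thesis by blast
qed

lemma mass_pderiv_nodal_bound:
  "\<exists>C\<ge>0. \<forall>p \<epsilon>. degree p \<le> Suc k \<longrightarrow> (\<forall>j\<in>{0..Suc k}. \<bar>poly p (y j)\<bar> \<le> \<epsilon>) \<longrightarrow>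
     mass (pderiv p) (pderiv p) \<le> C * \<epsilon>\<^sup>2"
proof -
  obtain A where A: "0 \<le> A" "\<And>p. degree p \<le> k \<Longrightarrow> mass p p \<le> A * (\<Sum>i\<le>k. (coeff p i)\<^sup>2)"
    using mass_coeff_bound by blast
  define c where "c i = (\<Sum>j\<in>{0..Suc k}. \<bar>coeff (pderiv (lagr y {0..Suc k} j)) i\<bar>)" for i
  have "mass (pderiv p) (pderiv p) \<le> (A * (\<Sum>i\<le>k. (c i)\<^sup>2)) * \<epsilon>\<^sup>2"
    if p: "degree p \<le> Suc k" and \<epsilon>: "\<forall>j\<in>{0..Suc k}. \<bar>poly p (y j)\<bar> \<le> \<epsilon>" for p \<epsilon>
  proof -
    have "(coeff (pderiv p) i)\<^sup>2 \<le> (c i)\<^sup>2 * \<epsilon>\<^sup>2" for i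
    proof -
      have "\<bar>coeff (pderiv p) i\<bar> \<le> c i * \<epsilon>" unfolding c_def
        using p \<epsilon> y_inj by (intro nodal_functional_bound) (auto simp: pderiv_add pderiv_smult)
      then have "\<bar>coeff (pderiv p) i\<bar>\<^sup>2 \<le> (c i * \<epsilon>)\<^sup>2" by (intro power_mono) auto
      then show ?thesis by (simp add: power_mult_distrib)
    qed
    then have "(\<Sum>i\<le>k. (coeff (pderiv p) i)\<^sup>2) \<le> (\<Sum>i\<le>k. (c i)\<^sup>2 * \<epsilon>\<^sup>2)" by (intro sum_mono)
    then have "A * (\<Sum>i\<le>k. (coeff (pderiv p) i)\<^sup>2) \<le> (A * (\<Sum>i\<le>k. (c i)\<^sup>2)) * \<epsilon>\<^sup>2"
      using A(1) unfolding sum_distrib_right[symmetric] mult.assoc by (intro mult_left_mono)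
    moreover have "degree (pderiv p) \<le> k" using p by (simp add: degree_pderiv)
    ultimately show ?thesis using A(2)[of "pderiv p"] by linarith
  qed
  moreover have "0 \<le> A * (\<Sum>i\<le>k. (c i)\<^sup>2)" using A(1) by (intro mult_nonneg_nonneg sum_nonneg) auto
  ultimately show ?thesis by blast
qed

lemma sup_nodal_bound:
  "\<exists>C\<ge>0. \<forall>p \<epsilon>. degree p \<le> k \<longrightarrow> (\<forall>j\<in>{1..Suc k}. \<bar>poly p (y j)\<bar> \<le> \<epsilon>) \<longrightarrow>
     (\<forall>x\<in>{-1..1}. \<bar>poly p x\<bar> \<le> C * \<epsilon>)"
proof -
  define c where "c i = (\<Sum>j\<in>{1..Suc k}. \<bar>coeff (lagr y {1..Suc k} j) i\<bar>)" for i
  have "\<bar>poly p x\<bar> \<le> (\<Sum>i\<le>k. c i) * \<epsilon>"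
    if p: "degree p \<le> k" and \<epsilon>: "\<forall>j\<in>{1..Suc k}. \<bar>poly p (y j)\<bar> \<le> \<epsilon>" and x: "x \<in> {-1..1}" for p \<epsilon> x
  proof -
    have "poly p x = (\<Sum>i\<le>k. coeff p i * x ^ i)" by (rule poly_as_sum) (use p in auto)
    also have "\<bar>\<dots>\<bar> \<le> (\<Sum>i\<le>k. \<bar>coeff p i * x ^ i\<bar>)" by (rule sum_abs)
    also have "\<dots> \<le> (\<Sum>i\<le>k. c i * \<epsilon>)"
    proof (intro sum_mono)
      fix i
      have "\<bar>coeff p i * x ^ i\<bar> \<le> \<bar>coeff p i\<bar> * 1"
        unfolding abs_mult power_abs using x by (intro mult_left_mono power_le_one) auto
      also have "\<bar>coeff p i\<bar> \<le> c i * \<epsilon>" unfolding c_def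
        using p \<epsilon> y_inj by (intro nodal_functional_bound) (auto intro: inj_on_subset)
      finally show "\<bar>coeff p i * x ^ i\<bar> \<le> c i * \<epsilon>" by simp
    qed
    finally show ?thesis by (simp add: sum_distrib_right)
  qed
  moreover have "0 \<le> (\<Sum>i\<le>k. c i)" unfolding c_def by (intro sum_nonneg) auto
  ultimately show ?thesis by blast
qed

end

section \<open>Characteristics and orthogonality to test functions\<close>

text \<open>The derivative of \<open>u\<close> in the direction \<open>(1, 1)\<close> is \<open>u\<^sub>t + u\<^sub>x = 0\<close>. At \<open>t = 0\<close>, where the
  equation is not available, continuity takes over.\<close>

lemma constant_along_characteristics:
  assumes ex: "exact_solution bc a b T u0 u"
    and r: "0 \<le> r" and x: "a \<le> x - r" "x \<le> b" and t: "0 \<le> t - r" "t \<le> T"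
  shows "u x t = u (x - r) (t - r)"
proof (cases "r = 0")
  case False
  then have r0: "0 < r" using r by simp
  define U where "U = (\<lambda>(x, t). u x t)"
  define \<gamma> where "\<gamma> \<sigma> = (x - \<sigma>, t - \<sigma>)" for \<sigma>
  have box: "\<gamma> \<sigma> \<in> {a..b} \<times> {0..T}" if "\<sigma> \<in> {0..r}" for \<sigma>
    using that x t by (auto simp: \<gamma>_def)
  have "continuous_on {0..r} (\<lambda>\<sigma>. U (\<gamma> \<sigma>))"
  proof (rule continuous_on_compose2[of "{a..b} \<times> {0..T}" U])
    show "continuous_on ({a..b} \<times> {0..T}) U"
      using ex unfolding exact_solution_def U_def by blast
    show "continuous_on {0..r} \<gamma>" unfolding \<gamma>_def by (intro continuous_intros)
    show "\<gamma> ` {0..r} \<subseteq> {a..b} \<times> {0..T}" using box by blast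
  qed
  moreover have "((\<lambda>\<sigma>. U (\<gamma> \<sigma>)) has_real_derivative 0) (at \<sigma>)" if s: "0 < \<sigma>" "\<sigma> < r" for \<sigma>
  proof -
    have "x - \<sigma> \<in> {a..b}" "t - \<sigma> \<in> {0<..T}" using s x t by auto
    then obtain ux ut where d: "(U has_derivative (\<lambda>(dx, dt). ux * dx + ut * dt))
           (at (\<gamma> \<sigma>) within {a..b} \<times> {0..T})" and eq: "ut + ux = 0"
      using ex unfolding exact_solution_def U_def \<gamma>_def by blast
    have "(\<gamma> has_derivative (\<lambda>h. (- h, - h))) (at \<sigma> within {0..r})"
      unfolding \<gamma>_def by (auto intro!: derivative_eq_intros)
    moreover have "\<gamma> ` {0..r} \<subseteq> {a..b} \<times> {0..T}" using box by blast
    ultimately have "((\<lambda>\<sigma>. U (\<gamma> \<sigma>)) has_derivative (\<lambda>h. (case (- h, - h) of (dx, dt) \<Rightarrow> ux * dx + ut * dt))) (at \<sigma> within {0..r})"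
      using has_derivative_in_compose has_derivative_subset[OF d] by blast
    then have "((\<lambda>\<sigma>. U (\<gamma> \<sigma>)) has_derivative (\<lambda>h. 0)) (at \<sigma> within {0..r})"
    proof (rule has_derivative_eq_rhs)
      show "(\<lambda>h. case (- h, - h) of (dx, dt) \<Rightarrow> ux * dx + ut * dt) = (\<lambda>h. 0)"
      proof
        fix h :: real
        have "ux * - h + ut * - h = - h * (ut + ux)" by (simp add: algebra_simps)
        then show "(case (- h, - h) of (dx, dt) \<Rightarrow> ux * dx + ut * dt) = 0" using eq by simp
      qed
    qed
    then have "((\<lambda>\<sigma>. U (\<gamma> \<sigma>)) has_derivative (\<lambda>h. 0)) (at \<sigma>)"
      using s by (simp add: at_within_Icc_at)
    then show ?thesis by (simp add: has_field_derivative_def lambda_zero)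
  qed
  ultimately have "U (\<gamma> r) = U (\<gamma> 0)"
    using r0 by (intro DERIV_isconst_end) auto
  then show ?thesis by (simp add: U_def \<gamma>_def)
qed simp

text \<open>A nonempty open set is not a null set.\<close>

lemma nonneg_if_AE_nonneg:
  fixes h :: "real \<Rightarrow> real"
  assumes ab: "a < b" and cont: "continuous_on {a..b} h" and ae: "AE x in lborel. x \<in> {a<..<b} \<longrightarrow> 0 \<le> h x"
    and x: "x \<in> {a..b}"
  shows "0 \<le> h x"
proof -
  define S where "S = {x\<in>{a<..<b}. h x < 0}"
  have "continuous_on {a<..<b} h" using cont by (rule continuous_on_subset) auto
  moreover have "S = {a<..<b} \<inter> h -` {..<0}" by (auto simp: S_def)
  ultimately have S: "open S" using continuous_open_preimage[of "{a<..<b}" h "{..<0}"] by simp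
  have "AE x in lborel. x \<notin> S" using ae by (auto simp: S_def)
  then have "S \<in> null_sets lborel" using S by (simp add: AE_iff_null_sets borel_open)
  then have "negligible S" by (simp add: negligible_iff_null_sets null_sets_completionI)
  then have "S = {}" using open_not_negligible[OF S] by blast
  then have "0 \<le> h x" if "x \<in> {a<..<b}" for x using that by (force simp: S_def)
  moreover have "closure {a<..<b} = {a..b}" using ab by simp
  ultimately show ?thesis
    using continuous_ge_on_closure[of "{a<..<b}" h x 0] cont x by simp
qed

text \<open>Continuous cut-offs with compact support in the open interval, converging to its indicator
  function. As combinations of them with zero mean are derivatives of test functions, they suffice
  to test weak derivatives.\<close>

definition ramp :: "real \<Rightarrow> real \<Rightarrow> nat \<Rightarrow> real \<Rightarrow> real" where
  "ramp x b n t = max 0 (min 1 (real n * min (t - x) (b - t) - 1))"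

lemma ramp_range: "0 \<le> ramp x b n t" "ramp x b n t \<le> 1"
  by (auto simp: ramp_def)

lemma ramp_cont: "continuous_on S (ramp x b n)"
  unfolding ramp_def by (intro continuous_intros)

lemma ramp_support:
  assumes "ramp x b n t \<noteq> 0"
  shows "0 < n" "x + 1 / real n \<le> t" "t \<le> b - 1 / real n"
proof -
  have *: "1 < real n * min (t - x) (b - t)" using assms by (auto simp: ramp_def max_def min_def split: if_splits)
  then show n: "0 < n" by (cases n) auto
  then have "0 < real n" by simp
  then have "1 / real n < min (t - x) (b - t)" using * by (simp only: pos_divide_less_eq mult.commute)
  then show "x + 1 / real n \<le> t" "t \<le> b - 1 / real n" by auto
qed

lemma ramp_inside:
  assumes "ramp x b n t \<noteq> 0"
  shows "t \<in> {x<..<b}"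
proof -
  have "0 < 1 / real n" using ramp_support(1)[OF assms] by simp
  then show ?thesis using ramp_support(2,3)[OF assms] unfolding greaterThanLessThan_iff by linarith
qed

lemma ramp_tendsto: "(\<lambda>n. ramp x b n t) \<longlonglongrightarrow> indicator {x<..<b} t"
proof (cases "t \<in> {x<..<b}")
  case True
  define m where "m = min (t - x) (b - t)"
  have m: "0 < m" using True by (auto simp: m_def)
  obtain N where N: "2 / m < real N" using reals_Archimedean2 by blast
  have "ramp x b n t = 1" if "N \<le> n" for n
  proof -
    have "2 / m < real n" using N that by linarith
    then have "2 < real n * m" using m by (simp add: pos_divide_less_eq)
    then show ?thesis by (simp add: ramp_def m_def[symmetric])
  qed
  then have "\<forall>\<^sub>F n in sequentially. ramp x b n t = 1" by (auto simp: eventually_sequentially)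
  then show ?thesis using True by (simp add: tendsto_eventually)
next
  case False
  have "ramp x b n t = 0" for n
  proof (rule ccontr)
    assume "ramp x b n t \<noteq> 0"
    from ramp_inside[OF this] show False using False by simp
  qed
  then show ?thesis using False by simp
qed

text \<open>In the limit the integral of \<open>e\<close> over every interval \<open>(x, b)\<close> vanishes, so the positive and
  the negative part of \<open>e\<close> are densities of the same measure.\<close>

lemma zero_if_orthogonal:
  fixes e :: "real \<Rightarrow> real"
  assumes int: "integrable lborel e" and bdd: "AE x in lborel. \<bar>e x\<bar> \<le> B"
    and supp: "\<And>x. x \<notin> {a<..<b} \<Longrightarrow> e x = 0"
    and orth: "\<And>x n. a \<le> x \<Longrightarrow> x < b \<Longrightarrow> (LINT t|lborel. e t * ramp x b n t) = 0"
  shows "AE x in lborel. e x = 0"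
proof -
  have [measurable]: "e \<in> borel_measurable borel" using int by auto
  have zero: "(LINT t|lborel. e t * indicator {x<..<b} t) = 0" if x: "a \<le> x" "x < b" for x
  proof -
    have "(\<lambda>n. LINT t|lborel. e t * ramp x b n t) \<longlonglongrightarrow> (LINT t|lborel. e t * indicator {x<..<b} t)"
    proof (rule integral_dominated_convergence[where w = "\<lambda>t. \<bar>e t\<bar>"])
      show "integrable lborel (\<lambda>t. \<bar>e t\<bar>)" using int by simp
      show "(\<lambda>t. e t * ramp x b n t) \<in> borel_measurable lborel" for n
      proof -
        have [measurable]: "ramp x b n \<in> borel_measurable borel"
          by (intro borel_measurable_continuous_onI ramp_cont)
        show ?thesis by simp
      qed
      show "AE t in lborel. (\<lambda>n. e t * ramp x b n t) \<longlonglongrightarrow> e t * indicator {x<..<b} t"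
        by (intro AE_I2 tendsto_mult tendsto_const ramp_tendsto)
      show "AE t in lborel. norm (e t * ramp x b n t) \<le> \<bar>e t\<bar>" for n
        using ramp_range[of x b n] by (intro AE_I2) (auto simp: abs_mult intro!: mult_left_le)
    qed auto
    moreover have "(\<lambda>n. LINT t|lborel. e t * ramp x b n t) = (\<lambda>n. 0)" using orth[OF x] by simp
    ultimately show ?thesis using LIMSEQ_unique tendsto_const by metis
  qed
  have zero': "(LINT t|lborel. e t * indicator {x<..} t) = 0" for x
  proof -
    have "(LINT t|lborel. e t * indicator {x<..} t) = (LINT t|lborel. e t * indicator {max a x<..<b} t)"
      using supp by (intro Bochner_Integration.integral_cong refl) (auto simp: indicator_def)
    also have "\<dots> = 0"
    proof (cases "max a x < b")
      case False
      then have "{max a x<..<b} = {}" by auto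
      then show ?thesis by simp
    qed (use zero in simp)
    finally show ?thesis .
  qed
  define p where "p t = max 0 (e t)" for t
  define m where "m t = max 0 (- e t)" for t
  have pm: "integrable lborel p" "integrable lborel m" "\<And>t. e t = p t - m t" "\<And>t. 0 \<le> p t" "\<And>t. 0 \<le> m t"
    unfolding p_def m_def using int by auto
  have [measurable]: "p \<in> borel_measurable borel" "m \<in> borel_measurable borel" unfolding p_def m_def by auto
  have eq: "(\<integral>\<^sup>+t\<in>{x<..}. ennreal (p t) \<partial>lborel) = (\<integral>\<^sup>+t\<in>{x<..}. ennreal (m t) \<partial>lborel)" for x
  proof -
    have i: "integrable lborel (\<lambda>t. p t * indicator {x<..} t)" "integrable lborel (\<lambda>t. m t * indicator {x<..} t)"
      using pm(1,2) integrable_real_mult_indicator[of "{x<..}" lborel] by auto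
    have "(LINT t|lborel. p t * indicator {x<..} t) - (LINT t|lborel. m t * indicator {x<..} t) = 0"
      using zero'[of x] unfolding pm(3) left_diff_distrib using i by simp
    moreover have "(\<integral>\<^sup>+t\<in>{x<..}. ennreal (q t) \<partial>lborel) = ennreal (LINT t|lborel. q t * indicator {x<..} t)"
      if "integrable lborel (\<lambda>t. q t * indicator {x<..} t)" "\<And>t. 0 \<le> q t" for q
    proof -
      have "(\<integral>\<^sup>+t\<in>{x<..}. ennreal (q t) \<partial>lborel) = (\<integral>\<^sup>+t. ennreal (q t * indicator {x<..} t) \<partial>lborel)"
        by (intro nn_integral_cong) (auto simp: indicator_def)
      then show ?thesis using that by (simp add: nn_integral_eq_integral)
    qed
    ultimately show ?thesis using i pm by simp
  qed
  have fin: "(\<integral>\<^sup>+t. ennreal (p t) \<partial>lborel) < \<infinity>"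
    using pm(1,4) by (simp add: nn_integral_eq_integral)
  have "density lborel p = density lborel m"
  proof (rule measure_eqI_lessThan)
    fix x
    have "emeasure (density lborel p) {x<..} = (\<integral>\<^sup>+t\<in>{x<..}. ennreal (p t) \<partial>lborel)"
      by (simp add: emeasure_density)
    moreover have "\<dots> \<le> (\<integral>\<^sup>+t. ennreal (p t) \<partial>lborel)"
      by (intro nn_integral_mono) (auto simp: indicator_def)
    ultimately show "emeasure (density lborel p) {x<..} < \<infinity>" using fin by (simp add: less_le_trans top.not_eq_extremum)
    show "emeasure (density lborel p) {x<..} = emeasure (density lborel m) {x<..}"
      using eq[of x] by (simp add: emeasure_density)
  qed auto
  then have "AE t in lborel. ennreal (p t) = ennreal (m t)"
    by (intro sigma_finite_measure.density_unique[OF lborel.sigma_finite_measure_axioms]) auto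
  then show ?thesis using pm by (auto simp: ennreal_inj)
qed

section \<open>Bounded weak derivatives\<close>

lemma lebesgue_eq_henstock:
  fixes \<psi> :: "real \<Rightarrow> real"
  assumes "continuous_on {c..d} \<psi>" and "\<And>x. x \<notin> {c..d} \<Longrightarrow> \<psi> x = 0"
  shows "integrable lborel \<psi>" and "(LINT x|lborel. \<psi> x) = integral {c..d} \<psi>"
proof -
  have eq: "(\<lambda>x. indicator {c..d} x *\<^sub>R \<psi> x) = \<psi>" using assms(2) by (auto simp: indicator_def fun_eq_iff)
  have i: "set_integrable lborel {c..d} \<psi>" by (rule borel_integrable_atLeastAtMost') fact
  then show "integrable lborel \<psi>" unfolding set_integrable_def eq .
  show "(LINT x|lborel. \<psi> x) = integral {c..d} \<psi>"
    using set_borel_integral_eq_integral(2)[OF i] unfolding set_lebesgue_integral_def eq .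
qed

text \<open>The primitive of a function with compact support has compact support precisely because of
  the vanishing mean.\<close>

lemma test_function_exists:
  fixes \<psi> :: "real \<Rightarrow> real"
  assumes cont: "continuous_on UNIV \<psi>" and cd: "a < c" "c \<le> d" "d < b"
    and supp: "\<And>x. x \<notin> {c..d} \<Longrightarrow> \<psi> x = 0" and zero: "(LINT x|lborel. \<psi> x) = 0"
  shows "\<exists>\<phi>. test_function a b \<phi> \<psi> \<and> (\<forall>x. x \<notin> {c..d} \<longrightarrow> \<phi> x = 0)"
proof -
  define g where "g x = integral {a..x} \<psi>" for x
  define \<phi> where "\<phi> x = (if x \<in> {a..b} then g x else 0)" for x
  have conts: "continuous_on S \<psi>" for S using cont by (rule continuous_on_subset) simp
  have deriv: "(g has_real_derivative \<psi> x) (at x within {a..b})" if "x \<in> {a..b}" for x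
    unfolding g_def using conts that by (rule integral_has_real_derivative)
  have out: "\<phi> x = 0" if "x \<notin> {c..d}" for x
  proof (cases "x \<in> {a..b}")
    case True
    show ?thesis
    proof (cases "x < c")
      case True
      have "integral {a..x} \<psi> = integral {a..x} (\<lambda>x. 0)"
        using True by (intro integral_cong supp) auto
      then show ?thesis by (simp add: \<phi>_def g_def)
    next
      case False
      have "(LINT x|lborel. \<psi> x) = integral {a..x} \<psi>"
        using False that cd by (intro lebesgue_eq_henstock conts supp) auto
      then show ?thesis using zero by (simp add: \<phi>_def g_def)
    qed
  qed (simp only: \<phi>_def if_False)
  have "(\<phi> has_real_derivative \<psi> x) (at x)" for x
  proof (cases "x \<in> {a<..<b}")
    case True
    then have "(g has_real_derivative \<psi> x) (at x)"
      using deriv[of x] by (simp add: at_within_Icc_at)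
    then show ?thesis
      by (rule has_field_derivative_transform_within_open[where S = "{a<..<b}"]) (use True in \<open>auto simp: \<phi>_def\<close>)
  next
    case False
    then have x: "x \<notin> {c..d}" using cd by auto
    have "((\<lambda>x. 0) has_real_derivative \<psi> x) (at x)" using supp[OF x] by simp
    then show ?thesis
      by (rule has_field_derivative_transform_within_open[where S = "- {c..d}"]) (use x out in auto)
  qed
  then have "test_function a b \<phi> \<psi>"
    unfolding test_function_def using cont cd out by blast
  then show ?thesis using out by blast
qed

text \<open>Fubini's theorem for \<open>g(s) \<psi>(x)\<close> on the half plane \<open>s < x\<close>.\<close>

lemma integral_by_parts_weak:
  fixes g \<phi> \<psi> :: "real \<Rightarrow> real"
  assumes g: "integrable lborel g" and cont: "continuous_on UNIV \<psi>"
    and supp: "\<And>x. x \<notin> {c..d} \<Longrightarrow> \<psi> x = 0" and d: "\<And>x. (\<phi> has_real_derivative \<psi> x) (at x)"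
    and \<phi>: "\<And>x. x \<notin> {c..d} \<Longrightarrow> \<phi> x = 0"
  shows "(LINT x|lborel. (LINT s|lborel. indicator {..<x} s * g s) * \<psi> x) = - (LINT s|lborel. g s * \<phi> s)"
proof -
  have [measurable]: "g \<in> borel_measurable borel" using g by auto
  have [measurable]: "\<psi> \<in> borel_measurable borel" using cont by (rule borel_measurable_continuous_onI)
  have \<psi>: "integrable lborel \<psi>"
    using cont supp by (intro lebesgue_eq_henstock[of c d]) (auto intro: continuous_on_subset)
  define F where "F = (\<lambda>(x, s). (if s < x then 1 else 0) * g s * \<psi> x)"
  have [measurable]: "F \<in> borel_measurable (lborel \<Otimes>\<^sub>M lborel)" unfolding F_def by measurable
  have prod: "integrable (lborel \<Otimes>\<^sub>M lborel) (\<lambda>(x, s). g s * \<psi> x)"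
  proof (rule lborel_pair.Fubini_integrable)
    show "integrable lborel (\<lambda>x. LINT s|lborel. norm (case (x, s) of (x, s) \<Rightarrow> g s * \<psi> x))"
      using g \<psi> by (simp add: abs_mult)
    show "AE x in lborel. integrable lborel (\<lambda>s. case (x, s) of (x, s) \<Rightarrow> g s * \<psi> x)"
      using g by simp
  qed measurable
  have int: "integrable (lborel \<Otimes>\<^sub>M lborel) F"
    by (rule Bochner_Integration.integrable_bound[OF prod]) (auto simp: F_def)
  have "(LINT x|lborel. (LINT s|lborel. indicator {..<x} s * g s) * \<psi> x) =
      (LINT x|lborel. LINT s|lborel. F (x, s))"
  proof (intro Bochner_Integration.integral_cong refl)
    fix x
    have "(LINT s|lborel. indicator {..<x} s * g s) * \<psi> x = (LINT s|lborel. (indicator {..<x} s * g s) * \<psi> x)"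
      by simp
    also have "\<dots> = (LINT s|lborel. F (x, s))"
      by (intro Bochner_Integration.integral_cong refl) (auto simp: F_def indicator_def)
    finally show "(LINT s|lborel. indicator {..<x} s * g s) * \<psi> x = (LINT s|lborel. F (x, s))" .
  qed
  also have "\<dots> = (LINT s|lborel. LINT x|lborel. F (x, s))"
    using lborel_pair.Fubini_integral[of "\<lambda>x s. F (x, s)"] int by simp
  also have "\<dots> = (LINT s|lborel. - (g s * \<phi> s))"
  proof (intro Bochner_Integration.integral_cong refl)
    fix s
    define e where "e = max s d + 1"
    have e: "s < e" "\<phi> e = 0" by (auto simp: e_def intro!: \<phi>)
    have "(LINT x|lborel. F (x, s)) = (LINT x|lborel. g s * (indicator {s..e} x *\<^sub>R \<psi> x))"
    proof (rule integral_cong_AE)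
      show "AE x in lborel. F (x, s) = g s * (indicator {s..e} x *\<^sub>R \<psi> x)"
        using AE_lborel_singleton[of s] by eventually_elim (auto simp: F_def indicator_def e_def intro!: supp)
    qed measurable
    also have "\<dots> = g s * (\<phi> e - \<phi> s)"
    proof -
      have "(LINT x|lborel. indicator {s..e} x *\<^sub>R \<psi> x) = \<phi> e - \<phi> s"
      proof (rule integral_FTC_atLeastAtMost)
        show "continuous_on {s..e} \<psi>" using cont by (rule continuous_on_subset) simp
        show "(\<phi> has_vector_derivative \<psi> x) (at x within {s..e})" for x
          using d[of x] by (auto simp: has_real_derivative_iff_has_vector_derivative
              intro: has_vector_derivative_at_within)
      qed (use e in simp)
      then show ?thesis by simp
    qed
    finally show "(LINT x|lborel. F (x, s)) = - (g s * \<phi> s)" using e by simp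
  qed
  finally show ?thesis by simp
qed

lemma primitive_lipschitz:
  fixes g :: "real \<Rightarrow> real"
  assumes g: "integrable lborel g" and K: "AE x in lborel. \<bar>g x\<bar> \<le> K"
  shows "\<bar>(LINT s|lborel. indicator {..<x} s * g s) - (LINT s|lborel. indicator {..<y} s * g s)\<bar> \<le> K * \<bar>x - y\<bar>"
proof -
  have main: "\<bar>(LINT s|lborel. indicator {..<x} s * g s) - (LINT s|lborel. indicator {..<y} s * g s)\<bar> \<le> K * (x - y)"
    if "y \<le> x" for x y
  proof -
    have i: "integrable lborel (\<lambda>s. indicator {..<z} s * g s)" for z
      using g integrable_real_mult_indicator[of "{..<z}" lborel g] by (simp add: mult.commute)
    have "(LINT s|lborel. indicator {..<x} s * g s) - (LINT s|lborel. indicator {..<y} s * g s) =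
        (LINT s|lborel. indicator {..<x} s * g s - indicator {..<y} s * g s)"
      using i by simp
    also have "\<bar>\<dots>\<bar> \<le> (LINT s|lborel. \<bar>indicator {..<x} s * g s - indicator {..<y} s * g s\<bar>)"
      by (rule integral_abs_bound)
    also have "\<dots> \<le> (LINT s|lborel. K * indicator {y..<x} s)"
    proof (rule integral_mono_AE)
      show "AE s in lborel. \<bar>indicator {..<x} s * g s - indicator {..<y} s * g s\<bar> \<le> K * indicator {y..<x} s"
        using K by eventually_elim (use that in \<open>auto simp: indicator_def\<close>)
      show "integrable lborel (\<lambda>s. K * indicator {y..<x} s)"
        using that by (intro integrable_mult_right integrable_real_indicator) auto
    qed (use i in auto)
    also have "\<dots> = K * (x - y)" using that by simp
    finally show ?thesis .
  qed
  show ?thesis using main[of x y] main[of y x] by (cases "y \<le> x") (auto simp: abs_minus_commute)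
qed

lemma ramp_integral_pos:
  assumes "a < b"
  shows "\<exists>n. 0 < (LINT t|lborel. ramp a b n t)"
proof -
  define m where "m = b - a"
  have m: "0 < m" using assms by (simp add: m_def)
  obtain n where n: "8 / m < real n" using reals_Archimedean2 by blast
  then have nm: "8 < real n * m" using m by (simp add: pos_divide_less_eq)
  have int: "integrable lborel (ramp a b n)"
  proof (rule lebesgue_eq_henstock(1)[of a b])
    show "ramp a b n x = 0" if "x \<notin> {a..b}" for x
      using that by (rule contrapos_np) (use ramp_inside[of a b n x] in auto)
  qed (rule ramp_cont)
  have "m / 2 = (LINT t|lborel. indicator {a + m / 4..b - m / 4} t)"
    using m by (simp add: m_def field_simps)
  also have "\<dots> \<le> (LINT t|lborel. ramp a b n t)"
  proof (rule integral_mono[OF _ int])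
    fix t
    show "indicator {a + m / 4..b - m / 4} t \<le> ramp a b n t"
    proof (cases "t \<in> {a + m / 4..b - m / 4}")
      case True
      then have "real n * (m / 4) \<le> real n * min (t - a) (b - t)" by (intro mult_left_mono) auto
      then have "ramp a b n t = 1" using nm unfolding ramp_def by linarith
      then show ?thesis by simp
    qed (simp add: ramp_range)
  qed (auto intro!: integrable_real_indicator simp: emeasure_lborel_Icc_eq)
  finally show ?thesis using m by (intro exI[of _ n]) simp
qed

text \<open>The lemma of du Bois-Reymond: \<open>f\<close> minus the primitive of \<open>g\<close> is orthogonal to the
  derivatives of test functions, hence to every continuous function with compact support and zero
  mean, and therefore constant. The last part of the conclusion allows one to climb to higher
  orders: if \<open>g\<close> in turn has a continuous representative \<open>H\<close>, the representative \<open>F\<close> of \<open>f\<close> is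
  continuously differentiable.\<close>

lemma weak_derivative_primitive:
  fixes f g :: "real \<Rightarrow> real"
  assumes ab: "a < b" and f: "set_borel_measurable lborel {a<..<b} f" and g: "set_borel_measurable lborel {a<..<b} g"
    and Kf: "AE x in lborel. x \<in> {a<..<b} \<longrightarrow> \<bar>f x\<bar> \<le> K" and Kg: "AE x in lborel. x \<in> {a<..<b} \<longrightarrow> \<bar>g x\<bar> \<le> K"
    and K: "0 \<le> K" and weak: "weak_derivative a b f g"
  shows "\<exists>F. (\<forall>x\<in>{a..b}. \<forall>y\<in>{a..b}. \<bar>F x - F y\<bar> \<le> K * \<bar>x - y\<bar>) \<and>
     (AE x in lborel. x \<in> {a<..<b} \<longrightarrow> f x = F x) \<and>
     (\<forall>H. continuous_on {a..b} H \<longrightarrow> (AE x in lborel. x \<in> {a<..<b} \<longrightarrow> g x = H x) \<longrightarrow>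
        (\<forall>x\<in>{a..b}. (F has_real_derivative H x) (at x within {a..b})))"
proof -
  define I where "I = (indicator {a<..<b} :: real \<Rightarrow> real)"
  define f1 where "f1 x = I x * f x" for x
  define g1 where "g1 x = I x * g x" for x
  have "f1 \<in> borel_measurable lborel" "g1 \<in> borel_measurable lborel"
    using f g unfolding set_borel_measurable_def f1_def[abs_def] g1_def[abs_def] I_def real_scaleR_def .
  then have mfg [measurable]: "f1 \<in> borel_measurable borel" "g1 \<in> borel_measurable borel" by simp_all
  have bf: "AE x in lborel. \<bar>f1 x\<bar> \<le> K" using Kf by eventually_elim (use K in \<open>auto simp: f1_def I_def indicator_def\<close>)
  have bg: "AE x in lborel. \<bar>g1 x\<bar> \<le> K" using Kg by eventually_elim (use K in \<open>auto simp: g1_def I_def indicator_def\<close>)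
  have integrableI: "integrable lborel h" if [measurable]: "h \<in> borel_measurable borel"
    and b: "AE x in lborel. \<bar>h x\<bar> \<le> B" and s: "\<And>x. x \<notin> {a<..<b} \<Longrightarrow> h x = 0" for h :: "real \<Rightarrow> real" and B
  proof (rule Bochner_Integration.integrable_bound)
    show "integrable lborel (\<lambda>x. B * I x)" using ab unfolding I_def by simp
    show "AE x in lborel. norm (h x) \<le> norm (B * I x)"
      using b by eventually_elim (use s in \<open>auto simp: I_def indicator_def\<close>)
  qed measurable
  have f1: "integrable lborel f1" by (rule integrableI[OF mfg(1) bf]) (auto simp: f1_def I_def)
  have g1: "integrable lborel g1" by (rule integrableI[OF mfg(2) bg]) (auto simp: g1_def I_def)
  define G where "G x = (LINT s|lborel. indicator {..<x} s * g1 s)" for x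
  have Glip: "\<bar>G x - G y\<bar> \<le> K * \<bar>x - y\<bar>" for x y
    unfolding G_def by (rule primitive_lipschitz[OF g1 bg])
  have Gcont: "continuous_on S G" for S
  proof (rule lipschitz_on_continuous_on[of K])
    show "K-lipschitz_on S G" using Glip K by (intro lipschitz_onI) (auto simp: dist_real_def)
  qed
  then have [measurable]: "G \<in> borel_measurable borel" by (intro borel_measurable_continuous_onI)
  have Ga: "G a = 0"
  proof -
    have "G a = (LINT s|(lborel :: real measure). 0)" unfolding G_def g1_def I_def
      by (intro Bochner_Integration.integral_cong refl) (auto simp: indicator_def)
    then show ?thesis by simp
  qed
  define E where "E x = f1 x - I x * G x" for x
  have Gb: "\<bar>G x\<bar> \<le> K * (b - a)" if "x \<in> {a<..<b}" for x
  proof -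
    have "\<bar>G x\<bar> \<le> K * \<bar>x - a\<bar>" using Glip[of x a] Ga by simp
    also have "\<dots> \<le> K * (b - a)" using that K by (intro mult_left_mono) auto
    finally show ?thesis .
  qed
  have bE: "AE x in lborel. \<bar>E x\<bar> \<le> K + K * (b - a)"
    using bf
  proof eventually_elim
    case (elim x)
    show ?case
    proof (cases "x \<in> {a<..<b}")
      case True
      then show ?thesis using elim Gb[OF True] by (auto simp: E_def I_def)
    next
      case False
      then show ?thesis using elim K ab by (simp add: E_def I_def f1_def)
    qed
  qed
  have mE [measurable]: "E \<in> borel_measurable borel" unfolding E_def[abs_def] I_def by measurable
  have E: "integrable lborel E" by (rule integrableI[OF mE bE]) (auto simp: E_def f1_def I_def)
  have orth: "(LINT x|lborel. E x * \<psi> x) = 0"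
    if cont: "continuous_on UNIV \<psi>" and cd: "a < c" "c \<le> d" "d < b"
    and supp: "\<And>x. x \<notin> {c..d} \<Longrightarrow> \<psi> x = 0" and zero: "(LINT x|lborel. \<psi> x) = 0" for \<psi> c d
  proof -
    obtain \<phi> where \<phi>: "test_function a b \<phi> \<psi>" "\<And>x. x \<notin> {c..d} \<Longrightarrow> \<phi> x = 0"
      using test_function_exists[OF cont cd supp zero] by blast
    obtain B where B: "\<And>x. \<bar>\<psi> x\<bar> \<le> B"
    proof -
      have "compact (\<psi> ` {c..d})" using cont by (intro compact_continuous_image) (auto intro: continuous_on_subset)
      then obtain B where "\<forall>z\<in>\<psi> ` {c..d}. norm z \<le> B" using compact_imp_bounded bounded_iff by metis
      then have "\<bar>\<psi> x\<bar> \<le> max 0 B" for x using supp[of x] by (cases "x \<in> {c..d}") (auto simp: max_def)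
      then show ?thesis using that by blast
    qed
    have [measurable]: "\<psi> \<in> borel_measurable borel" using cont by (rule borel_measurable_continuous_onI)
    have "(LINT x:{a<..<b}|lborel. f x * \<psi> x) = - (LINT x:{a<..<b}|lborel. g x * \<phi> x)"
      using weak \<phi>(1) unfolding weak_derivative_def by blast
    then have 1: "(LINT x|lborel. f1 x * \<psi> x) = - (LINT x|lborel. g1 x * \<phi> x)"
      unfolding set_lebesgue_integral_def f1_def g1_def I_def by (simp add: mult.assoc)
    have 2: "(LINT x|lborel. G x * \<psi> x) = - (LINT x|lborel. g1 x * \<phi> x)"
      unfolding G_def using \<phi> unfolding test_function_def
      by (intro integral_by_parts_weak[OF g1 cont supp]) auto
    have 3: "(LINT x|lborel. G x * \<psi> x) = (LINT x|lborel. I x * G x * \<psi> x)"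
    proof (intro Bochner_Integration.integral_cong refl)
      show "G x * \<psi> x = I x * G x * \<psi> x" for x
        using supp[of x] cd by (cases "x \<in> {c..d}") (auto simp: I_def)
    qed
    have i1: "integrable lborel (\<lambda>x. f1 x * \<psi> x)"
    proof (rule integrableI)
      show "(\<lambda>x. f1 x * \<psi> x) \<in> borel_measurable borel" by measurable
      show "AE x in lborel. \<bar>f1 x * \<psi> x\<bar> \<le> K * B"
        using bf by eventually_elim (use B K in \<open>auto simp: abs_mult intro!: mult_mono\<close>)
    qed (auto simp: f1_def I_def)
    have i2: "integrable lborel (\<lambda>x. I x * G x * \<psi> x)"
    proof (rule integrableI)
      show "(\<lambda>x. I x * G x * \<psi> x) \<in> borel_measurable borel" unfolding I_def by measurable
      have "\<bar>I x * G x * \<psi> x\<bar> \<le> K * (b - a) * B" for x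
      proof (cases "x \<in> {a<..<b}")
        case True
        then show ?thesis using Gb B K ab by (auto simp: I_def abs_mult intro!: mult_mono)
      next
        case False
        have "0 \<le> B" using B[of 0] by linarith
        then show ?thesis using False K ab by (simp add: I_def)
      qed
      then show "AE x in lborel. \<bar>I x * G x * \<psi> x\<bar> \<le> K * (b - a) * B" by simp
    qed (auto simp: I_def)
    have "(LINT x|lborel. E x * \<psi> x) = (LINT x|lborel. f1 x * \<psi> x - I x * G x * \<psi> x)"
      by (simp add: E_def left_diff_distrib)
    also have "\<dots> = 0" using i1 i2 1 2 3 by simp
    finally show ?thesis .
  qed
  obtain m where m: "0 < (LINT t|lborel. ramp a b m t)" using ramp_integral_pos[OF ab] by blast
  have ramp_int: "integrable lborel (ramp x b n)" if "a \<le> x" "x < b" for x n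
  proof (rule lebesgue_eq_henstock(1)[of x b])
    show "ramp x b n t = 0" if "t \<notin> {x..b}" for t
    proof (rule ccontr)
      assume "ramp x b n t \<noteq> 0"
      from ramp_inside[OF this] show False using that by auto
    qed
  qed (rule ramp_cont)
  have E_ramp: "integrable lborel (\<lambda>t. E t * ramp x b n t)" for x n
  proof (rule Bochner_Integration.integrable_bound[OF E])
    have [measurable]: "ramp x b n \<in> borel_measurable borel" by (intro borel_measurable_continuous_onI ramp_cont)
    show "(\<lambda>t. E t * ramp x b n t) \<in> borel_measurable lborel" by simp
    show "AE t in lborel. norm (E t * ramp x b n t) \<le> norm (E t)"
      using ramp_range[of x b n] by (intro AE_I2) (auto simp: abs_mult intro!: mult_left_le)
  qed
  \<comment> \<open>The constant is found by testing with one ramp of positive mean.\<close>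
  define \<kappa> where "\<kappa> = (LINT t|lborel. E t * ramp a b m t) / (LINT t|lborel. ramp a b m t)"
  have ramp_orth: "(LINT t|lborel. E t * ramp x b n t) = \<kappa> * (LINT t|lborel. ramp x b n t)" if x: "a \<le> x" "x < b" for x n
  proof -
    define q where "q = (LINT t|lborel. ramp x b n t) / (LINT t|lborel. ramp a b m t)"
    define \<psi> where "\<psi> t = ramp x b n t - q * ramp a b m t" for t
    \<comment> \<open>A common compact support of the two ramps.\<close>
    define \<delta> where "\<delta> = min ((b - a) / 2) (min (1 / real (Suc n)) (1 / real (Suc m)))"
    have \<delta>: "0 < \<delta>" using ab by (simp add: \<delta>_def)
    have "(LINT t|lborel. \<psi> t) = 0"
      unfolding \<psi>_def using m ramp_int[OF x, of n] ramp_int[of a m] ab by (simp add: q_def)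
    moreover have "\<psi> t = 0" if "t \<notin> {a + \<delta>..b - \<delta>}" for t
    proof -
      have "ramp z b l t = 0" if "a \<le> z" "\<delta> \<le> 1 / real l" "t \<notin> {a + \<delta>..b - \<delta>}" for z l
        using ramp_support[of z b l t] that by fastforce
      moreover have "ramp z b 0 t = 0" for z by (simp add: ramp_def)
      moreover have "\<delta> \<le> 1 / real n" if "n \<noteq> 0"
      proof -
        have "1 / real (Suc n) \<le> 1 / real n" using that by (intro divide_left_mono) auto
        then show ?thesis by (simp add: \<delta>_def)
      qed
      moreover have "\<delta> \<le> 1 / real m" if "m \<noteq> 0"
      proof -
        have "1 / real (Suc m) \<le> 1 / real m" using that by (intro divide_left_mono) auto
        then show ?thesis by (simp add: \<delta>_def)
      qed
      ultimately show ?thesis using that x by (cases "n = 0"; cases "m = 0") (simp_all add: \<psi>_def)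
    qed
    moreover have "continuous_on UNIV \<psi>" unfolding \<psi>_def by (intro continuous_intros ramp_cont)
    moreover have "a + \<delta> \<le> b - \<delta>"
    proof -
      have "\<delta> \<le> (b - a) / 2" unfolding \<delta>_def by (rule min.cobounded1)
      then show ?thesis by simp
    qed
    ultimately have "(LINT t|lborel. E t * \<psi> t) = 0" using \<delta> by (intro orth[of \<psi> "a + \<delta>" "b - \<delta>"]) auto
    moreover have "(LINT t|lborel. E t * \<psi> t) = (LINT t|lborel. E t * ramp x b n t) - q * (LINT t|lborel. E t * ramp a b m t)"
    proof -
      have "(LINT t|lborel. E t * \<psi> t) = (LINT t|lborel. E t * ramp x b n t - q * (E t * ramp a b m t))"
        by (intro Bochner_Integration.integral_cong refl) (simp add: \<psi>_def algebra_simps)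
      also have "\<dots> = (LINT t|lborel. E t * ramp x b n t) - (LINT t|lborel. q * (E t * ramp a b m t))"
        using E_ramp by (intro Bochner_Integration.integral_diff) auto
      finally show ?thesis by simp
    qed
    ultimately show ?thesis by (simp add: q_def \<kappa>_def)
  qed
  have I: "integrable lborel (\<lambda>x. \<kappa> * I x)" using ab unfolding I_def by simp
  have "AE x in lborel. E x - \<kappa> * I x = 0"
  proof (rule zero_if_orthogonal)
    show "integrable lborel (\<lambda>x. E x - \<kappa> * I x)" using E I by simp
    show "AE x in lborel. \<bar>E x - \<kappa> * I x\<bar> \<le> (K + K * (b - a)) + \<bar>\<kappa>\<bar>"
      using bE
    proof eventually_elim
      case (elim x)
      have "\<bar>E x - \<kappa> * I x\<bar> \<le> \<bar>E x\<bar> + \<bar>\<kappa> * I x\<bar>" by (rule abs_triangle_ineq4)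
      also have "\<bar>\<kappa> * I x\<bar> \<le> \<bar>\<kappa>\<bar>" by (auto simp: I_def indicator_def)
      finally show ?case using elim by linarith
    qed
    show "E x - \<kappa> * I x = 0" if "x \<notin> {a<..<b}" for x
      using that by (simp add: E_def f1_def I_def)
    fix x n assume x: "a \<le> x" "x < b"
    have I_ramp: "I t * ramp x b n t = ramp x b n t" for t
    proof (cases "ramp x b n t = 0")
      case False
      from ramp_inside[OF this] have "t \<in> {a<..<b}" using x by auto
      then show ?thesis by (simp add: I_def)
    qed simp
    have "(LINT t|lborel. (E t - \<kappa> * I t) * ramp x b n t) = (LINT t|lborel. E t * ramp x b n t - \<kappa> * ramp x b n t)"
      by (intro Bochner_Integration.integral_cong refl) (simp add: left_diff_distrib mult.assoc I_ramp)
    also have "\<dots> = (LINT t|lborel. E t * ramp x b n t) - (LINT t|lborel. \<kappa> * ramp x b n t)"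
      using E_ramp ramp_int[OF x] by (intro Bochner_Integration.integral_diff) auto
    also have "\<dots> = 0" using ramp_orth[OF x] by simp
    finally show "(LINT t|lborel. (E t - \<kappa> * I t) * ramp x b n t) = 0" .
  qed
  then have ae: "AE x in lborel. x \<in> {a<..<b} \<longrightarrow> f x = G x + \<kappa>"
    by eventually_elim (auto simp: E_def f1_def I_def)
  have "(G has_real_derivative H x) (at x within {a..b})"
    if H: "continuous_on {a..b} H" and eq: "AE x in lborel. x \<in> {a<..<b} \<longrightarrow> g x = H x" and x: "x \<in> {a..b}" for H x
  proof -
    have "G z = integral {a..z} H" if z: "z \<in> {a..b}" for z
    proof -
      have c: "continuous_on {a..z} H" using H by (rule continuous_on_subset) (use z in auto)
      have i: "set_integrable lborel {a..z} H" by (rule borel_integrable_atLeastAtMost') fact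
      have "G z = (LINT s:{a..z}|lborel. H s)"
        unfolding G_def set_lebesgue_integral_def
      proof (rule integral_cong_AE)
        show "AE s in lborel. indicator {..<z} s * g1 s = indicator {a..z} s *\<^sub>R H s"
          using eq AE_lborel_singleton[of a] AE_lborel_singleton[of z]
          by eventually_elim (use z in \<open>auto simp: g1_def I_def indicator_def\<close>)
        show "(\<lambda>s. indicator {a..z} s *\<^sub>R H s) \<in> borel_measurable lborel"
          using i unfolding set_integrable_def by auto
      qed measurable
      then show ?thesis using set_borel_integral_eq_integral(2)[OF i] by simp
    qed
    moreover have "((\<lambda>z. integral {a..z} H) has_real_derivative H x) (at x within {a..b})"
      using H x by (rule integral_has_real_derivative)
    ultimately show ?thesis
      using x by (auto intro: has_field_derivative_transform_within[where d = 1])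
  qed
  then have deriv: "((\<lambda>x. G x + \<kappa>) has_real_derivative H x) (at x within {a..b})"
    if "continuous_on {a..b} H" "AE x in lborel. x \<in> {a<..<b} \<longrightarrow> g x = H x" "x \<in> {a..b}" for H x
    using that by (auto intro!: derivative_eq_intros)
  show ?thesis
    using Glip ae deriv by (intro exI[of _ "\<lambda>x. G x + \<kappa>"]) auto
qed

section \<open>The exact solution as a travelling profile\<close>

text \<open>Each weak derivative of order at most \<open>n\<close> has a Lipschitz representative, and the continuity
  of the one of order \<open>j + 1\<close> makes the one of order \<open>j\<close> differentiable.\<close>

lemma sobolev_classical:
  fixes f :: "real \<Rightarrow> real"
  assumes ab: "a < b" and cont: "continuous_on {a..b} f"
    and norm: "sobolev_inf_norm (Suc n) a b f < ennreal K"
  shows "\<exists>F. (\<forall>x\<in>{a..b}. F 0 x = f x) \<and>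
     (\<forall>j<n. \<forall>x\<in>{a..b}. (F j has_real_derivative F (Suc j) x) (at x within {a..b})) \<and>
     (\<forall>j\<le>n. \<forall>x\<in>{a..b}. \<bar>F j x\<bar> \<le> K) \<and>
     (\<forall>j\<le>n. \<forall>x\<in>{a..b}. \<forall>y\<in>{a..b}. \<bar>F j x - F j y\<bar> \<le> K * \<bar>x - y\<bar>)"
proof -
  obtain L g where L: "0 \<le> L" "ennreal L < ennreal K" and g0: "g 0 = f"
    and g: "\<And>j. j \<le> Suc n \<Longrightarrow> set_borel_measurable lborel {a<..<b} (g j)"
      "\<And>j. j \<le> Suc n \<Longrightarrow> AE x in lborel. x \<in> {a<..<b} \<longrightarrow> \<bar>g j x\<bar> \<le> L"
    and weak: "\<And>j. j < Suc n \<Longrightarrow> weak_derivative a b (g j) (g (Suc j))"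
    using norm unfolding sobolev_inf_norm_def Inf_less_iff by blast
  have K: "0 \<le> K" "L \<le> K" using L by (auto simp: ennreal_less_iff)
  have gK: "AE x in lborel. x \<in> {a<..<b} \<longrightarrow> \<bar>g j x\<bar> \<le> K" if "j \<le> Suc n" for j
    using g(2)[OF that] by eventually_elim (use K in auto)
  define P where "P j F \<longleftrightarrow> (\<forall>x\<in>{a..b}. \<forall>y\<in>{a..b}. \<bar>F x - F y\<bar> \<le> K * \<bar>x - y\<bar>) \<and>
     (AE x in lborel. x \<in> {a<..<b} \<longrightarrow> g j x = F x) \<and>
     (\<forall>H. continuous_on {a..b} H \<longrightarrow> (AE x in lborel. x \<in> {a<..<b} \<longrightarrow> g (Suc j) x = H x) \<longrightarrow>
        (\<forall>x\<in>{a..b}. (F has_real_derivative H x) (at x within {a..b})))" for j and F :: "real \<Rightarrow> real"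
  have "\<exists>F. P j F" if "j < Suc n" for j
    unfolding P_def using that by (intro weak_derivative_primitive[OF ab _ _ _ _ K(1) weak] g gK) auto
  then obtain F where PF: "\<And>j. j \<le> n \<Longrightarrow> P j (F j)" unfolding less_Suc_eq_le by metis
  have F: "\<And>j x y. j \<le> n \<Longrightarrow> x \<in> {a..b} \<Longrightarrow> y \<in> {a..b} \<Longrightarrow> \<bar>F j x - F j y\<bar> \<le> K * \<bar>x - y\<bar>"
    "\<And>j. j \<le> n \<Longrightarrow> AE x in lborel. x \<in> {a<..<b} \<longrightarrow> g j x = F j x"
    "\<And>j H x. j \<le> n \<Longrightarrow> continuous_on {a..b} H \<Longrightarrow> (AE x in lborel. x \<in> {a<..<b} \<longrightarrow> g (Suc j) x = H x) \<Longrightarrow>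
        x \<in> {a..b} \<Longrightarrow> (F j has_real_derivative H x) (at x within {a..b})"
    using PF unfolding P_def by blast+
  have Fc: "continuous_on {a..b} (F j)" if "j \<le> n" for j
  proof (rule lipschitz_on_continuous_on[of K])
    show "K-lipschitz_on {a..b} (F j)" using F(1)[OF that] K by (intro lipschitz_onI) (auto simp: dist_real_def)
  qed
  have "F 0 x = f x" if x: "x \<in> {a..b}" for x
  proof -
    have ae: "AE x in lborel. x \<in> {a<..<b} \<longrightarrow> f x = F 0 x" using F(2)[of 0] g0 by simp
    have "0 \<le> F 0 x - f x"
      using ae by (intro nonneg_if_AE_nonneg[OF ab _ _ x] continuous_on_diff Fc cont) auto
    moreover have "0 \<le> f x - F 0 x"
      using ae by (intro nonneg_if_AE_nonneg[OF ab _ _ x] continuous_on_diff Fc cont) auto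
    ultimately show ?thesis by simp
  qed
  moreover have "(F j has_real_derivative F (Suc j) x) (at x within {a..b})" if "j < n" "x \<in> {a..b}" for j x
    using that by (intro F(3) Fc F(2)) auto
  moreover have "\<bar>F j x\<bar> \<le> K" if j: "j \<le> n" and x: "x \<in> {a..b}" for j x
  proof -
    have j': "j \<le> Suc n" using j by simp
    have ae: "AE x in lborel. x \<in> {a<..<b} \<longrightarrow> \<bar>F j x\<bar> \<le> K"
      using F(2)[OF j] gK[OF j'] by eventually_elim auto
    have "AE x in lborel. x \<in> {a<..<b} \<longrightarrow> 0 \<le> K - F j x" using ae by eventually_elim auto
    then have "0 \<le> K - F j x"
      by (intro nonneg_if_AE_nonneg[OF ab _ _ x] continuous_intros Fc j)
    moreover have "AE x in lborel. x \<in> {a<..<b} \<longrightarrow> 0 \<le> K + F j x" using ae by eventually_elim auto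
    then have "0 \<le> K + F j x"
      by (intro nonneg_if_AE_nonneg[OF ab _ _ x] continuous_intros Fc j)
    ultimately show ?thesis by linarith
  qed
  ultimately show ?thesis using F(1) by blast
qed

lemma lipschitz_from_local:
  fixes f :: "real \<Rightarrow> real"
  assumes d: "0 < d" and loc: "\<And>x y. x \<in> {c..e} \<Longrightarrow> y \<in> {c..e} \<Longrightarrow> \<bar>x - y\<bar> \<le> d \<Longrightarrow> \<bar>f x - f y\<bar> \<le> K * \<bar>x - y\<bar>"
    and x: "x \<in> {c..e}" and y: "y \<in> {c..e}"
  shows "\<bar>f x - f y\<bar> \<le> K * \<bar>x - y\<bar>"
proof -
  have chain: "\<bar>f x - f y\<bar> \<le> K * (y - x)"
    if "x \<in> {c..e}" "y \<in> {c..e}" "x \<le> y" "y - x \<le> real m * d" for x y m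
    using that
  proof (induction m arbitrary: y)
    case 0
    then show ?case by simp
  next
    case (Suc m)
    show ?case
    proof (cases "y - x \<le> real m * d")
      case True
      then show ?thesis using Suc.IH Suc.prems by blast
    next
      case False
      define z where "z = max x (y - d)"
      have z: "z \<in> {c..e}" "x \<le> z" "z \<le> y" "z - x \<le> real m * d" "y - z \<le> d"
        using Suc.prems d False by (auto simp: z_def algebra_simps max_def)
      have "\<bar>f x - f z\<bar> \<le> K * (z - x)" using Suc.IH[of z] Suc.prems z by simp
      moreover have "\<bar>f z - f y\<bar> \<le> K * (y - z)" using loc[of z y] Suc.prems z by simp
      ultimately show ?thesis by (simp add: algebra_simps)
    qed
  qed
  have main: "\<bar>f x - f y\<bar> \<le> K * (y - x)" if xy: "x \<in> {c..e}" "y \<in> {c..e}" "x \<le> y" for x y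
  proof -
    obtain m where "(y - x) / d < real m" using reals_Archimedean2 by blast
    then have "y - x \<le> real m * d" using d by (simp add: pos_divide_less_eq)
    then show ?thesis using chain xy by blast
  qed
  show ?thesis using main[of x y] main[of y x] x y by (cases "x \<le> y") (auto simp: abs_minus_commute)
qed

lemma real_derivative_unique:
  assumes "(f has_real_derivative D) (at x within {c..d})" "(f has_real_derivative E) (at x within {c..d})"
    and "c < d" "x \<in> {c..d}"
  shows "D = E"
  using vector_derivative_unique_within_closed_interval[of c d x f D E] assms
  by (simp add: has_real_derivative_iff_has_vector_derivative)

text \<open>The profile \<open>w 0\<close> of the travelling wave \<open>u x t = w 0 (x - t)\<close> with its derivatives \<open>w j\<close>.
  The arguments \<open>x - t\<close> fill \<open>{a - T..b}\<close>. In the part left of \<open>a\<close> the boundary condition determines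
  the profile; it is required of every derivative, because the interpolants of all of them serve as
  grid functions with that boundary condition.\<close>

definition smooth_profile ::
    "boundary \<Rightarrow> real \<Rightarrow> real \<Rightarrow> real \<Rightarrow> real \<Rightarrow> nat \<Rightarrow> (nat \<Rightarrow> real \<Rightarrow> real) \<Rightarrow> bool" where
  "smooth_profile bc a b T K n w \<longleftrightarrow>
     (\<forall>j<n. \<forall>x\<in>{a - T..b}. (w j has_real_derivative w (Suc j) x) (at x within {a - T..b})) \<and>
     (\<forall>j\<le>n. \<forall>x\<in>{a - T..b}. \<forall>y\<in>{a - T..b}. \<bar>w j x - w j y\<bar> \<le> K * \<bar>x - y\<bar>) \<and>
     (\<forall>j\<le>n. \<forall>x\<in>{a - T..a}. w j x = (case bc of Zero_Inflow \<Rightarrow> 0 | Periodic \<Rightarrow> w j (x + (b - a))))"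

text \<open>At a fixed time \<open>t\<close> the profile is visible through the window \<open>{a - t..b - t}\<close> and inherits
  the regularity of \<open>u\<close> at time \<open>t\<close>. Windows at nearby times overlap in intervals, on which all
  derivatives agree, so the pieces fit together; Lipschitz bounds on windows of a fixed size give
  one on the whole interval. The boundary condition for the derivatives follows by differentiating
  the one for \<open>w 0\<close>.\<close>

lemma smooth_profile_exists:
  assumes ab: "a < b" and T: "0 < T" and ex: "exact_solution bc a b T u0 u"
    and norm: "solution_norm (Suc n) a b T u < ennreal K"
  shows "\<exists>w. smooth_profile bc a b T K n w \<and> (\<forall>x\<in>{a..b}. \<forall>t\<in>{0..T}. u x t = w 0 (x - t))"
proof -
  have "0 < ennreal K" using norm by (rule le_less_trans[OF zero_le])
  then have K: "0 \<le> K" by simp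
  have cont: "continuous_on {a..b} (\<lambda>x. u x t)" if "t \<in> {0..T}" for t
  proof -
    have "continuous_on ({a..b} \<times> {0..T}) (\<lambda>(x, t). u x t)" using ex by (simp add: exact_solution_def)
    then have "continuous_on {a..b} (\<lambda>x. (\<lambda>(x, t). u x t) (x, t))"
      by (rule continuous_on_compose2) (use that in \<open>auto intro!: continuous_intros\<close>)
    then show ?thesis by simp
  qed
  define P where "P t F \<longleftrightarrow> (\<forall>x\<in>{a..b}. F 0 x = u x t) \<and>
     (\<forall>j<n. \<forall>x\<in>{a..b}. (F j has_real_derivative F (Suc j) x) (at x within {a..b})) \<and>
     (\<forall>j\<le>n. \<forall>x\<in>{a..b}. \<bar>F j x\<bar> \<le> K) \<and>
     (\<forall>j\<le>n. \<forall>x\<in>{a..b}. \<forall>y\<in>{a..b}. \<bar>F j x - F j y\<bar> \<le> K * \<bar>x - y\<bar>)" for t and F :: "nat \<Rightarrow> real \<Rightarrow> real"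
  have "\<exists>F. P t F" if t: "t \<in> {0..T}" for t
    unfolding P_def
  proof (rule sobolev_classical[OF ab cont[OF t]])
    have "sobolev_inf_norm (Suc n) a b (\<lambda>x. u x t) \<le> solution_norm (Suc n) a b T u"
      unfolding solution_norm_def using t by (rule SUP_upper)
    then show "sobolev_inf_norm (Suc n) a b (\<lambda>x. u x t) < ennreal K" using norm by (rule order.strict_trans1)
  qed
  then obtain F where F: "\<And>t. t \<in> {0..T} \<Longrightarrow> P t (F t)" by metis
  have F0: "\<And>t x. t \<in> {0..T} \<Longrightarrow> x \<in> {a..b} \<Longrightarrow> F t 0 x = u x t"
    and Fd: "\<And>t j x. t \<in> {0..T} \<Longrightarrow> j < n \<Longrightarrow> x \<in> {a..b} \<Longrightarrow>
        (F t j has_real_derivative F t (Suc j) x) (at x within {a..b})"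
    and Fl: "\<And>t j x y. t \<in> {0..T} \<Longrightarrow> j \<le> n \<Longrightarrow> x \<in> {a..b} \<Longrightarrow> y \<in> {a..b} \<Longrightarrow> \<bar>F t j x - F t j y\<bar> \<le> K * \<bar>x - y\<bar>"
    using F unfolding P_def by blast+
  define W where "W z = (if a \<le> z then u z 0 else u a (a - z))" for z
  have uW: "u x t = W (x - t)" if "x \<in> {a..b}" "t \<in> {0..T}" for x t
  proof (cases "a \<le> x - t")
    case True
    then show ?thesis using constant_along_characteristics[OF ex, of t x t] that by (simp add: W_def)
  next
    case False
    then show ?thesis using constant_along_characteristics[OF ex, of "x - a" x t] that
      by (simp add: W_def algebra_simps)
  qed
  have Fshift: "((\<lambda>z. F t j (z + t)) has_real_derivative F t (Suc j) (x + t)) (at x within {c..d})"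
    if "t \<in> {0..T}" "j < n" "{c..d} \<subseteq> {a - t..b - t}" "x \<in> {c..d}" for t j x c d
  proof -
    have "x + t \<in> {a..b}" using that by auto
    then have "(F t j has_real_derivative F t (Suc j) (x + t)) (at (x + t) within (\<lambda>z. z + t) ` {c..d})"
      using that by (intro DERIV_subset[OF Fd]) auto
    moreover have "((\<lambda>z. z + t) has_real_derivative 1) (at x within {c..d})" by (auto intro!: derivative_eq_intros)
    ultimately show ?thesis using DERIV_image_chain[of "F t j" _ "\<lambda>z. z + t" x "{c..d}" 1] by (simp add: o_def)
  qed
  \<comment> \<open>All derivatives of the profile agree on overlapping windows. The bound on \<open>t - t'\<close> makes the
    overlap a nondegenerate interval, on which derivatives are unique.\<close>
  have indep: "F t j (x + t) = F t' j (x + t')"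
    if "t \<in> {0..T}" "t' \<in> {0..T}" "\<bar>t - t'\<bar> < b - a" "x + t \<in> {a..b}" "x + t' \<in> {a..b}" "j \<le> n" for t t' j x
    using that
  proof (induction j arbitrary: x)
    case 0
    then show ?case using F0 uW by simp
  next
    case (Suc j)
    define c d where "c = max (a - t) (a - t')" and "d = min (b - t) (b - t')"
    have cd: "c < d" "x \<in> {c..d}" "{c..d} \<subseteq> {a - t..b - t}" "{c..d} \<subseteq> {a - t'..b - t'}"
      using Suc.prems ab by (auto simp: c_def d_def)
    have "((\<lambda>z. F t j (z + t)) has_real_derivative F t (Suc j) (x + t)) (at x within {c..d})"
      using Suc.prems cd by (intro Fshift) auto
    moreover have "((\<lambda>z. F t j (z + t)) has_real_derivative F t' (Suc j) (x + t')) (at x within {c..d})"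
    proof (rule has_field_derivative_transform_within[where d = 1])
      show "((\<lambda>z. F t' j (z + t')) has_real_derivative F t' (Suc j) (x + t')) (at x within {c..d})"
        using Suc.prems cd by (intro Fshift) auto
      show "F t' j (z + t') = F t j (z + t)" if z: "z \<in> {c..d}" for z
      proof -
        have "z \<in> {a - t..b - t}" "z \<in> {a - t'..b - t'}" using z cd(3,4) by blast+
        then have "z + t \<in> {a..b}" "z + t' \<in> {a..b}" by auto
        then show ?thesis using Suc.IH[of z] Suc.prems by auto
      qed
    qed (use cd in auto)
    ultimately show ?case using cd by (intro real_derivative_unique)
  qed
  \<comment> \<open>A time whose window contains all points of the domain within distance \<open>r\<close> of \<open>x\<close>: the window
    is centred at \<open>x\<close> unless this requires a time outside of \<open>{0..T}\<close>.\<close>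
  define \<sigma> where "\<sigma> x = max 0 (min T ((a + b) / 2 - x))" for x
  have \<sigma>: "\<sigma> x \<in> {0..T}" for x using T by (auto simp: \<sigma>_def)
  define r where "r = (b - a) / 2"
  have r: "0 < r" using ab by (simp add: r_def)
  have window: "z + \<sigma> x \<in> {a..b}" if "x \<in> {a - T..b}" "z \<in> {a - T..b}" "\<bar>z - x\<bar> \<le> r" for x z
  proof -
    have z: "z - x \<le> r" "x - z \<le> r" using that(3) by linarith+
    have r2: "2 * r = b - a" by (simp add: r_def)
    define m where "m = (a + b) / 2"
    have m: "m = a + r" "m = b - r" using r2 by (simp_all add: m_def)
    have zb: "a \<le> z + T" "z \<le> b" using that by auto
    have sx: "\<sigma> x = max 0 (min T (m - x))" by (simp add: \<sigma>_def m_def)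
    consider "m - x \<le> 0" | "0 < m - x" "m - x \<le> T" | "0 < m - x" "T < m - x" by linarith
    then show ?thesis
    proof cases
      case 1
      then have "\<sigma> x = 0" using T by (simp add: sx)
      then show ?thesis using 1 z zb m by simp
    next
      case 2
      then have "\<sigma> x = m - x" by (simp add: sx)
      then show ?thesis using z m by simp
    next
      case 3
      then have "\<sigma> x = T" using T by (simp add: sx)
      then show ?thesis using 3 z zb m by simp
    qed
  qed
  have \<sigma>_lip: "\<bar>\<sigma> z - \<sigma> x\<bar> \<le> \<bar>z - x\<bar>" for x z by (auto simp: \<sigma>_def)
  define w where "w j x = F (\<sigma> x) j (x + \<sigma> x)" for j x
  have w: "w j z = F (\<sigma> x) j (z + \<sigma> x)"
    if "x \<in> {a - T..b}" "z \<in> {a - T..b}" "\<bar>z - x\<bar> \<le> r" "j \<le> n" for j x z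
    unfolding w_def
  proof (rule indep)
    show "z + \<sigma> z \<in> {a..b}" using window[of z z] that r by simp
    show "z + \<sigma> x \<in> {a..b}" using window that by blast
    have "r < b - a" using r by (simp add: r_def)
    then show "\<bar>\<sigma> z - \<sigma> x\<bar> < b - a" using \<sigma>_lip[of z x] that by linarith
  qed (use \<sigma> that in auto)
  have deriv: "(w j has_real_derivative w (Suc j) x) (at x within {a - T..b})"
    if j: "j < n" and x: "x \<in> {a - T..b}" for j x
  proof -
    define c d where "c = max (a - T) (x - r)" and "d = min b (x + r)"
    have sub: "{c..d} \<subseteq> {a - \<sigma> x..b - \<sigma> x}"
    proof
      fix z assume "z \<in> {c..d}"
      then have "z + \<sigma> x \<in> {a..b}" using x by (intro window) (auto simp: c_def d_def)
      then show "z \<in> {a - \<sigma> x..b - \<sigma> x}" by auto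
    qed
    have xc: "x \<in> {c..d}" using x r by (auto simp: c_def d_def)
    have "(w j has_real_derivative F (\<sigma> x) (Suc j) (x + \<sigma> x)) (at x within {c..d})"
    proof (rule has_field_derivative_transform_within[where d = 1])
      show "((\<lambda>z. F (\<sigma> x) j (z + \<sigma> x)) has_real_derivative F (\<sigma> x) (Suc j) (x + \<sigma> x)) (at x within {c..d})"
        using j sub xc \<sigma> by (intro Fshift) auto
      show "F (\<sigma> x) j (z + \<sigma> x) = w j z" if "z \<in> {c..d}" for z
        using w[of x z j] that x j by (auto simp: c_def d_def)
    qed (use xc in auto)
    then have "(w j has_real_derivative w (Suc j) x) (at x within {c..d})" by (simp add: w_def)
    moreover have "at x within {c..d} = at x within {a - T..b}"
      by (rule at_within_nhd[of x "{x - r<..<x + r}"]) (use r x in \<open>auto simp: c_def d_def\<close>)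
    ultimately show ?thesis by simp
  qed
  have lip: "\<bar>w j x - w j y\<bar> \<le> K * \<bar>x - y\<bar>" if j: "j \<le> n" and xy: "x \<in> {a - T..b}" "y \<in> {a - T..b}" for j x y
  proof (rule lipschitz_from_local[OF r _ xy])
    fix x y assume "x \<in> {a - T..b}" "y \<in> {a - T..b}" "\<bar>x - y\<bar> \<le> r"
    then show "\<bar>w j x - w j y\<bar> \<le> K * \<bar>x - y\<bar>"
      using w[of x x j] w[of x y j] j r window[of x x] window[of x y] Fl[OF \<sigma>[of x] j, of "x + \<sigma> x" "y + \<sigma> x"]
      by (simp add: abs_minus_commute)
  qed
  have w0: "w 0 z = W z" if "z \<in> {a - T..b}" for z
    using window[of z z] that r \<sigma>[of z] by (simp add: w_def F0 uW)
  have wcont: "continuous_on {a - T..b} (w j)" if "j \<le> n" for j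
  proof (rule lipschitz_on_continuous_on[of K])
    show "K-lipschitz_on {a - T..b} (w j)" using lip[OF that] K by (intro lipschitz_onI) (auto simp: dist_real_def)
  qed
  \<comment> \<open>The values that the boundary condition prescribes to the left of \<open>a\<close>.\<close>
  define B where "B j x = (case bc of Zero_Inflow \<Rightarrow> 0 | Periodic \<Rightarrow> w j (x + (b - a)))" for j x
  have Bd: "(B j has_real_derivative B (Suc j) x) (at x within {a - T..a})" if "j < n" "x \<in> {a - T..a}" for j x
  proof (cases bc)
    case Periodic
    have "(w j has_real_derivative w (Suc j) (x + (b - a))) (at (x + (b - a)) within (\<lambda>z. z + (b - a)) ` {a - T..a})"
      using that ab by (intro DERIV_subset[OF deriv]) auto
    moreover have "((\<lambda>z. z + (b - a)) has_real_derivative 1) (at x within {a - T..a})" by (auto intro!: derivative_eq_intros)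
    ultimately show ?thesis
      using DERIV_image_chain[of "w j" _ "\<lambda>z. z + (b - a)" x "{a - T..a}" 1] Periodic
      by (simp add: o_def B_def[abs_def])
  qed (simp add: B_def[abs_def])
  have Bcont: "continuous_on {a - T..a} (B 0)"
  proof (cases bc)
    case Periodic
    have "continuous_on {a - T..a} (\<lambda>x. w 0 (x + (b - a)))"
      by (rule continuous_on_compose2[OF wcont[of 0]]) (use ab in \<open>auto intro!: continuous_intros\<close>)
    then show ?thesis using Periodic by (simp add: B_def[abs_def])
  qed (simp add: B_def[abs_def])
  have bdry: "w j x = B j x" if "j \<le> n" "x \<in> {a - T..a}" for j x
    using that
  proof (induction j arbitrary: x)
    case 0
    have "w 0 x - B 0 x = 0" if "x \<in> {a - T..<a}" for x
    proof -
      have t: "a - x \<in> {0<..T}" using that by auto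
      then have bd: "case bc of Zero_Inflow \<Rightarrow> u a (a - x) = 0 | Periodic \<Rightarrow> u a (a - x) = u b (a - x)"
        using ex unfolding exact_solution_def by blast
      have "w 0 x = u a (a - x)" using w0[of x] uW[of a "a - x"] that ab by auto
      moreover have "w 0 (x + (b - a)) = u b (a - x)"
        using w0[of "x + (b - a)"] uW[of b "a - x"] that ab by (auto simp: algebra_simps)
      ultimately show ?thesis using bd by (cases bc) (simp_all add: B_def)
    qed
    moreover have "continuous_on {a - T..a} (\<lambda>x. w 0 x - B 0 x)"
      using wcont[of 0] Bcont ab by (intro continuous_on_diff) (auto intro: continuous_on_subset)
    moreover have "closure {a - T..<a} = {a - T..a}" using T by simp
    ultimately have "w 0 x - B 0 x = 0"
      using continuous_constant_on_closure[of "{a - T..<a}" "\<lambda>x. w 0 x - B 0 x" 0 x] 0 by simp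
    then show ?case by simp
  next
    case (Suc j)
    have "(w j has_real_derivative w (Suc j) x) (at x within {a - T..a})"
      using Suc.prems ab by (intro DERIV_subset[OF deriv]) auto
    moreover have "(w j has_real_derivative B (Suc j) x) (at x within {a - T..a})"
    proof (rule has_field_derivative_transform_within[where d = 1])
      show "(B j has_real_derivative B (Suc j) x) (at x within {a - T..a})" using Suc.prems by (intro Bd) auto
      show "B j z = w j z" if "z \<in> {a - T..a}" for z using Suc.IH[of z] Suc.prems that by simp
    qed (use Suc.prems in auto)
    ultimately show ?case using Suc.prems T by (intro real_derivative_unique) auto
  qed
  have "smooth_profile bc a b T K n w"
    unfolding smooth_profile_def using deriv lip bdry by (simp add: B_def)
  moreover have "u x t = w 0 (x - t)" if "x \<in> {a..b}" "t \<in> {0..T}" for x t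
    using uW[OF that] w0[of "x - t"] that by auto
  ultimately show ?thesis by blast
qed

section \<open>The stability polynomial of the time discretization\<close>

text \<open>The Taylor polynomial of the exponential function.\<close>

definition texp :: "nat \<Rightarrow> real poly" where
  "texp n = (\<Sum>\<kappa>\<le>n. monom (1 / fact \<kappa>) \<kappa>)"

lemma coeff_texp: "coeff (texp n) i = (if i \<le> n then 1 / fact i else 0)"
  by (simp add: texp_def coeff_sum)

lemma poly_texp_0: "poly (texp n) 0 = 1"
  by (induction n) (simp_all add: texp_def poly_monom)

lemma pderiv_texp: "pderiv (texp (Suc n)) = texp n"
proof (rule poly_eqI)
  fix i
  have "real (Suc i) / fact (Suc i) = 1 / (fact i :: real)"
    unfolding fact_Suc by (simp del: of_nat_Suc)
  then show "coeff (pderiv (texp (Suc n))) i = coeff (texp n) i"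
    by (simp add: coeff_pderiv coeff_texp del: fact_Suc of_nat_Suc)
qed

lemma poly_eq_if_pderiv_eq:
  fixes p q :: "real poly"
  assumes "pderiv p = pderiv q" and "poly p 0 = poly q 0"
  shows "p = q"
proof (rule poly_eqI)
  fix i
  show "coeff p i = coeff q i"
  proof (cases i)
    case 0
    then show ?thesis using assms(2) by (simp add: poly_0_coeff_0)
  next
    case (Suc j)
    have "coeff (pderiv p) j = coeff (pderiv q) j" using assms(1) by simp
    then show ?thesis using Suc by (simp add: coeff_pderiv del: of_nat_Suc)
  qed
qed

text \<open>With \<open>x\<close> in the place of \<open>\<tau>L\<close>, the stage \<open>l < s\<close> is \<open>(1 + x)\<^sup>l\<close>; for \<open>s = m + 1\<close> this is the
  last one.\<close>

definition rk_poly :: "nat \<Rightarrow> real poly" where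
  "rk_poly m = (\<Sum>\<kappa>\<le>m. Polynomial.smult (rk_coeff m \<kappa>) ([:1, 1:] ^ \<kappa>)) +
     Polynomial.smult (rk_coeff m m) ([:0, 1:] * [:1, 1:] ^ m)"

lemma rk_coeff_sum: "(\<Sum>\<kappa>\<le>m. rk_coeff m \<kappa>) = 1"
proof (cases m)
  case (Suc n)
  have "rk_coeff m \<kappa> = (if \<kappa> = Suc n then 1 / fact (n + 2)
                   else if 1 \<le> \<kappa> \<and> \<kappa> \<le> n then 1 / real \<kappa> * rk_coeff n (\<kappa> - 1)
                   else 0)" if "1 \<le> \<kappa>" for \<kappa>
    using that Suc by (auto simp: Let_def)
  then have "(\<Sum>\<kappa>=1..Suc n. rk_coeff m \<kappa>) = (\<Sum>\<kappa>=1..Suc n. if \<kappa> = Suc n then 1 / fact (n + 2)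
                   else if 1 \<le> \<kappa> \<and> \<kappa> \<le> n then 1 / real \<kappa> * rk_coeff n (\<kappa> - 1)
                   else 0)" by (intro sum.cong) auto
  moreover have "rk_coeff m 0 = 1 - (\<Sum>\<kappa>=1..Suc n. if \<kappa> = Suc n then 1 / fact (n + 2)
                   else if 1 \<le> \<kappa> \<and> \<kappa> \<le> n then 1 / real \<kappa> * rk_coeff n (\<kappa> - 1)
                   else 0)" using Suc by (simp add: Let_def)
  moreover have "{..m} = insert 0 {1..Suc n}" using Suc by auto
  ultimately show ?thesis by simp
qed simp

lemma pderiv_linear_power: "pderiv ([:1, 1:] ^ Suc n :: real poly) = Polynomial.smult (real (Suc n)) ([:1, 1:] ^ n)"
  unfolding pderiv_power_Suc by (simp add: pderiv_pCons)

text \<open>The recursion for the coefficients \<open>g\<^bsub>s-1,l\<^esub>\<close> is made for this: it divides by \<open>l\<close> what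
  differentiating \<open>(1 + x)\<^sup>l\<close> multiplies by \<open>l\<close>.\<close>

lemma pderiv_rk_poly: "pderiv (rk_poly (Suc m)) = rk_poly m"
proof -
  let ?w = "[:1, 1:] :: real poly"
  let ?g = "rk_coeff (Suc m)"
  have g: "real (Suc \<kappa>) * ?g (Suc \<kappa>) = rk_coeff m \<kappa>" if "\<kappa> < m" for \<kappa>
    using that by (simp add: Let_def del: of_nat_Suc)
  have gl: "?g (Suc m) = 1 / fact (m + 2)" by (simp add: rk_coeff_last)
  have gm: "rk_coeff m m = 1 / fact (m + 1)" by (simp add: rk_coeff_last)
  have fact2: "(1 / fact (m + 2)) * real (m + 2) = (1 / fact (m + 1) :: real)"
  proof -
    have eq: "(fact (m + 2) :: real) = real (m + 2) * fact (m + 1)" by (simp add: algebra_simps)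
    have aux: "1 / (c * d) * c = 1 / d" if "c \<noteq> 0" for c d :: real using that by simp
    show ?thesis unfolding eq by (rule aux) linarith
  qed
  have "pderiv (\<Sum>\<kappa>\<le>Suc m. Polynomial.smult (?g \<kappa>) (?w ^ \<kappa>)) =
     (\<Sum>\<kappa>\<le>Suc m. Polynomial.smult (?g \<kappa>) (pderiv (?w ^ \<kappa>)))"
    by (simp only: higher_pderiv_sum[of 1, simplified] pderiv_smult)
  also have "\<dots> = (\<Sum>\<kappa>\<le>m. Polynomial.smult (?g (Suc \<kappa>)) (pderiv (?w ^ Suc \<kappa>)))"
    unfolding sum.atMost_Suc_shift by simp
  also have "\<dots> = (\<Sum>\<kappa>\<le>m. Polynomial.smult (real (Suc \<kappa>) * ?g (Suc \<kappa>)) (?w ^ \<kappa>))"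
    unfolding pderiv_linear_power smult_smult by (simp only: mult.commute)
  also have "\<dots> = (\<Sum>\<kappa><m. Polynomial.smult (rk_coeff m \<kappa>) (?w ^ \<kappa>)) +
     Polynomial.smult (real (Suc m) * ?g (Suc m)) (?w ^ m)"
    unfolding lessThan_Suc_atMost[symmetric] sum.lessThan_Suc by (intro arg_cong2[where f = "(+)"] sum.cong refl) (use g in auto)
  finally have 1: "pderiv (\<Sum>\<kappa>\<le>Suc m. Polynomial.smult (?g \<kappa>) (?w ^ \<kappa>)) =
     (\<Sum>\<kappa><m. Polynomial.smult (rk_coeff m \<kappa>) (?w ^ \<kappa>)) +
     Polynomial.smult (real (Suc m) * ?g (Suc m)) (?w ^ m)" .
  have X: "[:0, 1:] = ?w - 1" by (simp add: one_pCons)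
  have 2: "pderiv ([:0, 1:] * ?w ^ Suc m) = Polynomial.smult (real (m + 2)) (?w ^ Suc m) -
      Polynomial.smult (real (m + 1)) (?w ^ m)"
  proof -
    have "[:0, 1:] * ?w ^ Suc m = ?w ^ Suc (Suc m) - ?w ^ Suc m"
      unfolding X by (simp only: left_diff_distrib power_Suc mult_1)
    then show ?thesis unfolding pderiv_diff pderiv_linear_power by (simp only:) (simp add: pderiv_diff pderiv_linear_power del: power_Suc)
  qed
  have "pderiv (rk_poly (Suc m)) = (\<Sum>\<kappa><m. Polynomial.smult (rk_coeff m \<kappa>) (?w ^ \<kappa>)) +
      Polynomial.smult (?g (Suc m) * real (m + 2)) (?w ^ Suc m)"
    unfolding rk_poly_def pderiv_add pderiv_smult 1 2
    by (simp add: smult_diff_right mult.commute del: power_Suc)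
  also have "\<dots> = (\<Sum>\<kappa><m. Polynomial.smult (rk_coeff m \<kappa>) (?w ^ \<kappa>)) +
      Polynomial.smult (rk_coeff m m) (?w ^ Suc m)"
    unfolding gl gm fact2 ..
  also have "\<dots> = rk_poly m"
  proof -
    have "?w ^ Suc m = ?w ^ m + [:0, 1:] * ?w ^ m" unfolding X by (simp add: left_diff_distrib del: power_Suc) simp
    then show ?thesis
      unfolding rk_poly_def lessThan_Suc_atMost[symmetric] sum.lessThan_Suc by (simp only: smult_add_right add.assoc)
  qed
  finally show ?thesis .
qed

text \<open>In both sequences each polynomial has its predecessor as derivative and the value \<open>1\<close> at
  \<open>0\<close>.\<close>

lemma rk_poly_eq_texp: "rk_poly m = texp (Suc m)"
proof (induction m)
  case 0
  show ?case by (simp add: rk_poly_def texp_def monom_0 monom_Suc one_pCons)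
next
  case (Suc m)
  have "poly (rk_poly (Suc m)) 0 = 1"
    unfolding rk_poly_def by (simp add: poly_sum rk_coeff_sum del: rk_coeff.simps sum.atMost_Suc)
  moreover have "poly (texp (Suc (Suc m))) 0 = 1" by (rule poly_texp_0)
  moreover have "pderiv (rk_poly (Suc m)) = pderiv (texp (Suc (Suc m)))"
    unfolding pderiv_rk_poly pderiv_texp by (rule Suc)
  ultimately show ?case using poly_eq_if_pderiv_eq by metis
qed

text \<open>The relation \<open>\<bbbE>\<^sub>\<kappa> = \<tau>L \<bbbE>\<^bsub>\<kappa>-1\<^esub>\<close> in the model where \<open>\<tau>L\<close> is the multiplication by a number
  \<open>x\<close>.\<close>

lemma temporal_diff_poly:
  assumes s: "1 \<le> s" and "\<kappa> \<le> s"
  shows "(\<Sum>l\<le>s. temporal_diff s \<kappa> l * (if l < s then (1 + x) ^ l else poly (texp s) x)) = x ^ \<kappa>"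
proof -
  define v where "v l = (if l < s then (1 + x) ^ l else poly (texp s) x)" for l
  have lin: "linear ((*) x)" by (auto intro: bounded_linear.linear bounded_linear_mult_right)
  have stage: "v (l + 1) = v l + x * v l" if "l + 2 \<le> s" for l
    using that by (simp add: v_def algebra_simps)
  have last: "v s = (\<Sum>\<kappa><s. rk_coeff (s - 1) \<kappa> *\<^sub>R v \<kappa>) + rk_coeff (s - 1) (s - 1) *\<^sub>R (x * v (s - 1))"
  proof -
    have S: "{..s - 1} = {..<s}" using s by auto
    have "v s = poly (rk_poly (s - 1)) x" using s rk_poly_eq_texp[of "s - 1"] by (simp add: v_def)
    also have "\<dots> = (\<Sum>\<kappa><s. rk_coeff (s - 1) \<kappa> * (1 + x) ^ \<kappa>) + rk_coeff (s - 1) (s - 1) * (x * (1 + x) ^ (s - 1))"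
      unfolding rk_poly_def S by (simp add: poly_sum)
    finally show ?thesis using s by (simp add: v_def)
  qed
  have "(\<Sum>l\<le>\<kappa>. temporal_diff s \<kappa> l *\<^sub>R v l) = x ^ \<kappa>" using assms(2)
  proof (induction \<kappa>)
    case 0
    then show ?case using s by (simp add: v_def)
  next
    case (Suc \<kappa>)
    have "(\<Sum>l\<le>Suc \<kappa>. temporal_diff s (Suc \<kappa>) l *\<^sub>R v l) = x * (\<Sum>l\<le>\<kappa>. temporal_diff s \<kappa> l *\<^sub>R v l)"
      unfolding Suc_eq_plus1 by (rule temporal_diff_step[OF lin s stage last]) (use Suc.prems in auto)
    also have "\<dots> = x ^ Suc \<kappa>" using Suc by simp
    finally show ?case .
  qed
  moreover have "(\<Sum>l\<le>s. temporal_diff s \<kappa> l *\<^sub>R v l) = (\<Sum>l\<le>\<kappa>. temporal_diff s \<kappa> l *\<^sub>R v l)"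
    using assms(2) by (intro sum.mono_neutral_right ballI) (auto simp del: temporal_diff.simps simp: temporal_diff_zero)
  ultimately show ?thesis unfolding v_def real_scaleR_def by (rule trans[rotated])
qed

text \<open>In the same model the identity defining \<open>\<beta>\<close> says that \<open>\<Sum>\<^sub>\<kappa> \<beta>\<^sub>\<kappa> x\<^sup>\<kappa>\<close> is \<open>\<beta>\<^sub>0\<close> times the last
  stage, that is, times the Taylor polynomial of \<open>exp\<close>.\<close>

lemma evolution_coeffs_eq:
  assumes s: "1 \<le> s" and ev: "evolution_coeffs s \<beta>" and "\<kappa> \<le> s"
  shows "\<beta> \<kappa> = \<beta> 0 / fact \<kappa>"
proof -
  define B where "B = (\<Sum>\<kappa>\<le>s. monom (\<beta> \<kappa>) \<kappa>)"
  have "poly B x = poly (Polynomial.smult (\<beta> 0) (texp s)) x" for x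
  proof -
    let ?v = "\<lambda>l. if l < s then (1 + x) ^ l else poly (texp s) x"
    have "poly B x = (\<Sum>\<kappa>\<le>s. \<beta> \<kappa> * x ^ \<kappa>)" by (simp add: B_def poly_sum poly_monom)
    also have "\<dots> = (\<Sum>\<kappa>\<le>s. \<beta> \<kappa> * (\<Sum>l\<le>s. temporal_diff s \<kappa> l * ?v l))"
      using temporal_diff_poly[OF s] by (intro sum.cong refl) simp
    also have "\<dots> = (\<Sum>l\<le>s. (\<Sum>\<kappa>\<le>s. \<beta> \<kappa> * temporal_diff s \<kappa> l) * ?v l)"
      unfolding sum_distrib_left sum_distrib_right by (subst sum.swap) (simp add: mult.assoc)
    also have "\<dots> = (\<Sum>l\<le>s. (if l = s then \<beta> 0 else 0) * ?v l)"
      using ev unfolding evolution_coeffs_def by (intro sum.cong refl) auto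
    also have "\<dots> = (\<Sum>l\<le>s. if l = s then \<beta> 0 * poly (texp s) x else 0)"
      by (intro sum.cong) auto
    also have "\<dots> = poly (Polynomial.smult (\<beta> 0) (texp s)) x" by simp
    finally show ?thesis .
  qed
  then have "B = Polynomial.smult (\<beta> 0) (texp s)" by (simp add: poly_eq_poly_eq_iff[symmetric] fun_eq_iff)
  then have "coeff B \<kappa> = \<beta> 0 * coeff (texp s) \<kappa>" by simp
  then show ?thesis using assms(3) by (simp add: B_def coeff_sum coeff_texp)
qed

section \<open>The discrete advection operator and its energy identity\<close>

context reference_cell
begin

text \<open>The upwind value at the left end point of cell \<open>i\<close>. A piecewise polynomial is a family of
  polynomials in the reference coordinates of the cells.\<close>

definition inflow :: "boundary \<Rightarrow> nat \<Rightarrow> (nat \<Rightarrow> real poly) \<Rightarrow> nat \<Rightarrow> real" where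
  "inflow bc N v i =
     (if i = 1 then (case bc of Zero_Inflow \<Rightarrow> 0 | Periodic \<Rightarrow> poly (v N) 1) else poly (v (i - 1)) 1)"

text \<open>The operator \<open>\<tau>L\<close> with \<open>(Lv, w\<^sup>*) = a\<^sub>h(v, w\<^sup>*)\<close>.\<close>

definition adv :: "boundary \<Rightarrow> nat \<Rightarrow> (nat \<Rightarrow> real) \<Rightarrow> real \<Rightarrow> (nat \<Rightarrow> real poly) \<Rightarrow> nat \<Rightarrow> real poly" where
  "adv bc N H \<tau> v i =
     (if i \<in> {1..N} then Polynomial.smult (\<tau> * (2 / H i)) (ref_adv (v i) (inflow bc N v i)) else 0)"

definition energy :: "nat \<Rightarrow> (nat \<Rightarrow> real) \<Rightarrow> (nat \<Rightarrow> real poly) \<Rightarrow> (nat \<Rightarrow> real poly) \<Rightarrow> real" where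
  "energy N H v w = (\<Sum>i=1..N. H i / 2 * mass (v i) (w i))"

text \<open>The value \<open>0\<close> outside of \<open>{1..N}\<close> makes equality of functions the same as equality of
  piecewise polynomials.\<close>

definition cellwise :: "nat \<Rightarrow> (nat \<Rightarrow> real poly) \<Rightarrow> bool" where
  "cellwise N v \<longleftrightarrow> (\<forall>i. degree (v i) \<le> k) \<and> (\<forall>i. i \<notin> {1..N} \<longrightarrow> v i = 0)"

text \<open>The index \<open>0\<close> accounts for what leaves through the outflow boundary. In the periodic case
  nothing does, since the jump between the last and the first cell is the one of index \<open>1\<close>.\<close>

definition jump :: "boundary \<Rightarrow> nat \<Rightarrow> (nat \<Rightarrow> real poly) \<Rightarrow> nat \<Rightarrow> real" where
  "jump bc N v i =
     (if i = 0 then (case bc of Zero_Inflow \<Rightarrow> poly (v N) 1 | Periodic \<Rightarrow> 0)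
      else poly (v i) (-1) - inflow bc N v i)"

lemma cellwise_adv: "cellwise N v \<Longrightarrow> cellwise N (adv bc N H \<tau> v)"
  unfolding cellwise_def adv_def by (auto intro!: degree_smult_le[THEN order_trans] ref_adv_degree)

lemma cellwise_adv_power: "cellwise N v \<Longrightarrow> cellwise N ((adv bc N H \<tau> ^^ p) v)"
  by (induction p) (auto intro: cellwise_adv)

lemma energy_adv:
  assumes v: "cellwise N v" and w: "cellwise N w" and H: "\<And>i. i \<in> {1..N} \<Longrightarrow> 0 < H i"
  shows "energy N H (adv bc N H \<tau> v) w = \<tau> * (\<Sum>i=1..N. inflow bc N v i * poly (w i) (-1)
      - poly (v i) 1 * poly (w i) 1 + cell_int (pderiv (w i) * v i))"
  unfolding energy_def sum_distrib_left
proof (intro sum.cong refl)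
  fix i assume i: "i \<in> {1..N}"
  then have "H i \<noteq> 0" using H by force
  moreover have "mass (ref_adv (v i) (inflow bc N v i)) (w i) = inflow bc N v i * poly (w i) (-1)
      - poly (v i) 1 * poly (w i) 1 + cell_int (pderiv (w i) * v i)"
    by (rule mass_ref_adv) (use v w in \<open>auto simp: cellwise_def\<close>)
  ultimately show "H i / 2 * mass (adv bc N H \<tau> v i) (w i) = \<tau> * (inflow bc N v i * poly (w i) (-1)
      - poly (v i) 1 * poly (w i) 1 + cell_int (pderiv (w i) * v i))"
    using i by (simp add: adv_def mass_smult)
qed

lemma energy_commute: "energy N H v w = energy N H w v"
  by (simp add: energy_def mass_commute)

text \<open>Integration by parts on each cell leaves traces at the mesh points, which combine to the
  products of the jumps because the upwind value is the left trace.\<close>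

lemma energy_skew:
  assumes v: "cellwise N v" and w: "cellwise N w" and H: "\<And>i. i \<in> {1..N} \<Longrightarrow> 0 < H i"
    and N: "1 \<le> N"
  shows "energy N H (adv bc N H \<tau> v) w + energy N H v (adv bc N H \<tau> w) =
    - \<tau> * (\<Sum>i\<in>{0..N}. jump bc N v i * jump bc N w i)"
proof -
  define c d where "c i = inflow bc N v i" and "d i = inflow bc N w i" for i
  have parts: "cell_int (pderiv (w i) * v i) + cell_int (pderiv (v i) * w i) =
      poly (v i) 1 * poly (w i) 1 - poly (v i) (-1) * poly (w i) (-1)" for i
    using cell_int_by_parts[of "w i" "v i"] by (simp add: mult.commute)
  have "energy N H (adv bc N H \<tau> v) w + energy N H v (adv bc N H \<tau> w) =
     \<tau> * ((\<Sum>i=1..N. c i * poly (w i) (-1) - poly (v i) 1 * poly (w i) 1 + cell_int (pderiv (w i) * v i)) +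
      (\<Sum>i=1..N. d i * poly (v i) (-1) - poly (w i) 1 * poly (v i) 1 + cell_int (pderiv (v i) * w i)))"
    using energy_adv[OF v w H, where bc = bc and \<tau> = \<tau>] energy_adv[OF w v H, where bc = bc and \<tau> = \<tau>]
      energy_commute[of N H v]
    by (simp add: distrib_left c_def d_def)
  also have "\<dots> = \<tau> * (\<Sum>i=1..N. c i * d i - poly (v i) 1 * poly (w i) 1 -
      (poly (v i) (-1) - c i) * (poly (w i) (-1) - d i))"
    unfolding sum.distrib[symmetric]
  proof (intro arg_cong[where f = "\<lambda>x. \<tau> * x"] sum.cong refl)
    fix i
    show "c i * poly (w i) (-1) - poly (v i) 1 * poly (w i) 1 + cell_int (pderiv (w i) * v i) +
        (d i * poly (v i) (-1) - poly (w i) 1 * poly (v i) 1 + cell_int (pderiv (v i) * w i)) =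
        c i * d i - poly (v i) 1 * poly (w i) 1 - (poly (v i) (-1) - c i) * (poly (w i) (-1) - d i)"
      using parts[of i] by (simp add: algebra_simps)
  qed
  also have "\<dots> = \<tau> * ((\<Sum>i=1..N. c i * d i) - (\<Sum>i=1..N. poly (v i) 1 * poly (w i) 1) -
      (\<Sum>i=1..N. jump bc N v i * jump bc N w i))"
    by (simp add: sum_subtractf jump_def c_def d_def)
  also have "(\<Sum>i=1..N. c i * d i) = (\<Sum>i=1..N. poly (v i) 1 * poly (w i) 1) - jump bc N v 0 * jump bc N w 0"
  proof -
    obtain M where M: "N = Suc M" using N by (cases N) auto
    have "(\<Sum>i=1..N. c i * d i) = c 1 * d 1 + (\<Sum>i=1..M. c (Suc i) * d (Suc i))"
      unfolding M by (simp only: One_nat_def sum.atLeast_Suc_atMost_Suc_shift sum.atLeast_Suc_atMost[of 1 "Suc M"])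
        (simp add: sum.atLeast_Suc_atMost sum.shift_bounds_cl_Suc_ivl)
    also have "(\<Sum>i=1..M. c (Suc i) * d (Suc i)) = (\<Sum>i=1..M. poly (v i) 1 * poly (w i) 1)"
      by (intro sum.cong refl) (auto simp: c_def d_def inflow_def)
    finally have 1: "(\<Sum>i=1..N. c i * d i) = c 1 * d 1 + (\<Sum>i=1..M. poly (v i) 1 * poly (w i) 1)" .
    have 2: "(\<Sum>i=1..N. poly (v i) 1 * poly (w i) 1) =
        (\<Sum>i=1..M. poly (v i) 1 * poly (w i) 1) + poly (v N) 1 * poly (w N) 1"
      unfolding M by simp
    show ?thesis unfolding 1 2
      by (cases bc) (simp_all add: c_def d_def inflow_def jump_def)
  qed
  also have "\<tau> * ((\<Sum>i=1..N. poly (v i) 1 * poly (w i) 1) - jump bc N v 0 * jump bc N w 0 -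
      (\<Sum>i=1..N. poly (v i) 1 * poly (w i) 1) - (\<Sum>i=1..N. jump bc N v i * jump bc N w i)) =
      - \<tau> * (\<Sum>i\<in>{0..N}. jump bc N v i * jump bc N w i)"
    by (simp add: sum.atLeast_Suc_atMost[of 0 N] algebra_simps)
  finally show ?thesis .
qed

lemma energy_nonneg: "(\<And>i. i \<in> {1..N} \<Longrightarrow> 0 < H i) \<Longrightarrow> 0 \<le> energy N H v v"
  unfolding energy_def by (intro sum_nonneg mult_nonneg_nonneg mass_nonneg) (auto simp: less_imp_le)

lemma mass_add_right: "mass r (p + q) = mass r p + mass r q"
  using mass_add[of p q r] by (simp add: mass_commute)

lemma mass_smult_right: "mass r (Polynomial.smult c p) = c * mass r p"
  using mass_smult[of c p r] by (simp add: mass_commute)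

lemma mass_square_add:
  "mass (p + Polynomial.smult t q) (p + Polynomial.smult t q) = mass p p + 2 * t * mass p q + t\<^sup>2 * mass q q"
  by (simp add: mass_add mass_add_right mass_smult mass_smult_right mass_commute[of q p] power2_eq_square algebra_simps)

lemma energy_square_add:
  "energy N H (\<lambda>i. v i + Polynomial.smult t (w i)) (\<lambda>i. v i + Polynomial.smult t (w i)) =
     energy N H v v + 2 * t * energy N H v w + t\<^sup>2 * energy N H w w"
  unfolding energy_def mass_square_add by (simp add: algebra_simps sum.distrib sum_distrib_left)

lemma energy_Cauchy_Schwarz:
  assumes H: "\<And>i. i \<in> {1..N} \<Longrightarrow> 0 < H i"
  shows "(energy N H v w)\<^sup>2 \<le> energy N H v v * energy N H w w"
proof (cases "energy N H w w = 0")
  case True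
  have "energy N H v w = 0"
  proof (rule ccontr)
    assume nz: "energy N H v w \<noteq> 0"
    define t where "t = - (energy N H v v + 1) / (2 * energy N H v w)"
    have "0 \<le> energy N H v v + 2 * t * energy N H v w + t\<^sup>2 * energy N H w w"
      unfolding energy_square_add[symmetric] by (rule energy_nonneg[OF H])
    moreover have "2 * t * energy N H v w = - (energy N H v v + 1)" using nz by (simp add: t_def)
    ultimately show False using True by simp
  qed
  then show ?thesis using True by simp
next
  case False
  then have pos: "0 < energy N H w w" using energy_nonneg[of N H w, OF H] by simp
  define t where "t = - energy N H v w / energy N H w w"
  have "0 \<le> energy N H v v + 2 * t * energy N H v w + t\<^sup>2 * energy N H w w"
    unfolding energy_square_add[symmetric] by (rule energy_nonneg[OF H])
  also have "\<dots> = energy N H v v - (energy N H v w)\<^sup>2 / energy N H w w"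
    using pos by (simp add: t_def power2_eq_square field_simps)
  finally show ?thesis using pos by (simp add: pos_divide_le_eq)
qed

definition enorm :: "nat \<Rightarrow> (nat \<Rightarrow> real) \<Rightarrow> (nat \<Rightarrow> real poly) \<Rightarrow> real" where
  "enorm N H v = sqrt (energy N H v v)"

lemma enorm_nonneg: "(\<And>i. i \<in> {1..N} \<Longrightarrow> 0 < H i) \<Longrightarrow> 0 \<le> enorm N H v"
  unfolding enorm_def by (intro real_sqrt_ge_zero energy_nonneg)

lemma enorm_square: "(\<And>i. i \<in> {1..N} \<Longrightarrow> 0 < H i) \<Longrightarrow> (enorm N H v)\<^sup>2 = energy N H v v"
  unfolding enorm_def by (intro real_sqrt_pow2 energy_nonneg)

lemma enorm_triangle:
  assumes H: "\<And>i. i \<in> {1..N} \<Longrightarrow> 0 < H i"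
  shows "enorm N H (\<lambda>i. v i + w i) \<le> enorm N H v + enorm N H w"
proof (rule power2_le_imp_le)
  have "\<bar>energy N H v w\<bar> \<le> enorm N H v * enorm N H w"
  proof -
    have "\<bar>energy N H v w\<bar> = sqrt ((energy N H v w)\<^sup>2)" by simp
    also have "\<dots> \<le> sqrt (energy N H v v * energy N H w w)"
      by (intro real_sqrt_le_mono energy_Cauchy_Schwarz H)
    finally show ?thesis by (simp add: enorm_def real_sqrt_mult)
  qed
  moreover have "(enorm N H (\<lambda>i. v i + w i))\<^sup>2 = (enorm N H v)\<^sup>2 + 2 * energy N H v w + (enorm N H w)\<^sup>2"
    using energy_square_add[of N H v 1 w] enorm_square[OF H] by simp
  ultimately show "(enorm N H (\<lambda>i. v i + w i))\<^sup>2 \<le> (enorm N H v + enorm N H w)\<^sup>2"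
    by (simp add: power2_eq_square algebra_simps)
  show "0 \<le> enorm N H v + enorm N H w" by (intro add_nonneg_nonneg enorm_nonneg H)
qed

lemma enorm_smult: "enorm N H (\<lambda>i. Polynomial.smult c (v i)) = \<bar>c\<bar> * enorm N H v"
proof -
  have "energy N H (\<lambda>i. Polynomial.smult c (v i)) (\<lambda>i. Polynomial.smult c (v i)) = c\<^sup>2 * energy N H v v"
    unfolding energy_def mass_smult mass_smult_right by (simp add: sum_distrib_left power2_eq_square mult_ac)
  then show ?thesis by (simp add: enorm_def real_sqrt_mult)
qed

lemma enorm_zero: "enorm N H (\<lambda>i. 0) = 0"
  using enorm_smult[of N H 0 "\<lambda>i. 0"] by simp

lemma enorm_sum:
  assumes H: "\<And>i. i \<in> {1..N} \<Longrightarrow> 0 < H i" and "finite A"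
  shows "enorm N H (\<lambda>i. \<Sum>a\<in>A. f a i) \<le> (\<Sum>a\<in>A. enorm N H (f a))"
  using assms(2)
proof (induction A rule: finite_induct)
  case (insert x A)
  have "enorm N H (\<lambda>i. \<Sum>a\<in>insert x A. f a i) = enorm N H (\<lambda>i. f x i + (\<Sum>a\<in>A. f a i))"
    using insert by simp
  also have "\<dots> \<le> enorm N H (f x) + enorm N H (\<lambda>i. \<Sum>a\<in>A. f a i)" by (rule enorm_triangle[OF H])
  finally show ?case using insert by simp
qed (simp add: enorm_zero)

lemma trace_bounds:
  "\<exists>D\<ge>0. \<forall>p. degree p \<le> k \<longrightarrow> (poly p 1)\<^sup>2 \<le> D * mass p p \<and> (poly p (-1))\<^sup>2 \<le> D * mass p p"
proof -
  obtain A B where A: "0 \<le> A" "\<And>p. degree p \<le> k \<Longrightarrow> (poly p 1)\<^sup>2 \<le> A * mass p p"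
    and B: "0 \<le> B" "\<And>p. degree p \<le> k \<Longrightarrow> (poly p (-1))\<^sup>2 \<le> B * mass p p"
    using mass_functional_bound[of "\<lambda>p. poly p 1"] mass_functional_bound[of "\<lambda>p. poly p (-1)"] by auto
  have "A * mass p p \<le> (A + B) * mass p p" "B * mass p p \<le> (A + B) * mass p p" for p
    using A(1) B(1) mass_nonneg[of p] by (auto intro!: mult_right_mono)
  then show ?thesis using A B by (intro exI[of _ "A + B"]) (meson add_nonneg_nonneg order_trans)
qed

text \<open>Scaling of the inverse and trace inequalities on the reference cell. A cell of length \<open>H i\<close>
  contributes a factor \<open>1 / H i\<close>, which mesh regularity bounds by \<open>1 / (\<alpha> h)\<close>.\<close>

lemma energy_tower_adv:
  assumes \<alpha>: "0 < \<alpha>"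
  shows "\<exists>C>0. \<forall>bc N H h \<tau> v. 1 \<le> N \<longrightarrow> 0 < h \<longrightarrow> (\<forall>i\<in>{1..N}. \<alpha> * h \<le> H i) \<longrightarrow> 0 < \<tau> \<longrightarrow> cellwise N v \<longrightarrow>
    energy_tower (C * (\<tau> / h))
      (\<lambda>p q. energy N H ((adv bc N H \<tau> ^^ p) v) ((adv bc N H \<tau> ^^ q) v)) {0..N}
      (\<lambda>p i. sqrt \<tau> * jump bc N ((adv bc N H \<tau> ^^ p) v) i)"
proof -
  obtain A where A: "0 \<le> A" "\<And>p c. degree p \<le> k \<Longrightarrow> mass (ref_adv p c) (ref_adv p c) \<le> A * (mass p p + c\<^sup>2)"
    using ref_adv_bound by blast
  obtain D where D: "0 \<le> D" "\<And>p. degree p \<le> k \<Longrightarrow> (poly p 1)\<^sup>2 \<le> D * mass p p"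
    "\<And>p. degree p \<le> k \<Longrightarrow> (poly p (-1))\<^sup>2 \<le> D * mass p p"
    using trace_bounds by blast
  define B where "B = 1 + A * (1 + D) + 5 * D"
  have B: "1 \<le> B" "A * (1 + D) \<le> B" "5 * D \<le> B" using A D by (auto simp: B_def)
  define C where "C = 2 * B / \<alpha>"
  have C: "0 < C" using B \<alpha> by (simp add: C_def)
  show ?thesis
  proof (intro exI[of _ C] conjI allI impI C)
    fix bc :: boundary and N :: nat and H :: "nat \<Rightarrow> real" and h \<tau> :: real and v :: "nat \<Rightarrow> real poly"
    assume N: "1 \<le> N" and h: "0 < h" and Hh: "\<forall>i\<in>{1..N}. \<alpha> * h \<le> H i" and \<tau>: "0 < \<tau>" and v: "cellwise N v"
    let ?E = "\<lambda>p. (adv bc N H \<tau> ^^ p) v"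
    define \<epsilon> where "\<epsilon> = \<alpha> * h"
    have \<epsilon>: "0 < \<epsilon>" using \<alpha> h by (simp add: \<epsilon>_def)
    have H\<epsilon>: "\<epsilon> \<le> H i" if "i \<in> {1..N}" for i using Hh that by (simp add: \<epsilon>_def)
    have H: "0 < H i" if "i \<in> {1..N}" for i using H\<epsilon>[OF that] \<epsilon> by linarith
    have cw: "cellwise N (?E p)" for p using v by (rule cellwise_adv_power)
    have mass_energy: "(\<Sum>i=1..N. mass (w i) (w i)) \<le> 2 / \<epsilon> * energy N H w w" for w
    proof -
      have "mass (w i) (w i) \<le> 2 / \<epsilon> * (H i / 2 * mass (w i) (w i))" if "i \<in> {1..N}" for i
      proof -
        have "1 * mass (w i) (w i) \<le> (2 / \<epsilon> * (H i / 2)) * mass (w i) (w i)"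
          using H\<epsilon>[OF that] \<epsilon> mass_nonneg by (intro mult_right_mono) (auto simp: field_simps)
        then show ?thesis by (simp add: mult.assoc)
      qed
      then show ?thesis unfolding energy_def sum_distrib_left by (intro sum_mono)
    qed
    have inflow_sum: "(\<Sum>i=1..N. (inflow bc N w i)\<^sup>2) \<le> D * (\<Sum>i=1..N. mass (w i) (w i))"
      if w: "cellwise N w" for w
    proof -
      define m where "m i = mass (w i) (w i)" for i
      have tr: "(poly (w i) 1)\<^sup>2 \<le> D * m i" for i using w D(2) by (auto simp: m_def cellwise_def)
      have m: "0 \<le> m i" for i by (simp add: m_def mass_nonneg)
      obtain M where M: "N = Suc M" using N by (cases N) auto
      have "(\<Sum>i=1..N. (inflow bc N w i)\<^sup>2) = (inflow bc N w 1)\<^sup>2 + (\<Sum>i=1..M. (inflow bc N w (Suc i))\<^sup>2)"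
        unfolding M by (simp add: sum.atLeast_Suc_atMost sum.shift_bounds_cl_Suc_ivl del: sum.cl_ivl_Suc)
      also have "(inflow bc N w 1)\<^sup>2 \<le> D * m N" using tr[of N] D(1) m[of N]
        by (cases bc) (auto simp: inflow_def)
      also have "(\<Sum>i=1..M. (inflow bc N w (Suc i))\<^sup>2) \<le> (\<Sum>i=1..M. D * m i)"
        using tr by (intro sum_mono) (auto simp: inflow_def)
      finally show ?thesis unfolding m_def[symmetric] by (simp add: M sum_distrib_left algebra_simps)
    qed
    have growth: "energy N H (adv bc N H \<tau> w) (adv bc N H \<tau> w) \<le> (C * (\<tau> / h))\<^sup>2 * energy N H w w"
      if w: "cellwise N w" for w
    proof -
      have "H i / 2 * mass (adv bc N H \<tau> w i) (adv bc N H \<tau> w i) \<le>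
          2 * \<tau>\<^sup>2 / \<epsilon> * (A * (mass (w i) (w i) + (inflow bc N w i)\<^sup>2))" if i: "i \<in> {1..N}" for i
      proof -
        have "H i / 2 * mass (adv bc N H \<tau> w i) (adv bc N H \<tau> w i) =
            2 * \<tau>\<^sup>2 / H i * mass (ref_adv (w i) (inflow bc N w i)) (ref_adv (w i) (inflow bc N w i))"
          using i H[OF i] by (simp add: adv_def mass_smult mass_smult_right power2_eq_square field_simps)
        also have "\<dots> \<le> 2 * \<tau>\<^sup>2 / \<epsilon> * (A * (mass (w i) (w i) + (inflow bc N w i)\<^sup>2))"
          using H\<epsilon>[OF i] \<epsilon> w H[OF i] by (intro mult_mono A divide_left_mono mass_nonneg) (auto simp: cellwise_def)
        finally show ?thesis .
      qed
      then have "energy N H (adv bc N H \<tau> w) (adv bc N H \<tau> w) \<le>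
          (\<Sum>i=1..N. 2 * \<tau>\<^sup>2 / \<epsilon> * (A * (mass (w i) (w i) + (inflow bc N w i)\<^sup>2)))"
        unfolding energy_def by (intro sum_mono)
      also have "\<dots> = 2 * \<tau>\<^sup>2 / \<epsilon> * (A * ((\<Sum>i=1..N. mass (w i) (w i)) + (\<Sum>i=1..N. (inflow bc N w i)\<^sup>2)))"
        by (simp only: sum_distrib_left[symmetric] sum.distrib)
      also have "\<dots> \<le> 2 * \<tau>\<^sup>2 / \<epsilon> * (A * ((1 + D) * (\<Sum>i=1..N. mass (w i) (w i))))"
        using inflow_sum[OF w] A(1) \<epsilon> by (intro mult_left_mono) (auto simp: algebra_simps)
      also have "\<dots> = 2 * \<tau>\<^sup>2 / \<epsilon> * (A * (1 + D)) * (\<Sum>i=1..N. mass (w i) (w i))"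
        by (simp only: mult.assoc)
      also have "\<dots> \<le> 2 * \<tau>\<^sup>2 / \<epsilon> * (B * B) * (2 / \<epsilon> * energy N H w w)"
      proof (rule mult_mono[OF _ mass_energy])
        have "A * (1 + D) \<le> B * 1" using B by simp
        also have "\<dots> \<le> B * B" using B by (intro mult_left_mono) auto
        finally show "2 * \<tau>\<^sup>2 / \<epsilon> * (A * (1 + D)) \<le> 2 * \<tau>\<^sup>2 / \<epsilon> * (B * B)"
          using \<epsilon> by (intro mult_left_mono) auto
      qed (use B \<epsilon> mass_nonneg in \<open>auto intro: sum_nonneg\<close>)
      also have "\<dots> = (C * (\<tau> / h))\<^sup>2 * energy N H w w"
        by (simp add: C_def \<epsilon>_def power2_eq_square)
      finally show ?thesis .
    qed
    have jumps: "\<tau> * (\<Sum>i\<in>{0..N}. (jump bc N w i)\<^sup>2) \<le> C * (\<tau> / h) * energy N H w w" if w: "cellwise N w" for w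
    proof -
      define m where "m i = mass (w i) (w i)" for i
      define S where "S = (\<Sum>i=1..N. m i)"
      have m: "0 \<le> m i" for i by (simp add: m_def mass_nonneg)
      have "(jump bc N w 0)\<^sup>2 \<le> D * m N"
        using w D(1) D(2)[of "w N"] m[of N] by (cases bc) (auto simp: jump_def m_def cellwise_def)
      also have "D * m N \<le> D * S"
        unfolding S_def using D(1) m N by (intro mult_left_mono member_le_sum) auto
      finally have j0: "(jump bc N w 0)\<^sup>2 \<le> D * S" .
      have "(jump bc N w i)\<^sup>2 \<le> 2 * (D * m i) + 2 * (inflow bc N w i)\<^sup>2" if "i \<in> {1..N}" for i
      proof -
        have "(poly (w i) (-1) - inflow bc N w i)\<^sup>2 \<le> 2 * (poly (w i) (-1))\<^sup>2 + 2 * (inflow bc N w i)\<^sup>2"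
          using zero_le_power2[of "poly (w i) (-1) + inflow bc N w i"] by (simp add: power2_eq_square algebra_simps)
        moreover have "(poly (w i) (-1))\<^sup>2 \<le> D * m i" using w D(3) by (auto simp: m_def cellwise_def)
        ultimately show ?thesis using that by (simp add: jump_def)
      qed
      then have "(\<Sum>i=1..N. (jump bc N w i)\<^sup>2) \<le> (\<Sum>i=1..N. 2 * (D * m i) + 2 * (inflow bc N w i)\<^sup>2)"
        by (intro sum_mono)
      also have "\<dots> = 2 * (D * S) + 2 * (\<Sum>i=1..N. (inflow bc N w i)\<^sup>2)"
        by (simp only: S_def sum.distrib sum_distrib_left)
      also have "\<dots> \<le> 4 * (D * S)" using inflow_sum[OF w] by (simp add: S_def m_def)
      finally have "(\<Sum>i\<in>{0..N}. (jump bc N w i)\<^sup>2) \<le> 5 * D * S"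
        using j0 by (simp add: sum.atLeast_Suc_atMost[of 0 N])
      also have "\<dots> \<le> B * (2 / \<epsilon> * energy N H w w)"
        using B mass_energy[of w] m by (intro mult_mono) (auto simp: S_def m_def intro: sum_nonneg)
      also have "\<dots> = C / h * energy N H w w" by (simp add: C_def \<epsilon>_def)
      finally have "\<tau> * (\<Sum>i\<in>{0..N}. (jump bc N w i)\<^sup>2) \<le> \<tau> * (C / h * energy N H w w)"
        using \<tau> by (intro mult_left_mono) auto
      then show ?thesis by (simp add: mult_ac)
    qed
    have rel: "energy N H (?E (Suc p)) (?E q) + energy N H (?E p) (?E (Suc q)) =
        - (\<Sum>i\<in>{0..N}. (sqrt \<tau> * jump bc N (?E p) i) * (sqrt \<tau> * jump bc N (?E q) i))" for p q
    proof -
      have "sqrt \<tau> * sqrt \<tau> = \<tau>" using \<tau> by simp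
      then have root: "(sqrt \<tau> * x) * (sqrt \<tau> * z) = \<tau> * (x * z)" for x z by (metis mult.assoc mult.left_commute)
      have "energy N H (adv bc N H \<tau> (?E p)) (?E q) + energy N H (?E p) (adv bc N H \<tau> (?E q)) =
          - \<tau> * (\<Sum>i\<in>{0..N}. jump bc N (?E p) i * jump bc N (?E q) i)"
        by (rule energy_skew[OF cw cw _ N]) (rule H)
      then show ?thesis unfolding root sum_distrib_left[symmetric] by simp
    qed
    have tr: "(\<Sum>i\<in>{0..N}. (sqrt \<tau> * jump bc N (?E p) i)\<^sup>2) \<le> C * (\<tau> / h) * energy N H (?E p) (?E p)" for p
      using jumps[OF cw[of p]] \<tau> by (simp add: power_mult_distrib sum_distrib_left)
    show "energy_tower (C * (\<tau> / h)) (\<lambda>p q. energy N H (?E p) (?E q)) {0..N}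
      (\<lambda>p i. sqrt \<tau> * jump bc N (?E p) i)"
      unfolding energy_tower_def
    proof (intro conjI allI)
      show "0 \<le> C * (\<tau> / h)" using C \<tau> h by simp
      show "finite {0..N}" by simp
      show "energy N H (?E p) (?E q) = energy N H (?E q) (?E p)" for p q by (rule energy_commute)
      show "0 \<le> energy N H (?E p) (?E p)" for p by (rule energy_nonneg[OF H])
      show "(energy N H (?E p) (?E q))\<^sup>2 \<le> energy N H (?E p) (?E p) * energy N H (?E q) (?E q)" for p q
        by (rule energy_Cauchy_Schwarz[OF H])
      show "energy N H (?E (Suc p)) (?E (Suc p)) \<le> (C * (\<tau> / h))\<^sup>2 * energy N H (?E p) (?E p)" for p
        using growth[OF cw[of p]] by simp
    qed (rule rel, rule tr)
  qed
qed

end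

section \<open>Stability of one time step\<close>

context reference_cell
begin

definition rk_step :: "boundary \<Rightarrow> nat \<Rightarrow> (nat \<Rightarrow> real) \<Rightarrow> nat \<Rightarrow> real \<Rightarrow> (nat \<Rightarrow> real poly) \<Rightarrow> nat \<Rightarrow> real poly" where
  "rk_step bc N H s \<tau> v i = (\<Sum>\<kappa>\<le>s. Polynomial.smult (1 / fact \<kappa>) ((adv bc N H \<tau> ^^ \<kappa>) v i))"

lemma mass_sum: "mass (\<Sum>a\<in>A. f a) r = (\<Sum>a\<in>A. mass (f a) r)"
proof (induction A rule: infinite_finite_induct)
  have "mass 0 r = 0" using mass_smult[of 0 0 r] by simp
  then show "mass (\<Sum>a\<in>A. f a) r = (\<Sum>a\<in>A. mass (f a) r)" if "infinite A" for A using that by simp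
  show "mass (\<Sum>a\<in>{}. f a) r = (\<Sum>a\<in>{}. mass (f a) r)" using \<open>mass 0 r = 0\<close> by simp
qed (simp add: mass_add)

lemma energy_rk_step:
  "energy N H (rk_step bc N H s \<tau> v) (rk_step bc N H s \<tau> v) =
     (\<Sum>p\<le>s. \<Sum>q\<le>s. 1 / fact p * (1 / fact q) *
        energy N H ((adv bc N H \<tau> ^^ p) v) ((adv bc N H \<tau> ^^ q) v))"
proof -
  let ?E = "\<lambda>p. (adv bc N H \<tau> ^^ p) v"
  let ?R = "rk_step bc N H s \<tau> v"
  have expand: "mass (?R i) r = (\<Sum>p\<le>s. 1 / fact p * mass (?E p i) r)" for i r
    by (simp only: rk_step_def mass_sum mass_smult)
  have "mass (?R i) (?R i) = (\<Sum>p\<le>s. \<Sum>q\<le>s. 1 / fact p * (1 / fact q) * mass (?E p i) (?E q i))" for i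
  proof -
    have "mass (?E p i) (?R i) = (\<Sum>q\<le>s. 1 / fact q * mass (?E p i) (?E q i))" for p
      unfolding mass_commute[of "?E p i"] by (rule expand)
    then show ?thesis unfolding expand[of i "?R i"] by (simp only: sum_distrib_left mult.assoc)
  qed
  then have "energy N H (rk_step bc N H s \<tau> v) (rk_step bc N H s \<tau> v) =
     (\<Sum>i=1..N. \<Sum>p\<le>s. \<Sum>q\<le>s. 1 / fact p * (1 / fact q) * (H i / 2 * mass (?E p i) (?E q i)))"
    unfolding energy_def by (simp add: sum_distrib_left mult_ac)
  also have "\<dots> = (\<Sum>p\<le>s. \<Sum>i=1..N. \<Sum>q\<le>s. 1 / fact p * (1 / fact q) * (H i / 2 * mass (?E p i) (?E q i)))"
    by (rule sum.swap)
  also have "\<dots> = (\<Sum>p\<le>s. \<Sum>q\<le>s. \<Sum>i=1..N. 1 / fact p * (1 / fact q) * (H i / 2 * mass (?E p i) (?E q i)))"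
    by (intro sum.cong refl sum.swap)
  finally show ?thesis by (simp add: energy_def sum_distrib_left)
qed

text \<open>The constants may not depend on the mesh. The bound \<open>\<tau> \<le> \<Lambda> h\<close> belongs to the notion since
  the consistency estimate trades powers of \<open>\<tau>\<close> for powers of \<open>h\<close>.\<close>

definition stable_under :: "boundary \<Rightarrow> nat \<Rightarrow> real \<Rightarrow> real \<Rightarrow> (real \<Rightarrow> real \<Rightarrow> bool) \<Rightarrow> bool" where
  "stable_under bc s \<alpha> T cfl \<longleftrightarrow> (\<exists>\<Lambda>\<ge>0. \<exists>C\<ge>0. \<forall>N H h \<tau> v.
     1 \<le> N \<and> 0 < h \<and> (\<forall>i\<in>{1..N}. \<alpha> * h \<le> H i) \<and> 0 < \<tau> \<and> \<tau> \<le> T \<and> cfl \<tau> h \<and> cellwise N v \<longrightarrow>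
     \<tau> \<le> \<Lambda> * h \<and>
     energy N H (rk_step bc N H s \<tau> v) (rk_step bc N H s \<tau> v) \<le> (1 + C * \<tau>) * energy N H v v)"

text \<open>For CFL numbers that are merely bounded: no cancellation is used.\<close>

lemma tower_crude_bound:
  assumes "0 \<le> M"
  shows "\<exists>K\<ge>0. \<forall>\<mu> a I J. energy_tower \<mu> a I J \<and> \<mu> \<le> M \<longrightarrow> quad_form s c a \<le> K * a 0 0"
proof -
  define L where "L = max 1 M"
  define K where "K = (\<Sum>p\<le>s. \<Sum>q\<le>s. \<bar>c p q\<bar> * L ^ (2 * s))"
  have L: "1 \<le> L" "M \<le> L" by (auto simp: L_def)
  have "quad_form s c a \<le> K * a 0 0" if tower: "energy_tower \<mu> a I J" and le: "\<mu> \<le> M" for \<mu> a I J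
  proof -
    have \<mu>: "0 \<le> \<mu>" and nn: "\<And>p. 0 \<le> a p p" and cs: "\<And>p q. (a p q)\<^sup>2 \<le> a p p * a q q"
      using tower unfolding energy_tower_def by auto
    have dec: "a p p \<le> L ^ (2 * s) * a 0 0" if "p \<le> s" for p
    proof -
      have "a p p \<le> \<mu> ^ (2 * p) * a 0 0" using energy_tower_decay[OF tower, of 0 p] by simp
      also have "\<mu> ^ (2 * p) \<le> L ^ (2 * p)" using \<mu> le L by (intro power_mono) auto
      also have "L ^ (2 * p) \<le> L ^ (2 * s)" using that L by (intro power_increasing) auto
      finally show ?thesis using nn by (auto intro: mult_right_mono order_trans)
    qed
    have "c p q * a p q \<le> \<bar>c p q\<bar> * L ^ (2 * s) * a 0 0" if "p \<le> s" "q \<le> s" for p q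
    proof -
      have "(a p q)\<^sup>2 \<le> (L ^ (2 * s) * a 0 0) * (L ^ (2 * s) * a 0 0)"
        using cs[of p q] dec[OF that(1)] dec[OF that(2)] nn L
        by (meson mult_mono order_trans mult_nonneg_nonneg zero_le_power zero_le_one)
      then have "\<bar>a p q\<bar> \<le> \<bar>L ^ (2 * s) * a 0 0\<bar>"
        unfolding abs_le_square_iff by (simp add: power2_eq_square)
      then have "\<bar>a p q\<bar> \<le> L ^ (2 * s) * a 0 0" using L nn by (simp add: abs_mult)
      then have "\<bar>c p q\<bar> * \<bar>a p q\<bar> \<le> \<bar>c p q\<bar> * (L ^ (2 * s) * a 0 0)" by (intro mult_left_mono) auto
      moreover have "c p q * a p q \<le> \<bar>c p q\<bar> * \<bar>a p q\<bar>" by (metis abs_ge_self abs_mult)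
      ultimately show ?thesis by (simp add: mult.assoc)
    qed
    then have "quad_form s c a \<le> (\<Sum>p\<le>s. \<Sum>q\<le>s. \<bar>c p q\<bar> * L ^ (2 * s) * a 0 0)"
      unfolding quad_form_def by (intro sum_mono) auto
    also have "\<dots> = K * a 0 0" by (simp only: K_def sum_distrib_right)
    finally show ?thesis .
  qed
  moreover have "0 \<le> K" using L unfolding K_def by (intro sum_nonneg) auto
  ultimately show ?thesis by blast
qed

text \<open>By \<open>evolution_coeffs_eq\<close> the coefficients \<open>1/(p! q!)\<close> of the expanded square are \<open>\<beta>\<^sub>p \<beta>\<^sub>q /
  \<beta>\<^sub>0\<^sup>2\<close>; the term \<open>p = q = 0\<close> is the old energy.\<close>

lemma energy_rk_step_quad_form:
  assumes s: "1 \<le> s" and ev: "evolution_coeffs s \<beta>"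
  shows "energy N H (rk_step bc N H s \<tau> v) (rk_step bc N H s \<tau> v) = energy N H v v +
     quad_form s (c_matrix s \<beta> 0) (\<lambda>p q. energy N H ((adv bc N H \<tau> ^^ p) v) ((adv bc N H \<tau> ^^ q) v)) / (\<beta> 0)\<^sup>2"
proof -
  define a where "a p q = energy N H ((adv bc N H \<tau> ^^ p) v) ((adv bc N H \<tau> ^^ q) v)" for p q
  have \<beta>0: "\<beta> 0 \<noteq> 0" using ev by (auto simp: evolution_coeffs_def)
  have c0: "c_matrix s \<beta> 0 p q = (\<beta> 0)\<^sup>2 * (1 / fact p * (1 / fact q)) - (if p = 0 \<and> q = 0 then (\<beta> 0)\<^sup>2 else 0)"
    if "p \<le> s" "q \<le> s" for p q
    using evolution_coeffs_eq[OF s ev that(1)] evolution_coeffs_eq[OF s ev that(2)] that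
    by (auto simp: power2_eq_square)
  have "quad_form s (c_matrix s \<beta> 0) a =
      quad_form s (\<lambda>p q. (\<beta> 0)\<^sup>2 * (1 / fact p * (1 / fact q)) - (if p = 0 \<and> q = 0 then (\<beta> 0)\<^sup>2 else 0)) a"
    by (rule quad_form_cong) (rule c0)
  also have "\<dots> = (\<beta> 0)\<^sup>2 * (\<Sum>p\<le>s. \<Sum>q\<le>s. 1 / fact p * (1 / fact q) * a p q) -
      quad_form s (\<lambda>p q. if p = 0 \<and> q = 0 then (\<beta> 0)\<^sup>2 else 0) a"
    unfolding quad_form_diff by (simp add: quad_form_def sum_distrib_left mult.assoc)
  also have "quad_form s (\<lambda>p q. if p = 0 \<and> q = 0 then (\<beta> 0)\<^sup>2 else 0) a = (\<beta> 0)\<^sup>2 * a 0 0"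
  proof -
    have "quad_form s (\<lambda>p q. if p = 0 \<and> q = 0 then (\<beta> 0)\<^sup>2 else 0) a =
       quad_form s (\<lambda>p q. if q = 0 then (if p = 0 then (\<beta> 0)\<^sup>2 else 0) else 0) a"
      by (rule quad_form_cong) auto
    also have "\<dots> = (\<Sum>p\<le>s. (if p = 0 then (\<beta> 0)\<^sup>2 else 0) * a p 0)" by (rule quad_form_column) simp
    also have "\<dots> = (\<Sum>p\<le>s. if p = 0 then (\<beta> 0)\<^sup>2 * a p 0 else 0)" by (intro sum.cong) auto
    also have "\<dots> = (\<beta> 0)\<^sup>2 * a 0 0" by simp
    finally show ?thesis .
  qed
  finally have eq: "quad_form s (c_matrix s \<beta> 0) a / (\<beta> 0)\<^sup>2 = (\<Sum>p\<le>s. \<Sum>q\<le>s. 1 / fact p * (1 / fact q) * a p q) - a 0 0"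
    using \<beta>0 by (simp add: diff_divide_distrib)
  have a00: "a 0 0 = energy N H v v" by (simp add: a_def)
  have "energy N H (rk_step bc N H s \<tau> v) (rk_step bc N H s \<tau> v) = a 0 0 + quad_form s (c_matrix s \<beta> 0) a / (\<beta> 0)\<^sup>2"
    unfolding eq energy_rk_step a_def by linarith
  then have "energy N H (rk_step bc N H s \<tau> v) (rk_step bc N H s \<tau> v) =
      energy N H v v + quad_form s (c_matrix s \<beta> 0) a / (\<beta> 0)\<^sup>2"
    unfolding a00 .
  then show ?thesis unfolding a_def[abs_def] .
qed

text \<open>For small CFL numbers the growth rate \<open>\<mu>\<^sup>g\<close> is at most a multiple of \<open>\<tau>\<close> by the CFL
  condition. Otherwise this condition bounds \<open>\<tau>\<close> from below by some \<open>\<tau>0\<close>, and any bounded growth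
  factor is at most \<open>1 + C\<tau>\<close> with \<open>C\<close> proportional to \<open>1/\<tau>0\<close>.\<close>

lemma stable_under_power_cfl:
  assumes s: "1 \<le> s" and ev: "evolution_coeffs s \<beta>" and \<alpha>: "0 < \<alpha>" and T: "0 < T" and c: "0 < c" and g: "1 \<le> g"
    and C: "0 \<le> C" and \<mu>0: "0 < \<mu>0"
    and bound: "\<And>\<mu> a I J. energy_tower \<mu> a I J \<Longrightarrow> \<mu> \<le> \<mu>0 \<Longrightarrow> quad_form s (c_matrix s \<beta> 0) a \<le> C * \<mu> ^ g * a 0 0"
  shows "stable_under bc s \<alpha> T (\<lambda>\<tau> h. (\<tau> / h) ^ g \<le> c * \<tau>)"
proof -
  have \<beta>0: "0 < (\<beta> 0)\<^sup>2" using ev by (auto simp: evolution_coeffs_def)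
  obtain Q where Q: "0 < Q" and tower: "\<And>bc N H h \<tau> v. 1 \<le> N \<Longrightarrow> 0 < h \<Longrightarrow> (\<forall>i\<in>{1..N}. \<alpha> * h \<le> H i) \<Longrightarrow> 0 < \<tau> \<Longrightarrow> cellwise N v \<Longrightarrow>
    energy_tower (Q * (\<tau> / h))
      (\<lambda>p q. energy N H ((adv bc N H \<tau> ^^ p) v) ((adv bc N H \<tau> ^^ q) v)) {0..N}
      (\<lambda>p i. sqrt \<tau> * jump bc N ((adv bc N H \<tau> ^^ p) v) i)"
    using energy_tower_adv[OF \<alpha>] by blast
  define \<Lambda> where "\<Lambda> = max 1 (c * T)"
  have \<Lambda>: "1 \<le> \<Lambda>" by (simp add: \<Lambda>_def)
  obtain K where K: "0 \<le> K" "\<And>\<mu> a I J. energy_tower \<mu> a I J \<Longrightarrow> \<mu> \<le> Q * \<Lambda> \<Longrightarrow>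
      quad_form s (c_matrix s \<beta> 0) a \<le> K * a 0 0"
    using tower_crude_bound[of "Q * \<Lambda>" s "c_matrix s \<beta> 0"] Q \<Lambda> by force
  \<comment> \<open>The smallest time step for which the CFL condition admits the CFL number \<open>\<mu>0 / Q\<close>.\<close>
  define \<tau>0 where "\<tau>0 = (\<mu>0 / Q) ^ g / c"
  have \<tau>0: "0 < \<tau>0" using \<mu>0 Q c by (simp add: \<tau>0_def)
  define G where "G = (C * Q ^ g * c + K / \<tau>0) / (\<beta> 0)\<^sup>2"
  have G: "0 \<le> G" using C Q c K \<tau>0 \<beta>0 by (simp add: G_def)
  have "\<tau> \<le> \<Lambda> * h \<and>
     energy N H (rk_step bc N H s \<tau> v) (rk_step bc N H s \<tau> v) \<le> (1 + G * \<tau>) * energy N H v v"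
    if N: "1 \<le> N" and h: "0 < h" and H: "\<forall>i\<in>{1..N}. \<alpha> * h \<le> H i" and \<tau>: "0 < \<tau>" "\<tau> \<le> T"
      and cfl: "(\<tau> / h) ^ g \<le> c * \<tau>" and v: "cellwise N v" for N H h \<tau> v
  proof -
    define a where "a p q = energy N H ((adv bc N H \<tau> ^^ p) v) ((adv bc N H \<tau> ^^ q) v)" for p q
    have tw: "energy_tower (Q * (\<tau> / h)) a {0..N} (\<lambda>p i. sqrt \<tau> * jump bc N ((adv bc N H \<tau> ^^ p) v) i)"
      using tower[OF N h H \<tau>(1) v] unfolding a_def[abs_def] .
    have nn: "0 \<le> a 0 0" using tw unfolding energy_tower_def by blast
    have a00: "a 0 0 = energy N H v v" by (simp add: a_def)
    have pos: "0 < \<tau> / h" using \<tau> h by simp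
    have lam: "\<tau> / h \<le> \<Lambda>"
    proof (cases "\<tau> / h \<le> 1")
      case False
      then have "\<tau> / h \<le> (\<tau> / h) ^ g" using g by (intro self_le_power) auto
      also have "\<dots> \<le> c * T" using cfl \<tau> c mult_left_mono[of \<tau> T c] by linarith
      finally show ?thesis by (simp add: \<Lambda>_def)
    qed (use \<Lambda> in simp)
    have "quad_form s (c_matrix s \<beta> 0) a \<le> (C * Q ^ g * c + K / \<tau>0) * \<tau> * a 0 0"
    proof (cases "Q * (\<tau> / h) \<le> \<mu>0")
      case True
      have "quad_form s (c_matrix s \<beta> 0) a \<le> C * (Q * (\<tau> / h)) ^ g * a 0 0" by (rule bound[OF tw True])
      also have "\<dots> = C * Q ^ g * (\<tau> / h) ^ g * a 0 0" by (simp only: power_mult_distrib mult.assoc)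
      also have "\<dots> \<le> C * Q ^ g * (c * \<tau>) * a 0 0"
        using cfl C Q nn by (intro mult_right_mono mult_left_mono) auto
      also have "\<dots> = C * Q ^ g * c * \<tau> * a 0 0" by (simp only: mult.assoc)
      also have "\<dots> \<le> (C * Q ^ g * c + K / \<tau>0) * \<tau> * a 0 0"
        using K \<tau>0 \<tau> nn by (intro mult_right_mono) auto
      finally show ?thesis .
    next
      case False
      then have "\<mu>0 / Q \<le> \<tau> / h" using Q by (simp add: pos_divide_le_eq mult.commute)
      then have "(\<mu>0 / Q) ^ g \<le> (\<tau> / h) ^ g" using \<mu>0 Q by (intro power_mono) auto
      then have "(\<mu>0 / Q) ^ g \<le> \<tau> * c" using cfl by (simp add: mult.commute)
      then have "\<tau>0 \<le> \<tau>" using c by (simp add: \<tau>0_def pos_divide_le_eq)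
      then have one: "1 \<le> \<tau> / \<tau>0" using \<tau>0 by simp
      have "Q * (\<tau> / h) \<le> Q * \<Lambda>" using lam Q by (intro mult_left_mono) auto
      then have "quad_form s (c_matrix s \<beta> 0) a \<le> K * a 0 0" by (rule K(2)[OF tw])
      also have "\<dots> \<le> K * (\<tau> / \<tau>0) * a 0 0"
        using K nn one mult_left_mono[of 1 "\<tau> / \<tau>0" K] by (intro mult_right_mono) auto
      also have "\<dots> = (K / \<tau>0) * \<tau> * a 0 0" by simp
      also have "\<dots> \<le> (C * Q ^ g * c + K / \<tau>0) * \<tau> * a 0 0"
        using C Q c \<tau> nn by (intro mult_right_mono) auto
      finally show ?thesis .
    qed
    then have "quad_form s (c_matrix s \<beta> 0) a / (\<beta> 0)\<^sup>2 \<le> (C * Q ^ g * c + K / \<tau>0) * \<tau> * a 0 0 / (\<beta> 0)\<^sup>2"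
      using \<beta>0 by (intro divide_right_mono) auto
    also have "\<dots> = G * \<tau> * a 0 0" by (simp add: G_def)
    finally have "energy N H (rk_step bc N H s \<tau> v) (rk_step bc N H s \<tau> v) \<le> a 0 0 + G * \<tau> * a 0 0"
      using energy_rk_step_quad_form[OF s ev, of N H bc \<tau> v] unfolding a_def[abs_def, symmetric] a00 by linarith
    moreover have "\<tau> \<le> \<Lambda> * h" using lam h by (simp add: pos_divide_le_eq)
    ultimately show ?thesis by (simp add: a00 distrib_right)
  qed
  then show ?thesis unfolding stable_under_def using \<Lambda> G by (intro exI[of _ \<Lambda>] exI[of _ G] conjI) auto
qed

text \<open>The energy does not grow at all as long as the CFL number is below the threshold.\<close>

lemma stable_under_linear_cfl:
  assumes s: "1 \<le> s" and ev: "evolution_coeffs s \<beta>" and \<alpha>: "0 < \<alpha>" and \<mu>0: "0 < \<mu>0"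
    and bound: "\<And>\<mu> a I J. energy_tower \<mu> a I J \<Longrightarrow> \<mu> \<le> \<mu>0 \<Longrightarrow> quad_form s (c_matrix s \<beta> 0) a \<le> 0"
  shows "\<exists>c>0. stable_under bc s \<alpha> T (\<lambda>\<tau> h. \<tau> \<le> c * h)"
proof -
  obtain Q where Q: "0 < Q" and tower: "\<And>bc N H h \<tau> v. 1 \<le> N \<Longrightarrow> 0 < h \<Longrightarrow> (\<forall>i\<in>{1..N}. \<alpha> * h \<le> H i) \<Longrightarrow> 0 < \<tau> \<Longrightarrow> cellwise N v \<Longrightarrow>
    energy_tower (Q * (\<tau> / h))
      (\<lambda>p q. energy N H ((adv bc N H \<tau> ^^ p) v) ((adv bc N H \<tau> ^^ q) v)) {0..N}
      (\<lambda>p i. sqrt \<tau> * jump bc N ((adv bc N H \<tau> ^^ p) v) i)"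
    using energy_tower_adv[OF \<alpha>] by blast
  define c where "c = \<mu>0 / Q"
  have c: "0 < c" using \<mu>0 Q by (simp add: c_def)
  have "energy N H (rk_step bc N H s \<tau> v) (rk_step bc N H s \<tau> v) \<le> energy N H v v"
    if N: "1 \<le> N" and h: "0 < h" and H: "\<forall>i\<in>{1..N}. \<alpha> * h \<le> H i" and \<tau>: "0 < \<tau>"
      and cfl: "\<tau> \<le> c * h" and v: "cellwise N v" for N H h \<tau> v
  proof -
    have "Q * (\<tau> / h) \<le> \<mu>0"
      using cfl h Q by (simp add: c_def field_simps)
    then have "quad_form s (c_matrix s \<beta> 0)
        (\<lambda>p q. energy N H ((adv bc N H \<tau> ^^ p) v) ((adv bc N H \<tau> ^^ q) v)) \<le> 0"
      by (rule bound[OF tower[OF N h H \<tau> v]])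
    then show ?thesis unfolding energy_rk_step_quad_form[OF s ev]
      by (simp add: divide_nonpos_nonneg del: c_matrix.simps)
  qed
  then have "stable_under bc s \<alpha> T (\<lambda>\<tau> h. \<tau> \<le> c * h)"
    unfolding stable_under_def using c by (intro exI[of _ c] exI[of _ 0] conjI) auto
  then show ?thesis using c by blast
qed

end

section \<open>Piecewise polynomials on a mesh\<close>

locale sv_mesh = reference_cell +
  fixes N :: nat and X :: "nat \<Rightarrow> real"
  assumes N: "1 \<le> N" and X: "strict_mono_on {0..N} X"
begin

abbreviation H :: "nat \<Rightarrow> real" where "H \<equiv> cell_len X"

definition of_ref :: "nat \<Rightarrow> real \<Rightarrow> real" where
  "of_ref i \<xi> = H i / 2 * \<xi> + (X (i - 1) + X i) / 2"

definition to_ref :: "nat \<Rightarrow> real \<Rightarrow> real" where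
  "to_ref i x = (x - (X (i - 1) + X i) / 2) * (2 / H i)"

text \<open>The polynomials of a trial function in reference coordinates; they are unique since a cell
  has infinitely many points.\<close>

definition pieces :: "(real \<Rightarrow> real) \<Rightarrow> nat \<Rightarrow> real poly" where
  "pieces w i = (if i \<in> {1..N}
     then SOME p. degree p \<le> k \<and> (\<forall>x\<in>{X (i - 1)<..<X i}. w x = poly p (to_ref i x)) else 0)"

lemma H_pos: "i \<in> {1..N} \<Longrightarrow> 0 < H i"
  using X unfolding cell_len_def strict_mono_on_def by auto

lemma to_of_ref: "i \<in> {1..N} \<Longrightarrow> to_ref i (of_ref i \<xi>) = \<xi>"
  using H_pos[of i] by (simp add: to_ref_def of_ref_def)

lemma of_to_ref: "i \<in> {1..N} \<Longrightarrow> of_ref i (to_ref i x) = x"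
  using H_pos[of i] by (simp add: to_ref_def of_ref_def field_simps)

lemma of_ref_left: "of_ref i (-1) = X (i - 1)" and of_ref_right: "of_ref i 1 = X i"
  by (simp_all add: of_ref_def cell_len_def field_simps)

lemma of_ref_less: "i \<in> {1..N} \<Longrightarrow> \<xi> < \<xi>' \<Longrightarrow> of_ref i \<xi> < of_ref i \<xi>'"
  using H_pos[of i] by (simp add: of_ref_def)

lemma of_ref_le: "i \<in> {1..N} \<Longrightarrow> \<xi> \<le> \<xi>' \<Longrightarrow> of_ref i \<xi> \<le> of_ref i \<xi>'"
  using of_ref_less[of i \<xi> \<xi>'] by (cases "\<xi> = \<xi>'") auto

lemma ctrl_point_of_ref: "ctrl_point y X i j = of_ref i (y j)"
  by (simp add: ctrl_point_def of_ref_def)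

lemma X_mono: "i \<le> j \<Longrightarrow> j \<le> N \<Longrightarrow> X i \<le> X j"
  using X unfolding strict_mono_on_def by (cases "i = j") (auto intro: less_imp_le)

lemma pieces_spec:
  assumes w: "w \<in> trial_space k N X" and i: "i \<in> {1..N}"
  shows "degree (pieces w i) \<le> k" and "\<And>x. x \<in> {X (i - 1)<..<X i} \<Longrightarrow> w x = poly (pieces w i) (to_ref i x)"
proof -
  obtain p where p: "degree p \<le> k" "\<And>x. x \<in> {X (i - 1)<..<X i} \<Longrightarrow> w x = poly p x"
    using w i unfolding trial_space_def by blast
  define q where "q = pcompose p [:(X (i - 1) + X i) / 2, H i / 2:]"
  have "degree q \<le> degree p * 1" unfolding q_def
    by (rule order_trans[OF degree_pcompose_le]) (intro mult_left_mono, auto)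
  moreover have "w x = poly q (to_ref i x)" if "x \<in> {X (i - 1)<..<X i}" for x
  proof -
    have "poly q (to_ref i x) = poly p (of_ref i (to_ref i x))"
      by (simp add: q_def poly_pcompose of_ref_def mult.commute add.commute)
    then show ?thesis using p(2)[OF that] of_to_ref[OF i] by simp
  qed
  ultimately have "\<exists>p. degree p \<le> k \<and> (\<forall>x\<in>{X (i - 1)<..<X i}. w x = poly p (to_ref i x))"
    using p(1) by (intro exI[of _ q]) auto
  from someI_ex[OF this] i show "degree (pieces w i) \<le> k"
    "\<And>x. x \<in> {X (i - 1)<..<X i} \<Longrightarrow> w x = poly (pieces w i) (to_ref i x)"
    by (auto simp: pieces_def)
qed

lemma cellwise_pieces: "w \<in> trial_space k N X \<Longrightarrow> cellwise N (pieces w)"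
  unfolding cellwise_def using pieces_spec(1)[of w] by (auto simp: pieces_def)

lemma poly_to_ref_tendsto: "((\<lambda>x. poly p (to_ref i x)) \<longlongrightarrow> poly p (to_ref i z)) (at z within S)"
proof -
  have "continuous_on UNIV (\<lambda>x. poly p (to_ref i x))"
    unfolding to_ref_def by (intro continuous_intros)
  then show ?thesis using continuous_on_def continuous_within_subset
    by (metis UNIV_I continuous_on_eq_continuous_within continuous_within subset_UNIV)
qed

lemma left_lim_eq:
  assumes w: "w \<in> trial_space k N X" and i: "i \<in> {1..N}" and \<xi>: "-1 < \<xi>" "\<xi> \<le> 1"
  shows "left_lim w (of_ref i \<xi>) = poly (pieces w i) \<xi>"
proof -
  let ?z = "of_ref i \<xi>"
  have lt: "X (i - 1) < ?z" using of_ref_less[OF i \<xi>(1)] by (simp add: of_ref_left)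
  have le: "?z \<le> X i" using of_ref_le[OF i \<xi>(2)] by (simp add: of_ref_right)
  have "\<forall>\<^sub>F x in at_left ?z. x \<in> {X (i - 1)<..<?z}" by (rule eventually_at_left_real[OF lt])
  then have "\<forall>\<^sub>F x in at_left ?z. poly (pieces w i) (to_ref i x) = w x"
    by eventually_elim (use le pieces_spec(2)[OF w i] in auto)
  then have "(w \<longlongrightarrow> poly (pieces w i) (to_ref i ?z)) (at_left ?z)"
    by (rule Lim_transform_eventually[OF poly_to_ref_tendsto])
  then show ?thesis unfolding left_lim_def to_of_ref[OF i] by (intro tendsto_Lim) auto
qed

lemma right_lim_eq:
  assumes w: "w \<in> trial_space k N X" and i: "i \<in> {1..N}"
  shows "right_lim w (X (i - 1)) = poly (pieces w i) (-1)"
proof -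
  let ?z = "X (i - 1)"
  have lt: "?z < X i" using of_ref_less[OF i, of "-1" 1] by (simp add: of_ref_left of_ref_right)
  have "\<forall>\<^sub>F x in at_right ?z. x \<in> {?z<..<X i}" by (rule eventually_at_right_real[OF lt])
  then have "\<forall>\<^sub>F x in at_right ?z. poly (pieces w i) (to_ref i x) = w x"
    by eventually_elim (use pieces_spec(2)[OF w i] in auto)
  then have "(w \<longlongrightarrow> poly (pieces w i) (to_ref i ?z)) (at_right ?z)"
    by (rule Lim_transform_eventually[OF poly_to_ref_tendsto])
  moreover have "to_ref i ?z = -1" using to_of_ref[OF i, of "-1"] by (simp add: of_ref_left)
  ultimately show ?thesis unfolding right_lim_def by (intro tendsto_Lim) auto
qed

lemma poly_to_ref_deriv:
  "((\<lambda>x. poly p (to_ref i x)) has_real_derivative poly (pderiv p) (to_ref i x) * (2 / H i)) (at x within S)"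
proof -
  have "((\<lambda>x. to_ref i x) has_real_derivative 2 / H i) (at x within S)"
  proof -
    have "((\<lambda>x. x - (X (i - 1) + X i) / 2) has_real_derivative 1) (at x within S)"
      by (auto intro!: derivative_eq_intros)
    from DERIV_cmult_right[OF this, of "2 / H i"] show ?thesis unfolding to_ref_def by simp
  qed
  from DERIV_chain2[OF poly_DERIV this] show ?thesis .
qed

lemma deriv_eq:
  assumes w: "w \<in> trial_space k N X" and i: "i \<in> {1..N}" and \<xi>: "-1 < \<xi>" "\<xi> < 1"
  shows "deriv w (of_ref i \<xi>) = poly (pderiv (pieces w i)) \<xi> * (2 / H i)"
proof (rule DERIV_imp_deriv)
  have "((\<lambda>x. poly (pieces w i) (to_ref i x)) has_real_derivative
      poly (pderiv (pieces w i)) (to_ref i (of_ref i \<xi>)) * (2 / H i)) (at (of_ref i \<xi>))"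
    by (rule poly_to_ref_deriv)
  then show "(w has_real_derivative poly (pderiv (pieces w i)) \<xi> * (2 / H i)) (at (of_ref i \<xi>))"
    unfolding to_of_ref[OF i]
  proof (rule has_field_derivative_transform_within_open)
    show "of_ref i \<xi> \<in> {X (i - 1)<..<X i}"
      using of_ref_less[OF i \<xi>(1)] of_ref_less[OF i \<xi>(2)] by (simp add: of_ref_left of_ref_right)
  qed (use pieces_spec(2)[OF w i] in auto)
qed

lemma y_interior: "j \<in> {1..k} \<Longrightarrow> -1 < y j \<and> y j < 1"
  using y_strict[of 0 j] y_strict[of j "Suc k"] y_first y_last by auto

lemma star_val_eq:
  assumes w: "w \<in> trial_space k N X" and i: "i \<in> {1..N}" and "j \<le> k"
  shows "star_val meth k y X w i j = ref_star (pieces w i) j"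
  using assms(3)
proof (induction j)
  case 0
  have "0 \<notin> idx" using idx_subset by auto
  then have "weight meth k y 0 = 0" by (simp add: weight_def)
  then show ?case using right_lim_eq[OF w i] by (simp add: ref_star_def cell_weight_def)
next
  case (Suc j)
  have "cell_weight meth k y X i (Suc j) * deriv w (ctrl_point y X i (Suc j)) =
      weight meth k y (Suc j) * poly (pderiv (pieces w i)) (y (Suc j))"
    unfolding ctrl_point_of_ref using deriv_eq[OF w i, of "y (Suc j)"] y_interior[of "Suc j"] Suc.prems H_pos[OF i]
    by (simp add: cell_weight_def)
  then show ?case using Suc by (simp add: ref_star_def)
qed

text \<open>At interior points and at the right end point the left limit is the value of the polynomial
  of the cell; at the left end point it comes from the neighbouring cell or the boundary.\<close>

lemma upwind_val_eq:
  assumes v: "v \<in> trial_space k N X" and i: "i \<in> {1..N}" and j: "j \<le> Suc k"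
  shows "upwind_val bc y N X v i j =
     poly (flux_poly (pieces v i) (inflow bc N (pieces v) i)) (y j)"
proof (cases "j = 0")
  case False
  then have "-1 < y j" using y_strict[of 0 j] y_first j by auto
  moreover have "y j \<le> 1" using y_range[OF j] by simp
  ultimately have "left_lim v (ctrl_point y X i j) = poly (pieces v i) (y j)"
    unfolding ctrl_point_of_ref by (rule left_lim_eq[OF v i])
  then show ?thesis using False j by (simp add: upwind_val_def flux_poly_node)
next
  case True
  have N1: "left_lim v (X N) = poly (pieces v N) 1"
    using left_lim_eq[OF v, of N 1] N by (simp add: of_ref_right)
  have "left_lim v (X (i - 1)) = poly (pieces v (i - 1)) 1" if "i \<noteq> 1"
  proof -
    have "i - 1 \<in> {1..N}" using i that unfolding atLeastAtMost_iff by linarith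
    from left_lim_eq[OF v this, of 1] show ?thesis by (simp add: of_ref_right)
  qed
  then show ?thesis using True N1
    by (auto simp: upwind_val_def inflow_def y_first flux_poly_first ctrl_point_of_ref of_ref_left split: boundary.splits)
qed

lemma sv_form_eq:
  assumes v: "v \<in> trial_space k N X" and w: "w \<in> trial_space k N X"
  shows "\<tau> * sv_form bc meth k y N X v w = energy N H (adv bc N H \<tau> (pieces v)) (pieces w)"
proof -
  have "H i / 2 * mass (adv bc N H \<tau> (pieces v) i) (pieces w i) =
      - \<tau> * (\<Sum>j=0..k. star_val meth k y X w i j * (upwind_val bc y N X v i (j + 1) - upwind_val bc y N X v i j))"
    if i: "i \<in> {1..N}" for i
  proof -
    define W where "W = flux_poly (pieces v i) (inflow bc N (pieces v) i)"
    have "degree W \<le> Suc k" unfolding W_def by (rule flux_poly_degree[OF pieces_spec(1)[OF v i]])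
    then have "mass (pderiv W) (pieces w i) = (\<Sum>j\<le>k. ref_star (pieces w i) j * (poly W (y (Suc j)) - poly W (y j)))"
      using pieces_spec(1)[OF w i] by (rule mass_eq_star)
    also have "\<dots> = (\<Sum>j\<le>k. star_val meth k y X w i j * (upwind_val bc y N X v i (j + 1) - upwind_val bc y N X v i j))"
      using star_val_eq[OF w i] upwind_val_eq[OF v i] by (intro sum.cong refl) (auto simp: W_def)
    finally have "mass (pderiv W) (pieces w i) =
        (\<Sum>j=0..k. star_val meth k y X w i j * (upwind_val bc y N X v i (j + 1) - upwind_val bc y N X v i j))"
      by (simp only: atLeast0AtMost)
    moreover have "H i / 2 * mass (adv bc N H \<tau> (pieces v) i) (pieces w i) = - \<tau> * mass (pderiv W) (pieces w i)"
      using i H_pos[OF i] by (simp add: adv_def mass_smult ref_adv_def W_def mass_uminus)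
    ultimately show ?thesis by simp
  qed
  then show ?thesis unfolding sv_form_def energy_def
    by (simp add: sum_distrib_left sum_negf[symmetric])
qed

lemma control_volume_integral:
  assumes v: "v \<in> trial_space k N X" and i: "i \<in> {1..N}" and j: "j \<le> k" and P: "pderiv P = pieces v i"
  shows "integrable lborel (\<lambda>x. indicator {ctrl_point y X i j<..<ctrl_point y X i (j + 1)} x * v x)"
    and "(LINT x|lborel. indicator {ctrl_point y X i j<..<ctrl_point y X i (j + 1)} x * v x) =
      H i / 2 * (poly P (y (Suc j)) - poly P (y j))"
proof -
  define c d where "c = ctrl_point y X i j" and "d = ctrl_point y X i (j + 1)"
  have yy: "y j < y (Suc j)" "y j \<in> {-1..1}" "y (Suc j) \<in> {-1..1}"
    using y_strict[of j "Suc j"] y_range[of j] y_range[of "Suc j"] j by auto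
  have cd: "c < d" unfolding c_def d_def ctrl_point_of_ref using of_ref_less[OF i yy(1)] by simp
  have sub: "{c<..<d} \<subseteq> {X (i - 1)<..<X i}"
    using of_ref_le[OF i, of "-1" "y j"] of_ref_le[OF i, of "y (Suc j)" 1] yy
    by (auto simp: c_def d_def ctrl_point_of_ref of_ref_left of_ref_right)
  have eq: "indicator {c<..<d} x * v x = indicator {c<..<d} x * poly (pieces v i) (to_ref i x)" for x
    using sub pieces_spec(2)[OF v i, of x] by (auto simp: indicator_def)
  have cont: "continuous_on S (\<lambda>x. poly (pieces v i) (to_ref i x))" for S
    unfolding to_ref_def by (intro continuous_intros)
  have [measurable]: "(\<lambda>x. poly (pieces v i) (to_ref i x)) \<in> borel_measurable borel"
    by (intro borel_measurable_continuous_onI cont)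
  have int: "set_integrable lborel {c..d} (\<lambda>x. poly (pieces v i) (to_ref i x))"
    by (rule borel_integrable_atLeastAtMost') (rule cont)
  have "set_integrable lborel {c<..<d} (\<lambda>x. poly (pieces v i) (to_ref i x))"
    by (rule set_integrable_subset[OF int]) auto
  then show "integrable lborel (\<lambda>x. indicator {ctrl_point y X i j<..<ctrl_point y X i (j + 1)} x * v x)"
    unfolding set_integrable_def c_def[symmetric] d_def[symmetric] eq by simp
  have "(LINT x|lborel. indicator {c<..<d} x * v x) = (LINT x|lborel. indicator {c..d} x *\<^sub>R poly (pieces v i) (to_ref i x))"
    unfolding eq
  proof (rule integral_cong_AE)
    show "AE x in lborel. indicator {c<..<d} x * poly (pieces v i) (to_ref i x) =
        indicator {c..d} x *\<^sub>R poly (pieces v i) (to_ref i x)"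
      using AE_lborel_singleton[of c] AE_lborel_singleton[of d]
      by eventually_elim (auto simp: indicator_def)
  qed measurable
  also have "\<dots> = H i / 2 * poly P (to_ref i d) - H i / 2 * poly P (to_ref i c)"
  proof (rule integral_FTC_atLeastAtMost)
    show "c \<le> d" using cd by simp
    show "continuous_on {c..d} (\<lambda>x. poly (pieces v i) (to_ref i x))" by (rule cont)
    fix x
    have "((\<lambda>x. H i / 2 * poly P (to_ref i x)) has_real_derivative
        H i / 2 * (poly (pderiv P) (to_ref i x) * (2 / H i))) (at x within {c..d})"
      by (intro DERIV_cmult poly_to_ref_deriv)
    then show "((\<lambda>x. H i / 2 * poly P (to_ref i x)) has_vector_derivative poly (pieces v i) (to_ref i x)) (at x within {c..d})"
      using H_pos[OF i] P by (simp add: has_real_derivative_iff_has_vector_derivative)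
  qed
  finally show "(LINT x|lborel. indicator {ctrl_point y X i j<..<ctrl_point y X i (j + 1)} x * v x) =
      H i / 2 * (poly P (y (Suc j)) - poly P (y j))"
    unfolding c_def d_def ctrl_point_of_ref to_of_ref[OF i] by (simp add: right_diff_distrib)
qed

text \<open>The integral of \<open>v\<close> over a control volume is an increment of an antiderivative, so
  \<open>mass_eq_star\<close> applies on each cell.\<close>

lemma l2_inner_eq:
  assumes v: "v \<in> trial_space k N X" and w: "w \<in> trial_space k N X"
  shows "l2_inner (X 0) (X N) v (star meth k y N X w) = energy N H (pieces v) (pieces w)"
proof -
  define C where "C i j = {ctrl_point y X i j<..<ctrl_point y X i (j + 1)}" for i j
  define \<sigma> where "\<sigma> i j = star_val meth k y X w i j" for i j
  have ap: "\<exists>P. pderiv P = pieces v i \<and> degree P \<le> Suc (degree (pieces v i))" for i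
    using antiderivative_exists[of "pieces v i"] by blast
  then obtain P where P: "\<And>i. pderiv (P i) = pieces v i" "\<And>i. degree (P i) \<le> Suc (degree (pieces v i))" by metis
  have sub: "C i j \<subseteq> {X 0..X N}" if i: "i \<in> {1..N}" and j: "j \<le> k" for i j
  proof -
    have "X 0 \<le> X (i - 1)" "X i \<le> X N" using X_mono i by auto
    moreover have "X (i - 1) \<le> of_ref i (y j)" "of_ref i (y (Suc j)) \<le> X i"
      using of_ref_le[OF i, of "-1" "y j"] of_ref_le[OF i, of "y (Suc j)" 1] y_range[of j] y_range[of "Suc j"] j
      by (auto simp: of_ref_left of_ref_right)
    ultimately show ?thesis unfolding C_def ctrl_point_of_ref by auto
  qed
  have int: "integrable lborel (\<lambda>x. indicator (C i j) x * v x)" if "i \<in> {1..N}" "j \<le> k" for i j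
    unfolding C_def by (rule control_volume_integral(1)[OF v that P(1)])
  have val: "(LINT x|lborel. indicator (C i j) x * v x) = H i / 2 * (poly (P i) (y (Suc j)) - poly (P i) (y j))"
    if "i \<in> {1..N}" "j \<le> k" for i j
    unfolding C_def by (rule control_volume_integral(2)[OF v that P(1)])
  have "l2_inner (X 0) (X N) v (star meth k y N X w) =
      (LINT x|lborel. (\<Sum>i=1..N. \<Sum>j=0..k. \<sigma> i j * (indicator (C i j) x * v x)))"
    unfolding l2_inner_def set_lebesgue_integral_def
  proof (intro Bochner_Integration.integral_cong refl)
    fix x
    have "indicator {X 0..X N} x * (\<sigma> i j * (indicator (C i j) x * v x)) = \<sigma> i j * (indicator (C i j) x * v x)"
      if "i \<in> {1..N}" "j \<le> k" for i j using sub[OF that] by (auto simp: indicator_def)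
    then have "(\<Sum>i=1..N. \<Sum>j=0..k. indicator {X 0..X N} x * (\<sigma> i j * (indicator (C i j) x * v x))) =
        (\<Sum>i=1..N. \<Sum>j=0..k. \<sigma> i j * (indicator (C i j) x * v x))"
      by (intro sum.cong refl) auto
    moreover have "indicator {X 0..X N} x *\<^sub>R (v x * star meth k y N X w x) =
        (\<Sum>i=1..N. \<Sum>j=0..k. indicator {X 0..X N} x * (\<sigma> i j * (indicator (C i j) x * v x)))"
      unfolding star_def \<sigma>_def[symmetric] C_def[symmetric] real_scaleR_def
      by (simp only: sum_distrib_left mult_ac)
    ultimately show "indicator {X 0..X N} x *\<^sub>R (v x * star meth k y N X w x) =
        (\<Sum>i=1..N. \<Sum>j=0..k. \<sigma> i j * (indicator (C i j) x * v x))"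
      by (rule trans[rotated])
  qed
  also have "\<dots> = (\<Sum>i=1..N. \<Sum>j=0..k. \<sigma> i j * (LINT x|lborel. indicator (C i j) x * v x))"
  proof -
    have inner: "integrable lborel (\<lambda>x. \<sigma> i j * (indicator (C i j) x * v x))" if "i \<in> {1..N}" "j \<in> {0..k}" for i j
      using that by (intro integrable_mult_right int) auto
    have "(LINT x|lborel. (\<Sum>i=1..N. \<Sum>j=0..k. \<sigma> i j * (indicator (C i j) x * v x))) =
        (\<Sum>i=1..N. LINT x|lborel. (\<Sum>j=0..k. \<sigma> i j * (indicator (C i j) x * v x)))"
      by (intro Bochner_Integration.integral_sum Bochner_Integration.integrable_sum inner)
    also have "\<dots> = (\<Sum>i=1..N. \<Sum>j=0..k. LINT x|lborel. \<sigma> i j * (indicator (C i j) x * v x))"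
      by (intro sum.cong refl Bochner_Integration.integral_sum inner)
    also have "\<dots> = (\<Sum>i=1..N. \<Sum>j=0..k. \<sigma> i j * (LINT x|lborel. indicator (C i j) x * v x))"
      by (simp only: integral_mult_right_zero)
    finally show ?thesis .
  qed
  also have "\<dots> = (\<Sum>i=1..N. H i / 2 * mass (pieces v i) (pieces w i))"
  proof (intro sum.cong refl)
    fix i assume i: "i \<in> {1..N}"
    have dP: "degree (P i) \<le> Suc k" using P(2)[of i] pieces_spec(1)[OF v i] by linarith
    have "(\<Sum>j=0..k. \<sigma> i j * (LINT x|lborel. indicator (C i j) x * v x)) =
        (\<Sum>j\<le>k. H i / 2 * (ref_star (pieces w i) j * (poly (P i) (y (Suc j)) - poly (P i) (y j))))"
      using val[OF i] star_val_eq[OF w i] by (intro sum.cong) (auto simp: \<sigma>_def)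
    then show "(\<Sum>j=0..k. \<sigma> i j * (LINT x|lborel. indicator (C i j) x * v x)) = H i / 2 * mass (pieces v i) (pieces w i)"
      using mass_eq_star[OF dP pieces_spec(1)[OF w i]] P(1)[of i] by (simp add: sum_distrib_left)
  qed
  finally show ?thesis by (simp add: energy_def)
qed

lemma pieces_surj:
  assumes D: "cellwise N D"
  shows "\<exists>w\<in>trial_space k N X. pieces w = D"
proof -
  define w where "w x = (\<Sum>i=1..N. indicator {X (i - 1)<..<X i} x * poly (D i) (to_ref i x))" for x
  have wD: "w x = poly (D i) (to_ref i x)" if i: "i \<in> {1..N}" and x: "x \<in> {X (i - 1)<..<X i}" for i x
  proof -
    have "indicator {X (l - 1)<..<X l} x = (0::real)" if l: "l \<in> {1..N}" "l \<noteq> i" for l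
    proof (cases "l < i")
      case True
      then have "X l \<le> X (i - 1)" using i by (intro X_mono) auto
      then show ?thesis using x by (auto simp: indicator_def)
    next
      case False
      then have "X i \<le> X (l - 1)" using l by (intro X_mono) auto
      then show ?thesis using x by (auto simp: indicator_def)
    qed
    then have "w x = (\<Sum>l\<in>{i}. indicator {X (l - 1)<..<X l} x * poly (D l) (to_ref l x))"
      unfolding w_def using i by (intro sum.mono_neutral_right) auto
    also have "\<dots> = indicator {X (i - 1)<..<X i} x * poly (D i) (to_ref i x)"
      by (simp only: sum.insert finite.emptyI sum.empty empty_iff not_False_eq_True add_0_right)
    finally show ?thesis using x by simp
  qed
  have w: "w \<in> trial_space k N X"
    unfolding trial_space_def
  proof (intro CollectI ballI)
    fix i assume i: "i \<in> {1..N}"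
    define m where "m = (X (i - 1) + X i) / 2"
    define q where "q = pcompose (D i) [:- m * (2 / H i), 2 / H i:]"
    have "degree q \<le> degree (D i) * 1" unfolding q_def
      by (rule order_trans[OF degree_pcompose_le]) (intro mult_left_mono, auto)
    then have "degree q \<le> k" using D by (auto simp: cellwise_def intro: order_trans)
    moreover have "w x = poly q x" if "x \<in> {X (i - 1)<..<X i}" for x
      unfolding wD[OF i that] q_def poly_pcompose to_ref_def m_def[symmetric]
      by (simp add: left_diff_distrib diff_divide_distrib)
    ultimately show "\<exists>p. degree p \<le> k \<and> (\<forall>x\<in>{X (i - 1)<..<X i}. w x = poly p x)" by blast
  qed
  have "pieces w i = D i" for i
  proof (cases "i \<in> {1..N}")
    case True
    have "poly (pieces w i - D i) \<xi> = 0" if "\<xi> \<in> {-1<..<1}" for \<xi>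
    proof -
      have "of_ref i \<xi> \<in> {X (i - 1)<..<X i}"
        using of_ref_less[OF True, of "-1" \<xi>] of_ref_less[OF True, of \<xi> 1] that by (simp add: of_ref_left of_ref_right)
      then show ?thesis using pieces_spec(2)[OF w True, of "of_ref i \<xi>"] wD[OF True, of "of_ref i \<xi>"]
        by (simp add: to_of_ref[OF True])
    qed
    then have "{-1<..<1} \<subseteq> {\<xi>. poly (pieces w i - D i) \<xi> = 0}" by blast
    then have "infinite {\<xi>. poly (pieces w i - D i) \<xi> = 0}"
      by (rule infinite_super) (simp add: infinite_Ioo)
    then have "pieces w i - D i = 0" using poly_roots_finite by blast
    then show ?thesis by simp
  next
    case False
    then have "pieces w i = 0" unfolding pieces_def by (rule if_not_P)
    moreover have "D i = 0" using D False unfolding cellwise_def by blast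
    ultimately show ?thesis by simp
  qed
  then show ?thesis using w by blast
qed

end

section \<open>The time step as a polynomial in the operator\<close>

context reference_cell
begin

lemma smult_sum_right:
  "Polynomial.smult c (\<Sum>a\<in>A. f a) = (\<Sum>a\<in>A. Polynomial.smult c (f a :: real poly))"
  by (induction A rule: infinite_finite_induct) (simp_all add: smult_add_right)

lemma ref_adv_add: "ref_adv (p + q) (c + d) = ref_adv p c + ref_adv q d"
  by (simp add: ref_adv_def flux_poly_def pderiv_diff pderiv_add pderiv_smult)
    (simp add: smult_add_left[symmetric] smult_diff_left[symmetric] algebra_simps)

lemma ref_adv_smult: "ref_adv (Polynomial.smult a p) (a * c) = Polynomial.smult a (ref_adv p c)"
  by (simp add: ref_adv_def flux_poly_def pderiv_diff pderiv_smult smult_diff_right right_diff_distrib)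

lemma inflow_add: "inflow bc N (\<lambda>i. v i + w i) i = inflow bc N v i + inflow bc N w i"
  by (auto simp: inflow_def split: boundary.splits)

lemma inflow_smult: "inflow bc N (\<lambda>i. Polynomial.smult a (v i)) i = a * inflow bc N v i"
  by (auto simp: inflow_def split: boundary.splits)

lemma adv_add: "adv bc N H \<tau> (\<lambda>i. v i + w i) = (\<lambda>i. adv bc N H \<tau> v i + adv bc N H \<tau> w i)"
  by (auto simp: adv_def inflow_add ref_adv_add smult_add_right)

lemma adv_smult: "adv bc N H \<tau> (\<lambda>i. Polynomial.smult a (v i)) = (\<lambda>i. Polynomial.smult a (adv bc N H \<tau> v i))"
  by (auto simp: adv_def inflow_smult ref_adv_smult mult_ac)

lemma adv_zero: "adv bc N H \<tau> (\<lambda>i. 0) = (\<lambda>i. 0)"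
  using adv_smult[of bc N H \<tau> 0 "\<lambda>i. 0"] by simp

lemma adv_sum: "adv bc N H \<tau> (\<lambda>i. \<Sum>a\<in>A. f a i) = (\<lambda>i. \<Sum>a\<in>A. adv bc N H \<tau> (f a) i)"
  by (induction A rule: infinite_finite_induct) (simp_all add: adv_zero adv_add)

lemma adv_diff: "adv bc N H \<tau> (\<lambda>i. v i - w i) = (\<lambda>i. adv bc N H \<tau> v i - adv bc N H \<tau> w i)"
  using adv_add[of bc N H \<tau> v "\<lambda>i. Polynomial.smult (-1) (w i)"] by (simp add: adv_smult[of _ _ _ _ "-1", simplified])

lemma energy_add: "energy N H (\<lambda>i. v i + w i) z = energy N H v z + energy N H w z"
  by (simp add: energy_def mass_add sum.distrib distrib_left)

lemma energy_smult: "energy N H (\<lambda>i. Polynomial.smult c (v i)) z = c * energy N H v z"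
  by (simp add: energy_def mass_smult sum_distrib_left mult_ac)

lemma energy_zero: "energy N H (\<lambda>i. 0) z = 0"
  using energy_smult[of N H 0 "\<lambda>i. 0" z] by simp

lemma energy_sum: "energy N H (\<lambda>i. \<Sum>a\<in>A. f a i) z = (\<Sum>a\<in>A. energy N H (f a) z)"
  by (induction A rule: infinite_finite_induct) (simp_all add: energy_zero energy_add)

lemma energy_diff: "energy N H (\<lambda>i. v i - w i) z = energy N H v z - energy N H w z"
  using energy_add[of N H v "\<lambda>i. Polynomial.smult (-1) (w i)" z] energy_smult[of N H "-1" w z] by simp

lemma energy_definite:
  assumes H: "\<And>i. i \<in> {1..N} \<Longrightarrow> 0 < H i" and v: "cellwise N v" and zero: "energy N H v v = 0"
  shows "v = (\<lambda>i. 0)"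
proof
  fix i
  show "v i = 0"
  proof (cases "i \<in> {1..N}")
    case True
    have "\<forall>i\<in>{1..N}. H i / 2 * mass (v i) (v i) = 0"
      using zero H mass_nonneg unfolding energy_def
      by (subst (asm) sum_nonneg_eq_0_iff) (auto intro!: mult_nonneg_nonneg simp: less_imp_le)
    then have "H i / 2 * mass (v i) (v i) = 0" using True by (rule bspec)
    then have "mass (v i) (v i) = 0" using H[OF True] by simp
    then show ?thesis by (rule mass_eq_0)
  qed (use v in \<open>auto simp: cellwise_def\<close>)
qed

text \<open>\<open>P(\<tau>L) v\<close> for polynomials \<open>P\<close> of degree at most \<open>s\<close>. The fixed range of summation makes the
  expression linear in \<open>P\<close>.\<close>

definition act :: "boundary \<Rightarrow> nat \<Rightarrow> (nat \<Rightarrow> real) \<Rightarrow> real \<Rightarrow> nat \<Rightarrow> real poly \<Rightarrow> (nat \<Rightarrow> real poly) \<Rightarrow> nat \<Rightarrow> real poly" where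
  "act bc N H \<tau> s P v i = (\<Sum>m\<le>s. Polynomial.smult (coeff P m) ((adv bc N H \<tau> ^^ m) v i))"

lemma act_add: "act bc N H \<tau> s (P + Q) v i = act bc N H \<tau> s P v i + act bc N H \<tau> s Q v i"
  by (simp add: act_def smult_add_left sum.distrib)

lemma act_smult: "act bc N H \<tau> s (Polynomial.smult c P) v i = Polynomial.smult c (act bc N H \<tau> s P v i)"
  by (simp add: act_def smult_sum_right)

lemma act_sum: "act bc N H \<tau> s (\<Sum>a\<in>A. f a) v i = (\<Sum>a\<in>A. act bc N H \<tau> s (f a) v i)"
proof (induction A rule: infinite_finite_induct)
qed (simp_all add: act_add, simp_all add: act_def)

lemma act_one: "act bc N H \<tau> s 1 v i = v i"
proof -
  have "act bc N H \<tau> s 1 v i = (\<Sum>m\<le>s. if m = 0 then v i else 0)"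
    unfolding act_def by (intro sum.cong refl) auto
  then show ?thesis by simp
qed

lemma act_shift:
  assumes "degree P < s"
  shows "act bc N H \<tau> s ([:0, 1:] * P) v = adv bc N H \<tau> (act bc N H \<tau> s P v)"
proof
  fix i
  have "adv bc N H \<tau> (act bc N H \<tau> s P v) i =
      (\<Sum>m\<le>s. Polynomial.smult (coeff P m) ((adv bc N H \<tau> ^^ Suc m) v i))"
    unfolding act_def[abs_def] adv_sum adv_smult by simp
  also have "\<dots> = (\<Sum>m<s. Polynomial.smult (coeff P m) ((adv bc N H \<tau> ^^ Suc m) v i))"
    using assms by (simp add: lessThan_Suc_atMost[symmetric] coeff_eq_0)
  also have "\<dots> = act bc N H \<tau> s ([:0, 1:] * P) v i"
    unfolding act_def sum.atMost_shift by simp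
  finally show "act bc N H \<tau> s ([:0, 1:] * P) v i = adv bc N H \<tau> (act bc N H \<tau> s P v) i" by simp
qed

end

context sv_mesh
begin

text \<open>As every family of polynomials belongs to a trial function, the weak relations of the scheme
  are equations between piecewise polynomials.\<close>

lemma zero_if_tested:
  assumes D: "cellwise N D" and test: "\<And>w. w \<in> trial_space k N X \<Longrightarrow> energy N H D (pieces w) = 0"
  shows "D = (\<lambda>i. 0)"
proof -
  obtain w where "w \<in> trial_space k N X" "pieces w = D" using pieces_surj[OF D] by blast
  then have "energy N H D D = 0" using test by metis
  then show ?thesis using H_pos D by (intro energy_definite[of N H D])
qed

text \<open>Removing the test functions, the stages below \<open>s\<close> become \<open>(1 + \<tau>L)\<^sup>l\<close> applied to the old
  value, and the last one becomes \<open>rk_poly\<close>, which is the Taylor polynomial of the exponential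
  function.\<close>

lemma scheme_step:
  assumes sol: "rksv_solution bc meth s k y N X M \<tau> u0 U" and s: "1 \<le> s" and n: "n < M"
  shows "pieces (U (n + 1) 0) = rk_step bc N H s \<tau> (pieces (U n 0))"
proof -
  define v where "v l = pieces (U n l)" for l
  define g where "g = rk_coeff (s - 1)"
  have tr: "U n l \<in> trial_space k N X" if "l \<le> s" for l
    using sol n that unfolding rksv_solution_def Let_def by blast
  have cw: "cellwise N (v l)" if "l \<le> s" for l unfolding v_def by (rule cellwise_pieces[OF tr[OF that]])
  have stages: "(\<forall>l. l + 2 \<le> s \<longrightarrow> l2_inner (X 0) (X N) (U n (l + 1)) (star meth k y N X w) =
        l2_inner (X 0) (X N) (U n l) (star meth k y N X w) + \<tau> * sv_form bc meth k y N X (U n l) w) \<and>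
      l2_inner (X 0) (X N) (U n s) (star meth k y N X w) =
        (\<Sum>\<kappa><s. g \<kappa> * l2_inner (X 0) (X N) (U n \<kappa>) (star meth k y N X w)) +
        \<tau> * g (s - 1) * sv_form bc meth k y N X (U n (s - 1)) w"
    if "w \<in> trial_space k N X" for w
    using sol n that unfolding rksv_solution_def Let_def g_def by blast
  have stage: "v (l + 1) = (\<lambda>i. v l i + adv bc N H \<tau> (v l) i)" if l: "l + 2 \<le> s" for l
  proof -
    let ?D = "\<lambda>i. v (l + 1) i - (v l i + adv bc N H \<tau> (v l) i)"
    have ll: "l \<le> s" "l + 1 \<le> s" using l by auto
    have "?D = (\<lambda>i. 0)"
    proof (rule zero_if_tested)
      show "cellwise N ?D"
        using cw[OF ll(1)] cw[OF ll(2)] cellwise_adv[OF cw[OF ll(1)], of bc H \<tau>]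
        by (auto simp: cellwise_def intro!: degree_diff_le degree_add_le)
      fix w assume w: "w \<in> trial_space k N X"
      have e: "l2_inner (X 0) (X N) (U n l) (star meth k y N X w) = energy N H (v l) (pieces w)" if "l \<le> s" for l
        unfolding v_def by (rule l2_inner_eq[OF tr[OF that] w])
      have "\<tau> * sv_form bc meth k y N X (U n l) w = energy N H (adv bc N H \<tau> (v l)) (pieces w)"
        unfolding v_def by (rule sv_form_eq[OF tr[OF ll(1)] w])
      moreover have "l2_inner (X 0) (X N) (U n (l + 1)) (star meth k y N X w) =
          l2_inner (X 0) (X N) (U n l) (star meth k y N X w) + \<tau> * sv_form bc meth k y N X (U n l) w"
        using stages[OF w] l by blast
      ultimately have "energy N H (v (l + 1)) (pieces w) = energy N H (v l) (pieces w) + energy N H (adv bc N H \<tau> (v l)) (pieces w)"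
        unfolding e[OF ll(1)] e[OF ll(2)] by simp
      then show "energy N H ?D (pieces w) = 0" by (simp add: energy_diff energy_add)
    qed
    then show ?thesis by (simp add: fun_eq_iff)
  qed
  have last: "v s = (\<lambda>i. (\<Sum>\<kappa><s. Polynomial.smult (g \<kappa>) (v \<kappa> i)) + Polynomial.smult (g (s - 1)) (adv bc N H \<tau> (v (s - 1)) i))"
  proof -
    let ?L = "\<lambda>i. (\<Sum>\<kappa><s. Polynomial.smult (g \<kappa>) (v \<kappa> i)) + Polynomial.smult (g (s - 1)) (adv bc N H \<tau> (v (s - 1)) i)"
    let ?D = "\<lambda>i. v s i - ?L i"
    have "?D = (\<lambda>i. 0)"
    proof (rule zero_if_tested)
      have "cellwise N ?L"
        using cw cellwise_adv[OF cw[of "s - 1"], of bc H \<tau>]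
        by (auto simp: cellwise_def intro!: degree_add_le degree_sum_le intro: degree_smult_le[THEN order_trans] sum.neutral)
      then show "cellwise N ?D"
        using cw[of s] by (auto simp: cellwise_def intro!: degree_diff_le)
      fix w assume w: "w \<in> trial_space k N X"
      have e: "l2_inner (X 0) (X N) (U n l) (star meth k y N X w) = energy N H (v l) (pieces w)" if "l \<le> s" for l
        unfolding v_def by (rule l2_inner_eq[OF tr[OF that] w])
      have "energy N H (v s) (pieces w) = (\<Sum>\<kappa><s. g \<kappa> * energy N H (v \<kappa>) (pieces w)) +
          g (s - 1) * energy N H (adv bc N H \<tau> (v (s - 1))) (pieces w)"
      proof -
        have "\<tau> * sv_form bc meth k y N X (U n (s - 1)) w = energy N H (adv bc N H \<tau> (v (s - 1))) (pieces w)"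
          unfolding v_def by (rule sv_form_eq[OF tr w]) simp
        then have "\<tau> * g (s - 1) * sv_form bc meth k y N X (U n (s - 1)) w =
            g (s - 1) * energy N H (adv bc N H \<tau> (v (s - 1))) (pieces w)"
          by (metis mult.assoc mult.commute)
        moreover have "(\<Sum>\<kappa><s. g \<kappa> * l2_inner (X 0) (X N) (U n \<kappa>) (star meth k y N X w)) =
            (\<Sum>\<kappa><s. g \<kappa> * energy N H (v \<kappa>) (pieces w))"
          using e by (intro sum.cong refl) auto
        ultimately show ?thesis using stages[OF w] e[of s] by simp
      qed
      then show "energy N H ?D (pieces w) = 0" by (simp add: energy_diff energy_add energy_sum energy_smult)
    qed
    then show ?thesis by (simp add: fun_eq_iff)
  qed
  have act_stage: "v l = act bc N H \<tau> s ([:1, 1:] ^ l) (v 0)" if "l < s" for l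
    using that
  proof (induction l)
    case 0
    show ?case by (simp add: act_one fun_eq_iff)
  next
    case (Suc l)
    have "[:1, 1:] ^ Suc l = [:1, 1:] ^ l + [:0, 1:] * [:1, 1::real:] ^ l"
    proof -
      have "[:1, 1:] = 1 + [:0, 1::real:]" by (simp add: one_pCons)
      then show ?thesis by (simp only: power_Suc distrib_right mult_1)
    qed
    moreover have "degree ([:1, 1::real:] ^ l) < s" using Suc.prems by (simp add: degree_linear_power[of 1] degree_power_eq)
    ultimately have "act bc N H \<tau> s ([:1, 1:] ^ Suc l) (v 0) =
        (\<lambda>i. act bc N H \<tau> s ([:1, 1:] ^ l) (v 0) i + adv bc N H \<tau> (act bc N H \<tau> s ([:1, 1:] ^ l) (v 0)) i)"
      by (simp only: act_shift[symmetric]) (simp only: act_add[abs_def])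
    then show ?case using Suc stage[of l] by simp
  qed
  have "v s = act bc N H \<tau> s (rk_poly (s - 1)) (v 0)"
  proof
    fix i
    have S: "{..s - 1} = {..<s}" using s by auto
    define Q where "Q = [:0, 1::real:] * [:1, 1:] ^ (s - 1)"
    have "rk_poly (s - 1) = (\<Sum>\<kappa><s. Polynomial.smult (g \<kappa>) ([:1, 1:] ^ \<kappa>)) + Polynomial.smult (g (s - 1)) Q"
      unfolding rk_poly_def S g_def Q_def ..
    then have split: "act bc N H \<tau> s (rk_poly (s - 1)) (v 0) i =
        act bc N H \<tau> s (\<Sum>\<kappa><s. Polynomial.smult (g \<kappa>) ([:1, 1:] ^ \<kappa>)) (v 0) i +
        Polynomial.smult (g (s - 1)) (act bc N H \<tau> s Q (v 0) i)"
      by (metis act_add act_smult)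
    have stages_act: "act bc N H \<tau> s (\<Sum>\<kappa><s. Polynomial.smult (g \<kappa>) ([:1, 1:] ^ \<kappa>)) (v 0) i =
        (\<Sum>\<kappa><s. Polynomial.smult (g \<kappa>) (v \<kappa> i))"
      unfolding act_sum
    proof (rule sum.cong[OF refl])
      fix \<kappa> assume "\<kappa> \<in> {..<s}"
      then have "v \<kappa> = act bc N H \<tau> s ([:1, 1:] ^ \<kappa>) (v 0)" by (intro act_stage) simp
      then show "act bc N H \<tau> s (Polynomial.smult (g \<kappa>) ([:1, 1:] ^ \<kappa>)) (v 0) i = Polynomial.smult (g \<kappa>) (v \<kappa> i)"
        unfolding act_smult by (rule arg_cong[OF sym, OF fun_cong])
    qed
    have "degree ([:1, 1::real:] ^ (s - 1)) < s" using s by (simp add: degree_power_eq)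
    then have "act bc N H \<tau> s Q (v 0) = adv bc N H \<tau> (act bc N H \<tau> s ([:1, 1:] ^ (s - 1)) (v 0))"
      unfolding Q_def by (rule act_shift)
    moreover have "v (s - 1) = act bc N H \<tau> s ([:1, 1:] ^ (s - 1)) (v 0)"
      using s by (intro act_stage) simp
    ultimately have Q_act: "act bc N H \<tau> s Q (v 0) i = adv bc N H \<tau> (v (s - 1)) i" by metis
    show "v s i = act bc N H \<tau> s (rk_poly (s - 1)) (v 0) i"
      unfolding split stages_act Q_act by (rule fun_cong[OF last])
  qed
  moreover have "rk_poly (s - 1) = texp s" using rk_poly_eq_texp[of "s - 1"] s by simp
  moreover have "act bc N H \<tau> s (texp s) (v 0) = rk_step bc N H s \<tau> (v 0)"
    by (simp add: fun_eq_iff act_def rk_step_def coeff_texp)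
  ultimately have "v s = rk_step bc N H s \<tau> (v 0)" by metis
  moreover have "U (n + 1) 0 = U n s" using sol n unfolding rksv_solution_def Let_def by blast
  ultimately show ?thesis by (simp add: v_def)
qed

end

section \<open>Consistency of the discrete operator\<close>

text \<open>The Lipschitz constant of the last derivative takes the place of a bound for a derivative of
  order \<open>n + 1\<close>.\<close>

lemma taylor_lipschitz:
  fixes w :: "nat \<Rightarrow> real \<Rightarrow> real"
  assumes "\<And>j x. j < n \<Longrightarrow> x \<in> {c..d} \<Longrightarrow> (w j has_real_derivative w (Suc j) x) (at x within {c..d})"
    and "\<And>x z. x \<in> {c..d} \<Longrightarrow> z \<in> {c..d} \<Longrightarrow> \<bar>w n x - w n z\<bar> \<le> K * \<bar>x - z\<bar>" and "0 \<le> K"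
    and "x \<in> {c..d}" "x0 \<in> {c..d}"
  shows "\<bar>w 0 x - (\<Sum>l\<le>n. w l x0 * (x - x0) ^ l / fact l)\<bar> \<le> K * \<bar>x - x0\<bar> ^ Suc n"
  using assms
proof (induction n arbitrary: w x)
  case 0
  then show ?case by simp
next
  case (Suc n)
  define S where "S = {min x x0..max x x0}"
  have S: "S \<subseteq> {c..d}" "x \<in> S" "x0 \<in> S" using Suc.prems(4,5) by (auto simp: S_def)
  define \<phi> where "\<phi> z = w 0 z - (\<Sum>l\<le>Suc n. w l x0 * (z - x0) ^ l / fact l)" for z
  define \<phi>' where "\<phi>' z = w (Suc 0) z - (\<Sum>l\<le>n. w (Suc l) x0 * (z - x0) ^ l / fact l)" for z
  have poly_deriv: "((\<lambda>z. \<Sum>l\<le>Suc n. w l x0 * (z - x0) ^ l / fact l) has_real_derivative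
      (\<Sum>l\<le>n. w (Suc l) x0 * (z - x0) ^ l / fact l)) (at z within S)" for z
  proof -
    have "((\<lambda>z. w (Suc l) x0 * (z - x0) ^ Suc l / fact (Suc l)) has_real_derivative
        w (Suc l) x0 * (z - x0) ^ l / fact l) (at z within S)" for l
    proof -
      have "((\<lambda>z. (z - x0) ^ Suc l) has_real_derivative real (Suc l) * (z - x0) ^ l) (at z within S)"
      proof -
        have "((\<lambda>z. z - x0) has_real_derivative 1) (at z within S)" by (auto intro!: derivative_eq_intros)
        from DERIV_power_Suc[OF this, of l] show ?thesis by simp
      qed
      then have "((\<lambda>z. w (Suc l) x0 / fact (Suc l) * (z - x0) ^ Suc l) has_real_derivative
          w (Suc l) x0 / fact (Suc l) * (real (Suc l) * (z - x0) ^ l)) (at z within S)"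
        by (rule DERIV_cmult)
      moreover have "w (Suc l) x0 / fact (Suc l) * (real (Suc l) * (z - x0) ^ l) = w (Suc l) x0 * (z - x0) ^ l / fact l"
        unfolding fact_Suc by (simp del: of_nat_Suc)
      ultimately show ?thesis by simp
    qed
    then have "((\<lambda>z. \<Sum>l\<le>n. w (Suc l) x0 * (z - x0) ^ Suc l / fact (Suc l)) has_real_derivative
        (\<Sum>l\<le>n. w (Suc l) x0 * (z - x0) ^ l / fact l)) (at z within S)"
      by (intro DERIV_sum)
    then have "((\<lambda>z. w 0 x0 + (\<Sum>l\<le>n. w (Suc l) x0 * (z - x0) ^ Suc l / fact (Suc l))) has_real_derivative
        0 + (\<Sum>l\<le>n. w (Suc l) x0 * (z - x0) ^ l / fact l)) (at z within S)"
      by (intro DERIV_add DERIV_const)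
    then show ?thesis unfolding sum.atMost_Suc_shift by simp
  qed
  have deriv: "(\<phi> has_real_derivative \<phi>' z) (at z within S)" if "z \<in> S" for z
    unfolding \<phi>_def \<phi>'_def using that S
    by (intro DERIV_diff poly_deriv DERIV_subset[OF Suc.prems(1)]) auto
  have bound: "\<bar>\<phi>' z\<bar> \<le> K * \<bar>x - x0\<bar> ^ Suc n" if "z \<in> S" for z
  proof -
    have "\<bar>w (Suc 0) z - (\<Sum>l\<le>n. w (Suc l) x0 * (z - x0) ^ l / fact l)\<bar> \<le> K * \<bar>z - x0\<bar> ^ Suc n"
      using that S Suc.prems by (intro Suc.IH[of "\<lambda>j. w (Suc j)" z]) auto
    also have "\<dots> \<le> K * \<bar>x - x0\<bar> ^ Suc n"
      using that Suc.prems(3) by (intro mult_left_mono power_mono) (auto simp: S_def)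
    finally show ?thesis by (simp add: \<phi>'_def)
  qed
  have "norm (\<phi> x - \<phi> x0) \<le> K * \<bar>x - x0\<bar> ^ Suc n * norm (x - x0)"
    by (rule field_differentiable_bound[of S \<phi> \<phi>']) (use S deriv bound in \<open>auto simp: S_def\<close>)
  moreover have "\<phi> x0 = 0" unfolding \<phi>_def sum.atMost_Suc_shift by simp
  ultimately show ?case by (simp add: \<phi>_def mult_ac)
qed

lemma profile_parts:
  assumes "smooth_profile bc a b T K n w"
  shows "j < n \<Longrightarrow> x \<in> {a - T..b} \<Longrightarrow> (w j has_real_derivative w (Suc j) x) (at x within {a - T..b})"
    and "j \<le> n \<Longrightarrow> x \<in> {a - T..b} \<Longrightarrow> z \<in> {a - T..b} \<Longrightarrow> \<bar>w j x - w j z\<bar> \<le> K * \<bar>x - z\<bar>"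
    and "j \<le> n \<Longrightarrow> x \<in> {a - T..a} \<Longrightarrow> w j x = (case bc of Zero_Inflow \<Rightarrow> 0 | Periodic \<Rightarrow> w j (x + (b - a)))"
  using assms unfolding smooth_profile_def by blast+

lemma profile_taylor:
  assumes p: "smooth_profile bc a b T K n w" and K: "0 \<le> K" and jl: "j + l \<le> n"
    and x: "x \<in> {a - T..b}" "x0 \<in> {a - T..b}"
  shows "\<bar>w j x - (\<Sum>i\<le>l. w (j + i) x0 * (x - x0) ^ i / fact i)\<bar> \<le> K * \<bar>x - x0\<bar> ^ Suc l"
  using taylor_lipschitz[of l "a - T" b "\<lambda>i. w (j + i)" K x x0] profile_parts[OF p] K jl x by simp

text \<open>The Taylor polynomial about the left end point of a cell of length \<open>2r\<close> with derivatives \<open>c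
  l\<close>, in reference coordinates.\<close>

definition taylor_poly :: "(nat \<Rightarrow> real) \<Rightarrow> real \<Rightarrow> nat \<Rightarrow> real poly" where
  "taylor_poly c r n = (\<Sum>l\<le>n. Polynomial.smult (c l * r ^ l / fact l) ([:1, 1:] ^ l))"

lemma poly_taylor_poly: "poly (taylor_poly c r n) \<xi> = (\<Sum>l\<le>n. c l * (r * (\<xi> + 1)) ^ l / fact l)"
  by (simp add: taylor_poly_def poly_sum power_mult_distrib add.commute mult.assoc)

lemma degree_taylor_poly: "degree (taylor_poly c r n) \<le> n"
  unfolding taylor_poly_def
  by (intro degree_sum_le) (auto intro!: degree_smult_le[THEN order_trans] simp: degree_power_eq)

lemma pderiv_taylor_poly:
  "pderiv (taylor_poly c r (Suc n)) = Polynomial.smult r (taylor_poly (\<lambda>l. c (Suc l)) r n)"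
proof -
  have "pderiv (taylor_poly c r (Suc n)) = (\<Sum>l\<le>Suc n. Polynomial.smult (c l * r ^ l / fact l) (pderiv ([:1, 1:] ^ l)))"
    unfolding taylor_poly_def by (simp only: higher_pderiv_sum[of 1, simplified] pderiv_smult)
  also have "\<dots> = (\<Sum>l\<le>n. Polynomial.smult (c (Suc l) * r ^ Suc l / fact (Suc l)) (pderiv ([:1, 1:] ^ Suc l)))"
    unfolding sum.atMost_Suc_shift by simp
  also have "\<dots> = (\<Sum>l\<le>n. Polynomial.smult r (Polynomial.smult (c (Suc l) * r ^ l / fact l) ([:1, 1:] ^ l)))"
  proof (intro sum.cong refl)
    fix l
    have eq: "c (Suc l) * r ^ Suc l / fact (Suc l) * real (Suc l) = r * (c (Suc l) * r ^ l / fact l)"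
      unfolding fact_Suc by (simp del: of_nat_Suc)
    show "Polynomial.smult (c (Suc l) * r ^ Suc l / fact (Suc l)) (pderiv ([:1, 1:] ^ Suc l)) =
        Polynomial.smult r (Polynomial.smult (c (Suc l) * r ^ l / fact l) ([:1, 1:] ^ l))"
      unfolding pderiv_linear_power smult_smult eq ..
  qed
  also have "\<dots> = Polynomial.smult r (taylor_poly (\<lambda>l. c (Suc l)) r n)"
    unfolding taylor_poly_def by (induction n) (simp_all add: smult_add_right)
  finally show ?thesis .
qed

context sv_mesh
begin

text \<open>The Lagrange projection in reference coordinates.\<close>

definition interp :: "(real \<Rightarrow> real) \<Rightarrow> nat \<Rightarrow> real poly" where
  "interp f i = (if i \<in> {1..N}
     then \<Sum>m\<in>{1..Suc k}. Polynomial.smult (f (of_ref i (y m))) (lagr y {1..Suc k} m) else 0)"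

lemma y_inj': "inj_on y {1..Suc k}"
  using y_inj by (rule inj_on_subset) auto

lemma interp_degree: "degree (interp f i) \<le> k"
proof -
  have "degree (lagr y {1..Suc k} m) \<le> k" if "m \<in> {1..Suc k}" for m
    using degree_lagr[of "{1..Suc k}" m y] that by simp
  then have "degree (\<Sum>m\<in>{1..Suc k}. Polynomial.smult (f (of_ref i (y m))) (lagr y {1..Suc k} m)) \<le> k"
    by (intro degree_sum_le degree_smult_le[THEN order_trans]) auto
  then show ?thesis unfolding interp_def by simp
qed

lemma interp_node:
  assumes "i \<in> {1..N}" "j \<in> {1..Suc k}"
  shows "poly (interp f i) (y j) = f (of_ref i (y j))"
proof -
  have "poly (interp f i) (y j) = (\<Sum>m\<in>{1..Suc k}. f (of_ref i (y m)) * poly (lagr y {1..Suc k} m) (y j))"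
    using assms by (simp add: interp_def poly_sum)
  also have "\<dots> = (\<Sum>m\<in>{1..Suc k}. if m = j then f (of_ref i (y m)) else 0)"
    using assms y_inj' by (intro sum.cong refl) (auto simp: poly_lagr_node)
  also have "\<dots> = f (of_ref i (y j))" using assms by simp
  finally show ?thesis .
qed

lemma interp_last: "i \<in> {1..N} \<Longrightarrow> poly (interp f i) 1 = f (X i)"
  using interp_node[of i "Suc k" f] y_last of_ref_right[of i] by simp

lemma cellwise_interp: "cellwise N (interp f)"
  unfolding cellwise_def using interp_degree by (auto simp: interp_def)

lemma interp_unique:
  assumes "cellwise N v" and "\<And>i j. i \<in> {1..N} \<Longrightarrow> j \<in> {1..Suc k} \<Longrightarrow> poly (v i) (y j) = f (of_ref i (y j))"
  shows "v = interp f"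
proof
  fix i
  show "v i = interp f i"
  proof (cases "i \<in> {1..N}")
    case True
    have "v i - interp f i = 0"
    proof (rule poly_zero_if_roots[of "{1..Suc k}" y])
      have "degree (v i - interp f i) \<le> k"
        using assms(1) interp_degree by (intro degree_diff_le) (auto simp: cellwise_def)
      then show "v i - interp f i = 0 \<or> degree (v i - interp f i) < card {1..Suc k}" by simp
    qed (use assms(2)[OF True] interp_node[OF True] y_inj' in auto)
    then show ?thesis by simp
  qed (use assms(1) in \<open>auto simp: cellwise_def interp_def\<close>)
qed

lemma pieces_lagrange_projection:
  assumes "lagrange_projection k y N X f pv"
  shows "pieces pv = interp f"
proof (rule interp_unique)
  have pv: "pv \<in> trial_space k N X" using assms by (simp add: lagrange_projection_def)
  then show "cellwise N (pieces pv)" by (rule cellwise_pieces)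
  fix i j assume ij: "i \<in> {1..N}" "j \<in> {1..Suc k}"
  have "-1 < y j" "y j \<le> 1" using y_strict[of 0 j] y_first y_range[of j] ij by auto
  then have "left_lim pv (of_ref i (y j)) = poly (pieces pv i) (y j)" by (rule left_lim_eq[OF pv ij(1)])
  then show "poly (pieces pv i) (y j) = f (of_ref i (y j))"
    using assms ij unfolding lagrange_projection_def ctrl_point_of_ref by simp
qed

lemma sum_H: "(\<Sum>i=1..N. H i) = X N - X 0"
proof -
  have "(\<Sum>i=1..n. H i) = X n - X 0" for n
    by (induction n) (auto simp: cell_len_def)
  then show ?thesis .
qed

lemma enorm_bound:
  assumes "\<And>i. i \<in> {1..N} \<Longrightarrow> mass (v i) (v i) \<le> B\<^sup>2" and "0 \<le> B"
  shows "enorm N H v \<le> sqrt (X N - X 0) * B"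
proof -
  have "energy N H v v \<le> (\<Sum>i=1..N. H i * B\<^sup>2)"
    unfolding energy_def
  proof (intro sum_mono)
    fix i assume i: "i \<in> {1..N}"
    have "H i / 2 * mass (v i) (v i) \<le> H i / 2 * B\<^sup>2"
      using H_pos[OF i] assms(1)[OF i] by (intro mult_left_mono) auto
    also have "\<dots> \<le> H i * B\<^sup>2" using H_pos[OF i] by (intro mult_right_mono) auto
    finally show "H i / 2 * mass (v i) (v i) \<le> H i * B\<^sup>2" .
  qed
  also have "\<dots> = (X N - X 0) * B\<^sup>2" by (simp only: sum_distrib_right[symmetric] sum_H)
  finally have "enorm N H v \<le> sqrt ((X N - X 0) * B\<^sup>2)" unfolding enorm_def by (rule real_sqrt_le_mono)
  then show ?thesis using assms(2) by (simp add: real_sqrt_mult)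
qed

lemma of_ref_range:
  assumes "i \<in> {1..N}" "\<xi> \<in> {-1..1}"
  shows "of_ref i \<xi> \<in> {X (i - 1)..X i}" and "of_ref i \<xi> \<in> {X 0..X N}"
proof -
  show *: "of_ref i \<xi> \<in> {X (i - 1)..X i}"
    using of_ref_le[OF assms(1), of "-1" \<xi>] of_ref_le[OF assms(1), of \<xi> 1] assms
    by (auto simp: of_ref_left of_ref_right)
  have "X 0 \<le> X (i - 1)" "X i \<le> X N" using X_mono assms(1) by auto
  then show "of_ref i \<xi> \<in> {X 0..X N}" using * by auto
qed

lemma of_ref_shift: "of_ref i \<xi> - X (i - 1) = H i / 2 * (\<xi> + 1)"
  by (simp add: of_ref_def cell_len_def field_simps)

text \<open>The Lagrange projection of \<open>\<partial>\<^sub>t\<^sup>j u = (-1)\<^sup>j w j (x - t)\<close>. Beyond order \<open>k + 1\<close> no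
  derivative is at hand; \<open>0\<close> serves instead, because such terms carry at least \<open>k + 2\<close> powers of
  \<open>\<tau>\<close>.\<close>

definition profile_interp :: "(nat \<Rightarrow> real \<Rightarrow> real) \<Rightarrow> nat \<Rightarrow> real \<Rightarrow> nat \<Rightarrow> real poly" where
  "profile_interp w j t = (if j \<le> Suc k then interp (\<lambda>x. (-1) ^ j * w j (x - t)) else (\<lambda>i. 0))"

lemma cellwise_profile_interp: "cellwise N (profile_interp w j t)"
  unfolding profile_interp_def using cellwise_interp by (auto simp: cellwise_def)

text \<open>The right end point of a cell is an interpolation point, and at the boundary the profile
  obeys the boundary condition. Thus the inflow value of an interpolant is exact.\<close>

lemma profile_inflow:
  assumes p: "smooth_profile bc (X 0) (X N) T K (Suc k) w" and j: "j \<le> Suc k" and t: "t \<in> {0..T}" and i: "i \<in> {1..N}"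
  shows "inflow bc N (profile_interp w j t) i = (-1) ^ j * w j (X (i - 1) - t)"
proof (cases "i = 1")
  case False
  then have i1: "i - 1 \<in> {1..N}" using i unfolding atLeastAtMost_iff by linarith
  show ?thesis using False j interp_last[OF i1] by (simp add: inflow_def profile_interp_def)
next
  case True
  have "w j (X 0 - t) = (case bc of Zero_Inflow \<Rightarrow> 0 | Periodic \<Rightarrow> w j (X 0 - t + (X N - X 0)))"
    using j t by (intro profile_parts(3)[OF p]) auto
  then show ?thesis using True j N interp_last[of N "\<lambda>x. (-1) ^ j * w j (x - t)"]
    by (cases bc) (simp_all add: inflow_def profile_interp_def)
qed

text \<open>The flux polynomial of the interpolant of \<open>\<partial>\<^sub>t\<^sup>j u\<close> takes the exact values at all \<open>k + 2\<close>
  points, so it differs from the Taylor polynomial \<open>P\<close> of degree \<open>n\<close> by \<open>O(h\<^bsup>n+1\<^esup>)\<close> at these points.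
  Its derivative, scaled by \<open>2 / H i\<close>, then differs by \<open>O(h\<^sup>n)\<close> from that of \<open>P\<close>, which is the
  Taylor polynomial to which the interpolant of \<open>- \<partial>\<^sub>t\<^bsup>j+1\<^esup> u\<close> is compared.\<close>

lemma consistency_cell:
  assumes p: "smooth_profile bc (X 0) (X N) T K (Suc k) w" and K: "0 \<le> K" and t: "t \<in> {0..T}"
    and jn: "j + n = Suc k" and i: "i \<in> {1..N}" and h: "\<alpha> * h \<le> H i" "H i \<le> h" and \<alpha>: "0 < \<alpha>" and h0: "0 < h"
    and C1: "\<And>p \<epsilon>. degree p \<le> Suc k \<Longrightarrow> (\<forall>j\<in>{0..Suc k}. \<bar>poly p (y j)\<bar> \<le> \<epsilon>) \<Longrightarrow> mass (pderiv p) (pderiv p) \<le> C1 * \<epsilon>\<^sup>2"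
    and C2: "\<And>p \<epsilon>. degree p \<le> k \<Longrightarrow> (\<forall>j\<in>{1..Suc k}. \<bar>poly p (y j)\<bar> \<le> \<epsilon>) \<Longrightarrow> mass p p \<le> C2 * \<epsilon>\<^sup>2"
    and Cpos: "0 \<le> C1" "0 \<le> C2"
  defines "\<delta> \<equiv> adv bc N H 1 (profile_interp w j t) i - profile_interp w (Suc j) t i"
  shows "mass \<delta> \<delta> \<le> (8 * C1 / \<alpha>\<^sup>2 + 2 * C2) * (K * h ^ n)\<^sup>2"
proof -
  define V where "V = profile_interp w j t i"
  define V' where "V' = profile_interp w (Suc j) t i"
  define c where "c l = (-1) ^ j * w (j + l) (X (i - 1) - t)" for l
  define P where "P = taylor_poly c (H i / 2) n"
  \<comment> \<open>For \<open>n = 0\<close>, that is \<open>j = k + 1\<close>, the Taylor polynomial is constant and the next interpolant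
    is \<open>0\<close> by definition.\<close>
  define P' where "P' = (if n = 0 then 0 else taylor_poly (\<lambda>l. c (Suc l)) (H i / 2) (n - 1))"
  define \<Phi> where "\<Phi> = flux_poly V (inflow bc N (profile_interp w j t) i)"
  have H: "0 < H i" by (rule H_pos[OF i])
  have jk: "j \<le> Suc k" using jn by simp
  have dV: "degree V \<le> k" using cellwise_profile_interp[of w j t] by (auto simp: V_def cellwise_def)
  have dV': "degree V' \<le> k" using cellwise_profile_interp[of w "Suc j" t] by (auto simp: V'_def cellwise_def)
  have d\<Phi>: "degree \<Phi> \<le> Suc k" unfolding \<Phi>_def by (rule flux_poly_degree[OF dV])
  have dP: "degree P \<le> Suc k" using degree_taylor_poly[of c "H i / 2" n] jn by (simp add: P_def)
  have dP': "degree P' \<le> k"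
    using degree_taylor_poly[of "\<lambda>l. c (Suc l)" "H i / 2" "n - 1"] jn by (auto simp: P'_def)
  have PP': "pderiv P = Polynomial.smult (H i / 2) P'"
  proof (cases n)
    case 0
    then show ?thesis by (simp add: P_def P'_def taylor_poly_def pderiv_pCons)
  next
    case (Suc m)
    then show ?thesis unfolding P_def P'_def by (simp add: pderiv_taylor_poly)
  qed
  have inside: "of_ref i \<xi> - t \<in> {X 0 - T..X N}" if "\<xi> \<in> {-1..1}" for \<xi>
    using of_ref_range(2)[OF i that] t by auto
  have left_inside: "X (i - 1) - t \<in> {X 0 - T..X N}" using inside[of "-1"] by (simp add: of_ref_left)
  have close: "\<bar>w (j + m) (of_ref i \<xi> - t) - (\<Sum>l\<le>q. w (j + m + l) (X (i - 1) - t) * (H i / 2 * (\<xi> + 1)) ^ l / fact l)\<bar>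
      \<le> K * h ^ Suc q" if \<xi>: "\<xi> \<in> {-1..1}" and q: "m + q = n" for m q \<xi>
  proof -
    have diff: "(of_ref i \<xi> - t) - (X (i - 1) - t) = H i / 2 * (\<xi> + 1)" using of_ref_shift[of i \<xi>] by simp
    have "\<bar>w (j + m) (of_ref i \<xi> - t) - (\<Sum>l\<le>q. w (j + m + l) (X (i - 1) - t) * (H i / 2 * (\<xi> + 1)) ^ l / fact l)\<bar>
        \<le> K * \<bar>H i / 2 * (\<xi> + 1)\<bar> ^ Suc q"
      using profile_taylor[OF p K, of "j + m" q "of_ref i \<xi> - t" "X (i - 1) - t"] q jn inside[OF \<xi>] left_inside
      unfolding diff by simp
    also have "\<dots> \<le> K * h ^ Suc q"
    proof (intro mult_left_mono power_mono K)
      have "H i / 2 * (\<xi> + 1) \<le> H i / 2 * 2" using \<xi> H by (intro mult_left_mono) auto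
      moreover have "0 \<le> H i / 2 * (\<xi> + 1)" using \<xi> H by auto
      ultimately show "\<bar>H i / 2 * (\<xi> + 1)\<bar> \<le> h" using h by simp
    qed simp
    finally show ?thesis .
  qed
  have sgn: "\<bar>(-1) ^ q * (x::real)\<bar> = \<bar>x\<bar>" for q x by (simp add: abs_mult power_abs)
  have flux_nodes: "\<bar>poly (\<Phi> - P) (y m)\<bar> \<le> K * h ^ Suc n" if m: "m \<in> {0..Suc k}" for m
  proof -
    have "poly \<Phi> (y m) = (-1) ^ j * w j (of_ref i (y m) - t)"
    proof (cases "m = 0")
      case True
      then show ?thesis unfolding \<Phi>_def profile_inflow[OF p jk t i]
        by (simp add: y_first flux_poly_first of_ref_left)
    next
      case False
      then have m1: "m \<in> {1..Suc k}" using m by auto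
      then show ?thesis unfolding \<Phi>_def flux_poly_node[OF m1] V_def
        using jk interp_node[OF i m1] by (simp add: profile_interp_def)
    qed
    then have "poly (\<Phi> - P) (y m) = (-1) ^ j * (w j (of_ref i (y m) - t) -
        (\<Sum>l\<le>n. w (j + l) (X (i - 1) - t) * (H i / 2 * (y m + 1)) ^ l / fact l))"
      by (simp add: P_def poly_taylor_poly c_def right_diff_distrib sum_distrib_left mult_ac)
    then show ?thesis using close[of "y m" 0 n] y_range[of m] m by (simp only: sgn) simp
  qed
  have deriv_nodes: "\<bar>poly (P' + V') (y m)\<bar> \<le> K * h ^ n" if m: "m \<in> {1..Suc k}" for m
  proof (cases n)
    case 0
    then have "V' = 0" using jn by (simp add: V'_def profile_interp_def)
    then show ?thesis using 0 K by (simp add: P'_def)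
  next
    case (Suc q)
    have "poly V' (y m) = (-1) ^ Suc j * w (Suc j) (of_ref i (y m) - t)"
      using interp_node[OF i m] jn Suc by (simp add: V'_def profile_interp_def)
    moreover have "poly P' (y m) = (-1) ^ j * (\<Sum>l\<le>q. w (j + 1 + l) (X (i - 1) - t) * (H i / 2 * (y m + 1)) ^ l / fact l)"
      using Suc by (simp add: P'_def poly_taylor_poly c_def sum_distrib_left mult_ac)
    ultimately have "poly (P' + V') (y m) = (-1) ^ Suc j * (w (j + 1) (of_ref i (y m) - t) -
        (\<Sum>l\<le>q. w (j + 1 + l) (X (i - 1) - t) * (H i / 2 * (y m + 1)) ^ l / fact l))"
      unfolding poly_add by (simp only: power_Suc Suc_eq_plus1 right_diff_distrib) simp
    then show ?thesis using close[of "y m" 1 q] y_range[of m] m Suc by (simp only: sgn) simp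
  qed
  have split: "\<delta> = Polynomial.smult (- (2 / H i)) (pderiv (\<Phi> - P)) + Polynomial.smult (-1) (P' + V')"
  proof -
    have "Polynomial.smult (2 / H i) (pderiv P) = P'" unfolding PP' using H by simp
    moreover have "\<delta> = Polynomial.smult (- (2 / H i)) (pderiv \<Phi>) - V'"
      using i by (simp add: \<delta>_def adv_def ref_adv_def \<Phi>_def V_def V'_def)
    ultimately show ?thesis by (simp add: pderiv_diff smult_diff_right algebra_simps)
  qed
  have square_sum: "mass (p + q) (p + q) \<le> 2 * mass p p + 2 * mass q q" for p q
    using mass_nonneg[of "p - q"] mass_square_add[of p 1 q] mass_square_add[of p "-1" q] by simp
  have "mass \<delta> \<delta> \<le> 2 * mass (Polynomial.smult (- (2 / H i)) (pderiv (\<Phi> - P))) (Polynomial.smult (- (2 / H i)) (pderiv (\<Phi> - P))) +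
      2 * mass (Polynomial.smult (-1) (P' + V')) (Polynomial.smult (-1) (P' + V'))"
    unfolding split by (rule square_sum)
  also have "\<dots> = 8 / (H i)\<^sup>2 * mass (pderiv (\<Phi> - P)) (pderiv (\<Phi> - P)) + 2 * mass (P' + V') (P' + V')"
    by (simp add: mass_smult mass_smult_right mass_uminus mass_commute[of _ "- _"] power2_eq_square
        del: smult_minus_left)
  also have "\<dots> \<le> 8 / (\<alpha> * h)\<^sup>2 * (C1 * (K * h ^ Suc n)\<^sup>2) + 2 * (C2 * (K * h ^ n)\<^sup>2)"
  proof (intro add_mono mult_mono)
    show "8 / (H i)\<^sup>2 \<le> 8 / (\<alpha> * h)\<^sup>2"
      using h \<alpha> h0 H by (intro divide_left_mono power_mono mult_pos_pos zero_less_power) auto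
    show "mass (pderiv (\<Phi> - P)) (pderiv (\<Phi> - P)) \<le> C1 * (K * h ^ Suc n)\<^sup>2"
      using flux_nodes d\<Phi> dP by (intro C1 degree_diff_le) auto
    show "mass (P' + V') (P' + V') \<le> C2 * (K * h ^ n)\<^sup>2"
      using deriv_nodes dP' dV' by (intro C2 degree_add_le) auto
  qed (use mass_nonneg in auto)
  also have "\<dots> = (8 * C1 / \<alpha>\<^sup>2 + 2 * C2) * (K * h ^ n)\<^sup>2"
    using \<alpha> h0 by (simp add: power_mult_distrib field_simps power2_eq_square)
  finally show ?thesis .
qed

end

section \<open>Local, accumulated and projection errors\<close>

text \<open>The constants in \<open>power_consistency\<close>.\<close>

primrec defect_const :: "real \<Rightarrow> real \<Rightarrow> real \<Rightarrow> nat \<Rightarrow> real" where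
  "defect_const M D L 0 = 0"
| "defect_const M D L (Suc \<kappa>) = M * defect_const M D L \<kappa> + D * L ^ \<kappa>"

lemma defect_const_nonneg: "0 \<le> M \<Longrightarrow> 0 \<le> D \<Longrightarrow> 0 \<le> L \<Longrightarrow> 0 \<le> defect_const M D L \<kappa>"
  by (induction \<kappa>) auto

context reference_cell
begin

lemma adv_scale: "adv bc N H \<tau> v i = Polynomial.smult \<tau> (adv bc N H 1 v i)"
  by (simp add: adv_def)

lemma cellwise_diff: "cellwise N v \<Longrightarrow> cellwise N w \<Longrightarrow> cellwise N (\<lambda>i. v i - w i)"
  by (auto simp: cellwise_def intro!: degree_diff_le)

lemma cellwise_smult: "cellwise N v \<Longrightarrow> cellwise N (\<lambda>i. Polynomial.smult c (v i))"
  by (auto simp: cellwise_def intro: degree_smult_le[THEN order_trans])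

lemma adv_power_diff: "(adv bc N H \<tau> ^^ \<kappa>) (\<lambda>i. v i - w i) = (\<lambda>i. (adv bc N H \<tau> ^^ \<kappa>) v i - (adv bc N H \<tau> ^^ \<kappa>) w i)"
  by (induction \<kappa>) (simp_all add: adv_diff)

lemma rk_step_diff: "rk_step bc N H s \<tau> (\<lambda>i. v i - w i) i = rk_step bc N H s \<tau> v i - rk_step bc N H s \<tau> w i"
  by (simp add: rk_step_def adv_power_diff smult_diff_right sum_subtractf)

end

context sv_mesh
begin

text \<open>If \<open>A\<^sub>\<kappa>\<close> denotes the difference and \<open>\<delta>\<^sub>\<kappa>\<close> the defect of one application of \<open>L\<close>, then \<open>A\<^bsub>\<kappa>+1\<^esub>
  = \<tau>L A\<^sub>\<kappa> + \<tau>\<^bsup>\<kappa>+1\<^esup> \<delta>\<^sub>\<kappa>\<close>. The defect loses \<open>\<kappa>\<close> powers of \<open>h\<close>, which the factor \<open>\<tau>\<^sup>\<kappa>\<close> restores since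
  \<open>\<tau>\<close> is at most a multiple of \<open>h\<close>.\<close>

lemma power_consistency:
  assumes K: "0 \<le> K" and h: "0 < h" and \<tau>: "0 < \<tau>" "\<tau> \<le> L * h" and L: "1 \<le> L" and M: "0 \<le> M" and D: "0 \<le> D"
    and op: "\<And>v. cellwise N v \<Longrightarrow> enorm N H (adv bc N H \<tau> v) \<le> M * enorm N H v"
    and def: "\<And>j. j \<le> Suc k \<Longrightarrow>
      enorm N H (\<lambda>i. adv bc N H 1 (profile_interp w j t) i - profile_interp w (Suc j) t i) \<le> D * (K * h ^ (Suc k - j))"
  shows "enorm N H (\<lambda>i. (adv bc N H \<tau> ^^ \<kappa>) (profile_interp w 0 t) i - Polynomial.smult (\<tau> ^ \<kappa>) (profile_interp w \<kappa> t i))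
     \<le> defect_const M D L \<kappa> * (\<tau> * K * h ^ Suc k)"
proof (induction \<kappa>)
  case 0
  show ?case by (simp add: enorm_zero)
next
  case (Suc \<kappa>)
  let ?V = "\<lambda>j. profile_interp w j t"
  define A where "A i = (adv bc N H \<tau> ^^ \<kappa>) (?V 0) i - Polynomial.smult (\<tau> ^ \<kappa>) (?V \<kappa> i)" for i
  define \<delta> where "\<delta> i = adv bc N H 1 (?V \<kappa>) i - ?V (Suc \<kappa>) i" for i
  have cwA: "cellwise N A"
    unfolding A_def using cellwise_profile_interp by (intro cellwise_diff cellwise_adv_power cellwise_smult)
  have eq: "(\<lambda>i. (adv bc N H \<tau> ^^ Suc \<kappa>) (?V 0) i - Polynomial.smult (\<tau> ^ Suc \<kappa>) (?V (Suc \<kappa>) i)) =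
      (\<lambda>i. adv bc N H \<tau> A i + Polynomial.smult (\<tau> ^ Suc \<kappa>) (\<delta> i))"
  proof
    fix i
    have "adv bc N H \<tau> A i = adv bc N H \<tau> ((adv bc N H \<tau> ^^ \<kappa>) (?V 0)) i -
        Polynomial.smult (\<tau> ^ \<kappa>) (Polynomial.smult \<tau> (adv bc N H 1 (?V \<kappa>) i))"
      unfolding A_def[abs_def] adv_diff adv_smult adv_scale[of bc N H \<tau> "?V \<kappa>"] ..
    then show "(adv bc N H \<tau> ^^ Suc \<kappa>) (?V 0) i - Polynomial.smult (\<tau> ^ Suc \<kappa>) (?V (Suc \<kappa>) i) =
        adv bc N H \<tau> A i + Polynomial.smult (\<tau> ^ Suc \<kappa>) (\<delta> i)"
      by (simp add: \<delta>_def smult_diff_right mult.commute)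
  qed
  have d: "\<tau> ^ Suc \<kappa> * enorm N H \<delta> \<le> D * L ^ \<kappa> * (\<tau> * K * h ^ Suc k)"
  proof (cases "\<kappa> \<le> Suc k")
    case True
    have "\<tau> ^ \<kappa> \<le> (L * h) ^ \<kappa>" using \<tau> by (intro power_mono) auto
    then have "\<tau> * \<tau> ^ \<kappa> * enorm N H \<delta> \<le> \<tau> * (L * h) ^ \<kappa> * (D * (K * h ^ (Suc k - \<kappa>)))"
      using def[OF True] \<tau> L h by (intro mult_mono mult_left_mono enorm_nonneg H_pos) (auto simp: \<delta>_def[abs_def])
    also have "\<dots> = D * L ^ \<kappa> * (\<tau> * K * (h ^ \<kappa> * h ^ (Suc k - \<kappa>)))"
      by (simp add: power_mult_distrib mult_ac)
    also have "h ^ \<kappa> * h ^ (Suc k - \<kappa>) = h ^ Suc k"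
      using True by (metis le_add_diff_inverse power_add)
    finally show ?thesis by simp
  next
    case False
    then have "\<delta> = (\<lambda>i. 0)" by (simp add: \<delta>_def[abs_def] profile_interp_def adv_zero)
    then show ?thesis using D L \<tau> K h by (simp add: enorm_zero)
  qed
  have "enorm N H (\<lambda>i. adv bc N H \<tau> A i + Polynomial.smult (\<tau> ^ Suc \<kappa>) (\<delta> i)) \<le>
      enorm N H (adv bc N H \<tau> A) + enorm N H (\<lambda>i. Polynomial.smult (\<tau> ^ Suc \<kappa>) (\<delta> i))"
    by (rule enorm_triangle) (rule H_pos)
  also have "enorm N H (\<lambda>i. Polynomial.smult (\<tau> ^ Suc \<kappa>) (\<delta> i)) = \<tau> ^ Suc \<kappa> * enorm N H \<delta>"
    unfolding enorm_smult using \<tau> by simp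
  also have "enorm N H (adv bc N H \<tau> A) + \<tau> ^ Suc \<kappa> * enorm N H \<delta> \<le>
      M * (defect_const M D L \<kappa> * (\<tau> * K * h ^ Suc k)) + D * L ^ \<kappa> * (\<tau> * K * h ^ Suc k)"
  proof (rule add_mono[OF _ d])
    have "enorm N H (adv bc N H \<tau> A) \<le> M * enorm N H A" by (rule op[OF cwA])
    also have "\<dots> \<le> M * (defect_const M D L \<kappa> * (\<tau> * K * h ^ Suc k))"
      using Suc.IH M unfolding A_def[abs_def] by (intro mult_left_mono)
    finally show "enorm N H (adv bc N H \<tau> A) \<le> M * (defect_const M D L \<kappa> * (\<tau> * K * h ^ Suc k))" .
  qed
  also have "\<dots> = defect_const M D L (Suc \<kappa>) * (\<tau> * K * h ^ Suc k)" by (simp add: algebra_simps)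
  finally show ?case unfolding eq .
qed

text \<open>Taylor's formula for \<open>u\<close> in time at every interpolation point. Its order is limited by the
  order \<open>s\<close> of the scheme and by the regularity of the profile.\<close>

lemma taylor_in_time:
  fixes s :: nat
  assumes p: "smooth_profile bc (X 0) (X N) T K (Suc k) w" and K: "0 \<le> K" and \<tau>: "0 \<le> \<tau>" and t: "0 \<le> t" "t + \<tau> \<le> T"
    and C2: "\<And>p \<epsilon>. degree p \<le> k \<Longrightarrow> (\<forall>j\<in>{1..Suc k}. \<bar>poly p (y j)\<bar> \<le> \<epsilon>) \<Longrightarrow> mass p p \<le> C2 * \<epsilon>\<^sup>2" and "0 \<le> C2"
  defines "m \<equiv> min s (Suc k)"
  shows "enorm N H (\<lambda>i. (\<Sum>\<kappa>\<le>s. Polynomial.smult (\<tau> ^ \<kappa> / fact \<kappa>) (profile_interp w \<kappa> t i)) - profile_interp w 0 (t + \<tau>) i)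
    \<le> sqrt (X N - X 0) * (sqrt C2 * (K * \<tau> ^ Suc m))"
proof (rule enorm_bound)
  fix i assume i: "i \<in> {1..N}"
  define E where "E = (\<Sum>\<kappa>\<le>s. Polynomial.smult (\<tau> ^ \<kappa> / fact \<kappa>) (profile_interp w \<kappa> t i)) - profile_interp w 0 (t + \<tau>) i"
  have dV: "degree (profile_interp w j t' i) \<le> k" for j t'
    using cellwise_profile_interp[of w j t'] by (simp add: cellwise_def)
  have "degree E \<le> k"
    unfolding E_def using dV by (intro degree_diff_le degree_sum_le degree_smult_le[THEN order_trans]) auto
  moreover have "\<bar>poly E (y j)\<bar> \<le> K * \<tau> ^ Suc m" if j: "j \<in> {1..Suc k}" for j
  proof -
    define x where "x = of_ref i (y j)"
    have x: "x \<in> {X 0..X N}" unfolding x_def using y_range[of j] j by (intro of_ref_range(2)[OF i]) auto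
    have "(\<Sum>\<kappa>\<le>s. \<tau> ^ \<kappa> / fact \<kappa> * poly (profile_interp w \<kappa> t i) (y j)) =
        (\<Sum>\<kappa>\<le>m. \<tau> ^ \<kappa> / fact \<kappa> * poly (profile_interp w \<kappa> t i) (y j))"
      by (rule sum.mono_neutral_right) (auto simp: m_def profile_interp_def)
    also have "\<dots> = (\<Sum>\<kappa>\<le>m. w \<kappa> (x - t) * (- \<tau>) ^ \<kappa> / fact \<kappa>)"
    proof (rule sum.cong[OF refl])
      fix \<kappa> assume "\<kappa> \<in> {..m}"
      then have "poly (profile_interp w \<kappa> t i) (y j) = (-1) ^ \<kappa> * w \<kappa> (x - t)"
        using interp_node[OF i j] by (simp add: m_def profile_interp_def x_def)
      then show "\<tau> ^ \<kappa> / fact \<kappa> * poly (profile_interp w \<kappa> t i) (y j) = w \<kappa> (x - t) * (- \<tau>) ^ \<kappa> / fact \<kappa>"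
        by (simp add: power_minus[of \<tau>] mult_ac)
    qed
    finally have "poly E (y j) = - (w 0 (x - (t + \<tau>)) - (\<Sum>\<kappa>\<le>m. w \<kappa> (x - t) * (- \<tau>) ^ \<kappa> / fact \<kappa>))"
      using interp_node[OF i j] by (simp add: E_def poly_sum profile_interp_def x_def)
    moreover have "\<bar>w 0 (x - (t + \<tau>)) - (\<Sum>\<kappa>\<le>m. w \<kappa> (x - t) * (- \<tau>) ^ \<kappa> / fact \<kappa>)\<bar> \<le> K * \<bar>- \<tau>\<bar> ^ Suc m"
      using profile_taylor[OF p K, of 0 m "x - (t + \<tau>)" "x - t"] x t \<tau> by (simp add: m_def)
    ultimately show ?thesis using \<tau> by simp
  qed
  ultimately have "mass E E \<le> C2 * (K * \<tau> ^ Suc m)\<^sup>2" by (intro C2) auto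
  then show "mass ((\<Sum>\<kappa>\<le>s. Polynomial.smult (\<tau> ^ \<kappa> / fact \<kappa>) (profile_interp w \<kappa> t i)) - profile_interp w 0 (t + \<tau>) i)
      ((\<Sum>\<kappa>\<le>s. Polynomial.smult (\<tau> ^ \<kappa> / fact \<kappa>) (profile_interp w \<kappa> t i)) - profile_interp w 0 (t + \<tau>) i)
      \<le> (sqrt C2 * (K * \<tau> ^ Suc m))\<^sup>2"
    using \<open>0 \<le> C2\<close> unfolding E_def by (simp only: power_mult_distrib[of "sqrt C2"] real_sqrt_pow2)
qed (use K \<tau> \<open>0 \<le> C2\<close> in auto)

text \<open>The step applied to the projected solution differs from the projected solution at the next
  time by the errors in space of the powers \<open>(\<tau>L)\<^sup>\<kappa>\<close> and by the Taylor remainder in time.\<close>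

lemma local_error:
  assumes p: "smooth_profile bc (X 0) (X N) T K (Suc k) w" and K: "0 \<le> K" and t: "0 \<le> t" "t + \<tau> \<le> T"
    and h: "0 < h" "\<And>i. i \<in> {1..N} \<Longrightarrow> \<alpha> * h \<le> H i \<and> H i \<le> h" and \<alpha>: "0 < \<alpha>"
    and \<tau>: "0 < \<tau>" "\<tau> \<le> L * h" and L: "1 \<le> L" and M: "0 \<le> M"
    and op: "\<And>v. cellwise N v \<Longrightarrow> enorm N H (adv bc N H \<tau> v) \<le> M * enorm N H v"
    and C1: "\<And>p \<epsilon>. degree p \<le> Suc k \<Longrightarrow> (\<forall>j\<in>{0..Suc k}. \<bar>poly p (y j)\<bar> \<le> \<epsilon>) \<Longrightarrow> mass (pderiv p) (pderiv p) \<le> C1 * \<epsilon>\<^sup>2"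
    and C2: "\<And>p \<epsilon>. degree p \<le> k \<Longrightarrow> (\<forall>j\<in>{1..Suc k}. \<bar>poly p (y j)\<bar> \<le> \<epsilon>) \<Longrightarrow> mass p p \<le> C2 * \<epsilon>\<^sup>2"
    and Cpos: "0 \<le> C1" "0 \<le> C2"
  defines "D \<equiv> sqrt (X N - X 0) * sqrt (8 * C1 / \<alpha>\<^sup>2 + 2 * C2)"
  shows "enorm N H (\<lambda>i. rk_step bc N H s \<tau> (profile_interp w 0 t) i - profile_interp w 0 (t + \<tau>) i) \<le>
     ((\<Sum>\<kappa>\<le>s. defect_const M D L \<kappa>) + sqrt (X N - X 0) * sqrt C2 * L ^ Suc k) * (\<tau> * (K * (h ^ Suc k + \<tau> ^ s)))"
proof -
  let ?V = "\<lambda>j. profile_interp w j t"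
  define Q where "Q = 8 * C1 / \<alpha>\<^sup>2 + 2 * C2"
  have Q: "0 \<le> Q" using Cpos by (simp add: Q_def)
  have XN: "X 0 \<le> X N" by (rule X_mono) auto
  have D: "0 \<le> D" using Q XN by (simp add: D_def Q_def[symmetric])
  have def: "enorm N H (\<lambda>i. adv bc N H 1 (?V j) i - ?V (Suc j) i) \<le> D * (K * h ^ (Suc k - j))" if j: "j \<le> Suc k" for j
  proof -
    have "enorm N H (\<lambda>i. adv bc N H 1 (?V j) i - ?V (Suc j) i) \<le> sqrt (X N - X 0) * (sqrt Q * (K * h ^ (Suc k - j)))"
    proof (rule enorm_bound)
      fix i assume i: "i \<in> {1..N}"
      have "mass (adv bc N H 1 (?V j) i - ?V (Suc j) i) (adv bc N H 1 (?V j) i - ?V (Suc j) i) \<le> Q * (K * h ^ (Suc k - j))\<^sup>2"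
        unfolding Q_def using j h(2)[OF i] t \<tau>
        by (intro consistency_cell[OF p K _ _ i _ _ \<alpha> h(1) C1 C2 Cpos]) auto
      then show "mass (adv bc N H 1 (?V j) i - ?V (Suc j) i) (adv bc N H 1 (?V j) i - ?V (Suc j) i) \<le>
          (sqrt Q * (K * h ^ (Suc k - j)))\<^sup>2"
        using Q by (simp only: power_mult_distrib[of "sqrt Q"] real_sqrt_pow2)
    qed (use Q K h in auto)
    then show ?thesis by (simp add: D_def Q_def mult.assoc)
  qed
  define A where "A \<kappa> i = (adv bc N H \<tau> ^^ \<kappa>) (?V 0) i - Polynomial.smult (\<tau> ^ \<kappa>) (?V \<kappa> i)" for \<kappa> i
  define R where "R i = (\<Sum>\<kappa>\<le>s. Polynomial.smult (\<tau> ^ \<kappa> / fact \<kappa>) (?V \<kappa> i)) - profile_interp w 0 (t + \<tau>) i" for i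
  define m where "m = min s (Suc k)"
  define S where "S = h ^ Suc k + \<tau> ^ s"
  have S: "h ^ Suc k \<le> S" "\<tau> ^ s \<le> S" "0 \<le> S" using h \<tau> by (auto simp: S_def)
  have split: "(\<lambda>i. rk_step bc N H s \<tau> (?V 0) i - profile_interp w 0 (t + \<tau>) i) =
      (\<lambda>i. (\<Sum>\<kappa>\<le>s. Polynomial.smult (1 / fact \<kappa>) (A \<kappa> i)) + R i)"
    by (simp add: rk_step_def A_def R_def fun_eq_iff smult_diff_right sum_subtractf)
  have "enorm N H (\<lambda>i. \<Sum>\<kappa>\<le>s. Polynomial.smult (1 / fact \<kappa>) (A \<kappa> i)) \<le>
      (\<Sum>\<kappa>\<le>s. enorm N H (\<lambda>i. Polynomial.smult (1 / fact \<kappa>) (A \<kappa> i)))"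
    by (rule enorm_sum) (use H_pos in auto)
  also have "\<dots> \<le> (\<Sum>\<kappa>\<le>s. defect_const M D L \<kappa> * (\<tau> * (K * S)))"
  proof (rule sum_mono)
    fix \<kappa>
    have "enorm N H (\<lambda>i. Polynomial.smult (1 / fact \<kappa>) (A \<kappa> i)) = 1 / fact \<kappa> * enorm N H (A \<kappa>)"
      unfolding enorm_smult by simp
    also have "\<dots> \<le> 1 * enorm N H (A \<kappa>)"
      by (intro mult_right_mono enorm_nonneg H_pos) (auto simp: fact_ge_1)
    also have "\<dots> \<le> defect_const M D L \<kappa> * (\<tau> * K * h ^ Suc k)"
      unfolding A_def[abs_def] mult_1 by (rule power_consistency[OF K h(1) \<tau> L M D op def])
    also have "\<dots> \<le> defect_const M D L \<kappa> * (\<tau> * (K * S))"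
      using S K \<tau> M D L defect_const_nonneg[of M D L \<kappa>]
      by (intro mult_left_mono) (auto simp: mult.assoc intro!: mult_left_mono)
    finally show "enorm N H (\<lambda>i. Polynomial.smult (1 / fact \<kappa>) (A \<kappa> i)) \<le> defect_const M D L \<kappa> * (\<tau> * (K * S))" .
  qed
  also have "\<dots> = (\<Sum>\<kappa>\<le>s. defect_const M D L \<kappa>) * (\<tau> * (K * S))" by (simp only: sum_distrib_right)
  finally have 1: "enorm N H (\<lambda>i. \<Sum>\<kappa>\<le>s. Polynomial.smult (1 / fact \<kappa>) (A \<kappa> i)) \<le>
      (\<Sum>\<kappa>\<le>s. defect_const M D L \<kappa>) * (\<tau> * (K * S))" .
  have Lk: "1 \<le> L ^ Suc k" by (rule one_le_power[OF L])
  \<comment> \<open>If \<open>s\<close> exceeds the available regularity, the time error of order \<open>\<tau>\<^bsup>k+1\<^esup>\<close> is counted as an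
    error in space.\<close>
  have "\<tau> ^ m \<le> L ^ Suc k * S"
  proof (cases "s \<le> Suc k")
    case True
    then have "\<tau> ^ m \<le> 1 * S" using S by (simp add: m_def)
    also have "\<dots> \<le> L ^ Suc k * S" using Lk S by (intro mult_right_mono)
    finally show ?thesis .
  next
    case False
    then have "\<tau> ^ m = \<tau> ^ Suc k" by (simp add: m_def)
    also have "\<dots> \<le> (L * h) ^ Suc k" using \<tau> by (intro power_mono) auto
    also have "\<dots> = L ^ Suc k * h ^ Suc k" by (rule power_mult_distrib)
    also have "\<dots> \<le> L ^ Suc k * S" using S(1) Lk by (intro mult_left_mono) auto
    finally show ?thesis .
  qed
  then have "K * \<tau> ^ Suc m \<le> L ^ Suc k * (\<tau> * (K * S))"
    using mult_left_mono[of "\<tau> ^ m" "L ^ Suc k * S" "K * \<tau>"] K \<tau> by (simp add: mult_ac)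
  then have "sqrt (X N - X 0) * sqrt C2 * (K * \<tau> ^ Suc m) \<le> sqrt (X N - X 0) * sqrt C2 * (L ^ Suc k * (\<tau> * (K * S)))"
    using XN Cpos by (intro mult_left_mono) auto
  moreover have "enorm N H R \<le> sqrt (X N - X 0) * (sqrt C2 * (K * \<tau> ^ Suc m))"
    unfolding R_def[abs_def] m_def using \<tau> by (intro taylor_in_time[OF p K _ t C2 Cpos(2)]) auto
  ultimately have 2: "enorm N H R \<le> sqrt (X N - X 0) * sqrt C2 * L ^ Suc k * (\<tau> * (K * S))"
    by (simp add: mult.assoc)
  have "enorm N H (\<lambda>i. (\<Sum>\<kappa>\<le>s. Polynomial.smult (1 / fact \<kappa>) (A \<kappa> i)) + R i) \<le>
      enorm N H (\<lambda>i. \<Sum>\<kappa>\<le>s. Polynomial.smult (1 / fact \<kappa>) (A \<kappa> i)) + enorm N H R"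
    by (rule enorm_triangle) (rule H_pos)
  then show ?thesis unfolding split S_def[symmetric] distrib_right using 1 2 by linarith
qed

text \<open>The discrete Gronwall inequality.\<close>

lemma accumulated_error:
  assumes e0: "e 0 = (\<lambda>i. 0)"
    and step: "\<And>n. n < M \<Longrightarrow> enorm N H (e (Suc n)) \<le> (1 + C * \<tau>) * enorm N H (e n) + \<tau> * F"
    and C: "0 \<le> C" "0 < \<tau>" "0 \<le> F" "real M * \<tau> = T" and n: "n \<le> M"
  shows "enorm N H (e n) \<le> T * exp (C * T) * F"
proof -
  have g1: "1 \<le> (1 + C * \<tau>) ^ n" for n using C by (intro one_le_power) auto
  have main: "enorm N H (e n) \<le> (1 + C * \<tau>) ^ n * (real n * (\<tau> * F))" using n
  proof (induction n)
    case 0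
    show ?case by (simp add: e0 enorm_zero)
  next
    case (Suc n)
    have "enorm N H (e (Suc n)) \<le> (1 + C * \<tau>) * enorm N H (e n) + \<tau> * F" using Suc.prems by (intro step) simp
    also have "\<dots> \<le> (1 + C * \<tau>) * ((1 + C * \<tau>) ^ n * (real n * (\<tau> * F))) + (1 + C * \<tau>) ^ Suc n * (\<tau> * F)"
      using Suc C mult_right_mono[OF g1[of "Suc n"], of "\<tau> * F"] by (intro add_mono mult_left_mono) auto
    also have "\<dots> = (1 + C * \<tau>) ^ Suc n * (real (Suc n) * (\<tau> * F))" by (simp add: algebra_simps)
    finally show ?case .
  qed
  have nT: "real n * \<tau> \<le> T" using n C mult_right_mono[of "real n" "real M" \<tau>] by simp
  have "(1 + C * \<tau>) ^ n \<le> exp (C * \<tau>) ^ n" using C by (intro power_mono exp_ge_add_one_self) auto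
  also have "\<dots> = exp (C * (real n * \<tau>))" by (simp add: exp_of_nat_mult[symmetric] mult_ac)
  also have "\<dots> \<le> exp (C * T)" using nT C by (simp add: mult_left_mono)
  finally have ex: "(1 + C * \<tau>) ^ n \<le> exp (C * T)" .
  have nF: "real n * (\<tau> * F) \<le> T * F" using mult_right_mono[OF nT, of F] C by (simp add: mult.assoc)
  have "(1 + C * \<tau>) ^ n * (real n * (\<tau> * F)) \<le> exp (C * T) * (T * F)"
    by (rule mult_mono[OF ex nF]) (use C in auto)
  then show ?thesis using main by (simp add: mult_ac)
qed

text \<open>The Taylor polynomial of degree \<open>k\<close> is close to the profile on the whole cell and, at the
  nodes, to the interpolant.\<close>

lemma projection_error:
  assumes p: "smooth_profile bc (X 0) (X N) T K (Suc k) w" and K: "0 \<le> K" and t: "t \<in> {0..T}"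
    and i: "i \<in> {1..N}" and h: "H i \<le> h" and \<xi>: "\<xi> \<in> {-1..1}"
    and C3: "\<And>p \<epsilon>. degree p \<le> k \<Longrightarrow> (\<forall>j\<in>{1..Suc k}. \<bar>poly p (y j)\<bar> \<le> \<epsilon>) \<Longrightarrow> \<forall>x\<in>{-1..1}. \<bar>poly p x\<bar> \<le> C3 * \<epsilon>"
  shows "\<bar>w 0 (of_ref i \<xi> - t) - poly (profile_interp w 0 t i) \<xi>\<bar> \<le> (1 + C3) * (K * h ^ Suc k)"
proof -
  define c where "c l = w l (X (i - 1) - t)" for l
  define P where "P = taylor_poly c (H i / 2) k"
  have H: "0 < H i" by (rule H_pos[OF i])
  have inside: "of_ref i \<xi> - t \<in> {X 0 - T..X N}" if "\<xi> \<in> {-1..1}" for \<xi>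
    using of_ref_range(2)[OF i that] t by auto
  have close: "\<bar>w 0 (of_ref i \<xi> - t) - poly P \<xi>\<bar> \<le> K * h ^ Suc k" if \<xi>: "\<xi> \<in> {-1..1}" for \<xi>
  proof -
    have diff: "(of_ref i \<xi> - t) - (X (i - 1) - t) = H i / 2 * (\<xi> + 1)" using of_ref_shift[of i \<xi>] by simp
    have "\<bar>w 0 (of_ref i \<xi> - t) - poly P \<xi>\<bar> \<le> K * \<bar>H i / 2 * (\<xi> + 1)\<bar> ^ Suc k"
      using profile_taylor[OF p K, of 0 k "of_ref i \<xi> - t" "X (i - 1) - t"] inside[OF \<xi>] inside[of "-1"]
      unfolding diff P_def poly_taylor_poly c_def by (simp add: of_ref_left)
    also have "\<dots> \<le> K * h ^ Suc k"
    proof (intro mult_left_mono power_mono K)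
      have "H i / 2 * (\<xi> + 1) \<le> H i / 2 * 2" using \<xi> H by (intro mult_left_mono) auto
      moreover have "0 \<le> H i / 2 * (\<xi> + 1)" using \<xi> H by auto
      ultimately show "\<bar>H i / 2 * (\<xi> + 1)\<bar> \<le> h" using h by simp
    qed simp
    finally show ?thesis .
  qed
  have "\<bar>poly (profile_interp w 0 t i - P) (y j)\<bar> \<le> K * h ^ Suc k" if j: "j \<in> {1..Suc k}" for j
    using close[of "y j"] y_range[of j] j interp_node[OF i j]
    by (simp add: profile_interp_def abs_minus_commute)
  moreover have "degree (profile_interp w 0 t i - P) \<le> k"
    using cellwise_profile_interp[of w 0 t] degree_taylor_poly[of c "H i / 2" k]
    by (intro degree_diff_le) (auto simp: cellwise_def P_def)
  ultimately have "\<bar>poly (profile_interp w 0 t i - P) \<xi>\<bar> \<le> C3 * (K * h ^ Suc k)" using C3 \<xi> by blast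
  then show ?thesis using close[OF \<xi>] by (simp add: distrib_right)
qed

lemma cell_integral:
  assumes i: "i \<in> {1..N}"
  shows "integrable lborel (\<lambda>x. indicator {X (i - 1)..X i} x * poly q (to_ref i x))"
    and "(LINT x|lborel. indicator {X (i - 1)..X i} x * poly q (to_ref i x)) = H i / 2 * cell_int q"
proof -
  have cont: "continuous_on S (\<lambda>x. poly q (to_ref i x))" for S
    unfolding to_ref_def by (intro continuous_intros)
  have le: "X (i - 1) \<le> X i" using H_pos[OF i] by (simp add: cell_len_def)
  have "set_integrable lborel {X (i - 1)..X i} (\<lambda>x. poly q (to_ref i x))"
    by (rule borel_integrable_atLeastAtMost') (rule cont)
  then show "integrable lborel (\<lambda>x. indicator {X (i - 1)..X i} x * poly q (to_ref i x))"
    unfolding set_integrable_def by simp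
  obtain P where P: "pderiv P = q" using antiderivative_exists[of q] by blast
  have "(LINT x|lborel. indicator {X (i - 1)..X i} x *\<^sub>R poly q (to_ref i x)) =
      H i / 2 * poly P (to_ref i (X i)) - H i / 2 * poly P (to_ref i (X (i - 1)))"
  proof (rule integral_FTC_atLeastAtMost[OF le _ cont])
    fix x
    have "((\<lambda>x. H i / 2 * poly P (to_ref i x)) has_real_derivative
        H i / 2 * (poly (pderiv P) (to_ref i x) * (2 / H i))) (at x within {X (i - 1)..X i})"
      by (intro DERIV_cmult poly_to_ref_deriv)
    then show "((\<lambda>x. H i / 2 * poly P (to_ref i x)) has_vector_derivative poly q (to_ref i x)) (at x within {X (i - 1)..X i})"
      using H_pos[OF i] P by (simp add: has_real_derivative_iff_has_vector_derivative)
  qed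
  moreover have "to_ref i (X i) = 1" "to_ref i (X (i - 1)) = -1"
    using to_of_ref[OF i, of 1] to_of_ref[OF i, of "-1"] by (simp_all add: of_ref_left of_ref_right)
  moreover have "cell_int q = poly P 1 - poly P (-1)" unfolding P[symmetric] by (rule cell_int_pderiv)
  ultimately show "(LINT x|lborel. indicator {X (i - 1)..X i} x * poly q (to_ref i x)) = H i / 2 * cell_int q"
    by (simp add: right_diff_distrib)
qed

lemma cell_of_point:
  assumes "x \<in> {X 0..X N}" and "x \<notin> X ` {0..N}"
  obtains i where "i \<in> {1..N}" and "x \<in> {X (i - 1)<..<X i}"
proof -
  define i where "i = (LEAST i. x \<le> X i)"
  have ex: "x \<le> X N" using assms by simp
  have le: "x \<le> X i" "i \<le> N" unfolding i_def by (rule LeastI[of _ N], rule ex) (rule Least_le, rule ex)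
  have "x \<noteq> X 0" using assms N by auto
  then have i0: "i \<noteq> 0" using le assms(1) by (cases "i = 0") auto
  have "\<not> x \<le> X (i - 1)" unfolding i_def by (rule not_less_Least) (use i0 in \<open>simp add: i_def\<close>)
  moreover have "x \<noteq> X i" using assms(2) le by auto
  ultimately show ?thesis using that[of i] le i0 by auto
qed

text \<open>The energy dominates the \<open>L\<^sub>2\<close> norm of a piecewise polynomial; mesh points are a null set.\<close>

lemma l2_norm_split:
  fixes v :: "real \<Rightarrow> real"
  assumes U: "U \<in> trial_space k N X" and V: "cellwise N V" and B: "0 \<le> B"
    and near: "\<And>i \<xi>. i \<in> {1..N} \<Longrightarrow> \<xi> \<in> {-1..1} \<Longrightarrow> \<bar>v (of_ref i \<xi>) - poly (V i) \<xi>\<bar> \<le> B"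
  shows "l2_norm (X 0) (X N) (\<lambda>x. v x - U x) \<le>
     sqrt (2 * (X N - X 0)) * B + sqrt 2 * enorm N H (\<lambda>i. pieces U i - V i)"
proof -
  define e where "e i = pieces U i - V i" for i
  define G where "G x = 2 * B\<^sup>2 * indicator {X 0..X N} x +
     2 * (\<Sum>i=1..N. indicator {X (i - 1)..X i} x * poly (e i * e i) (to_ref i x))" for x
  have XN: "X 0 \<le> X N" by (rule X_mono) auto
  have i1: "integrable lborel (\<lambda>x. \<Sum>i=1..N. indicator {X (i - 1)..X i} x * poly (e i * e i) (to_ref i x))"
    by (intro Bochner_Integration.integrable_sum cell_integral(1))
  have i2: "integrable lborel (\<lambda>x. 2 * B\<^sup>2 * indicator {X 0..X N} x)"
    by (intro integrable_mult_right integrable_real_indicator) (auto simp: emeasure_lborel_Icc_eq)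
  have G: "integrable lborel G" unfolding G_def[abs_def] using i1 i2 by simp
  have "(LINT x|lborel. (\<Sum>i=1..N. indicator {X (i - 1)..X i} x * poly (e i * e i) (to_ref i x))) =
      (\<Sum>i=1..N. H i / 2 * cell_int (e i * e i))"
  proof -
    have "(LINT x|lborel. (\<Sum>i=1..N. indicator {X (i - 1)..X i} x * poly (e i * e i) (to_ref i x))) =
        (\<Sum>i=1..N. LINT x|lborel. indicator {X (i - 1)..X i} x * poly (e i * e i) (to_ref i x))"
      by (intro Bochner_Integration.integral_sum cell_integral(1))
    also have "\<dots> = (\<Sum>i=1..N. H i / 2 * cell_int (e i * e i))"
      by (intro sum.cong refl cell_integral(2))
    finally show ?thesis .
  qed
  then have intG: "integral\<^sup>L lborel G = 2 * B\<^sup>2 * (X N - X 0) + 2 * (\<Sum>i=1..N. H i / 2 * cell_int (e i * e i))"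
    unfolding G_def[abs_def] using i1 i2 XN by simp
  have "(\<Sum>i=1..N. H i / 2 * cell_int (e i * e i)) \<le> energy N H e e"
    unfolding energy_def using H_pos by (intro sum_mono mult_left_mono mass_ge) (auto simp: less_imp_le)
  also have "\<dots> = (enorm N H e)\<^sup>2" by (rule enorm_square[symmetric]) (rule H_pos)
  finally have intG': "integral\<^sup>L lborel G \<le> 2 * B\<^sup>2 * (X N - X 0) + 2 * (enorm N H e)\<^sup>2" unfolding intG by simp
  have G0: "0 \<le> G x" for x
    unfolding G_def by (intro add_nonneg_nonneg mult_nonneg_nonneg sum_nonneg) (auto simp: indicator_def)
  have "AE x in lborel. indicator {X 0..X N} x *\<^sub>R ((v x - U x) * (v x - U x)) \<le> G x"
  proof -
    have "AE x in lborel. x \<notin> X ` {0..N}"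
      by (rule AE_not_in) (rule finite_imp_null_set_lborel, simp)
    then show ?thesis
    proof eventually_elim
      case (elim x)
      show ?case
      proof (cases "x \<in> {X 0..X N}")
        case True
        obtain i where i: "i \<in> {1..N}" and x: "x \<in> {X (i - 1)<..<X i}" using cell_of_point[OF True elim] .
        define \<xi> where "\<xi> = to_ref i x"
        have x\<xi>: "x = of_ref i \<xi>" using of_to_ref[OF i] by (simp add: \<xi>_def)
        have \<xi>: "\<xi> \<in> {-1..1}"
        proof -
          have "of_ref i (-1) < of_ref i \<xi>" "of_ref i \<xi> < of_ref i 1" using x x\<xi> by (auto simp: of_ref_left of_ref_right)
          then have "\<not> \<xi> \<le> -1" "\<not> 1 \<le> \<xi>" using of_ref_le[OF i, of \<xi> "-1"] of_ref_le[OF i, of 1 \<xi>] by auto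
          then show ?thesis by auto
        qed
        have Ux: "U x = poly (pieces U i) \<xi>" unfolding \<xi>_def by (rule pieces_spec(2)[OF U i x])
        define r where "r = v x - poly (V i) \<xi>"
        have r: "\<bar>r\<bar> \<le> B" unfolding r_def x\<xi> by (rule near[OF i \<xi>])
        have "r\<^sup>2 \<le> B\<^sup>2" using power_mono[OF r, of 2] by simp
        moreover have "v x - U x = r - poly (e i) \<xi>" by (simp add: r_def Ux e_def)
        moreover have "(r - poly (e i) \<xi>)\<^sup>2 \<le> 2 * r\<^sup>2 + 2 * (poly (e i) \<xi>)\<^sup>2"
          using zero_le_power2[of "r + poly (e i) \<xi>"] by (simp add: power2_eq_square algebra_simps)
        ultimately have "(v x - U x) * (v x - U x) \<le> 2 * B\<^sup>2 + 2 * poly (e i * e i) \<xi>"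
          by (simp add: power2_eq_square)
        moreover have "poly (e i * e i) \<xi> \<le> (\<Sum>i=1..N. indicator {X (i - 1)..X i} x * poly (e i * e i) (to_ref i x))"
        proof -
          have "poly (e i * e i) \<xi> = indicator {X (i - 1)..X i} x * poly (e i * e i) (to_ref i x)"
            using x by (simp add: \<xi>_def)
          also have "\<dots> \<le> (\<Sum>i=1..N. indicator {X (i - 1)..X i} x * poly (e i * e i) (to_ref i x))"
            using i by (intro member_le_sum) (auto simp: indicator_def)
          finally show ?thesis .
        qed
        ultimately have "(v x - U x) * (v x - U x) \<le> 2 * B\<^sup>2 +
            2 * (\<Sum>i=1..N. indicator {X (i - 1)..X i} x * poly (e i * e i) (to_ref i x))" by linarith
        then show ?thesis unfolding G_def using True by (simp only: indicator_simps(1) scaleR_one mult_1_right)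
      next
        case False
        then show ?thesis using G0[of x] by simp
      qed
    qed
  qed
  then have "l2_inner (X 0) (X N) (\<lambda>x. v x - U x) (\<lambda>x. v x - U x) \<le> integral\<^sup>L lborel G"
    unfolding l2_inner_def set_lebesgue_integral_def by (intro integral_mono_AE'[OF G]) (auto simp: G0)
  also have "\<dots> \<le> 2 * (X N - X 0) * B\<^sup>2 + 2 * (enorm N H e)\<^sup>2" proof -
    have "2 * (X N - X 0) * B\<^sup>2 = 2 * B\<^sup>2 * (X N - X 0)" by (simp only: mult_ac)
    then show ?thesis using intG' by linarith
  qed
  also have "\<dots> \<le> (sqrt (2 * (X N - X 0)) * B + sqrt 2 * enorm N H e)\<^sup>2"
  proof -
    define p where "p = sqrt (2 * (X N - X 0)) * B"
    define q where "q = sqrt 2 * enorm N H e"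
    have "p\<^sup>2 = 2 * (X N - X 0) * B\<^sup>2" using XN by (simp add: p_def power_mult_distrib)
    moreover have "q\<^sup>2 = 2 * (enorm N H e)\<^sup>2" by (simp add: q_def power_mult_distrib)
    moreover have "0 \<le> p" "0 \<le> q" using XN B enorm_nonneg[of N H e, OF H_pos] by (simp_all add: p_def q_def)
    then have "0 \<le> 2 * p * q" by simp
    moreover have "(p + q)\<^sup>2 = p\<^sup>2 + q\<^sup>2 + 2 * p * q" by (rule power2_sum)
    ultimately have "2 * (X N - X 0) * B\<^sup>2 + 2 * (enorm N H e)\<^sup>2 \<le> (p + q)\<^sup>2" by linarith
    then show ?thesis by (simp only: p_def q_def)
  qed
  finally have "l2_norm (X 0) (X N) (\<lambda>x. v x - U x) \<le> sqrt ((sqrt (2 * (X N - X 0)) * B + sqrt 2 * enorm N H e)\<^sup>2)"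
    unfolding l2_norm_def by (rule real_sqrt_le_mono)
  also have "\<dots> = sqrt (2 * (X N - X 0)) * B + sqrt 2 * enorm N H e"
    using XN B enorm_nonneg[of N H e, OF H_pos] by simp
  finally show ?thesis by (simp add: e_def[abs_def])
qed

end

section \<open>The error estimate\<close>

context reference_cell
begin

text \<open>Let \<open>e\<^sup>n\<close> be the difference of the discrete solution and the projection of the exact one.
  Then \<open>e\<^bsup>n+1\<^esup> = R(\<tau>L) e\<^sup>n + d\<^sup>n\<close> with the local error \<open>d\<^sup>n\<close>, and stability sums up the local
  errors. The constants depend only on the reference cell, \<open>\<alpha>\<close>, \<open>s\<close>, \<open>T\<close>, \<open>b - a\<close> and the constants
  of stability.\<close>

lemma error_estimate_if_stable:
  assumes ab: "a < b" and T: "0 < T" and \<alpha>: "0 < \<alpha>" and s: "1 \<le> s"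
    and stable: "stable_under bc s \<alpha> T cfl"
  shows "\<exists>C>0. error_estimate bc meth s k y a b T \<alpha> cfl C"
proof -
  obtain \<Lambda> Cs where \<Lambda>: "0 \<le> \<Lambda>" and Cs: "0 \<le> Cs" and st: "\<And>N H h \<tau> v.
     1 \<le> N \<Longrightarrow> 0 < h \<Longrightarrow> (\<forall>i\<in>{1..N}. \<alpha> * h \<le> H i) \<Longrightarrow> 0 < \<tau> \<Longrightarrow> \<tau> \<le> T \<Longrightarrow> cfl \<tau> h \<Longrightarrow> cellwise N v \<Longrightarrow>
     \<tau> \<le> \<Lambda> * h \<and>
     energy N H (rk_step bc N H s \<tau> v) (rk_step bc N H s \<tau> v) \<le> (1 + Cs * \<tau>) * energy N H v v"
    using stable unfolding stable_under_def by blast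
  define L where "L = max 1 \<Lambda>"
  have L: "1 \<le> L" "\<Lambda> \<le> L" by (auto simp: L_def)
  obtain Q where Q: "0 < Q" and tower: "\<And>bc N H h \<tau> v. 1 \<le> N \<Longrightarrow> 0 < h \<Longrightarrow> (\<forall>i\<in>{1..N}. \<alpha> * h \<le> H i) \<Longrightarrow> 0 < \<tau> \<Longrightarrow> cellwise N v \<Longrightarrow>
    energy_tower (Q * (\<tau> / h))
      (\<lambda>p q. energy N H ((adv bc N H \<tau> ^^ p) v) ((adv bc N H \<tau> ^^ q) v)) {0..N}
      (\<lambda>p i. sqrt \<tau> * jump bc N ((adv bc N H \<tau> ^^ p) v) i)"
    using energy_tower_adv[OF \<alpha>] by blast
  define A where "A = Q * L"
  have A: "0 \<le> A" using Q L by (simp add: A_def)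
  obtain C1 where C1: "0 \<le> C1" "\<And>p \<epsilon>. degree p \<le> Suc k \<Longrightarrow> (\<forall>j\<in>{0..Suc k}. \<bar>poly p (y j)\<bar> \<le> \<epsilon>) \<Longrightarrow> mass (pderiv p) (pderiv p) \<le> C1 * \<epsilon>\<^sup>2"
    using mass_pderiv_nodal_bound by blast
  obtain C2 where C2: "0 \<le> C2" "\<And>p \<epsilon>. degree p \<le> k \<Longrightarrow> (\<forall>j\<in>{1..Suc k}. \<bar>poly p (y j)\<bar> \<le> \<epsilon>) \<Longrightarrow> mass p p \<le> C2 * \<epsilon>\<^sup>2"
    using mass_nodal_bound by blast
  obtain C3 where C3: "0 \<le> C3" "\<And>p \<epsilon>. degree p \<le> k \<Longrightarrow> (\<forall>j\<in>{1..Suc k}. \<bar>poly p (y j)\<bar> \<le> \<epsilon>) \<Longrightarrow> \<forall>x\<in>{-1..1}. \<bar>poly p x\<bar> \<le> C3 * \<epsilon>"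
    using sup_nodal_bound by blast
  define D where "D = sqrt (b - a) * sqrt (8 * C1 / \<alpha>\<^sup>2 + 2 * C2)"
  define E where "E = (\<Sum>\<kappa>\<le>s. defect_const A D L \<kappa>) + sqrt (b - a) * sqrt C2 * L ^ Suc k"
  have D: "0 \<le> D" using ab C1 C2 by (simp add: D_def)
  have E: "0 \<le> E"
    unfolding E_def using A D L ab C2 by (intro add_nonneg_nonneg sum_nonneg defect_const_nonneg) auto
  define C where "C = 1 + sqrt (2 * (b - a)) * (1 + C3) + sqrt 2 * (T * exp (Cs * T) * E)"
  have pos: "0 \<le> sqrt (2 * (b - a)) * (1 + C3)" "0 \<le> sqrt 2 * (T * exp (Cs * T) * E)"
    using ab C3 T E by auto
  have C: "0 < C" using pos by (simp add: C_def)
  have "error_estimate bc meth s k y a b T \<alpha> cfl C"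
    unfolding error_estimate_def
  proof (intro allI impI)
    fix u0 u N X M U n
    assume asm: "exact_solution bc a b T u0 u \<and> regular_mesh \<alpha> a b N X \<and> 1 \<le> M \<and>
        rksv_solution bc meth s k y N X M (T / real M) u0 U \<and> cfl (T / real M) (mesh_size N X)"
      and n: "n \<le> M"
    define \<tau> where "\<tau> = T / real M"
    define h where "h = mesh_size N X"
    have ex: "exact_solution bc a b T u0 u" and mesh: "regular_mesh \<alpha> a b N X" and M: "1 \<le> M"
      and sol: "rksv_solution bc meth s k y N X M \<tau> u0 U" and cfl: "cfl \<tau> h"
      using asm by (auto simp: \<tau>_def h_def)
    have N: "1 \<le> N" and X0: "X 0 = a" and XN: "X N = b" and mono: "strict_mono_on {0..N} X"
      using mesh by (auto simp: regular_mesh_def)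
    interpret sv_mesh meth k y N X by unfold_locales (use N mono in auto)
    have fin: "finite (cell_len X ` {1..N})" "cell_len X ` {1..N} \<noteq> {}" using N by auto
    have Hh: "\<alpha> * h \<le> H i \<and> H i \<le> h" if i: "i \<in> {1..N}" for i
    proof -
      have "H i \<le> h" unfolding h_def mesh_size_def using fin i by (intro Max_ge) auto
      moreover have "\<alpha> * h \<le> Min (cell_len X ` {1..N})" using mesh by (simp add: regular_mesh_def h_def mesh_size_def)
      moreover have "Min (cell_len X ` {1..N}) \<le> H i" using fin i by (intro Min_le) auto
      ultimately show ?thesis by linarith
    qed
    have h: "0 < h" using Hh[of 1] H_pos[of 1] N by force
    have \<tau>: "0 < \<tau>" "\<tau> \<le> T" "real M * \<tau> = T" using T M by (auto simp: \<tau>_def field_simps)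
    have low: "\<forall>i\<in>{1..N}. \<alpha> * h \<le> H i" using Hh by blast
    have \<tau>L: "\<tau> \<le> L * h"
    proof -
      have "\<tau> \<le> \<Lambda> * h"
        using st[OF N h low \<tau>(1,2) cfl, of "\<lambda>i. 0"] by (simp add: cellwise_def)
      also have "\<dots> \<le> L * h" using L h by (intro mult_right_mono) auto
      finally show ?thesis .
    qed
    have op: "enorm N H (adv bc N H \<tau> v) \<le> A * enorm N H v" if v: "cellwise N v" for v
    proof -
      have "energy N H (adv bc N H \<tau> v) (adv bc N H \<tau> v) \<le> (Q * (\<tau> / h))\<^sup>2 * energy N H v v"
        using energy_tower_decay[OF tower[OF N h low \<tau>(1) v, of bc], of 0 1] by simp
      also have "\<dots> \<le> A\<^sup>2 * energy N H v v"
      proof (intro mult_right_mono power_mono energy_nonneg H_pos)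
        have "\<tau> / h \<le> L" using \<tau>L h by (simp add: pos_divide_le_eq)
        then show "Q * (\<tau> / h) \<le> A" unfolding A_def using Q by (intro mult_left_mono) auto
      qed (use Q \<tau> h in auto)
      finally have "enorm N H (adv bc N H \<tau> v) \<le> sqrt (A\<^sup>2 * energy N H v v)"
        unfolding enorm_def by (rule real_sqrt_le_mono)
      then show ?thesis using A by (simp add: real_sqrt_mult enorm_def)
    qed
    have stab: "enorm N H (rk_step bc N H s \<tau> v) \<le> (1 + Cs * \<tau>) * enorm N H v" if v: "cellwise N v" for v
    proof -
      have g: "1 \<le> 1 + Cs * \<tau>" using Cs \<tau> by simp
      have "enorm N H (rk_step bc N H s \<tau> v) \<le> sqrt ((1 + Cs * \<tau>) * energy N H v v)"
        unfolding enorm_def using st[OF N h low \<tau>(1,2) cfl v] by (intro real_sqrt_le_mono) blast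
      also have "\<dots> = sqrt (1 + Cs * \<tau>) * enorm N H v" by (simp add: real_sqrt_mult enorm_def)
      also have "sqrt (1 + Cs * \<tau>) \<le> 1 + Cs * \<tau>"
        using g self_le_power[of "1 + Cs * \<tau>" 2] by (intro real_le_lsqrt) auto
      then have "sqrt (1 + Cs * \<tau>) * enorm N H v \<le> (1 + Cs * \<tau>) * enorm N H v"
        by (intro mult_right_mono enorm_nonneg H_pos)
      finally show ?thesis .
    qed
    define S where "S = h ^ (k + 1) + \<tau> ^ s"
    have S: "0 < S" "h ^ Suc k \<le> S" using h \<tau> by (auto simp: S_def add_pos_pos)
    define x where "x = l2_norm a b (\<lambda>x. u x (real n * \<tau>) - U n 0 x)"
    \<comment> \<open>The norm is defined by infima that need not be attained, so the estimate is first proved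
      with any larger number in its place.\<close>
    have bound: "x \<le> C * S * K" if K: "solution_norm (k + 2) a b T u < ennreal K" for K
    proof -
      have "solution_norm (Suc (Suc k)) a b T u < ennreal K" using K by simp
      then obtain w where w: "smooth_profile bc a b T K (Suc k) w" and uw: "\<And>x t. x \<in> {a..b} \<Longrightarrow> t \<in> {0..T} \<Longrightarrow> u x t = w 0 (x - t)"
        using smooth_profile_exists[OF ab T ex] by blast
      have p: "smooth_profile bc (X 0) (X N) T K (Suc k) w" using w X0 XN by simp
      have "0 < ennreal K" using K by (rule le_less_trans[OF zero_le])
      then have K0: "0 \<le> K" by simp
      have tn: "real n * \<tau> \<in> {0..T}" if "n \<le> M" for n
      proof -
        have "real n * \<tau> \<le> real M * \<tau>" using that \<tau> by (intro mult_right_mono) auto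
        then show ?thesis using \<tau> by auto
      qed
      define V where "V n = profile_interp w 0 (real n * \<tau>)" for n :: nat
      define e where "e n = (\<lambda>i. pieces (U n 0) i - V n i)" for n
      have cwV: "cellwise N (V n)" for n unfolding V_def by (rule cellwise_profile_interp)
      have trU: "U n 0 \<in> trial_space k N X" if nM: "n \<le> M" for n
      proof (cases "n < M")
        case True
        then show ?thesis using sol unfolding rksv_solution_def Let_def by blast
      next
        case False
        then obtain n' where n': "n = n' + 1" "n' < M" using nM M by (cases n) auto
        then have "U n 0 = U n' s" "U n' s \<in> trial_space k N X"
          using sol unfolding rksv_solution_def Let_def by blast+
        then show ?thesis by simp
      qed
      have cwU: "cellwise N (pieces (U n 0))" if "n \<le> M" for n by (rule cellwise_pieces[OF trU[OF that]])
      \<comment> \<open>The scheme starts from the projection of the initial value.\<close>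
      have e0: "e 0 = (\<lambda>i. 0)"
      proof -
        have "pieces (U 0 0) = interp u0"
          using sol by (intro pieces_lagrange_projection) (simp add: rksv_solution_def Let_def)
        also have "interp u0 = V 0"
        proof
          fix i
          have "u0 (of_ref i (y m)) = w 0 (of_ref i (y m))" if i: "i \<in> {1..N}" and m: "m \<in> {1..Suc k}" for m
          proof -
            have x: "of_ref i (y m) \<in> {a..b}"
              using of_ref_range(2)[OF i y_range[of m]] m X0 XN by simp
            have "u0 (of_ref i (y m)) = u (of_ref i (y m)) 0" using ex x by (simp add: exact_solution_def)
            then show ?thesis using uw[OF x, of 0] T by simp
          qed
          then show "interp u0 i = V 0 i"
            unfolding V_def profile_interp_def interp_def by (auto intro!: sum.cong simp del: sum.cl_ivl_Suc)
        qed
        finally show ?thesis by (simp add: e_def)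
      qed
      have step: "enorm N H (e (Suc m)) \<le> (1 + Cs * \<tau>) * enorm N H (e m) + \<tau> * (E * (K * S))" if m: "m < M" for m
      proof -
        have mM: "m \<le> M" "Suc m \<le> M" using m by auto
        define d where "d = (\<lambda>i. rk_step bc N H s \<tau> (V m) i - V (Suc m) i)"
        have "pieces (U (Suc m) 0) = rk_step bc N H s \<tau> (pieces (U m 0))"
          using scheme_step[OF sol s m] by simp
        then have "e (Suc m) = (\<lambda>i. rk_step bc N H s \<tau> (e m) i + d i)"
          by (simp add: e_def d_def rk_step_diff fun_eq_iff)
        then have "enorm N H (e (Suc m)) \<le> enorm N H (rk_step bc N H s \<tau> (e m)) + enorm N H d"
          using enorm_triangle[of N H "rk_step bc N H s \<tau> (e m)" d] H_pos by simp
        also have "\<dots> \<le> (1 + Cs * \<tau>) * enorm N H (e m) + \<tau> * (E * (K * S))"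
        proof (rule add_mono)
          show "enorm N H (rk_step bc N H s \<tau> (e m)) \<le> (1 + Cs * \<tau>) * enorm N H (e m)"
            unfolding e_def by (intro stab cellwise_diff cwU cwV mM)
          have t: "0 \<le> real m * \<tau>" "real m * \<tau> + \<tau> \<le> T" using tn[OF mM(1)] tn[OF mM(2)] by (auto simp: algebra_simps)
          have time: "real m * \<tau> + \<tau> = real (Suc m) * \<tau>" by (simp add: algebra_simps)
          have "enorm N H (\<lambda>i. rk_step bc N H s \<tau> (profile_interp w 0 (real m * \<tau>)) i - profile_interp w 0 (real m * \<tau> + \<tau>) i) \<le>
              ((\<Sum>\<kappa>\<le>s. defect_const A (sqrt (X N - X 0) * sqrt (8 * C1 / \<alpha>\<^sup>2 + 2 * C2)) L \<kappa>) + sqrt (X N - X 0) * sqrt C2 * L ^ Suc k) *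
              (\<tau> * (K * (h ^ Suc k + \<tau> ^ s)))"
            by (rule local_error[OF p K0 t h Hh \<alpha> \<tau>(1) \<tau>L L(1) A op C1(2) C2(2) C1(1) C2(1)])
          then have "enorm N H d \<le> E * (\<tau> * (K * S))"
            unfolding time X0 XN D_def[symmetric] E_def[symmetric] by (simp add: d_def V_def S_def)
          then show "enorm N H d \<le> \<tau> * (E * (K * S))" by (simp only: mult.left_commute)
        qed
        finally show ?thesis .
      qed
      have en: "enorm N H (e n) \<le> T * exp (Cs * T) * (E * (K * S))"
        using E K0 S by (intro accumulated_error[of e M Cs \<tau>, OF e0 step Cs \<tau>(1) _ \<tau>(3) n]) auto
      have "l2_norm (X 0) (X N) (\<lambda>x. u x (real n * \<tau>) - U n 0 x) \<le>
          sqrt (2 * (X N - X 0)) * ((1 + C3) * (K * h ^ Suc k)) + sqrt 2 * enorm N H (\<lambda>i. pieces (U n 0) i - V n i)"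
      proof (rule l2_norm_split[OF trU[OF n] cwV])
        show "0 \<le> (1 + C3) * (K * h ^ Suc k)" using C3 K0 h by simp
        fix i \<xi> assume i: "i \<in> {1..N}" and \<xi>: "\<xi> \<in> {-1..1::real}"
        have "u (of_ref i \<xi>) (real n * \<tau>) = w 0 (of_ref i \<xi> - real n * \<tau>)"
          using of_ref_range(2)[OF i \<xi>] X0 XN by (intro uw tn[OF n]) auto
        moreover have "\<bar>w 0 (of_ref i \<xi> - real n * \<tau>) - poly (profile_interp w 0 (real n * \<tau>) i) \<xi>\<bar> \<le> (1 + C3) * (K * h ^ Suc k)"
        proof (rule projection_error[OF p K0 tn[OF n] i _ \<xi>])
          show "H i \<le> h" using Hh[OF i] by blast
        qed (rule C3(2))
        ultimately show "\<bar>u (of_ref i \<xi>) (real n * \<tau>) - poly (V n i) \<xi>\<bar> \<le> (1 + C3) * (K * h ^ Suc k)"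
          by (simp only: V_def)
      qed
      then have "x \<le> sqrt (2 * (b - a)) * ((1 + C3) * (K * h ^ Suc k)) + sqrt 2 * enorm N H (e n)"
        by (simp add: x_def X0 XN e_def)
      also have "\<dots> \<le> sqrt (2 * (b - a)) * ((1 + C3) * (K * S)) + sqrt 2 * (T * exp (Cs * T) * (E * (K * S)))"
        using en S K0 C3 ab by (intro add_mono mult_left_mono) auto
      also have "\<dots> = (C - 1) * (K * S)" by (simp add: C_def algebra_simps)
      also have "\<dots> \<le> C * (K * S)" using K0 S by (intro mult_right_mono) auto
      finally show ?thesis by (simp add: mult_ac)
    qed
    have CS: "0 < C * S" using C S by simp
    show "ennreal (l2_norm a b (\<lambda>x. u x (real n * (T / real M)) - U n 0 x))
        \<le> ennreal (C * (mesh_size N X ^ (k + 1) + (T / real M) ^ s)) * solution_norm (k + 2) a b T u"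
    \<comment> \<open>If the norm is infinite, the right-hand side is infinite as well because its other factor
      is positive.\<close>
    proof (cases "solution_norm (k + 2) a b T u")
      case (real \<nu>)
      have "x \<le> C * S * \<nu> + \<epsilon>" if "0 < \<epsilon>" for \<epsilon>
      proof -
        have "solution_norm (k + 2) a b T u < ennreal (\<nu> + \<epsilon> / (C * S))"
          using real that CS by (simp add: ennreal_less_iff)
        from bound[OF this] have "x \<le> C * S * \<nu> + C * S * (\<epsilon> / (C * S))" by (simp only: distrib_left)
        then show ?thesis using C S by simp
      qed
      then have "x \<le> C * S * \<nu>" by (rule field_le_epsilon)
      then show ?thesis using real CS
        by (simp add: x_def \<tau>_def S_def h_def ennreal_mult[symmetric] ennreal_leI)
    next
      case top
      then have "ennreal (C * S) * solution_norm (k + 2) a b T u = top_class.top"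
        using C S by (simp add: ennreal_mult_top del: add_2_eq_Suc' add_2_eq_Suc)
      then show ?thesis unfolding S_def \<tau>_def h_def by (simp only: top_greatest)
    qed
  qed
  then show ?thesis using C by blast
qed

end

theorem theorem5p2:
  fixes a b T \<alpha> :: real and s k r \<zeta> \<rho> :: nat
    and meth :: sv_method and bc :: boundary
    and y \<beta> :: "nat \<Rightarrow> real"
  assumes "a < b" and "0 < T" and "0 < \<alpha>" and "1 \<le> s" and "1 \<le> k"
    and "reference_points meth k y"
    and "evolution_coeffs s \<beta>"
    and "r \<in> {0, 1}"
    and "\<zeta> = termination_index s \<beta>"
    and "\<rho> = contribution_index r s \<beta>"
  shows "(c_matrix s \<beta> \<zeta> \<zeta> \<zeta> < 0 \<and> \<rho> = \<zeta> \<longrightarrow>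
            (\<exists>c>0. \<exists>C>0. error_estimate bc meth s k y a b T \<alpha> (\<lambda>\<tau> h. \<tau> \<le> c * h) C)) \<and>
         (c_matrix s \<beta> \<zeta> \<zeta> \<zeta> < 0 \<and> \<rho> < \<zeta> \<longrightarrow>
            (\<forall>c>0. \<exists>C>0. error_estimate bc meth s k y a b T \<alpha>
               (\<lambda>\<tau> h. (\<tau> / h) ^ (2 * \<rho> + 1) \<le> c * \<tau>) C)) \<and>
         (c_matrix s \<beta> \<zeta> \<zeta> \<zeta> > 0 \<longrightarrow>
            (\<forall>c>0. \<exists>C>0. error_estimate bc meth s k y a b T \<alpha>
               (\<lambda>\<tau> h. (\<tau> / h) ^ min (2 * \<zeta>) (2 * \<rho> + 1) \<le> c * \<tau>) C))"
proof (cases "c_matrix s \<beta> \<zeta> \<zeta> \<zeta> = 0")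
  case True
  then show ?thesis by simp
next
  case False
  interpret reference_cell meth k y by unfold_locales (use assms in auto)
  note \<zeta> = termination_index_spec[OF assms(9) False]
  note \<rho> = contribution_index_spec[OF assms(10,9,8) \<zeta>(1)]
  note estimate = error_estimate_if_stable[OF assms(1-4)]
  obtain C \<mu>0 where C: "0 \<le> C" and \<mu>0: "0 < \<mu>0" and growth: "\<And>\<mu> a I J. energy_tower \<mu> a I J \<Longrightarrow> \<mu> \<le> \<mu>0 \<Longrightarrow>
      (c_matrix s \<beta> \<zeta> \<zeta> \<zeta> < 0 \<and> \<rho> = \<zeta> \<longrightarrow> quad_form s (c_matrix s \<beta> 0) a \<le> 0) \<and>
      (c_matrix s \<beta> \<zeta> \<zeta> \<zeta> < 0 \<longrightarrow> quad_form s (c_matrix s \<beta> 0) a \<le> C * \<mu> ^ (2 * \<rho> + 1) * a 0 0) \<and>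
      quad_form s (c_matrix s \<beta> 0) a \<le> C * \<mu> ^ min (2 * \<zeta>) (2 * \<rho> + 1) * a 0 0"
    using energy_growth_bound[OF \<zeta> \<rho>] by blast
  show ?thesis
  proof (intro conjI impI allI)
    assume "c_matrix s \<beta> \<zeta> \<zeta> \<zeta> < 0 \<and> \<rho> = \<zeta>"
    then have "\<exists>c>0. stable_under bc s \<alpha> T (\<lambda>\<tau> h. \<tau> \<le> c * h)"
      using growth by (intro stable_under_linear_cfl[OF assms(4,7,3) \<mu>0]) blast
    then show "\<exists>c>0. \<exists>C>0. error_estimate bc meth s k y a b T \<alpha> (\<lambda>\<tau> h. \<tau> \<le> c * h) C"
      using estimate by blast
  next
    fix c :: real
    assume neg: "c_matrix s \<beta> \<zeta> \<zeta> \<zeta> < 0 \<and> \<rho> < \<zeta>" and c: "0 < c"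
    have "stable_under bc s \<alpha> T (\<lambda>\<tau> h. (\<tau> / h) ^ (2 * \<rho> + 1) \<le> c * \<tau>)"
      by (rule stable_under_power_cfl[OF assms(4,7,3,2) c _ C \<mu>0]) (use growth neg in auto)
    then show "\<exists>C>0. error_estimate bc meth s k y a b T \<alpha> (\<lambda>\<tau> h. (\<tau> / h) ^ (2 * \<rho> + 1) \<le> c * \<tau>) C"
      by (rule estimate)
  next
    fix c :: real
    assume c: "0 < c"
    have "stable_under bc s \<alpha> T (\<lambda>\<tau> h. (\<tau> / h) ^ min (2 * \<zeta>) (2 * \<rho> + 1) \<le> c * \<tau>)"
      by (rule stable_under_power_cfl[OF assms(4,7,3,2) c _ C \<mu>0]) (use growth \<zeta>(1) in auto)
    then show "\<exists>C>0. error_estimate bc meth s k y a b T \<alpha>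
        (\<lambda>\<tau> h. (\<tau> / h) ^ min (2 * \<zeta>) (2 * \<rho> + 1) \<le> c * \<tau>) C"
      by (rule estimate)
  qed
qed

end
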